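(* Let $W=G\circ\Phi$ be a polyconvex stored energy with $G$ satisfying the hypotheses (H1)--(H5) listed in the context. For each time step $h>0$ let $\Theta^j=(v^j,\Xi^j)$, $j\ge0$, be spatial iterates satisfying (P1)--(P5) of the context and let $\Theta^{(h)}=(V^{(h)},\Xi^{(h)})$, $\Xi^{(h)}=(F^{(h)},Z^{(h)},w^{(h)})$, be the piecewise linear interpolates defined in the context. Let $(\bar V,\bar F)$ be a smooth solution on $\mathbb{T}^3\times[0,T]$ of $$\partial_t v_i=\partial_\alpha\Big(\frac{\partial G}{\partial\Xi_A}(\Phi(F))\frac{\partial\Phi^A}{\partial F_{i\alpha}}(F)\Big),\qquad \partial_tF_{i\alpha}=\partial_\alpha v_i,$$ with $\bar F(\cdot,0)$ a gradient, and set $\bar\Theta=(\bar V,\Phi(\bar F))$. Assume that the initial data satisfy $\Theta^{(h)}(\cdot,0)=\bar\Theta(\cdot,0)$. Then $$\sup_{t\in[0,T]}\Big(\|V^{(h)}-\bar V\|^2_{L^2(\mathbb{T}^3)}+\|\Xi^{(h)}-\Phi(\bar F)\|^2_{L^2(\mathbb{T}^3)}+\|F^{(h)}-\bar F\|^p_{L^p(\mathbb{T}^3)}\Big)=O(h)\qquad\text{as }h\downarrow0.$$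
   Context: **Setting.** $\mathbb{T}^3$ is the three-dimensional torus (periodic boundary conditions), $L^p=L^p(\mathbb{T}^3)$, $W^{1,p}=W^{1,p}(\mathbb{T}^3)$. $M^{3\times3}\cong\mathbb{R}^9$ denotes real $3\times 3$ matrices, $M^{3\times3}_+$ those with positive determinant. Indices $i,\alpha,\dots$ run over $1,2,3$; $A,B,\dots$ run over $1,\dots,19$; repeated indices are summed. $\Phi(F)=(F,\mathrm{cof}\,F,\det F)\in M^{3\times3}\times M^{3\times3}\times\mathbb{R}\cong\mathbb{R}^{19}$, with components $\Phi^A(F)$; elements of $\mathbb{R}^{19}$ are written $\Xi=(F,Z,w)$. The stored energy is $W:M_+^{3\times3}\to\mathbb{R}$, $W(F)=G(\Phi(F))$, $G:\mathbb{R}^{19}\to\mathbb{R}$ uniformly convex. Notation: $G_{,A}=\partial G/\partial\Xi_A$, $\Phi^A_{,i\alpha}=\partial\Phi^A/\partial F_{i\alpha}$. A matrix field $F$ is a gradient if $F_{i\alpha}=\partial_\alpha y_i$ for some map $y$. **Hypotheses on $G$** (with fixed positive constants $c_1,\dots,c_8$): (H1) $G\in C^3(\mathbb{R}^{19};[0,\infty))$ has the form $G(\Xi)=H(F)+R(\Xi)$ with $H\in C^3(M^{3\times3};[0,\infty))$ and $R\in C^3(\mathbb{R}^{19};[0,\infty))$ strictly convex, satisfying $\kappa|F|^{p-2}|z|^2\le z^T\nabla^2H(F)z\le\kappa'|F|^{p-2}|z|^2$ for all $z\in\mathbb{R}^9$, and $\gamma I\le\nabla^2R\le\gamma'I$,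 for some fixed $\gamma,\gamma',\kappa,\kappa'>0$ and $p\in[6,\infty)$. (H2) $G(\Xi)\ge c_1|F|^p+c_2|Z|^2+c_3|w|^2-c_4$. (H3) $G(\Xi)\le c_5(|F|^p+|Z|^2+|w|^2+1)$. (H4) $|G_F|^{\frac{p}{p-1}}+|G_Z|^{\frac{p}{p-2}}+|G_w|^{\frac{p}{p-3}}\le c_6(|F|^p+|Z|^2+|w|^2+1)$. (H5) $\big|\frac{\partial^3H}{\partial F_{i\alpha}\partial F_{ml}\partial F_{rs}}\big|\le c_7|F|^{p-3}$ and $\big|\frac{\partial^3R}{\partial\Xi_A\partial\Xi_B\partial\Xi_D}\big|\le c_8$. **Iterates.** For given $h>0$ and initial data $\Theta^0=(v^0,\Xi^0)=(v^0,F^0,Z^0,w^0)\in L^2\times L^p\times L^2\times L^2$, the iterates $\Theta^j=(v^j,\Xi^j)=(v^j,F^j,Z^j,w^j)\in L^2\times L^p\times L^2\times L^2$, $j\ge1$, satisfy: (P1) $(v^j,\Xi^j)$ is the unique minimizer of $\mathcal{J}(v,\Xi)=\int_{\mathbb{T}^3}\big(\frac12|v-v^{j-1}|^2+G(\Xi)\big)dx$ over the weakly closed affine subspace $\mathcal{C}$ of those $(v,\Xi)\in L^2\times L^p\times L^2\times L^2$ such that for all $\varphi\in C^\infty(\mathbb{T}^3)$ (and all $A$): $\int_{\mathbb{T}^3}\frac{\Xi_A-\Xi_A^{j-1}}{h}\varphi\,dx=-\int_{\mathbb{T}^3}\Phi^A_{,i\alpha}(F^{j-1})v_i\,\partial_\alpha\varphi\,dx$.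 (P2) In $\mathcal{D}'(\mathbb{T}^3)$: $\frac{v^j_i-v^{j-1}_i}{h}=\partial_\alpha\big(G_{,A}(\Xi^j)\Phi^A_{,i\alpha}(F^{j-1})\big)$ and $\frac{\Xi^j_A-\Xi^{j-1}_A}{h}=\partial_\alpha\big(\Phi^A_{,i\alpha}(F^{j-1})v^j_i\big)$. (P3) If $F^0$ is a gradient, then so is $F^j$ for all $j\ge1$. (P4) $v^j\in W^{1,p}(\mathbb{T}^3)$ for all $j\ge1$. (P5) There is $E_0>0$ determined by the initial data (not depending on $h$) with $\sup_{j\ge0}\big(\|v^j\|_{L^2}^2+\int_{\mathbb{T}^3}G(\Xi^j)dx\big)+\sum_{j=1}^\infty\|\Theta^j-\Theta^{j-1}\|_{L^2}^2\le E_0$. **Interpolates.** With $\mathcal{X}^j$ the characteristic function of $[(j-1)h,jh)$: $V^{(h)}(t)=\sum_{j\ge1}\mathcal{X}^j(t)\big(v^{j-1}+\frac{t-h(j-1)}{h}(v^j-v^{j-1})\big)$, $\Xi^{(h)}(t)=(F^{(h)},Z^{(h)},w^{(h)})(t)=\sum_{j\ge1}\mathcal{X}^j(t)\big(\Xi^{j-1}+\frac{t-h(j-1)}{h}(\Xi^j-\Xi^{j-1})\big)$. *)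

theory Defs
  imports "HOL-Analysis.Analysis"
begin

type_synonym vec3 = "real ^ 3"
type_synonym mat3 = "real ^ 3 ^ 3"
type_synonym xi = "mat3 \<times> mat3 \<times> real"

definition dderiv :: "'a::real_normed_vector \<Rightarrow> ('a \<Rightarrow> 'b::real_normed_vector) \<Rightarrow> 'a \<Rightarrow> 'b" where
  "dderiv u f x = frechet_derivative f (at x) u"

abbreviation partial :: "3 \<Rightarrow> (vec3 \<Rightarrow> 'b::real_normed_vector) \<Rightarrow> vec3 \<Rightarrow> 'b" where
  "partial \<alpha> \<equiv> dderiv (axis \<alpha> 1)"

definition grad :: "('a::euclidean_space \<Rightarrow> real) \<Rightarrow> 'a \<Rightarrow> 'a" where
  "grad f x = (\<Sum>b\<in>Basis. dderiv b f x *\<^sub>R b)"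

definition hess_form :: "('a::euclidean_space \<Rightarrow> real) \<Rightarrow> 'a \<Rightarrow> 'a \<Rightarrow> real" where
  "hess_form f x z = (\<Sum>a\<in>Basis. \<Sum>b\<in>Basis. (z \<bullet> a) * (z \<bullet> b) * dderiv a (dderiv b f) x)"

text \<open>\<open>Ck_on k U f\<close> is meant for open \<open>U\<close> only; smoothness on an arbitrary set is smoothness of
  an extension to an open neighbourhood.\<close>

primrec Ck_on :: "nat \<Rightarrow> 'a::euclidean_space set \<Rightarrow> ('a \<Rightarrow> 'b::real_normed_vector) \<Rightarrow> bool" where
  "Ck_on 0 U f = continuous_on U f"
| "Ck_on (Suc k) U f = ((\<forall>x\<in>U. f differentiable (at x)) \<and> (\<forall>u. Ck_on k U (dderiv u f)))"

definition smooth_on :: "'a::euclidean_space set \<Rightarrow> ('a \<Rightarrow> 'b::real_normed_vector) \<Rightarrow> bool" where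
  "smooth_on S f \<longleftrightarrow>
     (\<exists>U g. open U \<and> S \<subseteq> U \<and> (\<forall>k. Ck_on k U g) \<and> (\<forall>x\<in>S. g x = f x))"

definition strictly_convex :: "('a::real_vector \<Rightarrow> real) \<Rightarrow> bool" where
  "strictly_convex f \<longleftrightarrow>
     (\<forall>x y t. x \<noteq> y \<longrightarrow> 0 < t \<longrightarrow> t < 1 \<longrightarrow>
        f ((1 - t) *\<^sub>R x + t *\<^sub>R y) < (1 - t) * f x + t * f y)"

definition uniformly_convex :: "('a::real_normed_vector \<Rightarrow> real) \<Rightarrow> bool" where
  "uniformly_convex f \<longleftrightarrow>
     (\<exists>m>0. \<forall>x y t. 0 \<le> t \<longrightarrow> t \<le> 1 \<longrightarrow>
        f ((1 - t) *\<^sub>R x + t *\<^sub>R y)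
          \<le> (1 - t) * f x + t * f y - m / 2 * t * (1 - t) * (norm (x - y))\<^sup>2)"

text \<open>The \<open>(i, \<alpha>)\<close> entry of \<open>cof F\<close> is the signed minor
  \<open>\<epsilon>_{ijk} \<epsilon>_{\<alpha>\<beta>\<gamma>} F_{j\<beta>} F_{k\<gamma>} / 2\<close>, obtained here by replacing row \<open>i\<close> of \<open>F\<close>
  by the \<open>\<alpha>\<close>-th unit vector.\<close>

definition cof :: "mat3 \<Rightarrow> mat3" where
  "cof F = (\<chi> i \<alpha>. det (\<chi> j. if j = i then axis \<alpha> 1 else F $ j))"

definition Phi :: "mat3 \<Rightarrow> xi" where
  "Phi F = (F, cof F, det F)"

text \<open>\<open>dPhi F i \<alpha> \<bullet> A\<close>, for \<open>A\<close> in the 19-element \<open>Basis\<close>, is \<open>\<partial>\<Phi>^A / \<partial>F_{i\<alpha>}\<close>; hence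
  \<open>grad G \<Xi> \<bullet> dPhi F i \<alpha>\<close> is \<open>G_{,A}(\<Xi>) \<Phi>^A_{,i\<alpha>}(F)\<close> summed over \<open>A\<close>.\<close>

definition dPhi :: "mat3 \<Rightarrow> 3 \<Rightarrow> 3 \<Rightarrow> xi" where
  "dPhi F i \<alpha> = dderiv (axis i (axis \<alpha> 1)) Phi F"

definition polyconvex_energy :: "(mat3 \<Rightarrow> real) \<Rightarrow> (xi \<Rightarrow> real) \<Rightarrow> bool" where
  "polyconvex_energy W G \<longleftrightarrow> uniformly_convex G \<and> (\<forall>F. det F > 0 \<longrightarrow> W F = G (Phi F))"

definition H1 :: "real \<Rightarrow> real \<Rightarrow> real \<Rightarrow> real \<Rightarrow> real \<Rightarrow> (mat3 \<Rightarrow> real) \<Rightarrow> (xi \<Rightarrow> real) \<Rightarrow> (xi \<Rightarrow> real) \<Rightarrow> bool" where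
  "H1 p \<kappa> \<kappa>' \<gamma> \<gamma>' H R G \<longleftrightarrow>
     p \<ge> 6 \<and> \<kappa> > 0 \<and> \<kappa>' > 0 \<and> \<gamma> > 0 \<and> \<gamma>' > 0 \<and>
     Ck_on 3 UNIV G \<and> (\<forall>\<Xi>. G \<Xi> \<ge> 0) \<and>
     Ck_on 3 UNIV H \<and> (\<forall>F. H F \<ge> 0) \<and>
     Ck_on 3 UNIV R \<and> (\<forall>\<Xi>. R \<Xi> \<ge> 0) \<and>
     (\<forall>F Z w. G (F, Z, w) = H F + R (F, Z, w)) \<and>
     strictly_convex R \<and>
     (\<forall>F z. \<kappa> * norm F powr (p - 2) * (norm z)\<^sup>2 \<le> hess_form H F z \<and>
            hess_form H F z \<le> \<kappa>' * norm F powr (p - 2) * (norm z)\<^sup>2) \<and>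
     (\<forall>\<Xi> z. \<gamma> * (norm z)\<^sup>2 \<le> hess_form R \<Xi> z \<and> hess_form R \<Xi> z \<le> \<gamma>' * (norm z)\<^sup>2)"

definition H2 :: "real \<Rightarrow> real \<Rightarrow> real \<Rightarrow> real \<Rightarrow> real \<Rightarrow> (xi \<Rightarrow> real) \<Rightarrow> bool" where
  "H2 p c1 c2 c3 c4 G \<longleftrightarrow> c1 > 0 \<and> c2 > 0 \<and> c3 > 0 \<and> c4 > 0 \<and>
     (\<forall>F Z w. G (F, Z, w) \<ge> c1 * norm F powr p + c2 * (norm Z)\<^sup>2 + c3 * \<bar>w\<bar>\<^sup>2 - c4)"

definition H3 :: "real \<Rightarrow> real \<Rightarrow> (xi \<Rightarrow> real) \<Rightarrow> bool" where
  "H3 p c5 G \<longleftrightarrow> c5 > 0 \<and>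
     (\<forall>F Z w. G (F, Z, w) \<le> c5 * (norm F powr p + (norm Z)\<^sup>2 + \<bar>w\<bar>\<^sup>2 + 1))"

definition H4 :: "real \<Rightarrow> real \<Rightarrow> (xi \<Rightarrow> real) \<Rightarrow> bool" where
  "H4 p c6 G \<longleftrightarrow> c6 > 0 \<and>
     (\<forall>F Z w. case grad G (F, Z, w) of (GF, GZ, Gw) \<Rightarrow>
        norm GF powr (p / (p - 1)) + norm GZ powr (p / (p - 2)) + \<bar>Gw\<bar> powr (p / (p - 3))
          \<le> c6 * (norm F powr p + (norm Z)\<^sup>2 + \<bar>w\<bar>\<^sup>2 + 1))"

definition H5 :: "real \<Rightarrow> real \<Rightarrow> real \<Rightarrow> (mat3 \<Rightarrow> real) \<Rightarrow> (xi \<Rightarrow> real) \<Rightarrow> bool" where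
  "H5 p c7 c8 H R \<longleftrightarrow> c7 > 0 \<and> c8 > 0 \<and>
     (\<forall>F. \<forall>a\<in>Basis. \<forall>b\<in>Basis. \<forall>d\<in>Basis.
        \<bar>dderiv a (dderiv b (dderiv d H)) F\<bar> \<le> c7 * norm F powr (p - 3)) \<and>
     (\<forall>\<Xi>. \<forall>a\<in>Basis. \<forall>b\<in>Basis. \<forall>d\<in>Basis.
        \<bar>dderiv a (dderiv b (dderiv d R)) \<Xi>\<bar> \<le> c8)"

text \<open>Functions on the torus \<open>\<real>^3 / \<int>^3\<close> are \<open>\<int>^3\<close>-periodic functions on \<open>\<real>^3\<close>, integrated
  over the unit cell. Elements of Lebesgue and Sobolev spaces are represented by functions, so
  equality in these spaces is equality almost everywhere.\<close>

definition periodic :: "(vec3 \<Rightarrow> 'b) \<Rightarrow> bool" where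
  "periodic f \<longleftrightarrow> (\<forall>x k. f (x + axis k 1) = f x)"

definition torus :: "vec3 measure" where
  "torus = lebesgue_on (cbox 0 1)"

definition Lp :: "real \<Rightarrow> (vec3 \<Rightarrow> 'b::euclidean_space) \<Rightarrow> bool" where
  "Lp p f \<longleftrightarrow> periodic f \<and> f \<in> borel_measurable lebesgue \<and>
     integrable torus (\<lambda>x. norm (f x) powr p)"

text \<open>The \<open>p\<close>-th power of the \<open>L^p\<close> norm, in particular the squared \<open>L^2\<close> norm for \<open>p = 2\<close>.\<close>

definition Lp_pow :: "real \<Rightarrow> (vec3 \<Rightarrow> 'b::euclidean_space) \<Rightarrow> ennreal" where
  "Lp_pow p f = (\<integral>\<^sup>+x. ennreal (norm (f x) powr p) \<partial>torus)"

definition test_function :: "(vec3 \<Rightarrow> real) \<Rightarrow> bool" where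
  "test_function \<phi> \<longleftrightarrow> periodic \<phi> \<and> smooth_on UNIV \<phi>"

text \<open>\<open>f = \<partial>_\<alpha> g_\<alpha>\<close> in the sense of distributions on the torus, for integrable \<open>f\<close> and \<open>g_\<alpha>\<close>.\<close>

definition weak_div :: "(vec3 \<Rightarrow> real) \<Rightarrow> (3 \<Rightarrow> vec3 \<Rightarrow> real) \<Rightarrow> bool" where
  "weak_div f g \<longleftrightarrow>
     (\<forall>\<phi>. test_function \<phi> \<longrightarrow>
        (LINT x|torus. f x * \<phi> x) = - (LINT x|torus. (\<Sum>\<alpha>\<in>UNIV. g \<alpha> x * partial \<alpha> \<phi> x)))"

definition W1p :: "real \<Rightarrow> (vec3 \<Rightarrow> vec3) \<Rightarrow> bool" where
  "W1p p f \<longleftrightarrow> Lp p f \<and>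
     (\<exists>D :: vec3 \<Rightarrow> mat3. Lp p D \<and>
        (\<forall>i \<alpha> \<phi>. test_function \<phi> \<longrightarrow>
           (LINT x|torus. D x $ i $ \<alpha> * \<phi> x) = - (LINT x|torus. f x $ i * partial \<alpha> \<phi> x)))"

text \<open>The map \<open>y\<close> is defined on \<open>\<real>^3\<close> and is not required to be periodic (only its gradient is):
  a gradient of a periodic map has mean zero, and then so has its determinant. The derivatives are
  weak ones, as the definition is applied to \<open>L^p\<close> fields.\<close>

definition is_gradient :: "(vec3 \<Rightarrow> mat3) \<Rightarrow> bool" where
  "is_gradient F \<longleftrightarrow>
     (\<exists>y :: vec3 \<Rightarrow> vec3.
        (\<forall>r. integrable (lebesgue_on (cball 0 r)) y) \<and>
        (\<forall>i \<alpha> \<phi>. smooth_on UNIV \<phi> \<and> (\<exists>r. \<forall>x. norm x > r \<longrightarrow> \<phi> x = 0) \<longrightarrow>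
           (LINT x|lebesgue. F x $ i $ \<alpha> * \<phi> x) = - (LINT x|lebesgue. y x $ i * partial \<alpha> \<phi> x)))"

definition state_space :: "real \<Rightarrow> ((vec3 \<Rightarrow> vec3) \<times> (vec3 \<Rightarrow> xi)) set" where
  "state_space p = {(v, \<Xi>). Lp 2 v \<and> Lp p (\<lambda>x. fst (\<Xi> x)) \<and>
     Lp 2 (\<lambda>x. fst (snd (\<Xi> x))) \<and> Lp 2 (\<lambda>x. snd (snd (\<Xi> x)))}"

text \<open>The equation \<open>(\<Xi>_A - \<Xi>0_A) / h = \<partial>_\<alpha> (\<Phi>^A_{,i\<alpha>}(F0) v_i)\<close> tested with smooth functions.\<close>

definition kinematic_constraint :: "real \<Rightarrow> (vec3 \<Rightarrow> xi) \<Rightarrow> (vec3 \<Rightarrow> vec3) \<Rightarrow> (vec3 \<Rightarrow> xi) \<Rightarrow> bool" where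
  "kinematic_constraint h \<Xi>0 v \<Xi> \<longleftrightarrow>
     (\<forall>A\<in>Basis. weak_div (\<lambda>x. (\<Xi> x \<bullet> A - \<Xi>0 x \<bullet> A) / h)
        (\<lambda>\<alpha> x. \<Sum>i\<in>UNIV. (dPhi (fst (\<Xi>0 x)) i \<alpha> \<bullet> A) * v x $ i))"

definition momentum_balance ::
  "(xi \<Rightarrow> real) \<Rightarrow> real \<Rightarrow> (vec3 \<Rightarrow> vec3) \<Rightarrow> (vec3 \<Rightarrow> xi) \<Rightarrow> (vec3 \<Rightarrow> vec3) \<Rightarrow> (vec3 \<Rightarrow> xi) \<Rightarrow> bool" where
  "momentum_balance G h v0 \<Xi>0 v \<Xi> \<longleftrightarrow>
     (\<forall>i. weak_div (\<lambda>x. (v x $ i - v0 x $ i) / h)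
        (\<lambda>\<alpha> x. grad G (\<Xi> x) \<bullet> dPhi (fst (\<Xi>0 x)) i \<alpha>))"

definition admissible :: "real \<Rightarrow> real \<Rightarrow> (vec3 \<Rightarrow> xi) \<Rightarrow> ((vec3 \<Rightarrow> vec3) \<times> (vec3 \<Rightarrow> xi)) set" where
  "admissible p h \<Xi>0 = {(v, \<Xi>) \<in> state_space p. kinematic_constraint h \<Xi>0 v \<Xi>}"

definition functional_J :: "(xi \<Rightarrow> real) \<Rightarrow> (vec3 \<Rightarrow> vec3) \<Rightarrow> (vec3 \<Rightarrow> vec3) \<Rightarrow> (vec3 \<Rightarrow> xi) \<Rightarrow> ennreal" where
  "functional_J G v0 v \<Xi> = (\<integral>\<^sup>+x. ennreal ((norm (v x - v0 x))\<^sup>2 / 2 + G (\<Xi> x)) \<partial>torus)"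

definition unique_minimizer ::
  "real \<Rightarrow> (xi \<Rightarrow> real) \<Rightarrow> real \<Rightarrow> (vec3 \<Rightarrow> vec3) \<Rightarrow> (vec3 \<Rightarrow> xi) \<Rightarrow> (vec3 \<Rightarrow> vec3) \<Rightarrow> (vec3 \<Rightarrow> xi) \<Rightarrow> bool" where
  "unique_minimizer p G h v0 \<Xi>0 v \<Xi> \<longleftrightarrow>
     (v, \<Xi>) \<in> admissible p h \<Xi>0 \<and>
     (\<forall>(v', \<Xi>')\<in>admissible p h \<Xi>0.
        functional_J G v0 v \<Xi> \<le> functional_J G v0 v' \<Xi>' \<and>
        (functional_J G v0 v' \<Xi>' = functional_J G v0 v \<Xi> \<longrightarrow>
           (AE x in lebesgue. v' x = v x \<and> \<Xi>' x = \<Xi> x)))"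

definition iterates ::
  "real \<Rightarrow> (xi \<Rightarrow> real) \<Rightarrow> real \<Rightarrow> real \<Rightarrow> (nat \<Rightarrow> vec3 \<Rightarrow> vec3) \<Rightarrow> (nat \<Rightarrow> vec3 \<Rightarrow> xi) \<Rightarrow> bool" where
  "iterates p G E0 h v \<Xi> \<longleftrightarrow>
     (\<forall>j. (v j, \<Xi> j) \<in> state_space p) \<and>
     (\<forall>j. unique_minimizer p G h (v j) (\<Xi> j) (v (Suc j)) (\<Xi> (Suc j))) \<and>
     (\<forall>j. momentum_balance G h (v j) (\<Xi> j) (v (Suc j)) (\<Xi> (Suc j)) \<and>
          kinematic_constraint h (\<Xi> j) (v (Suc j)) (\<Xi> (Suc j))) \<and>
     (is_gradient (\<lambda>x. fst (\<Xi> 0 x)) \<longrightarrow> (\<forall>j\<ge>1. is_gradient (\<lambda>x. fst (\<Xi> j x)))) \<and>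
     (\<forall>j\<ge>1. W1p p (v j)) \<and>
     (SUP j. Lp_pow 2 (v j) + (\<integral>\<^sup>+x. ennreal (G (\<Xi> j x)) \<partial>torus))
       + (\<Sum>j. Lp_pow 2 (\<lambda>x. (v (Suc j) x, \<Xi> (Suc j) x) - (v j x, \<Xi> j x))) \<le> ennreal E0"

text \<open>Piecewise linear interpolation in time; the summation index is shifted by one, so that the
  \<open>j\<close>-th term lives on \<open>[j h, (j + 1) h)\<close>.\<close>

definition interpolate :: "real \<Rightarrow> (nat \<Rightarrow> vec3 \<Rightarrow> 'b::real_normed_vector) \<Rightarrow> real \<Rightarrow> vec3 \<Rightarrow> 'b" where
  "interpolate h u t x =
     (\<Sum>j. indicator {real j * h ..< real (Suc j) * h} t *\<^sub>R
        (u j x + ((t - h * real j) / h) *\<^sub>R (u (Suc j) x - u j x)))"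

definition smooth_solution ::
  "(xi \<Rightarrow> real) \<Rightarrow> real \<Rightarrow> (real \<Rightarrow> vec3 \<Rightarrow> vec3) \<Rightarrow> (real \<Rightarrow> vec3 \<Rightarrow> mat3) \<Rightarrow> bool" where
  "smooth_solution G T V F \<longleftrightarrow>
     (\<forall>t\<in>{0..T}. periodic (V t) \<and> periodic (F t)) \<and>
     smooth_on ({0..T} \<times> UNIV) (\<lambda>(t, x). V t x) \<and>
     smooth_on ({0..T} \<times> UNIV) (\<lambda>(t, x). F t x) \<and>
     (\<forall>t\<in>{0..T}. \<forall>x i.
        ((\<lambda>s. V s x $ i) has_real_derivative
           (\<Sum>\<alpha>\<in>UNIV. partial \<alpha> (\<lambda>y. grad G (Phi (F t y)) \<bullet> dPhi (F t y) i \<alpha>) x))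
          (at t within {0..T})) \<and>
     (\<forall>t\<in>{0..T}. \<forall>x i \<alpha>.
        ((\<lambda>s. F s x $ i $ \<alpha>) has_real_derivative partial \<alpha> (\<lambda>y. V t y $ i) x)
          (at t within {0..T}))"

end

theory Submission
  imports Defs "HOL-Analysis.Analysis" "HOL-Computational_Algebra.Polynomial"
begin

text \<open>The iterates are compared with the smooth solution \<open>(Vb, Fb)\<close> through the relative entropy

  \<open>e(v, \<Xi>; t) = \<integral> |v - Vb|\<^sup>2 / 2 + G(\<Xi>) - G(\<Phi>(Fb)) - \<nabla>G(\<Phi>(Fb)) \<bullet> (\<Xi> - \<Phi>(Fb)) dx\<close>,

  the constant \<open>ent\<close> below. Uniform convexity and the growth of \<open>G\<close> from below make it control the
  error \<open>|v - Vb|\<^sup>2 + |\<Xi> - \<Phi>(Fb)|\<^sup>2 + |F - Fb|^p\<close> (\<open>eta_coercive\<close>).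

  In one step of the scheme first the state changes at a fixed time, then the time at a fixed state.
  In the first change the part of \<open>e\<close> that is not affine in the state is the energy, and the energy
  does not increase because the new state is a minimiser (\<open>energy_decrease\<close>); the affine part is
  found by testing the discrete equations with \<open>Vb\<close> and \<open>\<nabla>G(\<Phi>(Fb))\<close> (\<open>entropy_step\<close>). The second
  change is a Taylor expansion in time (\<open>ent_time_step\<close>). The two contributions of order \<open>h\<close> cancel
  up to terms quadratic in the error and a null Lagrangian in the old deformation gradient
  (\<open>flux_drift\<close>). Since that gradient and \<open>Fb\<close> differ by a weak gradient, the integral of the null
  Lagrangian is quadratic in their difference as well (\<open>null_lagrangian\<close>, \<open>null_part_integral\<close>).

  The property of differing by a weak gradient is used in the dual form \<open>differ_by_gradient\<close>,
  equality of the integrals against solenoidal fields; the kinematic equations of the scheme and of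
  the smooth solution both preserve these integrals (\<open>differ_by_gradient_step\<close>,
  \<open>differ_by_gradient_time\<close>). The relative entropies \<open>a\<^sub>j\<close> of the iterates thus satisfy
  \<open>a\<^sub>0 = 0\<close> and \<open>a\<^sub>j\<^sub>+\<^sub>1 \<le> (1 + C h) a\<^sub>j + C h\<^sup>2\<close>, and the discrete Gronwall lemma gives \<open>a\<^sub>j = O(h)\<close>
  (\<open>discrete_error\<close>). Interpolation adds errors of the same order (\<open>interpolated_error\<close>).

  Two regularity issues arise. The field \<open>\<nabla>G(\<Phi>(Fb))\<close> is only of class \<open>C^2\<close>, so the weak equations
  are first extended from smooth to \<open>C^1\<close> test functions by mollification (\<open>weak_div_C1\<close>). And that
  \<open>Fb\<close> is a gradient at time \<open>0\<close> is given in the weak sense, whereas the pointwise vanishing of its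
  curl is needed (\<open>is_gradient_curl_free\<close>).\<close>

section \<open>Directional derivatives and functions of class C^k\<close>

lemma dderiv_eq: "(f has_derivative f') (at x) \<Longrightarrow> dderiv u f x = f' u"
  unfolding dderiv_def using frechet_derivative_at by metis

lemma has_derivative_dderiv:
  "f differentiable (at x) \<Longrightarrow> (f has_derivative (\<lambda>u. dderiv u f x)) (at x)"
  unfolding dderiv_def by (simp add: frechet_derivative_works)

lemma dderiv_Basis_sum:
  fixes f :: "'a::euclidean_space \<Rightarrow> 'b::real_normed_vector"
  assumes "f differentiable (at x)"
  shows "dderiv u f x = (\<Sum>b\<in>Basis. (u \<bullet> b) *\<^sub>R dderiv b f x)"
proof -
  have lin: "linear (\<lambda>u. dderiv u f x)"
    using assms unfolding dderiv_def by (simp add: linear_frechet_derivative)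
  have "dderiv u f x = dderiv (\<Sum>b\<in>Basis. (u \<bullet> b) *\<^sub>R b) f x"
    by (simp add: euclidean_representation)
  also have "\<dots> = (\<Sum>b\<in>Basis. (u \<bullet> b) *\<^sub>R dderiv b f x)"
    by (simp add: linear_sum[OF lin] linear_cmul[OF lin] o_def)
  finally show ?thesis .
qed

lemma dderiv_cong_open:
  assumes "open U" "x \<in> U" "\<And>y. y \<in> U \<Longrightarrow> f y = g y"
  shows "dderiv u f x = dderiv u g x"
proof (cases "f differentiable (at x)")
  case True
  then have "(f has_derivative frechet_derivative f (at x)) (at x)"
    by (simp add: frechet_derivative_works)
  then have "(g has_derivative frechet_derivative f (at x)) (at x)"
    using has_derivative_transform_within_open assms by metis
  then show ?thesis using dderiv_eq unfolding dderiv_def by (metis frechet_derivative_at)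
next
  case False
  \<comment> \<open>both derivatives are then the same arbitrary value\<close>
  have "\<And>f'. (f has_derivative f') (at x) = (g has_derivative f') (at x)"
    using has_derivative_transform_within_open assms by metis
  then show ?thesis unfolding dderiv_def frechet_derivative_def by simp
qed

lemma differentiable_cong_open:
  assumes "open U" "x \<in> U" "\<And>y. y \<in> U \<Longrightarrow> f y = g y" "f differentiable (at x)"
  shows "g differentiable (at x)"
  using has_derivative_transform_within_open assms unfolding differentiable_def by metis

lemma Ck_on_cong:
  assumes "open U" "\<And>y. y \<in> U \<Longrightarrow> f y = g y" "Ck_on k U f"
  shows "Ck_on k U g"
  using assms(2,3)
proof (induction k arbitrary: f g)
  case 0
  then show ?case by (auto cong: continuous_on_cong)
next
  case (Suc k)
  have "Ck_on k U (dderiv u g)" for u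
    by (rule Suc.IH[of "dderiv u f"]) (use Suc.prems dderiv_cong_open[OF assms(1), of _ f g] in auto)
  moreover have "\<forall>x\<in>U. g differentiable (at x)"
    using Suc.prems differentiable_cong_open[OF assms(1), of _ f g] by auto
  ultimately show ?case by simp
qed

lemma Ck_on_Suc_imp: "Ck_on (Suc k) U f \<Longrightarrow> Ck_on k U f"
proof (induction k arbitrary: f)
  case 0
  then show ?case
    by (auto intro!: continuous_at_imp_continuous_on differentiable_imp_continuous_within)
next
  case (Suc k)
  then show ?case by (metis Ck_on.simps(2))
qed

lemma Ck_on_le: "Ck_on k U f \<Longrightarrow> j \<le> k \<Longrightarrow> Ck_on j U f"
  by (induction k) (auto simp: le_Suc_eq dest: Ck_on_Suc_imp simp del: Ck_on.simps)

lemma Ck_on_subset: "Ck_on k U f \<Longrightarrow> V \<subseteq> U \<Longrightarrow> Ck_on k V f"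
  by (induction k arbitrary: f) (auto intro: continuous_on_subset)

lemma Ck_on_continuous: "Ck_on k U f \<Longrightarrow> continuous_on U f"
  using Ck_on_le[of k U f 0] by simp

lemma Ck_on_differentiable: "Ck_on k U f \<Longrightarrow> k > 0 \<Longrightarrow> x \<in> U \<Longrightarrow> f differentiable (at x)"
  by (cases k) auto

lemma Ck_on_dderiv: "Ck_on (Suc k) U f \<Longrightarrow> Ck_on k U (dderiv u f)"
  by simp

lemma Ck_on_const [simp]: "Ck_on k U (\<lambda>x. c)"
proof (induction k arbitrary: c)
  case (Suc k)
  have "dderiv u (\<lambda>x::'a. c) = (\<lambda>x. 0)" for u
    by (auto simp: dderiv_def)
  then show ?case using Suc by simp
qed simp

lemma Ck_on_linear:
  assumes "bounded_linear L"
  shows "Ck_on k U L"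
proof (cases k)
  case 0
  then show ?thesis using assms by (simp add: linear_continuous_on)
next
  case (Suc j)
  have "dderiv u L = (\<lambda>x. L u)" for u
    using dderiv_eq[OF bounded_linear_imp_has_derivative[OF assms]] by auto
  then show ?thesis using assms Suc
    by (auto intro!: bounded_linear_imp_differentiable)
qed

lemma Ck_on_add:
  assumes "open U" "Ck_on k U f" "Ck_on k U g"
  shows "Ck_on k U (\<lambda>x. f x + g x)"
  using assms(2,3)
proof (induction k arbitrary: f g)
  case 0
  then show ?case by (auto intro: continuous_intros)
next
  case (Suc k)
  have "Ck_on k U (dderiv u (\<lambda>x. f x + g x))" for u
  proof (rule Ck_on_cong[OF assms(1)])
    show "Ck_on k U (\<lambda>x. dderiv u f x + dderiv u g x)" using Suc by auto
    show "dderiv u f y + dderiv u g y = dderiv u (\<lambda>x. f x + g x) y" if "y \<in> U" for y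
      using dderiv_eq[OF has_derivative_add[OF has_derivative_dderiv has_derivative_dderiv], of f y g u]
        Suc.prems that by simp
  qed
  then show ?case using Suc.prems by auto
qed

lemma Ck_on_sum:
  assumes "open U" "\<And>i. i \<in> I \<Longrightarrow> Ck_on k U (f i)"
  shows "Ck_on k U (\<lambda>x. \<Sum>i\<in>I. f i x)"
  using assms(2)
  by (induction I rule: infinite_finite_induct) (auto intro!: Ck_on_add[OF assms(1)])

lemma (in bounded_bilinear) dderiv_prod:
  assumes "f differentiable (at x)" "g differentiable (at x)"
  shows "dderiv u (\<lambda>x. prod (f x) (g x)) x = prod (f x) (dderiv u g x) + prod (dderiv u f x) (g x)"
  using dderiv_eq[OF FDERIV[OF has_derivative_dderiv has_derivative_dderiv]] assms by blast

lemma (in bounded_bilinear) Ck_on_prod: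
  assumes "open U" "Ck_on k U f" "Ck_on k U g"
  shows "Ck_on k U (\<lambda>x. prod (f x) (g x))"
  using assms(2,3)
proof (induction k arbitrary: f g)
  case 0
  then show ?case by (auto intro: continuous_on)
next
  case (Suc k)
  have "Ck_on k U (dderiv u (\<lambda>x. prod (f x) (g x)))" for u
  proof (rule Ck_on_cong[OF assms(1)])
    show "Ck_on k U (\<lambda>x. prod (f x) (dderiv u g x) + prod (dderiv u f x) (g x))"
      by (intro Ck_on_add assms Suc.IH) (use Suc.prems Ck_on_Suc_imp in auto)
    show "prod (f y) (dderiv u g y) + prod (dderiv u f y) (g y)
        = dderiv u (\<lambda>x. prod (f x) (g x)) y" if "y \<in> U" for y
      using dderiv_prod[of f y g u] Suc.prems that by simp
  qed
  moreover have "(\<lambda>x. prod (f x) (g x)) differentiable (at x)" if "x \<in> U" for x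
    by (rule differentiableI[OF FDERIV[OF has_derivative_dderiv has_derivative_dderiv]])
      (use Suc.prems that in auto)
  ultimately show ?case by simp
qed

lemmas Ck_on_scaleR = bounded_bilinear.Ck_on_prod[OF bounded_bilinear_scaleR]
lemmas Ck_on_mult = bounded_bilinear.Ck_on_prod[OF bounded_bilinear_mult]
lemmas Ck_on_inner = bounded_bilinear.Ck_on_prod[OF bounded_bilinear_inner]

lemma dderiv_compose:
  assumes "f differentiable (at x)" "g differentiable (at (f x))"
  shows "dderiv u (\<lambda>x. g (f x)) x = dderiv (dderiv u f x) g (f x)"
  by (rule dderiv_eq[OF has_derivative_compose[OF has_derivative_dderiv has_derivative_dderiv]])
    (use assms in auto)

lemma Ck_on_compose:
  fixes f :: "'a::euclidean_space \<Rightarrow> 'b::euclidean_space" and g :: "'b \<Rightarrow> 'c::real_normed_vector"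
  assumes "open U" "Ck_on k V g" "Ck_on k U f" "f ` U \<subseteq> V"
  shows "Ck_on k U (\<lambda>x. g (f x))"
  using assms(2,3)
proof (induction k arbitrary: g)
  case 0
  then show ?case using assms(4) by (auto intro: continuous_on_compose2)
next
  case (Suc k)
  have diff: "f differentiable (at x)" "g differentiable (at (f x))" if "x \<in> U" for x
    using Suc.prems that assms(4) by auto
  have "Ck_on k U (dderiv u (\<lambda>x. g (f x)))" for u
  proof (rule Ck_on_cong[OF assms(1)])
    show "Ck_on k U (\<lambda>x. \<Sum>b\<in>Basis. (dderiv u f x \<bullet> b) *\<^sub>R dderiv b g (f x))"
      using Suc.prems Ck_on_Suc_imp[OF Suc.prems(2)]
      by (intro Ck_on_sum Ck_on_scaleR Ck_on_inner assms(1) Suc.IH) auto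
    show "(\<Sum>b\<in>Basis. (dderiv u f y \<bullet> b) *\<^sub>R dderiv b g (f y)) = dderiv u (\<lambda>x. g (f x)) y"
      if "y \<in> U" for y
      using dderiv_compose[OF diff[OF that]] dderiv_Basis_sum[OF diff(2)[OF that]] by metis
  qed
  moreover have "(\<lambda>x. g (f x)) differentiable (at x)" if "x \<in> U" for x
    by (rule differentiableI[OF has_derivative_compose[OF has_derivative_dderiv has_derivative_dderiv]])
      (use diff[OF that] in auto)
  ultimately show ?case by simp
qed

lemma Ck_on_linear_compose:
  fixes f :: "'a::euclidean_space \<Rightarrow> 'b::euclidean_space"
  assumes "open U" "bounded_linear L" "Ck_on k U f"
  shows "Ck_on k U (\<lambda>x. L (f x))"
  using Ck_on_compose[OF assms(1) Ck_on_linear[OF assms(2)] assms(3)] by blast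

lemma Ck_on_uminus:
  assumes "open U" "Ck_on k U f"
  shows "Ck_on k U (\<lambda>x. - f x)"
  using Ck_on_scaleR[OF assms(1) Ck_on_const[of k U "-1"] assms(2)] by simp

lemma Ck_on_diff:
  assumes "open U" "Ck_on k U f" "Ck_on k U g"
  shows "Ck_on k U (\<lambda>x. f x - g x)"
  using Ck_on_add[OF assms(1,2) Ck_on_uminus[OF assms(1,3)]] by simp

lemma Ck_on_euclidean:
  fixes f :: "'a::euclidean_space \<Rightarrow> 'b::euclidean_space"
  assumes "open U" "\<And>b. b \<in> Basis \<Longrightarrow> Ck_on k U (\<lambda>x. f x \<bullet> b)"
  shows "Ck_on k U f"
proof -
  have "Ck_on k U (\<lambda>x. \<Sum>b\<in>Basis. (f x \<bullet> b) *\<^sub>R b)"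
    using assms by (intro Ck_on_sum Ck_on_scaleR) auto
  then show ?thesis by (simp add: euclidean_representation)
qed

lemma Ck_on_Pair:
  fixes f :: "'a::euclidean_space \<Rightarrow> 'b::euclidean_space" and g :: "'a \<Rightarrow> 'c::euclidean_space"
  assumes "open U" "Ck_on k U f" "Ck_on k U g"
  shows "Ck_on k U (\<lambda>x. (f x, g x))"
proof -
  have 1: "bounded_linear (\<lambda>y::'b. (y, 0::'c))"
    by (intro bounded_linear_Pair bounded_linear_ident bounded_linear_zero)
  have 2: "bounded_linear (\<lambda>y::'c. (0::'b, y))"
    by (intro bounded_linear_Pair bounded_linear_ident bounded_linear_zero)
  show ?thesis
    using Ck_on_add[OF assms(1) Ck_on_linear_compose[OF assms(1) 1 assms(2)]
        Ck_on_linear_compose[OF assms(1) 2 assms(3)]] by simp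
qed

lemma Ck_on_power:
  fixes f :: "'a::euclidean_space \<Rightarrow> real"
  assumes "open U" "Ck_on k U f"
  shows "Ck_on k U (\<lambda>x. f x ^ n)"
  by (induction n) (auto intro: Ck_on_mult assms)

lemma Ck_on_prod_set:
  fixes f :: "'i \<Rightarrow> 'a::euclidean_space \<Rightarrow> real"
  assumes "open U" "\<And>i. i \<in> I \<Longrightarrow> Ck_on k U (f i)"
  shows "Ck_on k U (\<lambda>x. \<Prod>i\<in>I. f i x)"
  using assms(2)
  by (induction I rule: infinite_finite_induct) (auto intro!: Ck_on_mult[OF assms(1)])

lemma dderiv_const: "dderiv u (\<lambda>x. c) = (\<lambda>x. 0)"
  by (auto simp: dderiv_def)

lemma dderiv_linear_compose:
  assumes "bounded_linear L" "f differentiable (at x)"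
  shows "dderiv u (\<lambda>x. L (f x)) x = L (dderiv u f x)"
  by (rule dderiv_eq[OF bounded_linear.has_derivative[OF assms(1) has_derivative_dderiv[OF assms(2)]]])

lemma dderiv_add:
  assumes "f differentiable (at x)" "g differentiable (at x)"
  shows "dderiv u (\<lambda>x. f x + g x) x = dderiv u f x + dderiv u g x"
  by (rule dderiv_eq[OF has_derivative_add[OF has_derivative_dderiv has_derivative_dderiv]])
     (use assms in auto)

lemma dderiv_diff:
  assumes "f differentiable (at x)" "g differentiable (at x)"
  shows "dderiv u (\<lambda>x. f x - g x) x = dderiv u f x - dderiv u g x"
  by (rule dderiv_eq[OF has_derivative_diff[OF has_derivative_dderiv has_derivative_dderiv]])
     (use assms in auto)

lemma dderiv_sum:
  assumes "\<And>i. i \<in> I \<Longrightarrow> f i differentiable (at x)"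
  shows "dderiv u (\<lambda>x. \<Sum>i\<in>I. f i x) x = (\<Sum>i\<in>I. dderiv u (f i) x)"
  by (rule dderiv_eq[OF has_derivative_sum[OF has_derivative_dderiv]]) (use assms in auto)

text \<open>The restriction to a line.\<close>

lemma dderiv_line:
  assumes "f differentiable (at (x + s *\<^sub>R z))"
  shows "((\<lambda>s. f (x + s *\<^sub>R z)) has_vector_derivative dderiv z f (x + s *\<^sub>R z)) (at s within S)"
proof -
  have "((\<lambda>s. x + s *\<^sub>R z) has_derivative (\<lambda>t. t *\<^sub>R z)) (at s within S)"
    by (auto intro!: derivative_eq_intros)
  from has_derivative_compose[OF this has_derivative_dderiv[OF assms]]
  have "((\<lambda>s. f (x + s *\<^sub>R z)) has_derivative (\<lambda>t. dderiv (t *\<^sub>R z) f (x + s *\<^sub>R z))) (at s within S)" .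
  moreover have "dderiv (t *\<^sub>R z) f (x + s *\<^sub>R z) = t *\<^sub>R dderiv z f (x + s *\<^sub>R z)" for t
    using linear_frechet_derivative[OF assms] by (simp add: dderiv_def linear_cmul)
  ultimately show ?thesis by (simp add: has_vector_derivative_def)
qed

lemma dderiv_line_real:
  fixes f :: "'a::real_normed_vector \<Rightarrow> real"
  assumes "f differentiable (at (x + s *\<^sub>R z))"
  shows "((\<lambda>s. f (x + s *\<^sub>R z)) has_real_derivative dderiv z f (x + s *\<^sub>R z)) (at s within S)"
  using dderiv_line[OF assms] by (simp add: has_real_derivative_iff_has_vector_derivative)

lemma dderiv_mvt:
  fixes f :: "'a::real_normed_vector \<Rightarrow> real"
  assumes "\<And>s. 0 \<le> s \<Longrightarrow> s \<le> 1 \<Longrightarrow> f differentiable (at (x + s *\<^sub>R z))"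
  shows "\<exists>s. 0 < s \<and> s < 1 \<and> f (x + z) - f x = dderiv z f (x + s *\<^sub>R z)"
proof -
  have "\<exists>s. 0 < s \<and> s < 1 \<and> f (x + 1 *\<^sub>R z) - f (x + 0 *\<^sub>R z) = (1 - 0) * dderiv z f (x + s *\<^sub>R z)"
    by (rule MVT2) (auto intro!: dderiv_line_real assms)
  then show ?thesis by auto
qed

lemma dderiv_scale:
  assumes "f differentiable (at x)"
  shows "dderiv (c *\<^sub>R u) f x = c *\<^sub>R dderiv u f x"
  using linear_frechet_derivative[OF assms] by (simp add: dderiv_def linear_cmul)

text \<open>Both mixed derivatives are the limit of the second difference quotient
  \<open>(f (x + tu + tw) - f (x + tu) - f (x + tw) + f x) / t\<^sup>2\<close>.\<close>

lemma second_difference: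
  fixes f :: "'a::euclidean_space \<Rightarrow> real"
  assumes "Ck_on 2 U f" "t > 0"
    "\<And>a b. 0 \<le> a \<Longrightarrow> a \<le> t \<Longrightarrow> 0 \<le> b \<Longrightarrow> b \<le> t \<Longrightarrow> x + a *\<^sub>R u + b *\<^sub>R w \<in> U"
  shows "\<exists>a b. 0 \<le> a \<and> a \<le> t \<and> 0 \<le> b \<and> b \<le> t \<and>
    f (x + t *\<^sub>R u + t *\<^sub>R w) - f (x + t *\<^sub>R u) - f (x + t *\<^sub>R w) + f x
      = t * t * dderiv u (dderiv w f) (x + a *\<^sub>R u + b *\<^sub>R w)"
proof -
  have C: "f differentiable (at y)" "dderiv w f differentiable (at y)" if "y \<in> U" for y w
    using assms(1) that by (auto simp: numeral_2_eq_2)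
  define \<phi> where "\<phi> b = f ((x + t *\<^sub>R u) + b *\<^sub>R w) - f (x + b *\<^sub>R w)" for b
  have "\<exists>b. 0 < b \<and> b < t \<and> \<phi> t - \<phi> 0 = (t - 0) *
      (dderiv w f ((x + t *\<^sub>R u) + b *\<^sub>R w) - dderiv w f (x + b *\<^sub>R w))"
    unfolding \<phi>_def
    by (rule MVT2) (use assms(2) assms(3)[of t] assms(3)[of 0] in \<open>auto intro!: DERIV_diff dderiv_line_real C\<close>)
  then obtain b where b: "0 < b" "b < t" "\<phi> t - \<phi> 0 =
      t * (dderiv w f ((x + t *\<^sub>R u) + b *\<^sub>R w) - dderiv w f (x + b *\<^sub>R w))" by auto
  have "\<exists>a. 0 < a \<and> a < t \<and> dderiv w f ((x + b *\<^sub>R w) + t *\<^sub>R u) - dderiv w f ((x + b *\<^sub>R w) + 0 *\<^sub>R u)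
     = (t - 0) * dderiv u (dderiv w f) ((x + b *\<^sub>R w) + a *\<^sub>R u)"
    by (rule MVT2)
      (use assms(2) in simp, rule dderiv_line_real[OF C(2)],
       use assms(3)[of _ b] b in \<open>auto simp: add_ac\<close>)
  then obtain a where a: "0 < a" "a < t" "dderiv w f ((x + b *\<^sub>R w) + t *\<^sub>R u) - dderiv w f (x + b *\<^sub>R w)
     = t * dderiv u (dderiv w f) ((x + b *\<^sub>R w) + a *\<^sub>R u)" by auto
  have "\<phi> t - \<phi> 0 = t * t * dderiv u (dderiv w f) (x + a *\<^sub>R u + b *\<^sub>R w)"
    using a(3) b(3) by (simp add: add_ac)
  then show ?thesis using a b unfolding \<phi>_def by (intro exI[of _ a] exI[of _ b]) auto
qed

lemma dderiv_commute:
  fixes f :: "'a::euclidean_space \<Rightarrow> real"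
  assumes "open U" "x \<in> U" "Ck_on 2 U f"
  shows "dderiv u (dderiv w f) x = dderiv w (dderiv u f) x"
proof -
  have cont: "continuous_on U (dderiv u (dderiv w f))" for u w
    using assms(3) by (auto simp: numeral_2_eq_2)
  have lim: "\<exists>\<delta>>0. \<forall>a b. \<bar>a\<bar> \<le> \<delta> \<longrightarrow> \<bar>b\<bar> \<le> \<delta> \<longrightarrow> x + a *\<^sub>R u + b *\<^sub>R w \<in> U \<and>
       \<bar>dderiv u (dderiv w f) (x + a *\<^sub>R u + b *\<^sub>R w) - dderiv u (dderiv w f) x\<bar> < e" if "e > 0" for e u w
  proof -
    obtain d1 where d1: "d1 > 0" "ball x d1 \<subseteq> U" using assms open_contains_ball by blast
    have "\<exists>d>0. \<forall>y\<in>U. dist y x < d \<longrightarrow>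
        dist (dderiv u (dderiv w f) y) (dderiv u (dderiv w f) x) < e"
      using cont[of u w] assms(2) \<open>e > 0\<close> unfolding continuous_on_iff by auto
    then obtain d2 where d2: "d2 > 0" "\<And>y. y \<in> U \<Longrightarrow> dist y x < d2 \<Longrightarrow>
        dist (dderiv u (dderiv w f) y) (dderiv u (dderiv w f) x) < e" by auto
    define \<delta> where "\<delta> = min d1 d2 / (2 * (norm u + norm w + 1))"
    have pos: "norm u + norm w + 1 > 0" by (simp add: add_nonneg_pos)
    have \<delta>: "\<delta> > 0" unfolding \<delta>_def using d1 d2 pos by auto
    have near: "dist (x + a *\<^sub>R u + b *\<^sub>R w) x < min d1 d2" if "\<bar>a\<bar> \<le> \<delta>" "\<bar>b\<bar> \<le> \<delta>" for a b
    proof -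
      have "dist (x + a *\<^sub>R u + b *\<^sub>R w) x = norm (a *\<^sub>R u + b *\<^sub>R w)" by (simp add: dist_norm)
      also have "\<dots> \<le> \<bar>a\<bar> * norm u + \<bar>b\<bar> * norm w" by (metis norm_scaleR norm_triangle_ineq)
      also have "\<dots> \<le> \<delta> * norm u + \<delta> * norm w" using that by (intro add_mono mult_right_mono) auto
      also have "\<dots> \<le> \<delta> * (norm u + norm w + 1)" using \<delta> by (simp add: algebra_simps)
      also have "\<dots> = min d1 d2 / 2" unfolding \<delta>_def using pos by (simp add: field_simps)
      also have "\<dots> < min d1 d2" using d1(1) d2(1) by (simp add: min_def)
      finally show ?thesis .
    qed
    have "x + a *\<^sub>R u + b *\<^sub>R w \<in> U \<and>
       \<bar>dderiv u (dderiv w f) (x + a *\<^sub>R u + b *\<^sub>R w) - dderiv u (dderiv w f) x\<bar> < e"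
      if "\<bar>a\<bar> \<le> \<delta>" "\<bar>b\<bar> \<le> \<delta>" for a b
    proof -
      have "x + a *\<^sub>R u + b *\<^sub>R w \<in> ball x d1" using near[OF that] by (simp add: dist_commute)
      then show ?thesis using d1(2) d2(2) near[OF that] by (auto simp: dist_real_def)
    qed
    then show ?thesis using \<delta> by blast
  qed
  have "\<bar>dderiv u (dderiv w f) x - dderiv w (dderiv u f) x\<bar> \<le> e" if "e > 0" for e
  proof -
    obtain d1 where d1: "d1 > 0" "\<And>a b. \<bar>a\<bar> \<le> d1 \<Longrightarrow> \<bar>b\<bar> \<le> d1 \<Longrightarrow> x + a *\<^sub>R u + b *\<^sub>R w \<in> U \<and>
       \<bar>dderiv u (dderiv w f) (x + a *\<^sub>R u + b *\<^sub>R w) - dderiv u (dderiv w f) x\<bar> < e / 2"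
      using lim[of "e / 2" u w] \<open>e > 0\<close> by auto
    obtain d2 where d2: "d2 > 0" "\<And>a b. \<bar>a\<bar> \<le> d2 \<Longrightarrow> \<bar>b\<bar> \<le> d2 \<Longrightarrow> x + a *\<^sub>R w + b *\<^sub>R u \<in> U \<and>
       \<bar>dderiv w (dderiv u f) (x + a *\<^sub>R w + b *\<^sub>R u) - dderiv w (dderiv u f) x\<bar> < e / 2"
      using lim[of "e / 2" w u] \<open>e > 0\<close> by auto
    define t where "t = min d1 d2"
    have t: "t > 0" using d1 d2 by (simp add: t_def)
    obtain a b where ab: "0 \<le> a" "a \<le> t" "0 \<le> b" "b \<le> t"
      "f (x + t *\<^sub>R u + t *\<^sub>R w) - f (x + t *\<^sub>R u) - f (x + t *\<^sub>R w) + f x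
        = t * t * dderiv u (dderiv w f) (x + a *\<^sub>R u + b *\<^sub>R w)"
      using second_difference[OF assms(3) t, of x u w] d1 by (auto simp: t_def)
    obtain a' b' where ab': "0 \<le> a'" "a' \<le> t" "0 \<le> b'" "b' \<le> t"
      "f (x + t *\<^sub>R w + t *\<^sub>R u) - f (x + t *\<^sub>R w) - f (x + t *\<^sub>R u) + f x
        = t * t * dderiv w (dderiv u f) (x + a' *\<^sub>R w + b' *\<^sub>R u)"
      using second_difference[OF assms(3) t, of x w u] d2 by (auto simp: t_def)
    have "t * t * dderiv u (dderiv w f) (x + a *\<^sub>R u + b *\<^sub>R w)
        = t * t * dderiv w (dderiv u f) (x + a' *\<^sub>R w + b' *\<^sub>R u)"
    proof -
      have "x + t *\<^sub>R w + t *\<^sub>R u = x + t *\<^sub>R u + t *\<^sub>R w" by (simp add: add_ac)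
      with ab(5) ab'(5) show ?thesis by (simp only: diff_right_commute)
    qed
    then have "dderiv u (dderiv w f) (x + a *\<^sub>R u + b *\<^sub>R w)
        = dderiv w (dderiv u f) (x + a' *\<^sub>R w + b' *\<^sub>R u)" using t by simp
    moreover have "\<bar>dderiv u (dderiv w f) (x + a *\<^sub>R u + b *\<^sub>R w) - dderiv u (dderiv w f) x\<bar> < e / 2"
      using d1(2)[of a b] ab by (auto simp: t_def)
    moreover have "\<bar>dderiv w (dderiv u f) (x + a' *\<^sub>R w + b' *\<^sub>R u) - dderiv w (dderiv u f) x\<bar> < e / 2"
      using d2(2)[of a' b'] ab' by (auto simp: t_def)
    ultimately show ?thesis by linarith
  qed
  then show ?thesis using field_le_epsilon[of "\<bar>dderiv u (dderiv w f) x - dderiv w (dderiv u f) x\<bar>" 0]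
    by auto
qed

text \<open>Functions of one real variable with an infinite chain of derivatives.\<close>

lemma Ck_on_real_family:
  fixes f :: "real \<Rightarrow> real"
  assumes "P f" "\<And>f. P f \<Longrightarrow> \<exists>f'. P f' \<and> (\<forall>x. (f has_real_derivative f' x) (at x))"
  shows "Ck_on k UNIV f"
proof -
  have "P f \<Longrightarrow> Ck_on k UNIV (\<lambda>x. c * f x)" for c f
  proof (induction k arbitrary: f c)
    case 0
    then obtain f' where "\<And>x. (f has_real_derivative f' x) (at x)" using assms(2) by blast
    then have "continuous_on UNIV f" by (meson DERIV_isCont continuous_at_imp_continuous_on)
    then show ?case by (auto intro!: continuous_on_mult_left)
  next
    case (Suc k)
    obtain f' where f': "P f'" "\<And>x. (f has_real_derivative f' x) (at x)" using assms(2) Suc.prems by blast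
    have d: "((\<lambda>x. c * f x) has_derivative (\<lambda>u. u * (c * f' x))) (at x)" for x
      proof -
      have "(*) (c * f' x) = (\<lambda>u. u * (c * f' x))" by (auto simp: mult.commute)
      then show ?thesis using DERIV_cmult[OF f'(2), of c x] by (simp only: has_field_derivative_def)
    qed
    then have "dderiv u (\<lambda>x. c * f x) = (\<lambda>x. (u * c) * f' x)" for u
      using dderiv_eq by (fastforce simp: mult.assoc)
    moreover have "Ck_on k UNIV (\<lambda>x. (u * c) * f' x)" for u by (rule Suc.IH[OF f'(1)])
    ultimately show ?case using d by (auto simp: differentiable_def)
  qed
  from this[of f 1] show ?thesis using assms(1) by simp
qed

section \<open>Integrals of derivatives\<close>

text \<open>The integral of the derivative is the derivative at \<open>s = 0\<close> of the integral of the shifted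
  function, which is constant.\<close>

lemma integral_dderiv_zero:
  fixes f :: "'a::euclidean_space \<Rightarrow> real"
  assumes "Ck_on 1 UNIV f"
    and "\<And>s. 0 \<le> s \<Longrightarrow> s \<le> 1 \<Longrightarrow> integral (cbox a b) (\<lambda>x. f (x + s *\<^sub>R u)) = integral (cbox a b) f"
  shows "integral (cbox a b) (dderiv u f) = 0"
proof -
  have C: "f differentiable (at x)" "continuous_on UNIV (dderiv u f)" "continuous_on UNIV f" for x
    using assms(1) Ck_on_continuous[OF assms(1)] by auto
  have "((\<lambda>s. integral (cbox a b) (\<lambda>x. f (x + s *\<^sub>R u))) has_vector_derivative
      integral (cbox a b) (\<lambda>x. dderiv u f (x + 0 *\<^sub>R u))) (at 0 within {0..1})"
  proof (rule leibniz_rule_vector_derivative)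
    show "((\<lambda>s. f (t + s *\<^sub>R u)) has_vector_derivative dderiv u f (t + s *\<^sub>R u)) (at s within {0..1})"
      for s t by (rule dderiv_line[OF C(1)])
    show "(\<lambda>x. f (x + s *\<^sub>R u)) integrable_on cbox a b" for s
      by (intro integrable_continuous continuous_intros continuous_on_compose2[OF C(3)]) auto
    show "continuous_on ({0..1} \<times> cbox a b) (\<lambda>(s, t). dderiv u f (t + s *\<^sub>R u))"
      unfolding split_beta by (intro continuous_intros continuous_on_compose2[OF C(2)]) auto
  qed auto
  moreover have "((\<lambda>s. integral (cbox a b) (\<lambda>x. f (x + s *\<^sub>R u))) has_vector_derivative 0)
      (at 0 within {0..1})"
    by (rule has_vector_derivative_transform[where f = "\<lambda>_. integral (cbox a b) f"])
      (use assms(2) in auto)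
  ultimately show ?thesis
    using vector_derivative_unique_within_closed_interval[of 0 1 0 _ "integral (cbox a b) (dderiv u f)" 0]
    by simp
qed

lemma mem_cell: "(x::vec3) \<in> cbox 0 1 \<longleftrightarrow> (\<forall>i. 0 \<le> x $ i \<and> x $ i \<le> 1)"
  by (simp add: mem_box_cart)

lemma integral_periodic_shift:
  fixes f :: "vec3 \<Rightarrow> real"
  assumes "periodic f" "continuous_on UNIV f" "0 \<le> s" "s \<le> 1"
  shows "integral (cbox 0 1) (\<lambda>x. f (x + s *\<^sub>R axis i 1)) = integral (cbox 0 1) f"
proof -
  let ?e = "axis i 1 :: vec3"
  have B: "?e \<in> Basis" by simp
  have int: "f integrable_on cbox a b" for a b
    by (rule integrable_continuous) (use assms(2) continuous_on_subset in blast)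
  have nth: "x \<bullet> ?e = x $ i" for x by (simp add: inner_axis)
  have "integral (cbox 0 1) (\<lambda>x. f (x + s *\<^sub>R ?e))
      = integral (cbox (s *\<^sub>R ?e) (1 + s *\<^sub>R ?e)) f"
    using integral_shift_cbox[of "s *\<^sub>R ?e" "s *\<^sub>R ?e" "1 + s *\<^sub>R ?e" f] by simp
  also have "\<dots> = integral (cbox (s *\<^sub>R ?e) (1 + s *\<^sub>R ?e) \<inter> {x. x \<bullet> ?e \<le> 1}) f
      + integral (cbox (s *\<^sub>R ?e) (1 + s *\<^sub>R ?e) \<inter> {x. x \<bullet> ?e \<ge> 1}) f"
    by (rule integral_split[OF int B])
  also have "cbox (s *\<^sub>R ?e) (1 + s *\<^sub>R ?e) \<inter> {x. x \<bullet> ?e \<le> 1} = cbox 0 1 \<inter> {x. x \<bullet> ?e \<ge> s}"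
  proof (rule set_eqI)
    fix x :: vec3
    have "x \<in> cbox (s *\<^sub>R ?e) (1 + s *\<^sub>R ?e) \<longleftrightarrow>
        (\<forall>j. (if j = i then s \<le> x $ j \<and> x $ j \<le> 1 + s else 0 \<le> x $ j \<and> x $ j \<le> 1))"
      by (auto simp: mem_box_cart axis_def)
    then show "x \<in> cbox (s *\<^sub>R ?e) (1 + s *\<^sub>R ?e) \<inter> {x. x \<bullet> ?e \<le> 1} \<longleftrightarrow> x \<in> cbox 0 1 \<inter> {x. x \<bullet> ?e \<ge> s}"
      using assms(3,4) by (simp only: Int_iff mem_Collect_eq nth mem_cell) (smt (verit))
  qed
  also have "cbox (s *\<^sub>R ?e) (1 + s *\<^sub>R ?e) \<inter> {x. x \<bullet> ?e \<ge> 1} = cbox ?e (1 + s *\<^sub>R ?e)"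
  proof (rule set_eqI)
    fix x :: vec3
    have "x \<in> cbox (s *\<^sub>R ?e) (1 + s *\<^sub>R ?e) \<longleftrightarrow>
        (\<forall>j. (if j = i then s \<le> x $ j \<and> x $ j \<le> 1 + s else 0 \<le> x $ j \<and> x $ j \<le> 1))"
      by (auto simp: mem_box_cart axis_def)
    moreover have "x \<in> cbox ?e (1 + s *\<^sub>R ?e) \<longleftrightarrow>
        (\<forall>j. (if j = i then 1 \<le> x $ j \<and> x $ j \<le> 1 + s else 0 \<le> x $ j \<and> x $ j \<le> 1))"
      by (auto simp: mem_box_cart axis_def)
    ultimately show "x \<in> cbox (s *\<^sub>R ?e) (1 + s *\<^sub>R ?e) \<inter> {x. x \<bullet> ?e \<ge> 1} \<longleftrightarrow> x \<in> cbox ?e (1 + s *\<^sub>R ?e)"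
      using assms(3,4) by (simp only: Int_iff mem_Collect_eq nth) (smt (verit))
  qed
  \<comment> \<open>The slab that the shift pushes out of the cell is moved back by periodicity.\<close>
  also have "integral (cbox ?e (1 + s *\<^sub>R ?e)) f
      = integral (cbox 0 (1 + s *\<^sub>R ?e - ?e)) f"
    using integral_shift_cbox[of ?e ?e "1 + s *\<^sub>R ?e" f] assms(1) by (simp add: periodic_def)
  also have "cbox 0 (1 + s *\<^sub>R ?e - ?e) = cbox 0 1 \<inter> {x. x \<bullet> ?e \<le> s}"
  proof (rule set_eqI)
    fix x :: vec3
    have "x \<in> cbox 0 (1 + s *\<^sub>R ?e - ?e) \<longleftrightarrow>
        (\<forall>j. (if j = i then 0 \<le> x $ j \<and> x $ j \<le> s else 0 \<le> x $ j \<and> x $ j \<le> 1))"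
      by (auto simp: mem_box_cart axis_def)
    then show "x \<in> cbox 0 (1 + s *\<^sub>R ?e - ?e) \<longleftrightarrow> x \<in> cbox 0 1 \<inter> {x. x \<bullet> ?e \<le> s}"
      using assms(3,4) by (simp only: Int_iff mem_Collect_eq nth mem_cell) (smt (verit))
  qed
  also have "integral (cbox 0 1 \<inter> {x. x \<bullet> ?e \<ge> s}) f + integral (cbox 0 1 \<inter> {x. x \<bullet> ?e \<le> s}) f
     = integral (cbox 0 1) f"
    using integral_split[OF int B, of 0 1 s] by simp
  finally show ?thesis .
qed

lemma integral_partial_periodic:
  assumes "periodic f" "Ck_on 1 UNIV f"
  shows "integral (cbox 0 1) (partial i f) = (0::real)"
  by (rule integral_dderiv_zero[OF assms(2)])
    (use integral_periodic_shift[OF assms(1) Ck_on_continuous[OF assms(2)]] in auto)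

text \<open>The support of \<open>f\<close> lies in the cube of half side \<open>r\<close>; the margin of width 1 keeps it inside the
  larger cube while \<open>f\<close> is shifted.\<close>

lemma integral_partial_compact:
  fixes f :: "vec3 \<Rightarrow> real"
  assumes "Ck_on 1 UNIV f" "\<And>x. f x \<noteq> 0 \<Longrightarrow> norm (x - c) \<le> r"
  shows "integral (cbox (c - (r + 1) *\<^sub>R 1) (c + (r + 1) *\<^sub>R 1)) (partial i f) = 0"
proof (rule integral_dderiv_zero[OF assms(1)])
  fix s :: real assume s: "0 \<le> s" "s \<le> 1"
  let ?a = "c - (r + 1) *\<^sub>R 1" and ?b = "c + (r + 1) *\<^sub>R 1" and ?e = "s *\<^sub>R axis i 1 :: vec3"
  let ?K = "cbox (c - r *\<^sub>R 1) (c + r *\<^sub>R 1)"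
  have supp: "x \<in> ?K" if "f x \<noteq> 0" for x
  proof -
    have "c $ j - r \<le> x $ j \<and> x $ j \<le> c $ j + r" for j
      using assms(2)[OF that] component_le_norm_cart[of "x - c" j]
      unfolding vector_minus_component by linarith
    then show ?thesis by (simp add: mem_box_cart)
  qed
  have int: "(f has_integral integral ?K f) ?K"
    by (rule integrable_integral, rule integrable_continuous)
      (use Ck_on_continuous[OF assms(1)] continuous_on_subset in blast)
  have eq: "integral T f = integral ?K f" if "?K \<subseteq> T" for T
    by (rule integral_unique, rule has_integral_on_superset[OF int _ that]) (use supp in blast)
  have "integral (cbox ?a ?b) (\<lambda>x. f (x + ?e)) = integral (cbox (?a + ?e) (?b + ?e)) f"
    using integral_shift_cbox[of "?a + ?e" ?e "?b + ?e" f] by simp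
  also have "\<dots> = integral ?K f"
  proof (rule eq)
    have "0 \<le> axis i s $ j \<and> axis i s $ j \<le> 1" for j :: 3 using s by (auto simp: axis_def)
    moreover have "?e = axis i s" by (simp add: vec_eq_iff axis_def)
    ultimately have e: "0 \<le> ?e $ j \<and> ?e $ j \<le> 1" for j by simp
    have "x \<in> cbox (?a + ?e) (?b + ?e)" if "x \<in> ?K" for x
      unfolding mem_box_cart
    proof
      fix j
      have "(c - r *\<^sub>R 1) $ j \<le> x $ j \<and> x $ j \<le> (c + r *\<^sub>R 1) $ j"
        using that unfolding mem_box_cart by blast
      then show "(?a + ?e) $ j \<le> x $ j \<and> x $ j \<le> (?b + ?e) $ j"
        using e[of j] unfolding vector_add_component vector_minus_component vector_scaleR_component
        by simp
    qed
    then show "?K \<subseteq> cbox (?a + ?e) (?b + ?e)" by blast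
  qed
  also have "\<dots> = integral (cbox ?a ?b) f"
  proof (rule eq[symmetric])
    have "x \<in> cbox ?a ?b" if "x \<in> ?K" for x
      unfolding mem_box_cart
    proof
      fix j
      have "(c - r *\<^sub>R 1) $ j \<le> x $ j \<and> x $ j \<le> (c + r *\<^sub>R 1) $ j"
        using that unfolding mem_box_cart by blast
      then show "?a $ j \<le> x $ j \<and> x $ j \<le> ?b $ j" by simp
    qed
    then show "?K \<subseteq> cbox ?a ?b" by blast
  qed
  finally show "integral (cbox ?a ?b) (\<lambda>x. f (x + ?e)) = integral (cbox ?a ?b) f" .
qed

section \<open>Weak gradients of class C^1 are curl free\<close>

text \<open>The functions \<open>q (1/x) exp (-1/x)\<close> for polynomials \<open>q\<close>, extended by zero to \<open>x \<le> 0\<close>,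
  are closed under differentiation; hence they are smooth.\<close>

definition exp_flat :: "real poly \<Rightarrow> real \<Rightarrow> real" where
  "exp_flat q x = (if x > 0 then poly q (1 / x) * exp (- (1 / x)) else 0)"

lemma poly_exp_tendsto_0: "((\<lambda>y::real. poly q y * exp (- y)) \<longlongrightarrow> 0) at_top"
proof -
  have "((\<lambda>y::real. \<Sum>i\<le>degree q. coeff q i * (y ^ i / exp y)) \<longlongrightarrow> (\<Sum>i\<le>degree q. coeff q i * 0)) at_top"
    by (intro tendsto_intros tendsto_power_div_exp_0)
  then show ?thesis
    by (simp add: poly_altdef sum_distrib_right exp_minus divide_inverse mult.assoc)
qed

lemma exp_flat_derivative:
  "(exp_flat q has_real_derivative exp_flat (monom 1 2 * (q - pderiv q)) x) (at x)"
proof (cases "x = 0")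
  case False
  show ?thesis
  proof (cases "x > 0")
    case True
    have "((\<lambda>x. poly q (1 / x) * exp (- (1 / x))) has_real_derivative
        exp_flat (monom 1 2 * (q - pderiv q)) x) (at x)"
      unfolding exp_flat_def using True
      by (auto intro!: derivative_eq_intros simp: poly_monom field_simps power2_eq_square)
    then show ?thesis
      by (rule has_field_derivative_transform_within_open[where S = "{0<..}"])
        (use True in \<open>auto simp: exp_flat_def\<close>)
  next
    case neg: False
    have "((\<lambda>x. 0) has_real_derivative exp_flat (monom 1 2 * (q - pderiv q)) x) (at x)"
      using neg by (simp add: exp_flat_def)
    then show ?thesis
      by (rule has_field_derivative_transform_within_open[where S = "{..<0}"])
        (use neg False in \<open>auto simp: exp_flat_def\<close>)
  qed
next
  case True
  have "((\<lambda>h. exp_flat q h / h) \<longlongrightarrow> 0) (at 0)"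
  proof (rule filterlim_split_at)
    show "((\<lambda>h. exp_flat q h / h) \<longlongrightarrow> 0) (at_left 0)"
      by (rule tendsto_eventually) (auto simp: eventually_at_filter exp_flat_def)
    have "((\<lambda>h::real. poly (pCons 0 q) (inverse h) * exp (- inverse h)) \<longlongrightarrow> 0) (at_right 0)"
      by (rule filterlim_compose[OF poly_exp_tendsto_0 filterlim_inverse_at_top_right])
    then show "((\<lambda>h. exp_flat q h / h) \<longlongrightarrow> 0) (at_right 0)"
      by (rule Lim_transform_eventually)
        (auto simp: eventually_at_filter exp_flat_def divide_inverse)
  qed
  then show ?thesis using True by (simp add: has_field_derivative_iff exp_flat_def)
qed

lemma Ck_on_exp_flat: "Ck_on k UNIV (exp_flat q)"
  by (rule Ck_on_real_family[where P = "\<lambda>f. \<exists>q. f = exp_flat q"])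
    (use exp_flat_derivative in blast)+

lemma bump_function:
  fixes c :: vec3
  assumes "r > 0"
  obtains \<phi> :: "vec3 \<Rightarrow> real" where "\<And>k. Ck_on k UNIV \<phi>" "\<And>x. \<phi> x \<ge> 0" "\<phi> c > 0"
    "\<And>x. norm (x - c) \<ge> r \<Longrightarrow> \<phi> x = 0"
proof
  let ?\<phi> = "\<lambda>x. exp_flat 1 (r\<^sup>2 - (x - c) \<bullet> (x - c))"
  show "Ck_on k UNIV ?\<phi>" for k
  proof (rule Ck_on_compose[OF open_UNIV Ck_on_exp_flat])
    have "Ck_on k UNIV (\<lambda>x. x - c)"
      by (rule Ck_on_diff[OF open_UNIV Ck_on_linear[OF bounded_linear_ident] Ck_on_const])
    from Ck_on_inner[OF open_UNIV this this]
    show "Ck_on k UNIV (\<lambda>x. r\<^sup>2 - (x - c) \<bullet> (x - c))"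
      by (rule Ck_on_diff[OF open_UNIV Ck_on_const])
  qed auto
  show "?\<phi> x \<ge> 0" for x by (simp add: exp_flat_def)
  show "?\<phi> c > 0" using assms by (simp add: exp_flat_def)
  show "?\<phi> x = 0" if "norm (x - c) \<ge> r" for x
    using power_mono[OF that, of 2] assms by (simp add: exp_flat_def dot_square_norm not_less)
qed

lemma lebesgue_integral_support:
  fixes f :: "vec3 \<Rightarrow> real"
  assumes "continuous_on UNIV f" "\<And>x. x \<notin> cbox a b \<Longrightarrow> f x = 0"
  shows "(LINT x|lebesgue. f x) = integral (cbox a b) f"
proof -
  have "set_integrable lebesgue (cbox a b) f"
    by (rule absolutely_integrable_continuous) (use assms(1) continuous_on_subset in blast)
  from set_lebesgue_integral_eq_integral(2)[OF this]
  have "(LINT x:cbox a b|lebesgue. f x) = integral (cbox a b) f" .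
  moreover have "(\<lambda>x. indicator (cbox a b) x *\<^sub>R f x) = f"
    by (rule ext) (use assms(2) in \<open>auto split: split_indicator\<close>)
  ultimately show ?thesis by (simp only: set_lebesgue_integral_def)
qed

text \<open>If a component \<open>q\<close> of the curl were positive at \<open>c\<close>, it would be positive on a ball. Take a bump
  function \<open>\<phi>\<close> supported there. As mixed derivatives of \<open>\<phi>\<close> commute, testing with its derivatives and
  integrating by parts gives \<open>\<integral> q \<phi> = 0\<close>, a contradiction.\<close>

lemma is_gradient_curl_free:
  assumes grad: "is_gradient F" and C: "Ck_on 1 UNIV F"
  shows "partial \<beta> (\<lambda>x. F x $ i $ \<alpha>) x = partial \<alpha> (\<lambda>x. F x $ i $ \<beta>) x"
proof (rule ccontr)
  have Fc: "Ck_on 1 UNIV (\<lambda>x. F x $ i $ \<alpha>)" for \<alpha>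
    by (rule Ck_on_linear_compose[OF open_UNIV _ C])
      (intro bounded_linear_compose[OF bounded_linear_vec_nth bounded_linear_vec_nth])
  have key: "partial \<beta> (\<lambda>x. F x $ i $ \<alpha>) c \<le> partial \<alpha> (\<lambda>x. F x $ i $ \<beta>) c" for \<alpha> \<beta> c
  proof (rule ccontr)
    define q where "q x = partial \<beta> (\<lambda>x. F x $ i $ \<alpha>) x - partial \<alpha> (\<lambda>x. F x $ i $ \<beta>) x" for x
    assume "\<not> ?thesis"
    then have "q c > 0" by (simp add: q_def)
    have qc: "continuous_on UNIV q"
      unfolding q_def using Fc by (intro continuous_on_diff) auto
    have "open {x. q x > 0}"
      using qc by (intro open_Collect_less continuous_intros)
    then obtain r where r: "r > 0" "ball c r \<subseteq> {x. q x > 0}"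
      using \<open>q c > 0\<close> open_contains_ball by (metis mem_Collect_eq)
    obtain \<phi> :: "vec3 \<Rightarrow> real" where \<phi>: "\<And>k. Ck_on k UNIV \<phi>" "\<And>x. \<phi> x \<ge> 0" "\<phi> c > 0"
        "\<And>x. norm (x - c) \<ge> r \<Longrightarrow> \<phi> x = 0"
      using bump_function[OF r(1)] by metis
    let ?K = "cbox (c - (r + 1) *\<^sub>R 1) (c + (r + 1) *\<^sub>R 1)"
    have inK: "x \<in> ?K" if "norm (x - c) \<le> r" for x
    proof -
      have "c $ j - (r + 1) \<le> x $ j \<and> x $ j \<le> c $ j + (r + 1)" for j
        using that component_le_norm_cart[of "x - c" j]
        unfolding vector_minus_component by linarith
      then show ?thesis by (simp add: mem_box_cart)
    qed
    have d\<phi>: "partial \<gamma> \<phi> x = 0" if "norm (x - c) > r" for \<gamma> x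
    proof -
      have "open {x. norm (x - c) > r}" by (intro open_Collect_less continuous_intros)
      then have "partial \<gamma> \<phi> x = partial \<gamma> (\<lambda>_. 0) x"
        by (rule dderiv_cong_open) (use that \<phi>(4) in auto)
      then show ?thesis by (simp add: dderiv_def)
    qed
    have dd\<phi>: "partial \<delta> (partial \<gamma> \<phi>) x = 0" if "norm (x - c) > r" for \<gamma> \<delta> x
    proof -
      have "open {x. norm (x - c) > r}" by (intro open_Collect_less continuous_intros)
      then have "partial \<delta> (partial \<gamma> \<phi>) x = partial \<delta> (\<lambda>_. 0) x"
        by (rule dderiv_cong_open) (use that d\<phi> in auto)
      then show ?thesis by (simp add: dderiv_def)
    qed
    obtain y :: "vec3 \<Rightarrow> vec3" where y: "\<And>i \<alpha> \<phi>. smooth_on UNIV \<phi> \<and> (\<exists>r. \<forall>x. norm x > r \<longrightarrow> \<phi> x = 0) \<Longrightarrow>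
          (LINT x|lebesgue. F x $ i $ \<alpha> * \<phi> x) = - (LINT x|lebesgue. y x $ i * partial \<alpha> \<phi> x)"
      using grad unfolding is_gradient_def by blast
    have test: "smooth_on UNIV (partial \<gamma> \<phi>) \<and> (\<exists>R. \<forall>x. norm x > R \<longrightarrow> partial \<gamma> \<phi> x = 0)" for \<gamma>
    proof
      show "smooth_on UNIV (partial \<gamma> \<phi>)"
        unfolding smooth_on_def using \<phi>(1) Ck_on_dderiv by (intro exI[of _ UNIV] exI[of _ "partial \<gamma> \<phi>"]) blast
      have "norm (x - c) > r" if "norm x > norm c + r" for x
        using that norm_triangle_ineq2[of x c] by linarith
      then show "\<exists>R. \<forall>x. norm x > R \<longrightarrow> partial \<gamma> \<phi> x = 0" using d\<phi> by blast
    qed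
    have "(LINT x|lebesgue. F x $ i $ \<alpha> * partial \<beta> \<phi> x) = (LINT x|lebesgue. F x $ i $ \<beta> * partial \<alpha> \<phi> x)"
      unfolding y[OF test] using dderiv_commute[OF open_UNIV UNIV_I \<phi>(1)] by metis
    moreover have "(LINT x|lebesgue. F x $ i $ \<alpha> * partial \<beta> \<phi> x)
       = - integral ?K (\<lambda>x. partial \<beta> (\<lambda>x. F x $ i $ \<alpha>) x * \<phi> x)" for \<alpha> \<beta>
    proof -
      have c1: "continuous_on UNIV (\<lambda>x. F x $ i $ \<alpha> * partial \<beta> \<phi> x)"
        using Fc \<phi>(1)[of 1] Ck_on_continuous[OF Fc] by (intro continuous_on_mult) auto
      have c2: "continuous_on UNIV (\<lambda>x. partial \<beta> (\<lambda>x. F x $ i $ \<alpha>) x * \<phi> x)"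
        using Fc Ck_on_continuous[OF \<phi>(1)] by (intro continuous_on_mult) auto
      have "(LINT x|lebesgue. F x $ i $ \<alpha> * partial \<beta> \<phi> x) = integral ?K (\<lambda>x. F x $ i $ \<alpha> * partial \<beta> \<phi> x)"
        by (rule lebesgue_integral_support[OF c1]) (use inK d\<phi> in force)
      moreover have "integral ?K (partial \<beta> (\<lambda>x. F x $ i $ \<alpha> * \<phi> x)) = 0"
        by (rule integral_partial_compact[OF Ck_on_mult[OF open_UNIV Fc \<phi>(1)]])
          (use \<phi>(4) in force)
      moreover have "partial \<beta> (\<lambda>x. F x $ i $ \<alpha> * \<phi> x) =
          (\<lambda>x. F x $ i $ \<alpha> * partial \<beta> \<phi> x + partial \<beta> (\<lambda>x. F x $ i $ \<alpha>) x * \<phi> x)"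
        by (rule ext, rule bounded_bilinear.dderiv_prod[OF bounded_bilinear_mult])
          (use Fc \<phi>(1)[of 1] in auto)
      moreover have "integral ?K (\<lambda>x. F x $ i $ \<alpha> * partial \<beta> \<phi> x + partial \<beta> (\<lambda>x. F x $ i $ \<alpha>) x * \<phi> x)
         = integral ?K (\<lambda>x. F x $ i $ \<alpha> * partial \<beta> \<phi> x) + integral ?K (\<lambda>x. partial \<beta> (\<lambda>x. F x $ i $ \<alpha>) x * \<phi> x)"
        by (intro integral_add integrable_continuous) (use c1 c2 continuous_on_subset in blast)+
      ultimately show ?thesis by simp
    qed
    ultimately have eq: "integral ?K (\<lambda>x. partial \<beta> (\<lambda>x. F x $ i $ \<alpha>) x * \<phi> x)
       = integral ?K (\<lambda>x. partial \<alpha> (\<lambda>x. F x $ i $ \<beta>) x * \<phi> x)" by simp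
    have cq: "continuous_on ?K (\<lambda>x. q x * \<phi> x)"
      by (intro continuous_intros continuous_on_subset[OF qc] continuous_on_subset[OF Ck_on_continuous[OF \<phi>(1)]]) auto
    have "integral ?K (\<lambda>x. q x * \<phi> x) = 0"
    proof -
      have "(\<lambda>x. q x * \<phi> x) = (\<lambda>x. partial \<beta> (\<lambda>x. F x $ i $ \<alpha>) x * \<phi> x - partial \<alpha> (\<lambda>x. F x $ i $ \<beta>) x * \<phi> x)"
        by (simp add: q_def left_diff_distrib)
      moreover have "(\<lambda>x. partial \<beta> (\<lambda>x. F x $ i $ \<alpha>) x * \<phi> x) integrable_on ?K" for \<alpha> \<beta>
        using Fc Ck_on_continuous[OF \<phi>(1)]
        by (intro integrable_continuous continuous_on_mult) (auto intro: continuous_on_subset)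
      ultimately show ?thesis using eq by (simp add: integral_diff)
    qed
    then have "((\<lambda>x. q x * \<phi> x) has_integral 0) ?K"
      using integrable_integral[OF integrable_continuous[OF cq]] by simp
    moreover have "q x * \<phi> x \<ge> 0" for x
    proof (cases "norm (x - c) \<ge> r")
      case True then show ?thesis using \<phi>(4) by simp
    next
      case False
      then have "x \<in> ball c r" by (simp add: dist_norm norm_minus_commute)
      then show ?thesis using r \<phi>(2)[of x] by (auto intro: mult_nonneg_nonneg less_imp_le)
    qed
    moreover have "box (c - (r + 1) *\<^sub>R 1) (c + (r + 1) *\<^sub>R 1) \<noteq> {}"
    proof -
      have "c \<in> box (c - (r + 1) *\<^sub>R 1) (c + (r + 1) *\<^sub>R 1)" using r by (simp add: mem_box_cart)
      then show ?thesis by blast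
    qed
    moreover have "c \<in> ?K" using inK[of c] r(1) by simp
    ultimately have "q c * \<phi> c = 0"
      by (intro has_integral_0_cbox_imp_0[OF cq])
    then show False using \<open>q c > 0\<close> \<phi>(3) by simp
  qed
  assume "\<not> ?thesis"
  then show False using key[of \<beta> \<alpha> x] key[of \<alpha> \<beta> x] by simp
qed

section \<open>Mollification on the torus\<close>

text \<open>The convolution on the torus; \<open>K\<close> is periodic in the applications.\<close>

definition conv :: "(vec3 \<Rightarrow> real) \<Rightarrow> (vec3 \<Rightarrow> real) \<Rightarrow> vec3 \<Rightarrow> real" where
  "conv \<phi> K x = integral (cbox 0 1) (\<lambda>y. \<phi> y * K (x - y))"

lemma sum_Basis_vec:
  "(\<Sum>b\<in>(Basis :: (real ^ 'n) set). f b) = (\<Sum>i\<in>UNIV. f (axis i 1))"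
proof -
  have B: "(Basis :: (real ^ 'n) set) = range (\<lambda>i. axis i 1)" by (auto simp: Basis_vec_def)
  have "inj (\<lambda>i. axis i 1 :: real ^ 'n)" by (auto simp: inj_def axis_eq_axis)
  from sum.reindex[OF this, of f] show ?thesis unfolding B by (simp only: o_def)
qed

lemma conv_integrable:
  fixes \<phi> K :: "vec3 \<Rightarrow> real"
  assumes "continuous_on UNIV \<phi>" "continuous_on UNIV K"
  shows "(\<lambda>y. \<phi> y * K (x - y)) integrable_on cbox 0 1"
proof -
  have "continuous_on UNIV (\<lambda>y. K (x - y))"
    by (rule continuous_on_compose2[OF assms(2)]) (auto intro!: continuous_intros)
  from continuous_on_mult[OF assms(1) this] show ?thesis
    by (intro integrable_continuous) (rule continuous_on_subset, auto)
qed

lemma conv_has_derivative: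
  assumes "continuous_on UNIV \<phi>" "Ck_on 1 UNIV K"
  shows "(conv \<phi> K has_derivative (\<lambda>u. conv \<phi> (dderiv u K) x)) (at x)"
proof -
  have K: "K differentiable (at x)" "continuous_on UNIV (dderiv u K)" "continuous_on UNIV K" for u x
    using assms(2) Ck_on_continuous[OF assms(2)] by auto
  define D where "D x y = (\<Sum>b\<in>Basis. (\<phi> y * dderiv b K (x - y)) *\<^sub>R blinfun_inner_left b)" for x y
  have D: "blinfun_apply (D x y) u = \<phi> y * dderiv u K (x - y)" for x y u
    using dderiv_Basis_sum[OF K(1), of u "x - y"]
    by (simp add: D_def blinfun.sum_left blinfun.scaleR_left sum_distrib_left mult_ac)
  have cont: "continuous_on (UNIV \<times> cbox 0 1) (\<lambda>(x, y). D x y)"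
    unfolding D_def split_beta
    by (intro continuous_intros continuous_on_compose2[OF K(2)] continuous_on_compose2[OF assms(1)]) auto
  have "((\<lambda>x. integral (cbox 0 1) (\<lambda>y. \<phi> y * K (x - y))) has_derivative
      blinfun_apply (integral (cbox 0 1) (D x))) (at x within UNIV)"
  proof (rule leibniz_rule)
    show "((\<lambda>x. \<phi> y * K (x - y)) has_derivative blinfun_apply (D x y)) (at x within UNIV)" for x y
    proof -
      have "((\<lambda>x. x - y) has_derivative (\<lambda>u. u)) (at x)" by (auto intro!: derivative_eq_intros)
      from has_derivative_compose[OF this has_derivative_dderiv[OF K(1)]]
      have "((\<lambda>x. \<phi> y * K (x - y)) has_derivative (\<lambda>u. \<phi> y * dderiv u K (x - y))) (at x)"
        by (rule has_derivative_mult_right)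
      moreover have "blinfun_apply (D x y) = (\<lambda>u. \<phi> y * dderiv u K (x - y))"
        using D by blast
      ultimately show ?thesis by simp
    qed
    show "(\<lambda>y. \<phi> y * K (x - y)) integrable_on cbox 0 1" for x
      by (rule conv_integrable[OF assms(1) K(3)])
    show "continuous_on (UNIV \<times> cbox 0 1) (\<lambda>(x, y). D x y)" by (rule cont)
  qed auto
  moreover
  have "blinfun_apply (integral (cbox 0 1) (D x)) u = conv \<phi> (dderiv u K) x" for u
  proof -
    have "(\<lambda>y. D x y) integrable_on cbox 0 1"
      by (rule integrable_continuous)
        (unfold D_def, intro continuous_intros continuous_on_compose2[OF K(2)]
          continuous_on_compose2[OF assms(1)], auto)
    from blinfun_apply_integral[OF this, of u] show ?thesis by (simp add: D conv_def)
  qed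
  then have "blinfun_apply (integral (cbox 0 1) (D x)) = (\<lambda>u. conv \<phi> (dderiv u K) x)" by blast
  ultimately show ?thesis by (simp add: conv_def[abs_def])
qed

lemma dderiv_conv:
  assumes "continuous_on UNIV \<phi>" "Ck_on 1 UNIV K"
  shows "dderiv u (conv \<phi> K) = conv \<phi> (dderiv u K)"
  by (rule ext) (rule dderiv_eq[OF conv_has_derivative[OF assms]])

lemma Ck_on_conv:
  assumes "continuous_on UNIV \<phi>" "\<And>k. Ck_on k UNIV K"
  shows "Ck_on k UNIV (conv \<phi> K)"
  using assms(2)
proof (induction k arbitrary: K)
  case 0
  have "conv \<phi> K differentiable (at x)" for x
    using conv_has_derivative[OF assms(1) 0] differentiableI by blast
  then show ?case
    by (auto intro!: continuous_at_imp_continuous_on differentiable_imp_continuous_within)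
next
  case (Suc k)
  have "Ck_on k UNIV (dderiv u (conv \<phi> K))" for u
    unfolding dderiv_conv[OF assms(1) Suc.prems] using Suc.prems by (intro Suc.IH Ck_on_dderiv)
  moreover have "conv \<phi> K differentiable (at x)" for x
    by (rule differentiableI[OF conv_has_derivative[OF assms(1) Suc.prems]])
  ultimately show ?case by simp
qed

lemma periodic_dderiv:
  assumes "periodic f"
  shows "periodic (dderiv u f)"
proof -
  have 1: "(f has_derivative D) (at (x + axis k 1))" if "(f has_derivative D) (at x)" for D x k
  proof -
    have "((\<lambda>y. y - axis k 1) has_derivative (\<lambda>u. u)) (at (x + axis k 1))"
      by (auto intro!: derivative_eq_intros)
    from has_derivative_compose[OF this] that
    have "((\<lambda>y. f (y - axis k 1)) has_derivative D) (at (x + axis k 1))" by simp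
    moreover have "f (y - axis k 1) = f y" for y
      using assms[unfolded periodic_def, rule_format, of "y - axis k 1" k] by simp
    ultimately show ?thesis by simp
  qed
  have 2: "(f has_derivative D) (at x)" if "(f has_derivative D) (at (x + axis k 1))" for D x k
  proof -
    have "((\<lambda>y. y + axis k 1) has_derivative (\<lambda>u. u)) (at x)"
      by (auto intro!: derivative_eq_intros)
    from has_derivative_compose[OF this that]
    show ?thesis using assms by (simp add: periodic_def)
  qed
  have "(f has_derivative D) (at (x + axis k 1)) = (f has_derivative D) (at x)" for D x k
    using 1 2 by blast
  then show ?thesis unfolding periodic_def dderiv_def frechet_derivative_def by simp
qed

lemma periodic_const: "periodic (\<lambda>x. c)" by (simp add: periodic_def)

lemma conv_partial:
  assumes "periodic \<phi>" "Ck_on 1 UNIV \<phi>" "periodic K" "Ck_on 1 UNIV K"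
  shows "conv \<phi> (partial i K) = conv (partial i \<phi>) K"
proof
  fix x
  let ?L = "\<lambda>y. K (x - y)"
  have d\<phi>: "\<phi> differentiable (at y)" and dK: "K differentiable (at y)" for y
    using assms(2,4) by auto
  have "bounded_linear (\<lambda>y::vec3. - y)" by (intro bounded_linear_minus bounded_linear_ident)
  then have CL: "Ck_on 1 UNIV ?L"
    by (intro Ck_on_compose[OF open_UNIV assms(4)])
      (use Ck_on_add[OF open_UNIV Ck_on_const[of 1 UNIV x] Ck_on_linear[of "\<lambda>y::vec3. - y" 1 UNIV]] in auto)
  have perL: "periodic ?L"
    unfolding periodic_def
  proof (intro allI)
    fix y and k :: 3
    show "K (x - (y + axis k 1)) = K (x - y)"
      using assms(3)[unfolded periodic_def, rule_format, of "x - (y + axis k 1)" k] by (simp add: algebra_simps)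
  qed
  have dL: "partial i ?L y = - partial i K (x - y)" for y
  proof -
    have "((\<lambda>y. x - y) has_derivative (\<lambda>u. - u)) (at y)"
      by (auto intro!: derivative_eq_intros)
    from dderiv_eq[OF has_derivative_compose[OF this has_derivative_dderiv[OF dK]], of "axis i 1"]
    have "partial i ?L y = dderiv (- axis i 1) K (x - y)" .
    also have "\<dots> = - partial i K (x - y)" using dderiv_scale[OF dK, of "-1"] by simp
    finally show ?thesis .
  qed
  have "0 = integral (cbox 0 1) (partial i (\<lambda>y. \<phi> y * ?L y))"
    using assms(1) perL
    by (intro integral_partial_periodic[symmetric] Ck_on_mult[OF open_UNIV assms(2) CL])
      (simp add: periodic_def)
  also have "partial i (\<lambda>y. \<phi> y * ?L y) = (\<lambda>y. partial i \<phi> y * K (x - y) - \<phi> y * partial i K (x - y))"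
  proof
    fix y
    show "partial i (\<lambda>y. \<phi> y * ?L y) y = partial i \<phi> y * K (x - y) - \<phi> y * partial i K (x - y)"
      using bounded_bilinear.dderiv_prod[OF bounded_bilinear_mult d\<phi>, of ?L y "axis i 1"] CL dL by simp
  qed
  also have "integral (cbox 0 1) \<dots> = conv (partial i \<phi>) K x - conv \<phi> (partial i K) x"
    unfolding conv_def using assms(2,4) Ck_on_continuous[OF assms(2)] Ck_on_continuous[OF assms(4)]
    by (intro integral_diff conv_integrable) auto
  finally show "conv \<phi> (partial i K) x = conv (partial i \<phi>) K x" by simp
qed

lemma conv_one_const:
  assumes "periodic K" "Ck_on 1 UNIV K"
  shows "conv (\<lambda>_. 1) K x = conv (\<lambda>_. 1) K 0"
proof -
  have z: "conv (\<lambda>_. 1) (dderiv u K) x = 0" for u x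
  proof -
    have "K differentiable (at y)" for y using assms(2) by auto
    then have "dderiv u K y = (\<Sum>i\<in>UNIV. u $ i * partial i K y)" for y
      by (subst dderiv_Basis_sum) (auto simp: sum_Basis_vec inner_axis)
    moreover have p0: "conv (\<lambda>_. 1) (partial i K) x = 0" for i
      using conv_partial[OF periodic_const[of 1] Ck_on_const assms, of i]
      by (simp add: dderiv_const conv_def fun_eq_iff)
    ultimately have "conv (\<lambda>_. 1) (dderiv u K) x = integral (cbox 0 1) (\<lambda>y. \<Sum>i\<in>UNIV. u $ i * (1 * partial i K (x - y)))"
      by (simp add: conv_def)
    also have "\<dots> = (\<Sum>i\<in>UNIV. integral (cbox 0 1) (\<lambda>y. u $ i * (1 * partial i K (x - y))))"
      using assms(2) by (intro integral_sum integrable_on_mult_right conv_integrable) auto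
    also have "\<dots> = (\<Sum>i\<in>UNIV. u $ i * conv (\<lambda>_. 1) (partial i K) x)"
      by (simp add: conv_def)
    finally show ?thesis by (simp add: p0)
  qed
  have "(conv (\<lambda>_. 1) K has_derivative (\<lambda>_. 0)) (at y)" for y
    using conv_has_derivative[of "\<lambda>_. 1" K y] assms(2) z by (simp add: continuous_on_const)
  then show ?thesis
    using has_derivative_zero_constant[of UNIV "conv (\<lambda>_. 1) K"] by (metis UNIV_I convex_UNIV)
qed

text \<open>A nonnegative trigonometric polynomial, hence smooth and periodic, that attains its maximum 1
  at the points of \<open>\<int>^3\<close> only; its powers concentrate there.\<close>

definition kernel :: "vec3 \<Rightarrow> real" where
  "kernel x = (\<Prod>i\<in>UNIV. (1 + cos (2 * pi * x $ i)) / 2)"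

lemma Ck_on_cos: "Ck_on k UNIV (cos :: real \<Rightarrow> real)"
proof (rule Ck_on_real_family[where P = "\<lambda>f. \<exists>a b. f = (\<lambda>x. a * cos x + b * sin x)"])
  show "\<exists>a b. cos = (\<lambda>x::real. a * cos x + b * sin x)"
    by (intro exI[of _ 1] exI[of _ 0]) simp
  fix f :: "real \<Rightarrow> real" assume "\<exists>a b. f = (\<lambda>x. a * cos x + b * sin x)"
  then obtain a b where f: "f = (\<lambda>x. a * cos x + b * sin x)" by blast
  show "\<exists>f'. (\<exists>a b. f' = (\<lambda>x. a * cos x + b * sin x)) \<and> (\<forall>x. (f has_real_derivative f' x) (at x))"
    unfolding f
    by (intro exI[of _ "\<lambda>x. b * cos x + (- a) * sin x"] conjI exI[of _ b] exI[of _ "- a"] refl allI)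
      (auto intro!: derivative_eq_intros)
qed

lemma Ck_on_kernel: "Ck_on k UNIV kernel"
proof -
  have "Ck_on k UNIV (\<lambda>x::vec3. cos (2 * pi * x $ i))" for i
  proof (rule Ck_on_compose[OF open_UNIV Ck_on_cos])
    show "Ck_on k UNIV (\<lambda>x::vec3. 2 * pi * x $ i)"
      by (rule Ck_on_linear) (intro bounded_linear_const_mult bounded_linear_vec_nth)
  qed auto
  then have "Ck_on k UNIV (\<lambda>x::vec3. (1 + cos (2 * pi * x $ i)) * (1 / 2))" for i
    by (intro Ck_on_mult Ck_on_add) auto
  then show ?thesis unfolding kernel_def
    by (intro Ck_on_prod_set) auto
qed

lemma periodic_kernel: "periodic kernel"
proof -
  have "cos (2 * pi * (x + axis k 1) $ i) = cos (2 * pi * x $ i)" for x :: vec3 and i k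
    by (simp add: axis_def algebra_simps cos_add)
  then show ?thesis unfolding periodic_def kernel_def by presburger
qed

lemma kernel_factor: "0 \<le> (1 + cos t) / 2" "(1 + cos t) / 2 \<le> 1" for t :: real
proof -
  show "0 \<le> (1 + cos t) / 2" using add_right_mono[OF cos_ge_minus_one[of t], of 1] by simp
  show "(1 + cos t) / 2 \<le> 1" using add_left_mono[OF cos_le_one[of t], of 1] by simp
qed

lemma kernel_bounds: "0 \<le> kernel x" "kernel x \<le> 1"
  unfolding kernel_def by (intro prod_nonneg prod_le_1; use kernel_factor in blast)+

lemma kernel_concentrated:
  assumes "0 < \<delta>" "\<delta> \<le> 1 / 2"
  shows "\<exists>q<1. q > 0 \<and> (\<forall>z. kernel z > q \<longrightarrow> (\<forall>i. \<bar>z $ i - of_int (round (z $ i))\<bar> < \<delta>))"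
  \<comment> \<open>The witness is the midpoint between 1 and the value of a factor of \<open>kernel\<close> at distance \<open>\<delta>\<close>.\<close>
proof (intro exI[of _ "(3 + cos (2 * pi * \<delta>)) / 4"] conjI allI impI)
  have "cos (2 * pi * \<delta>) < cos 0"
    using assms by (intro cos_monotone_0_pi) auto
  then show lt: "(3 + cos (2 * pi * \<delta>)) / 4 < 1" by simp
  show "(3 + cos (2 * pi * \<delta>)) / 4 > 0" using kernel_factor(1)[of "2 * pi * \<delta>"] by simp
  fix z :: vec3 and i :: 3
  assume z: "(3 + cos (2 * pi * \<delta>)) / 4 < kernel z"
  let ?t = "z $ i - of_int (round (z $ i))"
  have "kernel z = (1 + cos (2 * pi * z $ i)) / 2 * (\<Prod>j\<in>UNIV - {i}. (1 + cos (2 * pi * z $ j)) / 2)"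
    unfolding kernel_def by (rule prod.remove) auto
  also have "\<dots> \<le> (1 + cos (2 * pi * z $ i)) / 2 * 1"
    by (intro mult_left_mono prod_le_1) (use kernel_factor in blast)+
  finally have "cos (2 * pi * z $ i) > cos (2 * pi * \<delta>)" using z lt by (simp add: field_simps)
  moreover have "cos (2 * pi * z $ i) = cos (2 * pi * \<bar>?t\<bar>)"
  proof -
    have "2 * pi * z $ i = 2 * pi * ?t + 2 * pi * of_int (round (z $ i))" by (simp add: algebra_simps)
    then have "cos (2 * pi * z $ i) = cos (2 * pi * ?t)"
      by (simp only: cos_add cos_int_2pin sin_int_2pin mult_zero_right diff_zero mult_1_right)
    also have "\<dots> = cos \<bar>2 * pi * ?t\<bar>" by (simp only: cos_abs_real)
    finally show ?thesis by (simp add: abs_mult)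
  qed
  ultimately have "cos (2 * pi * \<bar>?t\<bar>) > cos (2 * pi * \<delta>)" by simp
  moreover have "cos (2 * pi * \<bar>?t\<bar>) \<le> cos (2 * pi * \<delta>)" if "\<delta> \<le> \<bar>?t\<bar>"
  proof (rule cos_monotone_0_pi_le)
    have "\<bar>?t\<bar> \<le> 1 / 2" using of_int_round_abs_le[of "z $ i"] by (simp add: abs_minus_commute)
    then show "2 * pi * \<bar>?t\<bar> \<le> pi" by simp
  qed (use assms that in auto)
  ultimately show "\<bar>?t\<bar> < \<delta>" by linarith
qed

lemma periodic_int:
  assumes "periodic f"
  shows "f (x + (\<chi> i. of_int (m i))) = f (x::vec3)"
proof -
  have n: "f (x + axis k (real n)) = f x" for x k n
  proof (induction n)
    case 0
    have "axis k 0 = (0::vec3)" by (simp add: vec_eq_iff axis_def)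
    then show ?case by (simp only: of_nat_0 add_0_right)
  next
    case (Suc n)
    have "x + axis k (real (Suc n)) = (x + axis k (real n)) + axis k 1"
      by (simp add: vec_eq_iff axis_def)
    then have "f (x + axis k (real (Suc n))) = f ((x + axis k (real n)) + axis k 1)" by (simp only:)
    also have "\<dots> = f (x + axis k (real n))" using assms unfolding periodic_def by blast
    finally show ?case using Suc by simp
  qed
  have z: "f (x + axis k (of_int m)) = f x" for x k m
  proof (cases "m \<ge> 0")
    case True
    then show ?thesis using n[of x k "nat m"] by simp
  next
    case False
    have e: "x + axis k (of_int m) + axis k (real (nat (- m))) = x"
      using False by (simp add: vec_eq_iff axis_def)
    show ?thesis using n[of "x + axis k (of_int m)" k "nat (- m)"] unfolding e by simp
  qed
  have "(\<chi> i. of_int (m i)) = axis 1 (of_int (m 1)) + axis 2 (of_int (m 2)) + axis 3 (of_int (m 3) :: real)"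
    by (simp add: vec_eq_iff forall_3 axis_def)
  then show ?thesis by (simp add: add.assoc[symmetric] z)
qed

lemma continuous_cell_bounded:
  fixes f :: "vec3 \<Rightarrow> 'b::real_normed_vector"
  assumes "continuous_on (cbox 0 1) f"
  shows "\<exists>M>0. \<forall>x\<in>cbox 0 1. norm (f x) \<le> M"
proof -
  obtain M where "M > 0" "\<forall>y\<in>f ` cbox 0 1. norm y \<le> M"
    using compact_imp_bounded[OF compact_continuous_image[OF assms compact_cbox]]
    unfolding bounded_pos by blast
  then show ?thesis by blast
qed

lemma periodic_reduce:
  assumes "periodic f"
  shows "\<exists>y\<in>cbox 0 1. \<forall>z. f (y + z) = f ((x::vec3) + z)"
proof (intro bexI allI)
  let ?y = "x + (\<chi> i. of_int (- \<lfloor>x $ i\<rfloor>))"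
  fix z
  have "f (?y + z) = f ((x + z) + (\<chi> i. of_int (- \<lfloor>x $ i\<rfloor>)))" by (simp add: algebra_simps)
  also have "\<dots> = f (x + z)" by (rule periodic_int[OF assms])
  finally show "f (?y + z) = f (x + z)" .
  have "0 \<le> x $ i + - of_int \<lfloor>x $ i\<rfloor> \<and> x $ i + - of_int \<lfloor>x $ i\<rfloor> \<le> 1" for i by linarith
  then show "?y \<in> cbox 0 1" unfolding mem_cell by simp
qed

lemma periodic_uniformly_continuous:
  assumes "periodic f" "continuous_on UNIV (f :: vec3 \<Rightarrow> real)" "e > 0"
  shows "\<exists>d>0. \<forall>x z. norm z < d \<longrightarrow> \<bar>f (x + z) - f x\<bar> < e"
proof -
  have "uniformly_continuous_on (cball 0 3) f"
    by (rule compact_uniformly_continuous) (use assms(2) continuous_on_subset in auto)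
  then obtain d where d: "d > 0" "\<And>x y. norm x \<le> 3 \<Longrightarrow> norm y \<le> 3 \<Longrightarrow> dist y x < d \<Longrightarrow> dist (f y) (f x) < e"
    unfolding uniformly_continuous_on_def using assms(3) by (metis mem_cball_0)
  have "\<bar>f (x + z) - f x\<bar> < e" if "norm z < min d (1 / 4)" for x z
  proof -
    obtain y where y: "y \<in> cbox 0 1" "\<And>z. f (y + z) = f (x + z)" using periodic_reduce[OF assms(1), of x] by blast
    have "norm y \<le> (\<Sum>i\<in>UNIV. \<bar>y $ i\<bar>)" by (rule norm_le_l1_cart)
    also have "\<dots> \<le> 2 + 1" 
    proof -
      have "\<bar>y $ i\<bar> \<le> 1" for i using y(1) by (simp add: mem_cell)
      from this[of 1] this[of 2] this[of 3] show ?thesis unfolding sum_3 by linarith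
    qed
    finally have ny: "norm y \<le> 3" by simp
    have "(y $ i)\<^sup>2 \<le> 1" for i using y(1) by (simp add: mem_cell power_le_one)
    from this[of 1] this[of 2] this[of 3] have "norm y ^ 2 \<le> 1 + 1 + 1"
      unfolding norm_vec_def L2_set_def by (simp add: sum_3)
    then have "(norm y)\<^sup>2 \<le> 2\<^sup>2" by simp
    then have "norm y \<le> 2" by (rule power2_le_imp_le) simp
    then have "norm (y + z) \<le> 3" using that norm_triangle_ineq[of y z] by linarith
    moreover have "dist (y + z) y < d" using that by (simp add: dist_norm)
    ultimately have "dist (f (y + z)) (f y) < e" by (rule d(2)[OF ny])
    then show ?thesis using y(2)[of z] y(2)[of 0] by (simp add: dist_real_def)
  qed
  then show ?thesis using d(1) by (intro exI[of _ "min d (1 / 4)"]) auto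
qed

text \<open>The mass of the powers near the lattice decays more slowly than every geometric sequence of ratio
  \<open>q < 1\<close>.\<close>

lemma kernel_mass:
  assumes "0 < q" "q < 1"
  shows "\<exists>c>0. \<forall>n. conv (\<lambda>_. 1) (\<lambda>x. kernel x ^ n) 0 \<ge> c * q ^ n"
proof -
  have k0: "kernel 0 = 1" by (simp add: kernel_def)
  have ck: "continuous_on UNIV kernel" by (rule Ck_on_continuous[OF Ck_on_kernel])
  then have "open {x. kernel x > q}" by (intro open_Collect_less continuous_intros)
  then obtain d where d: "d > 0" "ball 0 d \<subseteq> {x. kernel x > q}"
    using k0 assms open_contains_ball by (metis mem_Collect_eq)
  define r where "r = min (1 / 2) (d / 4)"
  have r: "0 < r" "r \<le> 1 / 2" "r \<le> d / 4" using d by (auto simp: r_def)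
  let ?B = "cbox 0 (r *\<^sub>R 1) :: vec3 set"
  have sub: "?B \<subseteq> cbox 0 1" 
  proof
    fix x assume "x \<in> ?B"
    then have "0 \<le> x $ i \<and> x $ i \<le> r" for i by (simp add: mem_box_cart)
    moreover have "r \<le> 1" using r by simp
    ultimately show "x \<in> cbox 0 1" unfolding mem_cell by (meson order_trans)
  qed
  have big: "kernel (0 - y) \<ge> q" if "y \<in> ?B" for y
  proof -
    have "norm (0 - y) \<le> (\<Sum>i\<in>UNIV. \<bar>(0 - y) $ i\<bar>)" by (rule norm_le_l1_cart)
    also have "\<dots> \<le> 3 * r" 
    proof -
      have "\<bar>(0 - y) $ i\<bar> \<le> r" for i using that by (simp add: mem_box_cart)
      from this[of 1] this[of 2] this[of 3] show ?thesis unfolding sum_3 by linarith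
    qed
    also have "\<dots> < d" using r by auto
    finally have "0 - y \<in> ball 0 d" by simp
    then have "0 - y \<in> {x. kernel x > q}" using d by blast
    then show ?thesis by simp
  qed
  have "r ^ 3 * q ^ n \<le> conv (\<lambda>_. 1) (\<lambda>x. kernel x ^ n) 0" for n
  proof -
    have int: "(\<lambda>y. 1 * kernel (0 - y) ^ n) integrable_on cbox 0 1"
      by (rule conv_integrable) (auto intro!: continuous_intros ck)
    have cont: "measure lborel ?B = r ^ 3"
      by (subst content_cbox_cart) (use r in \<open>auto simp: interval_ne_empty_cart\<close>)
    have "r ^ 3 * q ^ n = integral ?B (\<lambda>_. q ^ n)" using cont by simp
    also have "\<dots> \<le> integral ?B (\<lambda>y. 1 * kernel (0 - y) ^ n)"
    proof (rule integral_le)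
      show "(\<lambda>y. 1 * kernel (0 - y) ^ n) integrable_on ?B"
        using integrable_on_subcbox[OF int sub] .
      show "q ^ n \<le> 1 * kernel (0 - y) ^ n" if "y \<in> ?B" for y
        using power_mono[OF big[OF that], of n] assms by simp
    qed auto
    also have "\<dots> \<le> integral (cbox 0 1) (\<lambda>y. 1 * kernel (0 - y) ^ n)"
      by (rule integral_subset_le[OF sub integrable_on_subcbox[OF int sub] int])
        (simp add: kernel_bounds)
    finally show ?thesis by (simp add: conv_def)
  qed
  then show ?thesis using r by (intro exI[of _ "r ^ 3"]) auto
qed

text \<open>Convolution with the \<open>n\<close>-th power of \<open>kernel\<close>, normalised to mass 1.\<close>

definition mollify :: "nat \<Rightarrow> (vec3 \<Rightarrow> real) \<Rightarrow> vec3 \<Rightarrow> real" where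
  "mollify n \<phi> x = conv \<phi> (\<lambda>x. kernel x ^ n) x / conv (\<lambda>_. 1) (\<lambda>x. kernel x ^ n) 0"

lemma kernel_power: "Ck_on k UNIV (\<lambda>x. kernel x ^ n)" "periodic (\<lambda>x. kernel x ^ n)"
  using Ck_on_power[OF open_UNIV Ck_on_kernel] periodic_kernel by (auto simp: periodic_def)

lemma kernel_mass_pos: "conv (\<lambda>_. 1) (\<lambda>x. kernel x ^ n) 0 > 0"
proof -
  obtain c :: real where c: "c > 0" "\<forall>n. conv (\<lambda>_. 1) (\<lambda>x. kernel x ^ n) 0 \<ge> c * (1 / 2) ^ n"
    using kernel_mass[of "1 / 2"] by auto
  have "0 < c * (1 / 2) ^ n" using c(1) by simp
  also have "\<dots> \<le> conv (\<lambda>_. 1) (\<lambda>x. kernel x ^ n) 0" using c(2) by blast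
  finally show ?thesis .
qed

text \<open>Where \<open>kernel (x - y) > q\<close>, the point \<open>y\<close> is close to \<open>x\<close> modulo \<open>\<int>^3\<close> and uniform continuity
  applies. Elsewhere the power of the kernel is at most \<open>q ^ n\<close>, which is negligible compared with
  its mass.\<close>

lemma mollify_converges:
  assumes "periodic \<phi>" "continuous_on UNIV \<phi>" "e > 0"
  shows "\<forall>\<^sub>F n in sequentially. \<forall>x. \<bar>mollify n \<phi> x - \<phi> x\<bar> \<le> e"
proof -
  obtain d where d: "d > 0" "\<And>x z. norm z < d \<Longrightarrow> \<bar>\<phi> (x + z) - \<phi> x\<bar> < e / 2"
    using periodic_uniformly_continuous[OF assms(1,2), of "e / 2"] assms(3) by auto
  define \<delta> where "\<delta> = min (1 / 2) (d / 4)"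
  have \<delta>: "0 < \<delta>" "\<delta> \<le> 1 / 2" "\<delta> \<le> d / 4" using d by (auto simp: \<delta>_def)
  obtain q where q: "0 < q" "q < 1" "\<And>z i. kernel z > q \<Longrightarrow> \<bar>z $ i - of_int (round (z $ i))\<bar> < \<delta>"
    using kernel_concentrated[OF \<delta>(1,2)] by blast
  obtain M where M: "M > 0" "\<And>x. x \<in> cbox 0 1 \<Longrightarrow> \<bar>\<phi> x\<bar> \<le> M"
    using continuous_cell_bounded[of \<phi>] assms(2) continuous_on_subset by (metis real_norm_def top_greatest)
  have Mall: "\<bar>\<phi> x\<bar> \<le> M" for x
    using periodic_reduce[OF assms(1), of x] M(2) by (metis add.right_neutral)
  \<comment> \<open>Any ratio strictly between \<open>q\<close> and 1 would do for the lower bound of the mass.\<close>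
  define q' where "q' = (1 + q) / 2"
  have q': "q < q'" "0 < q'" "q' < 1" using q by (auto simp: q'_def)
  obtain c where c: "c > 0" "\<And>n. conv (\<lambda>_. 1) (\<lambda>x. kernel x ^ n) 0 \<ge> c * q' ^ n"
    using kernel_mass[OF q'(2,3)] by blast
  have close: "\<bar>\<phi> y - \<phi> x\<bar> < e / 2" if "kernel (x - y) > q" for x y
  proof -
    let ?m = "\<lambda>i. round ((x - y) $ i)"
    let ?z = "y + (\<chi> i. of_int (?m i)) - x"
    have "\<bar>?z $ i\<bar> \<le> \<delta>" for i using q(3)[OF that, of i] by simp
    from this[of 1] this[of 2] this[of 3] have "norm ?z \<le> 3 * \<delta>"
      using norm_le_l1_cart[of ?z] unfolding sum_3 by linarith
    then have "norm ?z < d" using \<delta>(1,3) d(1) by linarith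
    moreover have "x + ?z = y + (\<chi> i. of_int (?m i))" by simp
    ultimately have "\<bar>\<phi> (y + (\<chi> i. of_int (?m i))) - \<phi> x\<bar> < e / 2"
      using d(2)[of ?z x] by (simp only:)
    then show ?thesis using periodic_int[OF assms(1), of y ?m] by simp
  qed
  have bound: "\<bar>mollify n \<phi> x - \<phi> x\<bar> \<le> e / 2 + (2 * M / c) * (q / q') ^ n" for n x
  proof -
    let ?N = "conv (\<lambda>_. 1) (\<lambda>x. kernel x ^ n) 0" and ?k = "\<lambda>x. kernel x ^ n"
    note N = kernel_mass_pos[of n]
    have ck: "continuous_on UNIV ?k" by (rule Ck_on_continuous[OF kernel_power(1)])
    have N': "conv (\<lambda>_. 1) ?k x = ?N"
      by (rule conv_one_const[OF kernel_power(2) kernel_power(1)])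
    have "conv \<phi> ?k x - \<phi> x * ?N = integral (cbox 0 1) (\<lambda>y. \<phi> y * ?k (x - y)) - integral (cbox 0 1) (\<lambda>y. \<phi> x * (1 * ?k (x - y)))"
      unfolding N'[symmetric] by (simp add: conv_def)
    also have "\<dots> = integral (cbox 0 1) (\<lambda>y. \<phi> y * ?k (x - y) - \<phi> x * (1 * ?k (x - y)))"
      by (intro integral_diff[symmetric] integrable_on_mult_right conv_integrable assms ck continuous_on_const)
    finally have eq: "conv \<phi> ?k x - \<phi> x * ?N = integral (cbox 0 1) (\<lambda>y. \<phi> y * ?k (x - y) - \<phi> x * (1 * ?k (x - y)))" .
    have "\<bar>conv \<phi> ?k x - \<phi> x * ?N\<bar> \<le> integral (cbox 0 1) (\<lambda>y. e / 2 * (1 * ?k (x - y)) + 2 * M * q ^ n)"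
      unfolding eq
    proof (rule integral_norm_bound_integral[where 'a = real, unfolded real_norm_def])
      show "(\<lambda>y. \<phi> y * ?k (x - y) - \<phi> x * (1 * ?k (x - y))) integrable_on cbox 0 1"
        by (intro integrable_diff integrable_on_mult_right conv_integrable assms ck continuous_on_const)
      show "(\<lambda>y. e / 2 * (1 * ?k (x - y)) + 2 * M * q ^ n) integrable_on cbox 0 1"
        by (intro integrable_add integrable_on_mult_right conv_integrable ck continuous_on_const integrable_const)
      fix y
      have "\<bar>\<phi> y * ?k (x - y) - \<phi> x * (1 * ?k (x - y))\<bar> = \<bar>\<phi> y - \<phi> x\<bar> * ?k (x - y)"
        using kernel_bounds[of "x - y"] by (simp add: abs_mult left_diff_distrib[symmetric])
      also have "\<dots> \<le> e / 2 * (1 * ?k (x - y)) + 2 * M * q ^ n"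
      proof (cases "kernel (x - y) > q")
        case True
        then have "\<bar>\<phi> y - \<phi> x\<bar> * ?k (x - y) \<le> e / 2 * ?k (x - y)"
          using close[OF True] kernel_bounds by (intro mult_right_mono) auto
        then show ?thesis using M q by (simp add: add_increasing2)
      next
        case False
        then have "?k (x - y) \<le> q ^ n" using kernel_bounds by (intro power_mono) auto
        moreover have "\<bar>\<phi> y - \<phi> x\<bar> \<le> 2 * M" using Mall[of x] Mall[of y] by linarith
        ultimately have "\<bar>\<phi> y - \<phi> x\<bar> * ?k (x - y) \<le> 2 * M * q ^ n"
          using M kernel_bounds by (intro mult_mono) auto
        moreover have "0 \<le> e / 2 * (1 * ?k (x - y))" using assms kernel_bounds by simp
        ultimately show ?thesis by linarith
      qed
      finally show "\<bar>\<phi> y * ?k (x - y) - \<phi> x * (1 * ?k (x - y))\<bar> \<le> e / 2 * (1 * ?k (x - y)) + 2 * M * q ^ n" .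
    qed
    also have "\<dots> = integral (cbox 0 1) (\<lambda>y. e / 2 * (1 * ?k (x - y))) + integral (cbox 0 1) (\<lambda>y::vec3. 2 * M * q ^ n)"
      by (intro integral_add integrable_on_mult_right conv_integrable ck continuous_on_const integrable_const)
    also have "\<dots> = e / 2 * ?N + 2 * M * q ^ n"
    proof -
      have "measure lborel (cbox 0 1 :: vec3 set) = 1"
        by (subst content_cbox_cart) (auto simp: interval_ne_empty_cart)
      then show ?thesis using N' by (simp add: conv_def)
    qed
    finally have le: "\<bar>conv \<phi> ?k x - \<phi> x * ?N\<bar> \<le> e / 2 * ?N + 2 * M * q ^ n" .
    have "\<bar>mollify n \<phi> x - \<phi> x\<bar> = \<bar>conv \<phi> ?k x - \<phi> x * ?N\<bar> / ?N"
    proof -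
      have "mollify n \<phi> x - \<phi> x = (conv \<phi> ?k x - \<phi> x * ?N) / ?N"
        using N by (simp add: mollify_def diff_divide_distrib)
      then show ?thesis using N by simp
    qed
    also have "\<dots> \<le> (e / 2 * ?N + 2 * M * q ^ n) / ?N"
      using le N by (intro divide_right_mono) auto
    also have "\<dots> = e / 2 + 2 * M * q ^ n / ?N" using N by (simp add: add_divide_distrib)
    also have "2 * M * q ^ n / ?N \<le> 2 * M * q ^ n / (c * q' ^ n)"
      using c M q q' N by (intro divide_left_mono) auto
    also have "2 * M * q ^ n / (c * q' ^ n) = (2 * M / c) * (q / q') ^ n"
      by (simp add: power_divide)
    finally show ?thesis by simp
  qed
  have "(\<lambda>n. (2 * M / c) * (q / q') ^ n) \<longlonglongrightarrow> (2 * M / c) * 0"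
    using q q' by (intro tendsto_intros LIMSEQ_power_zero) auto
  then have "\<forall>\<^sub>F n in sequentially. (2 * M / c) * (q / q') ^ n < e / 2"
    using assms(3) by (intro order_tendstoD(2)) auto
  then show ?thesis
  proof eventually_elim
    case (elim n)
    have "\<bar>mollify n \<phi> x - \<phi> x\<bar> \<le> e" for x
      using bound[of n x] elim by linarith
    then show ?case by blast
  qed
qed

lemma test_function_mollify:
  assumes "continuous_on UNIV \<phi>"
  shows "test_function (mollify n \<phi>)"
proof -
  have "Ck_on k UNIV (\<lambda>x. conv \<phi> (\<lambda>x. kernel x ^ n) x * (1 / conv (\<lambda>_. 1) (\<lambda>x. kernel x ^ n) 0))" for k
    using Ck_on_conv[OF assms, of "\<lambda>x. kernel x ^ n"] kernel_power(1)
    by (intro Ck_on_mult) auto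
  then have "smooth_on UNIV (mollify n \<phi>)"
    unfolding smooth_on_def mollify_def
    by (intro exI[of _ UNIV] exI[of _ "\<lambda>x. conv \<phi> (\<lambda>x. kernel x ^ n) x / conv (\<lambda>_. 1) (\<lambda>x. kernel x ^ n) 0"]) auto
  moreover have "kernel (x + axis k 1 - y) = kernel (x - y)" for x y k
    using periodic_kernel[unfolded periodic_def, rule_format, of "x - y" k] by (simp add: algebra_simps)
  then have "periodic (mollify n \<phi>)"
    by (simp add: periodic_def mollify_def conv_def)
  ultimately show ?thesis by (simp add: test_function_def)
qed

lemma partial_mollify:
  assumes "periodic \<phi>" "Ck_on 1 UNIV \<phi>"
  shows "partial i (mollify n \<phi>) = mollify n (partial i \<phi>)"
proof
  fix x
  let ?k = "\<lambda>x. kernel x ^ n" and ?N = "conv (\<lambda>_. 1) (\<lambda>x. kernel x ^ n) 0"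
  note c = Ck_on_continuous[OF assms(2)]
  have "bounded_linear (\<lambda>t::real. t / ?N)" by (rule bounded_linear_divide)
  moreover have "conv \<phi> ?k differentiable (at x)"
    using conv_has_derivative[OF c kernel_power(1)] differentiableI by blast
  ultimately have "partial i (\<lambda>x. conv \<phi> ?k x / ?N) x = partial i (conv \<phi> ?k) x / ?N"
    by (rule dderiv_linear_compose)
  also have "partial i (conv \<phi> ?k) = conv (partial i \<phi>) ?k"
    using dderiv_conv[OF c kernel_power(1)] conv_partial[OF assms kernel_power(2) kernel_power(1)] by metis
  finally show "partial i (mollify n \<phi>) x = mollify n (partial i \<phi>) x"
    by (simp add: mollify_def[abs_def])
qed

section \<open>Integration over the torus\<close>

lemma space_torus [simp]: "space torus = cbox 0 1"
  by (simp add: torus_def)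

lemma finite_measure_torus: "finite_measure torus"
  unfolding torus_def by (rule finite_measure_lebesgue_on) auto

lemma emeasure_torus: "emeasure torus (space torus) = 1"
proof -
  have "emeasure torus (space torus) = emeasure lebesgue (cbox 0 1 :: vec3 set)"
    by (simp add: torus_def emeasure_restrict_space)
  also have "\<dots> = 1"
  proof -
    have "(\<Prod>b\<in>Basis. (1 - 0 :: vec3) \<bullet> b) = 1"
      by (rule prod.neutral) (auto simp: Basis_vec_def inner_axis)
    moreover have "(0::vec3) \<bullet> b \<le> 1 \<bullet> b" if "b \<in> Basis" for b
      using that by (auto simp: Basis_vec_def inner_axis)
    ultimately show ?thesis by (simp add: emeasure_lborel_cbox_eq)
  qed
  finally show ?thesis .
qed

lemma torus_measurable_continuous:
  fixes f :: "vec3 \<Rightarrow> 'b::euclidean_space"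
  shows "continuous_on (cbox 0 1) f \<Longrightarrow> f \<in> borel_measurable torus"
  unfolding torus_def by (rule continuous_imp_measurable_on_sets_lebesgue) auto

lemma torus_measurable: "f \<in> borel_measurable lebesgue \<Longrightarrow> f \<in> borel_measurable torus"
  unfolding torus_def by (rule measurable_restrict_space1)

lemma torus_integrable_bounded:
  fixes f :: "vec3 \<Rightarrow> 'b::euclidean_space"
  assumes "f \<in> borel_measurable torus" "\<And>x. x \<in> cbox 0 1 \<Longrightarrow> norm (f x) \<le> M"
  shows "integrable torus f"
  by (rule finite_measure.integrable_const_bound[OF finite_measure_torus _ assms(1), of M])
    (use assms(2) in \<open>auto intro: AE_I2\<close>)

lemma torus_integrable_continuous:
  fixes f :: "vec3 \<Rightarrow> 'b::euclidean_space"
  assumes "continuous_on (cbox 0 1) f"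
  shows "integrable torus f"
proof -
  obtain M where "\<forall>x\<in>cbox 0 1. norm (f x) \<le> M" using continuous_cell_bounded[OF assms] by blast
  then show ?thesis using torus_integrable_bounded[OF torus_measurable_continuous[OF assms]] by blast
qed

lemma torus_integral_eq:
  fixes f :: "vec3 \<Rightarrow> real"
  shows "integrable torus f \<Longrightarrow> (LINT x|torus. f x) = integral (cbox 0 1) f"
  unfolding torus_def by (rule lebesgue_integral_eq_integral) auto

lemma torus_integrable_mult:
  fixes f \<phi> :: "vec3 \<Rightarrow> real"
  assumes "integrable torus f" "continuous_on (cbox 0 1) \<phi>"
  shows "integrable torus (\<lambda>x. f x * \<phi> x)"
proof -
  obtain M where M: "\<And>x. x \<in> cbox 0 1 \<Longrightarrow> norm (\<phi> x) \<le> M"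
    using continuous_cell_bounded[OF assms(2)] by blast
  have "integrable torus (\<lambda>x. f x * M)" using assms(1) by simp
  then show ?thesis
  proof (rule Bochner_Integration.integrable_bound)
    show "(\<lambda>x. f x * \<phi> x) \<in> borel_measurable torus"
      using assms torus_measurable_continuous by (intro borel_measurable_times) auto
    have "norm (f x * \<phi> x) \<le> norm (f x * M)" if "x \<in> cbox 0 1" for x
      using M[OF that] by (simp add: abs_mult mult_left_mono)
    then show "AE x in torus. norm (f x * \<phi> x) \<le> norm (f x * M)" by (intro AE_I2) simp
  qed
qed

lemma torus_integral_partial:
  assumes "periodic f" "Ck_on 1 UNIV f"
  shows "(LINT x|torus. partial i f x) = (0::real)"
proof -
  have "continuous_on (cbox 0 1) (partial i f)"
    using assms(2) by (auto intro: continuous_on_subset)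
  from torus_integral_eq[OF torus_integrable_continuous[OF this]]
  show ?thesis using integral_partial_periodic[OF assms, of i] by simp
qed

text \<open>Mollification extends a weak divergence identity to test functions of class \<open>C^1\<close>.\<close>

lemma weak_div_C1:
  assumes wd: "weak_div f g" and f: "integrable torus f" and g: "\<And>\<alpha>. integrable torus (g \<alpha>)"
    and \<phi>: "periodic \<phi>" "Ck_on 1 UNIV \<phi>"
  shows "(LINT x|torus. f x * \<phi> x) = - (LINT x|torus. (\<Sum>\<alpha>\<in>UNIV. g \<alpha> x * partial \<alpha> \<phi> x))"
proof -
  let ?A = "\<lambda>\<phi>. (LINT x|torus. f x * \<phi> x) + (\<Sum>\<alpha>\<in>UNIV. LINT x|torus. g \<alpha> x * partial \<alpha> \<phi> x)"
  let ?B = "(LINT x|torus. \<bar>f x\<bar>) + (\<Sum>\<alpha>\<in>UNIV. LINT x|torus. \<bar>g \<alpha> x\<bar>)"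
  have int1: "integrable torus (\<lambda>x. f x * \<phi> x)" if "Ck_on 1 UNIV \<phi>" for \<phi>
    using Ck_on_continuous[OF that] continuous_on_subset by (intro torus_integrable_mult[OF f]) blast
  have int2: "integrable torus (\<lambda>x. g \<alpha> x * partial \<alpha> \<phi> x)" if "Ck_on 1 UNIV \<phi>" for \<phi> \<alpha>
  proof -
    have "continuous_on UNIV (partial \<alpha> \<phi>)" using that by simp
    then show ?thesis using continuous_on_subset by (intro torus_integrable_mult[OF g]) blast
  qed
  have eqA: "?A \<phi> = (LINT x|torus. f x * \<phi> x) + (LINT x|torus. (\<Sum>\<alpha>\<in>UNIV. g \<alpha> x * partial \<alpha> \<phi> x))"
    if "Ck_on 1 UNIV \<phi>" for \<phi>
    using int2[OF that] by (simp add: Bochner_Integration.integral_sum)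
  have diff: "\<bar>(LINT x|torus. u x * \<psi> x) - (LINT x|torus. u x * \<eta> x)\<bar> \<le> e * (LINT x|torus. \<bar>u x\<bar>)"
    if u: "integrable torus u" and c: "continuous_on UNIV \<psi>" "continuous_on UNIV \<eta>" and close: "\<And>x. \<bar>\<psi> x - \<eta> x\<bar> \<le> e"
    for u \<psi> \<eta> :: "vec3 \<Rightarrow> real" and e
  proof -
    have i: "integrable torus (\<lambda>x. u x * \<psi> x)" "integrable torus (\<lambda>x. u x * \<eta> x)"
      using c continuous_on_subset by (blast intro: torus_integrable_mult[OF u])+
    have "(LINT x|torus. u x * \<psi> x) - (LINT x|torus. u x * \<eta> x) = (LINT x|torus. u x * \<psi> x - u x * \<eta> x)"
      by (rule Bochner_Integration.integral_diff[OF i, symmetric])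
    also have "\<bar>\<dots>\<bar> \<le> (LINT x|torus. \<bar>u x * \<psi> x - u x * \<eta> x\<bar>)" by (rule integral_abs_bound)
    also have "\<dots> \<le> (LINT x|torus. e * \<bar>u x\<bar>)"
    proof (rule integral_mono)
      show "integrable torus (\<lambda>x. \<bar>u x * \<psi> x - u x * \<eta> x\<bar>)" using i by auto
      show "integrable torus (\<lambda>x. e * \<bar>u x\<bar>)" using u by auto
      fix x
      have "\<bar>u x * \<psi> x - u x * \<eta> x\<bar> = \<bar>u x\<bar> * \<bar>\<psi> x - \<eta> x\<bar>" by (simp add: right_diff_distrib[symmetric] abs_mult)
      also have "\<dots> \<le> \<bar>u x\<bar> * e" by (rule mult_left_mono[OF close]) simp
      finally show "\<bar>u x * \<psi> x - u x * \<eta> x\<bar> \<le> e * \<bar>u x\<bar>" by (simp add: mult.commute)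
    qed
    finally show ?thesis by simp
  qed
  have small: "\<bar>?A \<phi>\<bar> \<le> e * ?B" if "e > 0" for e
  proof -
    have "\<forall>\<^sub>F n in sequentially. (\<forall>x. \<bar>mollify n \<phi> x - \<phi> x\<bar> \<le> e) \<and>
        (\<forall>\<alpha>\<in>UNIV. \<forall>x. \<bar>mollify n (partial \<alpha> \<phi>) x - partial \<alpha> \<phi> x\<bar> \<le> e)"
      using \<phi> \<open>e > 0\<close> periodic_dderiv[OF \<phi>(1)] Ck_on_continuous[OF \<phi>(2)]
      by (intro eventually_conj eventually_ball_finite ballI mollify_converges) auto
    then obtain n where n: "\<And>x. \<bar>mollify n \<phi> x - \<phi> x\<bar> \<le> e"
      "\<And>\<alpha> x. \<bar>mollify n (partial \<alpha> \<phi>) x - partial \<alpha> \<phi> x\<bar> \<le> e"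
      using eventually_happens'[OF sequentially_bot] by blast
    have tf: "test_function (mollify n \<phi>)" by (rule test_function_mollify[OF Ck_on_continuous[OF \<phi>(2)]])
    have C: "Ck_on 1 UNIV (mollify n \<phi>)"
    proof -
      obtain U h where "open U" "UNIV \<subseteq> U" "\<forall>k. Ck_on k U h" "\<forall>x\<in>UNIV. h x = mollify n \<phi> x"
        using tf unfolding test_function_def smooth_on_def by blast
      then show ?thesis using Ck_on_cong[of UNIV h "mollify n \<phi>" 1] Ck_on_subset by blast
    qed
    have "?A (mollify n \<phi>) = 0" using wd tf eqA[OF C] by (simp add: weak_div_def)
    then have "\<bar>?A \<phi>\<bar> = \<bar>((LINT x|torus. f x * \<phi> x) - (LINT x|torus. f x * mollify n \<phi> x)) +
        (\<Sum>\<alpha>\<in>UNIV. (LINT x|torus. g \<alpha> x * partial \<alpha> \<phi> x) - (LINT x|torus. g \<alpha> x * partial \<alpha> (mollify n \<phi>) x))\<bar>"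
      by (simp add: sum_subtractf)
    also have "\<dots> \<le> \<bar>(LINT x|torus. f x * \<phi> x) - (LINT x|torus. f x * mollify n \<phi> x)\<bar> +
        (\<Sum>\<alpha>\<in>UNIV. \<bar>(LINT x|torus. g \<alpha> x * partial \<alpha> \<phi> x) - (LINT x|torus. g \<alpha> x * partial \<alpha> (mollify n \<phi>) x)\<bar>)"
      by (rule order_trans[OF abs_triangle_ineq add_left_mono[OF sum_abs]])
    also have "\<dots> \<le> e * (LINT x|torus. \<bar>f x\<bar>) + (\<Sum>\<alpha>\<in>UNIV. e * (LINT x|torus. \<bar>g \<alpha> x\<bar>))"
    proof (intro add_mono sum_mono diff f g)
      show "continuous_on UNIV \<phi>" "continuous_on UNIV (mollify n \<phi>)" using Ck_on_continuous C \<phi>(2) by blast+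
      show "continuous_on UNIV (partial \<alpha> \<phi>)" "continuous_on UNIV (partial \<alpha> (mollify n \<phi>))" for \<alpha>
        using C \<phi>(2) by simp_all
      show "\<bar>\<phi> x - mollify n \<phi> x\<bar> \<le> e" for x using n(1)[of x] by (simp add: abs_minus_commute)
      show "\<bar>partial \<alpha> \<phi> x - partial \<alpha> (mollify n \<phi>) x\<bar> \<le> e" for x \<alpha>
        using n(2)[of \<alpha> x] partial_mollify[OF \<phi>, of \<alpha> n] by (simp add: abs_minus_commute)
    qed
    finally show ?thesis by (simp add: sum_distrib_left distrib_left)
  qed
  have B0: "?B \<ge> 0" by (intro add_nonneg_nonneg sum_nonneg Bochner_Integration.integral_nonneg) auto
  have "\<bar>?A \<phi>\<bar> \<le> 0 + e" if "e > 0" for e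
  proof -
    have "e / (?B + 1) > 0" using that B0 by simp
    from small[OF this] have "\<bar>?A \<phi>\<bar> \<le> e * (?B / (?B + 1))" by simp
    also have "\<dots> \<le> e * 1" using that B0 by (intro mult_left_mono) auto
    finally show ?thesis by simp
  qed
  then have "?A \<phi> = 0" using field_le_epsilon[of "\<bar>?A \<phi>\<bar>" 0] by auto
  then show ?thesis using eqA[OF \<phi>(2)] by simp
qed

section \<open>The map of minors and its derivative\<close>

lemma index3_add [simp]:
  "(1::3) + 1 = 2" "(2::3) + 1 = 3" "(3::3) + 1 = 1" "(1::3) + 2 = 3" "(2::3) + 2 = 1" "(3::3) + 2 = 2"
  by simp_all

lemma index3_wrap [simp]: "(4::3) = 1" "(5::3) = 2"
  by simp_all

lemma inner_mat: "(A::mat3) \<bullet> B = A $ 1 \<bullet> B $ 1 + A $ 2 \<bullet> B $ 2 + A $ 3 \<bullet> B $ 3"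
  by (simp only: inner_vec_def[of A B] sum_3)

text \<open>The polarised cofactor: \<open>cofb F F = 2 cof F\<close>. Row indices are counted modulo 3.\<close>

definition cofb :: "mat3 \<Rightarrow> mat3 \<Rightarrow> mat3" where
  "cofb A B = (\<chi> r. cross3 (A $ (r + 1)) (B $ (r + 2)) + cross3 (B $ (r + 1)) (A $ (r + 2)))"

lemma cof_row: "cof F $ r = cross3 (F $ (r + 1)) (F $ (r + 2))"
proof -
  have "cof F $ r $ \<alpha> = cross3 (F $ (r + 1)) (F $ (r + 2)) $ \<alpha>" for \<alpha>
    using exhaust_3[of r] exhaust_3[of \<alpha>]
    by (elim disjE) (simp_all add: cof_def det_3 axis_def cross3_def algebra_simps)
  then show ?thesis by (simp add: vec_eq_iff)
qed

lemma cof_eq_cofb: "cof F = (1 / 2) *\<^sub>R cofb F F"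
  by (simp add: vec_eq_iff[where 'a = vec3] cof_row cofb_def)

lemma bounded_bilinear_cofb: "bounded_bilinear cofb"
proof -
  have "bilinear cofb"
    unfolding bilinear_def linear_iff
    by (auto simp: cofb_def vec_eq_iff[where 'a = vec3] cross_add_left cross_add_right cross_mult_left
        cross_mult_right scaleR_add_right)
  then show ?thesis by (simp add: bilinear_conv_bounded_bilinear)
qed

interpretation cofb: bounded_bilinear cofb by (rule bounded_bilinear_cofb)

lemma cofb_commute: "cofb A B = cofb B A"
  by (simp add: cofb_def vec_eq_iff[where 'a = vec3] add.commute)

lemma det_eq_cof: "det F = (1 / 3) * (cof F \<bullet> F)"
  by (simp add: inner_mat cof_row det_3 cross3_def inner_vec_def[where 'a = real] sum_3) (simp add: algebra_simps)

lemma cofb_inner: "cofb F E \<bullet> F = 2 * (cof F \<bullet> E)"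
  by (simp add: inner_mat cof_row cofb_def cross3_def inner_vec_def[where 'a = real] sum_3) (simp add: algebra_simps)

text \<open>The derivative of \<open>Phi\<close> at \<open>F\<close> in the direction \<open>E\<close>.\<close>

definition DPhi :: "mat3 \<Rightarrow> mat3 \<Rightarrow> xi" where
  "DPhi F E = (E, cofb F E, cof F \<bullet> E)"

lemma cof_has_derivative: "(cof has_derivative cofb F) (at F)"
proof -
  have "((\<lambda>F. (1 / 2) *\<^sub>R cofb F F) has_derivative (\<lambda>E. (1 / 2) *\<^sub>R (cofb F E + cofb E F))) (at F)"
    by (intro has_derivative_scaleR_right cofb.FDERIV has_derivative_ident)
  moreover have "(\<lambda>E. (1 / 2) *\<^sub>R (cofb F E + cofb E F)) = cofb F"
    by (simp add: cofb_commute[of _ F] scaleR_2[symmetric] fun_eq_iff)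
  ultimately show ?thesis by (simp add: cof_eq_cofb[abs_def])
qed

lemma Phi_has_derivative: "(Phi has_derivative DPhi F) (at F)"
proof -
  have "((\<lambda>F. (1 / 3) * (cof F \<bullet> F)) has_derivative (\<lambda>E. (1 / 3) * (cof F \<bullet> E + cofb F E \<bullet> F))) (at F)"
    by (intro has_derivative_mult_right has_derivative_inner cof_has_derivative has_derivative_ident)
  then have "(det has_derivative (\<lambda>E. cof F \<bullet> E)) (at F)"
    by (simp add: det_eq_cof[abs_def] cofb_inner)
  then have "((\<lambda>F. (F, cof F, det F)) has_derivative (\<lambda>E. (E, cofb F E, cof F \<bullet> E))) (at F)"
    by (intro has_derivative_Pair has_derivative_ident cof_has_derivative)
  then show ?thesis by (simp add: Phi_def[abs_def] DPhi_def[abs_def])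
qed

lemma dPhi_eq: "dPhi F i \<alpha> = DPhi F (axis i (axis \<alpha> 1))"
  unfolding dPhi_def by (rule dderiv_eq[OF Phi_has_derivative])

lemma bounded_linear_DPhi: "bounded_linear (DPhi F)"
  using Phi_has_derivative by (rule has_derivative_bounded_linear)

lemma Ck_on_cof: "Ck_on k UNIV cof"
proof -
  have id: "Ck_on k UNIV (\<lambda>F::mat3. F)" by (rule Ck_on_linear[OF bounded_linear_ident])
  show ?thesis unfolding cof_eq_cofb[abs_def]
    by (intro Ck_on_scaleR[OF open_UNIV Ck_on_const] cofb.Ck_on_prod[OF open_UNIV] id)
qed

lemma Ck_on_Phi: "Ck_on k UNIV Phi"
proof -
  have id: "Ck_on k UNIV (\<lambda>F::mat3. F)" by (rule Ck_on_linear[OF bounded_linear_ident])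
  show ?thesis unfolding Phi_def[abs_def] det_eq_cof
    by (rule Ck_on_Pair[OF open_UNIV id Ck_on_Pair[OF open_UNIV Ck_on_cof
        Ck_on_mult[OF open_UNIV Ck_on_const Ck_on_inner[OF open_UNIV Ck_on_cof id]]]])
qed

text \<open>The derivative of the minors in the direction of a matrix whose only row is \<open>w\<close>, in terms of
  triple products.\<close>

lemma inner_DPhi_row:
  "m \<bullet> DPhi F (axis i w) = fst m $ i \<bullet> w
     + (F $ (i + 2) \<bullet> cross3 w (fst (snd m) $ (i + 1)) + F $ (i + 1) \<bullet> cross3 (fst (snd m) $ (i + 2)) w)
     + snd (snd m) * (w \<bullet> cross3 (F $ (i + 1)) (F $ (i + 2)))"
proof -
  obtain a b c where m: "m = (a, b, c)" by (cases m)
  have sp: "y \<bullet> cross3 x z = x \<bullet> cross3 z y" "y \<bullet> cross3 z x = x \<bullet> cross3 y z" for x y z :: vec3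
    by (simp_all add: cross3_def inner_vec_def sum_3 algebra_simps)
  show ?thesis unfolding m
    using exhaust_3[of i]
    by (elim disjE) (simp_all add: DPhi_def inner_mat cofb_def cof_row axis_def sp inner_commute[of "cross3 _ _" w])
qed

lemma DPhi_diff: "DPhi F E - DPhi F' E = (0, cofb (F - F') E, (cof F - cof F') \<bullet> E)"
  by (simp add: DPhi_def cofb.diff_left inner_diff_left)

lemma cof_diff: "cof F - cof F' = cofb F' (F - F') + (1 / 2) *\<^sub>R cofb (F - F') (F - F')"
proof -
  have "cofb F F - cofb F' F' = 2 *\<^sub>R cofb F' (F - F') + cofb (F - F') (F - F')"
    by (simp add: cofb.diff_left cofb.diff_right cofb_commute[of F F'] scaleR_2)
  then show ?thesis
    by (simp add: cof_eq_cofb scaleR_diff_right[symmetric] scaleR_add_right)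
qed

section \<open>Weak form of the null Lagrangian identities\<close>

text \<open>The classical differential operators. A field is \<open>curl_free\<close> if its Jacobian is symmetric.\<close>

definition gradv :: "(vec3 \<Rightarrow> real) \<Rightarrow> vec3 \<Rightarrow> vec3" where
  "gradv f x = (\<chi> \<alpha>. partial \<alpha> f x)"

definition divv :: "(vec3 \<Rightarrow> vec3) \<Rightarrow> vec3 \<Rightarrow> real" where
  "divv Y x = (\<Sum>\<alpha>\<in>UNIV. partial \<alpha> (\<lambda>x. Y x $ \<alpha>) x)"

definition curl_free :: "(vec3 \<Rightarrow> vec3) \<Rightarrow> bool" where
  "curl_free a \<longleftrightarrow> (\<forall>x \<alpha> \<beta>. partial \<beta> (\<lambda>x. a x $ \<alpha>) x = partial \<alpha> (\<lambda>x. a x $ \<beta>) x)"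

lemma Ck_on_nth:
  fixes a :: "'a::euclidean_space \<Rightarrow> ('b::euclidean_space) ^ 'n"
  shows "open U \<Longrightarrow> Ck_on k U a \<Longrightarrow> Ck_on k U (\<lambda>x. a x $ i)"
  by (rule Ck_on_linear_compose[OF _ bounded_linear_vec_nth])

lemma Ck_on_vec:
  fixes a :: "'a::euclidean_space \<Rightarrow> real ^ 'n"
  assumes "open U" "\<And>i. Ck_on k U (\<lambda>x. a x $ i)"
  shows "Ck_on k U a"
  by (rule Ck_on_euclidean[OF assms(1)]) (use assms(2) in \<open>auto simp: Basis_vec_def inner_axis\<close>)

interpretation cross: bounded_bilinear cross3
  using bilinear_cross by (simp add: bilinear_conv_bounded_bilinear)

lemma norm_cross_le: "norm (cross3 x y) \<le> norm x * norm y"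
proof -
  have "(norm (cross3 x y))\<^sup>2 \<le> (norm x * norm y)\<^sup>2"
    using norm_cross_dot[of x y] zero_le_power2[of "x \<bullet> y"] by linarith
  then show ?thesis by (rule power2_le_imp_le) simp
qed

lemma divv_cross:
  assumes "Ck_on 1 UNIV a" "Ck_on 1 UNIV b" "curl_free a" "curl_free b"
  shows "divv (\<lambda>x. cross3 (a x) (b x)) x = 0"
proof -
  have d: "(\<lambda>x. a x $ i) differentiable (at x)" "(\<lambda>x. b x $ i) differentiable (at x)" for i
    using Ck_on_nth[OF open_UNIV assms(1), of i] Ck_on_nth[OF open_UNIV assms(2), of i] by auto
  have D: "partial \<alpha> (\<lambda>x. a x $ i * b x $ j - b x $ k * a x $ l) x
      = (a x $ i * partial \<alpha> (\<lambda>x. b x $ j) x + partial \<alpha> (\<lambda>x. a x $ i) x * b x $ j)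
      - (b x $ k * partial \<alpha> (\<lambda>x. a x $ l) x + partial \<alpha> (\<lambda>x. b x $ k) x * a x $ l)" for \<alpha> i j k l
    using d by (subst dderiv_diff) (auto simp: bounded_bilinear.dderiv_prod[OF bounded_bilinear_mult])
  have ca: "partial \<beta> (\<lambda>x. a x $ \<alpha>) x = partial \<alpha> (\<lambda>x. a x $ \<beta>) x" for \<alpha> \<beta>
    using assms(3) unfolding curl_free_def by blast
  have cb: "partial \<beta> (\<lambda>x. b x $ \<alpha>) x = partial \<alpha> (\<lambda>x. b x $ \<beta>) x" for \<alpha> \<beta>
    using assms(4) unfolding curl_free_def by blast
  show ?thesis
    unfolding divv_def sum_3 cross_components D
    using ca[of 1 2] ca[of 1 3] ca[of 2 3] cb[of 1 2] cb[of 1 3] cb[of 2 3]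
    by (simp add: algebra_simps)
qed

lemma curl_free_const: "curl_free (\<lambda>x. c)"
  by (simp add: curl_free_def dderiv_const)

lemma curl_free_gradv:
  assumes "Ck_on 2 UNIV f"
  shows "curl_free (gradv f)"
  using dderiv_commute[OF open_UNIV UNIV_I assms] by (simp add: curl_free_def gradv_def)

lemma Ck_on_gradv: "Ck_on (Suc k) UNIV f \<Longrightarrow> Ck_on k UNIV (gradv f)"
  by (rule Ck_on_vec) (auto simp: gradv_def)

lemma periodic_gradv:
  assumes "periodic f"
  shows "periodic (gradv f)"
proof -
  have "partial \<alpha> f (x + axis k 1) = partial \<alpha> f x" for \<alpha> k x
    using periodic_dderiv[OF assms, of "axis \<alpha> 1"] unfolding periodic_def by blast
  then show ?thesis by (simp add: periodic_def gradv_def)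
qed

lemma integral_grad_dot:
  assumes "periodic f" "Ck_on 1 UNIV f" "periodic Y" "Ck_on 1 UNIV Y" "\<And>x. divv Y x = 0"
  shows "(LINT x|torus. gradv f x \<bullet> Y x) = 0"
proof -
  have Yc: "Ck_on 1 UNIV (\<lambda>x. Y x $ \<alpha>)" for \<alpha> by (rule Ck_on_nth[OF open_UNIV assms(4)])
  have D: "partial \<alpha> (\<lambda>x. f x * Y x $ \<alpha>) x = f x * partial \<alpha> (\<lambda>x. Y x $ \<alpha>) x + partial \<alpha> f x * Y x $ \<alpha>" for \<alpha> x
    using assms(2) Yc[of \<alpha>] by (intro bounded_bilinear.dderiv_prod[OF bounded_bilinear_mult]) auto
  have C: "Ck_on 1 UNIV (\<lambda>x. f x * Y x $ \<alpha>)" for \<alpha>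
    by (rule Ck_on_mult[OF open_UNIV assms(2) Yc])
  have int: "integrable torus (partial \<alpha> (\<lambda>x. f x * Y x $ \<alpha>))" for \<alpha>
  proof (rule torus_integrable_continuous)
    have "continuous_on UNIV (partial \<alpha> (\<lambda>x. f x * Y x $ \<alpha>))" using C[of \<alpha>] by simp
    then show "continuous_on (cbox 0 1) (partial \<alpha> (\<lambda>x. f x * Y x $ \<alpha>))" by (rule continuous_on_subset) simp
  qed
  have "gradv f x \<bullet> Y x = (\<Sum>\<alpha>\<in>UNIV. partial \<alpha> (\<lambda>x. f x * Y x $ \<alpha>) x)" for x
  proof -
    have "(\<Sum>\<alpha>\<in>UNIV. partial \<alpha> (\<lambda>x. f x * Y x $ \<alpha>) x) = f x * divv Y x + gradv f x \<bullet> Y x"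
      by (simp add: D sum.distrib divv_def gradv_def inner_vec_def sum_distrib_left)
    then show ?thesis using assms(5) by simp
  qed
  then have "(LINT x|torus. gradv f x \<bullet> Y x) = (\<Sum>\<alpha>\<in>UNIV. LINT x|torus. partial \<alpha> (\<lambda>x. f x * Y x $ \<alpha>) x)"
    using int by (simp add: Bochner_Integration.integral_sum)
  also have "\<dots> = 0"
    using assms(1,3) C by (intro sum.neutral ballI torus_integral_partial) (auto simp: periodic_def)
  finally show ?thesis .
qed

text \<open>By the Helmholtz decomposition the following says that the rows of \<open>F - F'\<close> are weak
  gradients of periodic functions; only this dual form is needed.\<close>

definition differ_by_gradient :: "(vec3 \<Rightarrow> mat3) \<Rightarrow> (vec3 \<Rightarrow> mat3) \<Rightarrow> bool" where
  "differ_by_gradient F F' \<longleftrightarrow>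
     (\<forall>j Y. periodic Y \<longrightarrow> Ck_on 1 UNIV Y \<longrightarrow> (\<forall>x. divv Y x = 0) \<longrightarrow>
        (LINT x|torus. F x $ j \<bullet> Y x) = (LINT x|torus. F' x $ j \<bullet> Y x))"

text \<open>The derivative of the minors is expanded around \<open>F'\<close>. The terms of degree at most one in
  \<open>F - F'\<close> integrate to zero against \<open>gradv f\<close>, because vector products of curl free fields are
  solenoidal; only the derivative of the determinant has a quadratic term.\<close>

lemma null_lagrangian:
  assumes F: "F \<in> borel_measurable torus" "integrable torus (\<lambda>x. (norm (F x))\<^sup>2)"
    and F': "periodic F'" "Ck_on 1 UNIV F'" "\<And>j. curl_free (\<lambda>x. F' x $ j)"
    and FF': "differ_by_gradient F F'"
    and f: "periodic f" "Ck_on 2 UNIV f"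
  shows "(LINT x|torus. m \<bullet> DPhi (F x) (axis i (gradv f x)))
    = (LINT x|torus. snd (snd m) *
        (gradv f x \<bullet> cross3 ((F x - F' x) $ (i + 1)) ((F x - F' x) $ (i + 2))))"
proof -
  obtain a b c where m: "m = (a, b, c)" by (cases m)
  have gf: "Ck_on 1 UNIV (gradv f)" using Ck_on_gradv[of 1 f] f(2) by (simp add: numeral_2_eq_2)
  have f1: "Ck_on 1 UNIV f" by (rule Ck_on_le[OF f(2)]) simp
  have cont: "continuous_on (cbox 0 1) u" if "Ck_on 1 UNIV u" for u :: "vec3 \<Rightarrow> 'z::euclidean_space"
    using Ck_on_continuous[OF that] continuous_on_subset by blast
  have Fint: "integrable torus (\<lambda>x. norm (F x))"
  proof (rule Bochner_Integration.integrable_bound)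
    show "integrable torus (\<lambda>x. 1 + (norm (F x))\<^sup>2)"
      using F(2) torus_integrable_continuous[of "\<lambda>_. 1::real"] by auto
    have t: "\<bar>t\<bar> \<le> 1 + t\<^sup>2" for t :: real
      using zero_le_power2[of "\<bar>t\<bar> - 1"] by (simp add: power2_eq_square algebra_simps abs_mult_self_eq)
    then have "norm (norm (F x)) \<le> norm (1 + (norm (F x))\<^sup>2)" for x
      using t[of "norm (F x)"] by (simp add: add_nonneg_nonneg)
    then show "AE x in torus. norm (norm (F x)) \<le> norm (1 + (norm (F x))\<^sup>2)" by simp
  qed (use F(1) in measurable)
  have Frow: "(\<lambda>x. F x $ j) \<in> borel_measurable torus" for j
    by (rule measurable_compose[OF F(1)])
      (rule borel_measurable_continuous_onI[OF linear_continuous_on[OF bounded_linear_vec_nth]])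
  have F'c: "Ck_on 1 UNIV (\<lambda>x. F' x $ j)" for j by (rule Ck_on_nth[OF open_UNIV F'(2)])
  have F'p: "periodic (\<lambda>x. F' x $ j)" for j using F'(1) by (simp add: periodic_def)
  have intY: "integrable torus (\<lambda>x. F x $ j \<bullet> Y x)" if Y: "Ck_on 1 UNIV Y" for j Y
  proof -
    obtain M where M: "M > 0" "\<And>x. x \<in> cbox 0 1 \<Longrightarrow> norm (Y x) \<le> M"
      using continuous_cell_bounded[OF cont[OF Y]] by blast
    have "integrable torus (\<lambda>x. norm (F x) * M)" using Fint by simp
    then show ?thesis
    proof (rule Bochner_Integration.integrable_bound)
      show "(\<lambda>x. F x $ j \<bullet> Y x) \<in> borel_measurable torus"
        by (intro borel_measurable_inner Frow torus_measurable_continuous cont Y)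
      have "norm (F x $ j \<bullet> Y x) \<le> norm (norm (F x) * M)" if "x \<in> cbox 0 1" for x
      proof -
        have "\<bar>F x $ j \<bullet> Y x\<bar> \<le> norm (F x $ j) * norm (Y x)" by (rule Cauchy_Schwarz_ineq2)
        also have "\<dots> \<le> norm (F x) * M" by (intro mult_mono M(2) that Finite_Cartesian_Product.norm_nth_le) auto
        finally show ?thesis using M(1) by simp
      qed
      then show "AE x in torus. norm (F x $ j \<bullet> Y x) \<le> norm (norm (F x) * M)" by (intro AE_I2) simp
    qed
  qed
  have tri: "x \<bullet> cross3 y z = y \<bullet> cross3 z x" for x y z :: vec3
    by (simp add: cross3_def inner_vec_def sum_3 algebra_simps)
  have zero': "(LINT x|torus. gradv f x \<bullet> cross3 (d x) (d' x)) = 0"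
    if "Ck_on 1 UNIV d" "Ck_on 1 UNIV d'" "curl_free d" "curl_free d'" "periodic d" "periodic d'" for d d'
    by (intro integral_grad_dot f(1) f1 cross.Ck_on_prod[OF open_UNIV] that divv_cross)
      (use that in \<open>simp add: periodic_def\<close>)
  have zero: "(LINT x|torus. F x $ j \<bullet> cross3 (gradv f x) (d x)) = 0"
    if d: "Ck_on 1 UNIV d" "curl_free d" "periodic d" for d j
  proof -
    let ?Y = "\<lambda>x. cross3 (gradv f x) (d x)"
    have "periodic ?Y" using periodic_gradv[OF f(1)] d(3) by (simp add: periodic_def)
    moreover have "Ck_on 1 UNIV ?Y" by (rule cross.Ck_on_prod[OF open_UNIV gf d(1)])
    moreover have "divv ?Y x = 0" for x by (rule divv_cross[OF gf d(1) curl_free_gradv[OF f(2)] d(2)])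
    ultimately have "(LINT x|torus. F x $ j \<bullet> ?Y x) = (LINT x|torus. F' x $ j \<bullet> ?Y x)"
      using FF' unfolding differ_by_gradient_def by blast
    also have "\<dots> = (LINT x|torus. gradv f x \<bullet> cross3 (d x) (F' x $ j))" by (simp add: tri)
    also have "\<dots> = 0" by (rule zero'[OF d(1) F'c d(2) F'(3) d(3) F'p])
    finally show ?thesis .
  qed
  have intZ: "integrable torus (\<lambda>x. F x $ j \<bullet> cross3 (gradv f x) (d x))" if "Ck_on 1 UNIV d" for d j
    by (rule intY[OF cross.Ck_on_prod[OF open_UNIV gf that]])
  have kc: "Ck_on 1 UNIV (\<lambda>x::vec3. d)" "curl_free (\<lambda>x. d)" "periodic (\<lambda>x. d)" for d :: vec3
    by (simp_all add: curl_free_const periodic_const del: Ck_on.simps One_nat_def)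
  let ?q = "\<lambda>x. gradv f x \<bullet> cross3 ((F x - F' x) $ (i + 1)) ((F x - F' x) $ (i + 2))"
  let ?T1 = "\<lambda>x. gradv f x \<bullet> a $ i"
    and ?T2 = "\<lambda>x. F x $ (i + 2) \<bullet> cross3 (gradv f x) (b $ (i + 1))"
    and ?T3 = "\<lambda>x. F x $ (i + 1) \<bullet> cross3 (gradv f x) (b $ (i + 2))"
    and ?T4 = "\<lambda>x. F x $ (i + 2) \<bullet> cross3 (gradv f x) (F' x $ (i + 1))"
    and ?T5 = "\<lambda>x. F x $ (i + 1) \<bullet> cross3 (gradv f x) (F' x $ (i + 2))"
    and ?T6 = "\<lambda>x. gradv f x \<bullet> cross3 (F' x $ (i + 1)) (F' x $ (i + 2))"
  have T1: "(LINT x|torus. ?T1 x) = 0"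
    by (rule integral_grad_dot[OF f(1) f1 kc(3) kc(1)]) (simp add: divv_def dderiv_const)
  have I1: "integrable torus ?T1" and I6: "integrable torus ?T6"
    by (intro torus_integrable_continuous cont Ck_on_inner[OF open_UNIV] gf kc cross.Ck_on_prod[OF open_UNIV] F'c)+
  note T = T1 zero[OF kc, of "i + 2" "b $ (i + 1)"] zero[OF kc, of "i + 1" "b $ (i + 2)"]
    zero[OF F'c F'(3) F'p, of "i + 2" "i + 1"] zero[OF F'c F'(3) F'p, of "i + 1" "i + 2"]
    zero'[OF F'c F'c F'(3) F'(3) F'p F'p, of "i + 1" "i + 2"]
  note I = I1 intZ[OF kc(1), of "i + 2" "b $ (i + 1)"] intZ[OF kc(1), of "i + 1" "b $ (i + 2)"]
    intZ[OF F'c, of "i + 2" "i + 1"] intZ[OF F'c, of "i + 1" "i + 2"] I6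
  have pt: "m \<bullet> DPhi (F x) (axis i (gradv f x)) = c * ?q x +
      (?T1 x + ?T2 x - ?T3 x + c * (?T4 x - ?T5 x - ?T6 x))" for x
  proof -
    have e: "w \<bullet> cross3 s t = w \<bullet> cross3 (s - s') (t - t') + (t \<bullet> cross3 w s' - s \<bullet> cross3 w t' - w \<bullet> cross3 s' t')"
      for w s t s' t' :: vec3
      by (simp add: cross3_def inner_vec_def sum_3 algebra_simps)
    have sk: "s \<bullet> cross3 t w = - (s \<bullet> cross3 w t)" for s t w :: vec3
      by (subst cross_skew) simp
    show ?thesis unfolding m inner_DPhi_row fst_conv snd_conv
      e[of "gradv f x" "F x $ (i + 1)" "F x $ (i + 2)" "F' x $ (i + 1)" "F' x $ (i + 2)"]
      sk[of "F x $ (i + 1)" "b $ (i + 2)"]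
      by (simp add: algebra_simps inner_commute[of "gradv f x" "a $ i"])
  qed
  have qint: "integrable torus ?q"
  proof -
    obtain M where M: "M > 0" "\<And>x. x \<in> cbox 0 1 \<Longrightarrow> norm (gradv f x) \<le> M"
      using continuous_cell_bounded[OF cont[OF gf]] by blast
    have "integrable torus (\<lambda>x. M * (2 * (norm (F x))\<^sup>2 + 2 * (norm (F' x))\<^sup>2))"
    proof -
      have "integrable torus (\<lambda>x. (norm (F' x))\<^sup>2)"
        by (intro torus_integrable_continuous continuous_intros cont[OF F'(2)])
      then show ?thesis using F(2) by (intro integrable_mult_right Bochner_Integration.integrable_add) auto
    qed
    then show ?thesis
    proof (rule Bochner_Integration.integrable_bound)
      have "(\<lambda>x. (F x - F' x) $ j) \<in> borel_measurable torus" for j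
        using Frow[of j] torus_measurable_continuous[OF cont[OF F'c], of j] by (simp add: borel_measurable_diff)
      moreover have "(\<lambda>p. cross3 (fst p) (snd p)) \<in> borel_measurable borel"
        by (intro borel_measurable_continuous_onI cross.continuous_on continuous_intros)
      ultimately have "(\<lambda>x. cross3 ((F x - F' x) $ (i + 1)) ((F x - F' x) $ (i + 2))) \<in> borel_measurable torus"
        using measurable_compose[OF borel_measurable_Pair, of _ torus _ "\<lambda>p. cross3 (fst p) (snd p)" borel]
        by simp
      then show "?q \<in> borel_measurable torus"
        by (rule borel_measurable_inner[OF torus_measurable_continuous[OF cont[OF gf]]])
      have "norm (?q x) \<le> norm (M * (2 * (norm (F x))\<^sup>2 + 2 * (norm (F' x))\<^sup>2))" if "x \<in> cbox 0 1" for x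
      proof -
        let ?K = "F x - F' x"
        have "\<bar>?q x\<bar> \<le> norm (gradv f x) * norm (cross3 (?K $ (i + 1)) (?K $ (i + 2)))"
          by (rule Cauchy_Schwarz_ineq2)
        also have "\<dots> \<le> M * (norm (?K $ (i + 1)) * norm (?K $ (i + 2)))"
          by (intro mult_mono M(2) that norm_cross_le) (use M in auto)
        also have "\<dots> \<le> M * (norm ?K * norm ?K)"
          using M(1) by (intro mult_left_mono mult_mono Finite_Cartesian_Product.norm_nth_le) auto
        also have "norm ?K * norm ?K \<le> 2 * (norm (F x))\<^sup>2 + 2 * (norm (F' x))\<^sup>2"
        proof -
          have "norm ?K * norm ?K \<le> (norm (F x) + norm (F' x)) * (norm (F x) + norm (F' x))"
            by (intro mult_mono norm_triangle_ineq4) auto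
          also have "\<dots> \<le> 2 * (norm (F x))\<^sup>2 + 2 * (norm (F' x))\<^sup>2"
            using zero_le_power2[of "norm (F x) - norm (F' x)"] by (simp add: power2_eq_square algebra_simps)
          finally show ?thesis .
        qed
        finally show ?thesis using M(1) by simp
      qed
      then show "AE x in torus. norm (?q x) \<le> norm (M * (2 * (norm (F x))\<^sup>2 + 2 * (norm (F' x))\<^sup>2))"
        by (intro AE_I2) simp
    qed
  qed
  have "(LINT x|torus. m \<bullet> DPhi (F x) (axis i (gradv f x))) = (LINT x|torus. c * ?q x)"
    unfolding pt using I T qint by simp
  then show ?thesis by (simp add: m)
qed

section \<open>Pointwise estimates for the stored energy\<close>

lemma norm_fst: "norm (fst z) \<le> norm z"
  by (cases z) (simp add: norm_fst_le)

lemma Ck_on_dderiv_3: "Ck_on 3 U f \<Longrightarrow> Ck_on 2 U (dderiv u f)"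
  by (simp add: numeral_3_eq_3 numeral_2_eq_2)

lemma grad_inner:
  assumes "f differentiable (at x)"
  shows "grad f x \<bullet> z = dderiv z f x"
proof -
  have "grad f x \<bullet> z = (\<Sum>b\<in>Basis. dderiv b f x * (b \<bullet> z))"
    by (simp only: grad_def inner_sum_left inner_scaleR_left)
  also have "\<dots> = (\<Sum>b\<in>Basis. (z \<bullet> b) *\<^sub>R dderiv b f x)"
    by (rule sum.cong[OF refl]) (simp only: inner_commute[of _ z] mult.commute real_scaleR_def)
  finally show ?thesis by (simp only: dderiv_Basis_sum[OF assms, of z])
qed

lemma grad_inner_Basis:
  assumes "b \<in> Basis"
  shows "grad f x \<bullet> b = dderiv b f x"
proof -
  have "grad f x \<bullet> b = (\<Sum>a\<in>Basis. dderiv a f x * (a \<bullet> b))"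
    by (simp only: grad_def inner_sum_left inner_scaleR_left)
  also have "\<dots> = (\<Sum>a\<in>Basis. if a = b then dderiv a f x else 0)"
    using assms by (intro sum.cong) (auto simp: inner_Basis)
  also have "\<dots> = dderiv b f x" using assms by simp
  finally show ?thesis .
qed

lemma Ck_on_grad: "open U \<Longrightarrow> Ck_on (Suc k) U f \<Longrightarrow> Ck_on k U (grad f)"
  by (rule Ck_on_euclidean) (simp_all add: grad_inner_Basis)

lemma dderiv_dderiv_sum:
  fixes f :: "'a::euclidean_space \<Rightarrow> real"
  assumes "Ck_on 2 UNIV f"
  shows "dderiv u (dderiv w f) x = (\<Sum>b\<in>Basis. (w \<bullet> b) * dderiv u (dderiv b f) x)"
proof -
  have C: "f differentiable (at y)" "dderiv b f differentiable (at y)" for y b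
    using assms by (auto simp: numeral_2_eq_2)
  have "dderiv w f = (\<lambda>x. \<Sum>b\<in>Basis. (w \<bullet> b) *\<^sub>R dderiv b f x)"
    by (rule ext) (rule dderiv_Basis_sum[OF C(1)])
  then have "dderiv u (dderiv w f) x = dderiv u (\<lambda>x. \<Sum>b\<in>Basis. (w \<bullet> b) *\<^sub>R dderiv b f x) x" by simp
  also have "\<dots> = (\<Sum>b\<in>Basis. dderiv u (\<lambda>x. (w \<bullet> b) *\<^sub>R dderiv b f x) x)"
    by (rule dderiv_sum) (auto intro!: differentiable_scaleR C)
  also have "\<dots> = (\<Sum>b\<in>Basis. (w \<bullet> b) * dderiv u (dderiv b f) x)"
    by (rule sum.cong[OF refl])
      (simp add: dderiv_linear_compose[OF bounded_linear_mult_right C(2)])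
  finally show ?thesis .
qed

lemma dderiv2_bound:
  fixes f :: "'a::euclidean_space \<Rightarrow> real"
  assumes "Ck_on 2 UNIV f" "\<And>a b. a \<in> Basis \<Longrightarrow> b \<in> Basis \<Longrightarrow> \<bar>dderiv a (dderiv b f) x\<bar> \<le> B"
  shows "\<bar>dderiv u (dderiv w f) x\<bar> \<le> (real DIM('a))\<^sup>2 * B * norm u * norm w"
proof -
  have C: "dderiv b f differentiable (at y)" for y b
    using assms by (auto simp: numeral_2_eq_2)
  have eq: "dderiv u (dderiv w f) x = (\<Sum>b\<in>Basis. \<Sum>a\<in>Basis. (w \<bullet> b) * ((u \<bullet> a) * dderiv a (dderiv b f) x))"
    unfolding dderiv_dderiv_sum[OF assms(1), of u w] unfolding dderiv_Basis_sum[OF C, of u]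
    by (simp only: sum_distrib_left real_scaleR_def)
  let ?t = "\<lambda>a b. (w \<bullet> b) * ((u \<bullet> a) * dderiv a (dderiv b f) x)"
  have t: "\<bar>?t a b\<bar> \<le> norm w * (norm u * B)" if "a \<in> Basis" "b \<in> Basis" for a b
  proof -
    have "\<bar>u \<bullet> a\<bar> * \<bar>dderiv a (dderiv b f) x\<bar> \<le> norm u * B"
      by (rule mult_mono[OF Basis_le_norm[OF that(1)] assms(2)[OF that]]) simp_all
    from mult_mono[OF Basis_le_norm[OF that(2), of w] this] show ?thesis
      by (simp add: abs_mult)
  qed
  have "\<bar>\<Sum>b\<in>Basis. \<Sum>a\<in>Basis. ?t a b\<bar> \<le> (\<Sum>b\<in>(Basis::'a set). \<Sum>a\<in>(Basis::'a set). \<bar>?t a b\<bar>)"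
    by (rule order_trans[OF sum_abs]) (rule sum_mono[OF sum_abs])
  also have "\<dots> \<le> (\<Sum>b\<in>(Basis::'a set). \<Sum>a\<in>(Basis::'a set). norm w * (norm u * B))"
    by (intro sum_mono t)
  finally have "\<bar>dderiv u (dderiv w f) x\<bar> \<le> (\<Sum>b\<in>(Basis::'a set). \<Sum>a\<in>(Basis::'a set). norm w * (norm u * B))"
    unfolding eq .
  then show ?thesis by (simp add: power2_eq_square mult_ac)
qed

lemma taylor2:
  fixes f :: "'a::euclidean_space \<Rightarrow> real"
  assumes "Ck_on 2 UNIV f"
  shows "\<exists>s. 0 < s \<and> s < 1 \<and> f (x + z) = f x + dderiv z f x + dderiv z (dderiv z f) (x + s *\<^sub>R z) / 2"
proof -
  have C: "f differentiable (at y)" "dderiv z f differentiable (at y)" for y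
    using assms by (auto simp: numeral_2_eq_2)
  define d where "d m s = (if m = 0 then f (x + s *\<^sub>R z) else if m = 1 then dderiv z f (x + s *\<^sub>R z)
      else dderiv z (dderiv z f) (x + s *\<^sub>R z))" for m :: nat and s
  have "DERIV (d m) s :> d (Suc m) s" if "m < 2" for m s
    using that dderiv_line_real[OF C(1), where x = x and s = s and z = z and S = UNIV]
      dderiv_line_real[OF C(2), where x = x and s = s and z = z and S = UNIV]
    by (cases m) (auto simp: d_def[abs_def])
  then have "\<exists>t>0. t < 1 \<and> d 0 1 = (\<Sum>m<2. d m 0 / fact m * 1 ^ m) + d 2 t / fact 2 * 1 ^ 2"
    by (intro Maclaurin) auto
  then show ?thesis by (auto simp: d_def numeral_2_eq_2)
qed

lemma taylor2_bound:
  fixes f :: "'a::euclidean_space \<Rightarrow> real"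
  assumes "Ck_on 2 UNIV f"
    and "\<And>s a b. 0 < s \<Longrightarrow> s < 1 \<Longrightarrow> a \<in> Basis \<Longrightarrow> b \<in> Basis \<Longrightarrow>
           \<bar>dderiv a (dderiv b f) (x + s *\<^sub>R z)\<bar> \<le> B"
  shows "\<bar>f (x + z) - f x - dderiv z f x\<bar> \<le> (real DIM('a))\<^sup>2 * B * (norm z)\<^sup>2"
proof -
  obtain s where s: "0 < s" "s < 1" "f (x + z) = f x + dderiv z f x + dderiv z (dderiv z f) (x + s *\<^sub>R z) / 2"
    using taylor2[OF assms(1)] by blast
  have "\<bar>dderiv z (dderiv z f) (x + s *\<^sub>R z)\<bar> \<le> (real DIM('a))\<^sup>2 * B * norm z * norm z"
    using s assms(2) by (intro dderiv2_bound assms(1)) auto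
  then show ?thesis using s(3) by (simp add: power2_eq_square mult_ac)
qed

text \<open>Powers with real exponents: what lies between the exponents \<open>2\<close> and \<open>p\<close> is controlled by the two.\<close>

lemma powr_between:
  fixes t :: real
  assumes "0 \<le> t" "2 \<le> q" "q \<le> p"
  shows "t powr q \<le> t\<^sup>2 + t powr p"
proof (cases "t \<le> 1")
  case True
  have "t powr q \<le> t powr 2" if "t > 0"
    using True that assms by (intro powr_mono') auto
  then have "t powr q \<le> t\<^sup>2" using assms(1) by (cases "t = 0") (auto simp: powr_numeral)
  then show ?thesis by (simp add: add_increasing2)
next
  case False
  then have "t powr q \<le> t powr p" using assms by (intro powr_mono) auto
  then show ?thesis by (simp add: add_increasing)
qed

lemma powr_sum_le:
  fixes a b :: real
  assumes "0 \<le> a" "0 \<le> b" "0 \<le> q"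
  shows "(a + b) powr q \<le> 2 powr q * (a powr q + b powr q)"
proof -
  have "(a + b) powr q \<le> (2 * max a b) powr q"
    using assms by (intro powr_mono2) auto
  also have "\<dots> = 2 powr q * max a b powr q" using assms by (simp add: powr_mult)
  also have "max a b powr q \<le> a powr q + b powr q" by (simp add: max_def)
  finally show ?thesis by (simp add: mult_left_mono)
qed

text \<open>The energy \<open>G(\<Xi>) = H(F) + R(\<Xi>)\<close>, of growth \<open>p\<close> in \<open>F\<close> and quadratic growth in \<open>Z\<close> and \<open>w\<close>.\<close>

locale stored_energy =
  fixes p \<kappa> \<kappa>' \<gamma> \<gamma>' c1 c2 c3 c4 c5 c7 c8 :: real and H :: "mat3 \<Rightarrow> real" and G R :: "xi \<Rightarrow> real"
  assumes uc: "uniformly_convex G" and H1: "H1 p \<kappa> \<kappa>' \<gamma> \<gamma>' H R G" and H2: "H2 p c1 c2 c3 c4 G"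
    and H3: "H3 p c5 G" and H5: "H5 p c7 c8 H R"
begin

lemma p6: "p \<ge> 6" using H1 by (simp add: H1_def)

lemma G_C3: "Ck_on 3 UNIV G" and H_C3: "Ck_on 3 UNIV H" and R_C3: "Ck_on 3 UNIV R"
  using H1 unfolding H1_def by blast+

lemma G_nonneg: "G \<Xi> \<ge> 0" using H1 unfolding H1_def by blast

lemma G_C2: "Ck_on 2 UNIV G" and H_C2: "Ck_on 2 UNIV H" and R_C2: "Ck_on 2 UNIV R"
  by (rule Ck_on_le[OF G_C3] Ck_on_le[OF H_C3] Ck_on_le[OF R_C3], simp)+

lemma G_diff: "G differentiable (at x)" and H_diff: "H differentiable (at y)" and R_diff: "R differentiable (at x)"
  by (rule Ck_on_differentiable[OF G_C3] Ck_on_differentiable[OF H_C3] Ck_on_differentiable[OF R_C3], simp, simp)+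

lemma dH_C2: "Ck_on 2 UNIV (dderiv u' H)" and dR_C2: "Ck_on 2 UNIV (dderiv u R)"
  by (rule Ck_on_dderiv_3[OF H_C3] Ck_on_dderiv_3[OF R_C3])+

lemma grad_G_C2: "Ck_on 2 UNIV (grad G)"
proof -
  have "Ck_on (Suc 2) UNIV G" using G_C3 by (simp only: eval_nat_numeral)
  then show ?thesis by (rule Ck_on_grad[OF open_UNIV])
qed

lemma G_split: "G \<Xi> = H (fst \<Xi>) + R \<Xi>"
proof (cases \<Xi>)
  case (fields F Z w)
  have "\<forall>F Z w. G (F, Z, w) = H F + R (F, Z, w)" using H1 unfolding H1_def by blast
  then show ?thesis by (simp add: fields)
qed

lemma dderiv_G: "dderiv u G \<Xi> = dderiv (fst u) H (fst \<Xi>) + dderiv u R \<Xi>"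
proof -
  have "((\<lambda>\<Xi>. H (fst \<Xi>) + R \<Xi>) has_derivative (\<lambda>u. dderiv (fst u) H (fst \<Xi>) + dderiv u R \<Xi>)) (at \<Xi>)"
    by (intro has_derivative_add has_derivative_dderiv R_diff
        has_derivative_compose[OF has_derivative_fst[OF has_derivative_ident] has_derivative_dderiv[OF H_diff]])
  then show ?thesis using G_split by (intro dderiv_eq) (simp add: G_split[abs_def])
qed

text \<open>The excess of \<open>G\<close> over its tangent plane at \<open>\<Xi>'\<close>.\<close>

definition Grel :: "xi \<Rightarrow> xi \<Rightarrow> real" where
  "Grel \<Xi> \<Xi>' = G \<Xi> - G \<Xi>' - grad G \<Xi>' \<bullet> (\<Xi> - \<Xi>')"

lemma G_convex:
  obtains m where "m > 0"
    "\<And>x y t. 0 \<le> t \<Longrightarrow> t \<le> 1 \<Longrightarrow>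
      G ((1 - t) *\<^sub>R x + t *\<^sub>R y) \<le> (1 - t) * G x + t * G y - m / 2 * t * (1 - t) * (norm (x - y))\<^sup>2"
  using uc unfolding uniformly_convex_def by metis

lemma Grel_ge: "\<exists>m>0. \<forall>\<Xi> \<Xi>'. Grel \<Xi> \<Xi>' \<ge> m * (norm (\<Xi> - \<Xi>'))\<^sup>2"
proof -
  obtain m where m: "m > 0" "\<And>x y t. 0 \<le> t \<Longrightarrow> t \<le> 1 \<Longrightarrow>
      G ((1 - t) *\<^sub>R x + t *\<^sub>R y) \<le> (1 - t) * G x + t * G y - m / 2 * t * (1 - t) * (norm (x - y))\<^sup>2"
    using G_convex by blast
  have "Grel y x \<ge> m / 2 * (norm (y - x))\<^sup>2" for x y
  proof -
    let ?z = "y - x"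
    have "((\<lambda>t. G (x + t *\<^sub>R ?z)) has_real_derivative dderiv ?z G (x + 0 *\<^sub>R ?z)) (at 0)"
      by (rule dderiv_line_real[OF G_diff])
    then have "((\<lambda>t. (G (x + t *\<^sub>R ?z) - G x) / t) \<longlongrightarrow> dderiv ?z G x) (at 0)"
      by (simp add: has_field_derivative_iff)
    then have lim: "((\<lambda>t. (G (x + t *\<^sub>R ?z) - G x) / t) \<longlongrightarrow> dderiv ?z G x) (at_right 0)"
      by (rule filterlim_mono) (auto simp: at_le)
    have lim2: "((\<lambda>t. G y - G x - m / 2 * (1 - t) * (norm ?z)\<^sup>2) \<longlongrightarrow> G y - G x - m / 2 * (1 - 0) * (norm ?z)\<^sup>2) (at_right 0)"
      by (intro tendsto_intros)
    have "\<forall>\<^sub>F t in at_right 0. t \<in> {0<..<1::real}"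
      by (rule eventually_at_right_real) simp
    then have "\<forall>\<^sub>F t in at_right 0. (G (x + t *\<^sub>R ?z) - G x) / t \<le> G y - G x - m / 2 * (1 - t) * (norm ?z)\<^sup>2"
    proof eventually_elim
      case (elim t)
      have "x + t *\<^sub>R ?z = (1 - t) *\<^sub>R x + t *\<^sub>R y" by (simp add: algebra_simps)
      then have "G (x + t *\<^sub>R ?z) - G x \<le> t * (G y - G x - m / 2 * (1 - t) * (norm ?z)\<^sup>2)"
        using m(2)[of t x y] elim by (simp add: algebra_simps norm_minus_commute)
      then show ?case using elim by (simp add: field_simps)
    qed
    from tendsto_le[OF _ lim2 lim this] have "dderiv ?z G x \<le> G y - G x - m / 2 * (norm ?z)\<^sup>2" by simp
    then show ?thesis unfolding Grel_def grad_inner[OF G_diff] by simp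
  qed
  then show ?thesis using m(1) by (intro exI[of _ "m / 2"]) auto
qed

text \<open>Uniform convexity gives the quadratic part. For \<open>|F - F'| > 1\<close> the power \<open>p\<close> is bounded through the
  growth of \<open>G\<close> from below, as \<open>\<Xi>'\<close> ranges over a bounded set; for \<open>|F - F'| \<le> 1\<close> it is at most the
  square.\<close>

lemma Grel_coercive:
  assumes "M \<ge> 0"
  shows "\<exists>C>0. \<forall>\<Xi> \<Xi>'. norm \<Xi>' \<le> M \<longrightarrow> G \<Xi>' \<le> M \<longrightarrow> norm (grad G \<Xi>') \<le> M \<longrightarrow>
    (norm (\<Xi> - \<Xi>'))\<^sup>2 + norm (fst \<Xi> - fst \<Xi>') powr p \<le> C * Grel \<Xi> \<Xi>'"
proof -
  obtain m where m: "m > 0" "\<And>\<Xi> \<Xi>'. Grel \<Xi> \<Xi>' \<ge> m * (norm (\<Xi> - \<Xi>'))\<^sup>2"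
    using Grel_ge by blast
  have c: "c1 > 0" "c4 > 0" and lower: "\<And>\<Xi>. G \<Xi> \<ge> c1 * norm (fst \<Xi>) powr p - c4"
  proof -
    show "c1 > 0" "c4 > 0" using H2 by (simp_all add: H2_def)
    have h: "c2 > 0" "c3 > 0" "\<And>F Z w. G (F, Z, w) \<ge> c1 * norm F powr p + c2 * (norm Z)\<^sup>2 + c3 * \<bar>w\<bar>\<^sup>2 - c4"
      using H2 by (simp_all add: H2_def)
    show "G \<Xi> \<ge> c1 * norm (fst \<Xi>) powr p - c4" for \<Xi>
    proof (cases \<Xi>)
      case (fields F Z w)
      have "c2 * (norm Z)\<^sup>2 + c3 * \<bar>w\<bar>\<^sup>2 \<ge> 0" using h by simp
      then show ?thesis using h(3)[of F Z w] fields by simp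
    qed
  qed
  define D where "D = 2 powr p * ((1 + (c4 + 2 * M) / m) / c1 + M powr p / m)"
  have Dpos: "D \<ge> 0" unfolding D_def using c m(1) assms by (intro mult_nonneg_nonneg add_nonneg_nonneg divide_nonneg_nonneg) auto
  have main: "norm (fst \<Xi> - fst \<Xi>') powr p \<le> (1 / m + D) * Grel \<Xi> \<Xi>'"
    if b: "norm \<Xi>' \<le> M" "G \<Xi>' \<le> M" "norm (grad G \<Xi>') \<le> M" for \<Xi> \<Xi>'
  proof -
    let ?z = "\<Xi> - \<Xi>'" and ?N = "Grel \<Xi> \<Xi>'"
    have zN: "(norm ?z)\<^sup>2 \<le> ?N / m" using m(2)[of \<Xi> \<Xi>'] m(1) by (simp add: field_simps)
    have Npos: "?N \<ge> 0" using order_trans[OF _ m(2)[of \<Xi> \<Xi>']] m(1) by simp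
    have fz: "norm (fst \<Xi> - fst \<Xi>') \<le> norm ?z" using norm_fst[of ?z] by simp
    show ?thesis
    proof (cases "norm (fst \<Xi> - fst \<Xi>') \<le> 1")
      case True
      have "norm (fst \<Xi> - fst \<Xi>') powr p \<le> (norm (fst \<Xi> - fst \<Xi>'))\<^sup>2"
      proof (cases "norm (fst \<Xi> - fst \<Xi>') = 0")
        case False
        then have "norm (fst \<Xi> - fst \<Xi>') powr p \<le> norm (fst \<Xi> - fst \<Xi>') powr 2"
          using True p6 by (intro powr_mono') auto
        then show ?thesis using False by (simp add: powr_numeral)
      qed simp
      also have "\<dots> \<le> (norm ?z)\<^sup>2" using fz by (intro power_mono) auto
      also have "\<dots> \<le> ?N / m" by (rule zN)
      also have "\<dots> \<le> (1 / m + D) * ?N" using Dpos Npos by (simp add: distrib_right)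
      finally show ?thesis .
    next
      case False
      then have z1: "norm ?z \<ge> 1" using fz by linarith
      have z2: "norm ?z \<le> (norm ?z)\<^sup>2" using mult_left_mono[OF z1, of "norm ?z"] by (simp add: power2_eq_square)
      have one: "1 \<le> ?N / m" and z3: "norm ?z \<le> ?N / m" using z1 z2 zN by linarith+
      have "c1 * norm (fst \<Xi>) powr p \<le> G \<Xi> + c4" using lower[of \<Xi>] by linarith
      also have "\<dots> = ?N + G \<Xi>' + grad G \<Xi>' \<bullet> ?z + c4" by (simp add: Grel_def)
      also have "\<dots> \<le> ?N + M + M * norm ?z + c4"
      proof -
        have "grad G \<Xi>' \<bullet> ?z \<le> norm (grad G \<Xi>') * norm ?z" by (rule norm_cauchy_schwarz)
        also have "\<dots> \<le> M * norm ?z" using b by (intro mult_right_mono) auto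
        finally show ?thesis using b by linarith
      qed
      also have "\<dots> \<le> ?N + M * (?N / m) + M * (?N / m) + c4 * (?N / m)"
        using mult_left_mono[OF one, of M] mult_left_mono[OF z3, of M] mult_left_mono[OF one, of c4] assms c by simp
      also have "\<dots> = (1 + (c4 + 2 * M) / m) * ?N" using m(1) by (simp add: field_simps)
      finally have Fp: "norm (fst \<Xi>) powr p \<le> (1 + (c4 + 2 * M) / m) / c1 * ?N" using c by (simp add: field_simps)
      have "norm (fst \<Xi> - fst \<Xi>') \<le> norm (fst \<Xi>) + M"
        using norm_triangle_ineq4[of "fst \<Xi>" "fst \<Xi>'"] norm_fst[of "\<Xi>'"] b by simp
      then have "norm (fst \<Xi> - fst \<Xi>') powr p \<le> (norm (fst \<Xi>) + M) powr p"
        using p6 by (intro powr_mono2) auto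
      also have "\<dots> \<le> 2 powr p * (norm (fst \<Xi>) powr p + M powr p)"
        using assms p6 by (intro powr_sum_le) auto
      also have "\<dots> \<le> 2 powr p * ((1 + (c4 + 2 * M) / m) / c1 * ?N + M powr p * (?N / m))"
        using Fp mult_left_mono[OF one, of "M powr p"] by (intro mult_left_mono add_mono) auto
      also have "\<dots> = D * ?N" by (simp add: D_def algebra_simps)
      also have "\<dots> \<le> (1 / m + D) * ?N" using m(1) Npos by (intro mult_right_mono) auto
      finally show ?thesis .
    qed
  qed
  show ?thesis
  proof (intro exI[of _ "2 / m + D"] conjI allI impI)
    show "2 / m + D > 0" using m(1) Dpos by (intro add_pos_nonneg) auto
    fix \<Xi> \<Xi>' assume b: "norm \<Xi>' \<le> M" "G \<Xi>' \<le> M" "norm (grad G \<Xi>') \<le> M"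
    have "(norm (\<Xi> - \<Xi>'))\<^sup>2 \<le> 1 / m * Grel \<Xi> \<Xi>'" using m(2)[of \<Xi> \<Xi>'] m(1) by (simp add: field_simps)
    then show "(norm (\<Xi> - \<Xi>'))\<^sup>2 + norm (fst \<Xi> - fst \<Xi>') powr p \<le> (2 / m + D) * Grel \<Xi> \<Xi>'"
      using main[OF b, of \<Xi>] by (simp add: algebra_simps)
  qed
qed

lemma R_third: 
  assumes "a \<in> Basis" "b \<in> Basis" "d \<in> Basis"
  shows "\<bar>dderiv a (dderiv b (dderiv d R)) \<Xi>\<bar> \<le> c8"
  using H5 assms unfolding H5_def by blast

lemma H_third: 
  assumes "a \<in> Basis" "b \<in> Basis" "d \<in> Basis"
  shows "\<bar>dderiv a (dderiv b (dderiv d H)) F\<bar> \<le> c7 * norm F powr (p - 3)"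
  using H5 assms unfolding H5_def by blast

lemma c78: "c7 > 0" "c8 > 0" using H5 by (simp_all add: H5_def)

lemma fst_Basis: "a \<in> (Basis :: xi set) \<Longrightarrow> fst a \<in> Basis \<or> fst a = 0"
  by (auto simp: Basis_prod_def)

text \<open>The third derivatives of \<open>H\<close> grow like \<open>|F|^(p - 3)\<close>, so that the second order remainder is of size
  \<open>|y|\<^sup>2 + |y|^(p - 1)\<close> with \<open>y = F - F'\<close>.\<close>

lemma dG_taylor:
  assumes "M \<ge> 0"
  shows "\<exists>C>0. \<forall>\<Xi> \<Xi>'. norm \<Xi>' \<le> M \<longrightarrow>
    norm (grad G \<Xi> - grad G \<Xi>' - dderiv (\<Xi> - \<Xi>') (grad G) \<Xi>')
      \<le> C * ((norm (\<Xi> - \<Xi>'))\<^sup>2 + norm (fst \<Xi> - fst \<Xi>') powr p)"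
proof -
  define nR where "nR = (real DIM(xi))\<^sup>2 * c8"
  define nH where "nH = (real DIM(mat3))\<^sup>2 * (c7 * 2 powr (p - 3))"
  have nn: "nR \<ge> 0" "nH \<ge> 0" using c78 by (simp_all add: nR_def nH_def)
  define B where "B = nR + nH * (M powr (p - 3) + 1)"
  have Bpos: "B \<ge> 0" unfolding B_def using nn by (intro add_nonneg_nonneg mult_nonneg_nonneg) auto
  have comp: "\<bar>dderiv a G \<Xi> - dderiv a G \<Xi>' - dderiv (\<Xi> - \<Xi>') (dderiv a G) \<Xi>'\<bar>
      \<le> B * ((norm (\<Xi> - \<Xi>'))\<^sup>2 + norm (fst \<Xi> - fst \<Xi>') powr p)"
    if a: "a \<in> Basis" and b: "norm \<Xi>' \<le> M" for a \<Xi> \<Xi>'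
  proof -
    let ?z = "\<Xi> - \<Xi>'" and ?y = "fst \<Xi> - fst \<Xi>'"
    have fz: "norm ?y \<le> norm ?z" using norm_fst[of ?z] by simp
    have "\<bar>dderiv a R (\<Xi>' + ?z) - dderiv a R \<Xi>' - dderiv ?z (dderiv a R) \<Xi>'\<bar> \<le> (real DIM(xi))\<^sup>2 * c8 * (norm ?z)\<^sup>2"
      by (rule taylor2_bound[OF dR_C2]) (use R_third a in auto)
    then have TR: "\<bar>dderiv a R \<Xi> - dderiv a R \<Xi>' - dderiv ?z (dderiv a R) \<Xi>'\<bar> \<le> nR * (norm ?z)\<^sup>2"
      by (simp add: nR_def)
    have TH: "\<bar>dderiv (fst a) H (fst \<Xi>) - dderiv (fst a) H (fst \<Xi>') - dderiv ?y (dderiv (fst a) H) (fst \<Xi>')\<bar>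
       \<le> nH * (M powr (p - 3) + norm ?y powr (p - 3)) * (norm ?y)\<^sup>2"
    proof (cases "fst a \<in> Basis")
      case False
      then have "fst a = 0" using fst_Basis[OF a] by blast
      moreover have "dderiv 0 H = (\<lambda>_. 0)" using dderiv_scale[OF H_diff, of 0] by auto
      ultimately show ?thesis using nn by (simp add: dderiv_const)
    next
      case True
      have "\<bar>dderiv (fst a) H (fst \<Xi>' + ?y) - dderiv (fst a) H (fst \<Xi>') - dderiv ?y (dderiv (fst a) H) (fst \<Xi>')\<bar>
         \<le> (real DIM(mat3))\<^sup>2 * (c7 * (2 powr (p - 3) * (M powr (p - 3) + norm ?y powr (p - 3)))) * (norm ?y)\<^sup>2"
      proof (rule taylor2_bound[OF dH_C2])
        fix s :: real and d e :: mat3 assume s: "0 < s" "s < 1" and de: "d \<in> Basis" "e \<in> Basis"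
        have "norm (fst \<Xi>' + s *\<^sub>R ?y) \<le> norm (fst \<Xi>') + s * norm ?y"
          using norm_triangle_ineq[of "fst \<Xi>'" "s *\<^sub>R ?y"] s by simp
        also have "\<dots> \<le> M + 1 * norm ?y"
          using b norm_fst[of "\<Xi>'"] s by (intro add_mono mult_right_mono) auto
        finally have "norm (fst \<Xi>' + s *\<^sub>R ?y) powr (p - 3) \<le> (M + norm ?y) powr (p - 3)"
          using p6 by (intro powr_mono2) auto
        also have "\<dots> \<le> 2 powr (p - 3) * (M powr (p - 3) + norm ?y powr (p - 3))"
          using assms p6 by (intro powr_sum_le) auto
        finally have "c7 * norm (fst \<Xi>' + s *\<^sub>R ?y) powr (p - 3)
            \<le> c7 * (2 powr (p - 3) * (M powr (p - 3) + norm ?y powr (p - 3)))"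
          using c78 by (intro mult_left_mono) auto
        with H_third[OF de True] show "\<bar>dderiv d (dderiv e (dderiv (fst a) H)) (fst \<Xi>' + s *\<^sub>R ?y)\<bar>
            \<le> c7 * (2 powr (p - 3) * (M powr (p - 3) + norm ?y powr (p - 3)))"
          by (rule order_trans)
      qed
      then show ?thesis by (simp add: nH_def mult_ac)
    qed
    have yp: "norm ?y powr (p - 3) * (norm ?y)\<^sup>2 \<le> (norm ?y)\<^sup>2 + norm ?y powr p"
    proof (cases "norm ?y = 0")
      case False
      have "norm ?y powr (p - 3) * (norm ?y)\<^sup>2 = norm ?y powr (p - 3) * norm ?y powr 2"
        using False by (simp add: powr_numeral)
      also have "\<dots> = norm ?y powr ((p - 3) + 2)" by (simp only: powr_add)
      also have "\<dots> = norm ?y powr (p - 1)" by simp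
      also have "\<dots> \<le> (norm ?y)\<^sup>2 + norm ?y powr p" using p6 by (intro powr_between) auto
      finally show ?thesis .
    qed simp
    have y2: "(norm ?y)\<^sup>2 \<le> (norm ?z)\<^sup>2" using fz by (intro power_mono) auto
    have dd: "dderiv ?z (dderiv a G) \<Xi>' = dderiv ?y (dderiv (fst a) H) (fst \<Xi>') + dderiv ?z (dderiv a R) \<Xi>'"
    proof -
      have d: "dderiv (fst a) H differentiable (at y)" "dderiv a R differentiable (at x)" for x y
        using Ck_on_differentiable[OF dH_C2] Ck_on_differentiable[OF dR_C2] by auto
      have "((\<lambda>\<Xi>. dderiv (fst a) H (fst \<Xi>) + dderiv a R \<Xi>) has_derivative
          (\<lambda>u. dderiv (fst u) (dderiv (fst a) H) (fst \<Xi>') + dderiv u (dderiv a R) \<Xi>')) (at \<Xi>')"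
        by (intro has_derivative_add has_derivative_dderiv d
            has_derivative_compose[OF has_derivative_fst[OF has_derivative_ident] has_derivative_dderiv[OF d(1)]])
      from dderiv_eq[OF this, of ?z] show ?thesis by (simp add: dderiv_G[abs_def])
    qed
    have "\<bar>dderiv a G \<Xi> - dderiv a G \<Xi>' - dderiv ?z (dderiv a G) \<Xi>'\<bar>
      \<le> nR * (norm ?z)\<^sup>2 + nH * (M powr (p - 3) + norm ?y powr (p - 3)) * (norm ?y)\<^sup>2"
      using TR TH unfolding dd dderiv_G by linarith
    also have "\<dots> = nR * (norm ?z)\<^sup>2 + nH * (M powr (p - 3) * (norm ?y)\<^sup>2 + norm ?y powr (p - 3) * (norm ?y)\<^sup>2)"
      by (simp add: algebra_simps)
    also have "\<dots> \<le> nR * (norm ?z)\<^sup>2 + nH * (M powr (p - 3) * (norm ?z)\<^sup>2 + ((norm ?z)\<^sup>2 + norm ?y powr p))"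
    proof -
      have "norm ?y powr (p - 3) * (norm ?y)\<^sup>2 \<le> (norm ?z)\<^sup>2 + norm ?y powr p"
        using yp y2 by linarith
      then show ?thesis using nn y2 by (intro add_left_mono mult_left_mono add_mono) auto
    qed
    also have "\<dots> \<le> B * ((norm ?z)\<^sup>2 + norm ?y powr p)"
    proof -
      have "nH * norm ?y powr p \<le> B * norm ?y powr p"
      proof (rule mult_right_mono)
        have "nH * 1 \<le> nH * (M powr (p - 3) + 1)" using nn by (intro mult_left_mono) auto
        then show "nH \<le> B" unfolding B_def using nn by simp
      qed simp
      then show ?thesis by (simp add: B_def algebra_simps)
    qed
    finally show ?thesis .
  qed
  show ?thesis
  proof (intro exI[of _ "real DIM(xi) * B + 1"] conjI allI impI)
    show "real DIM(xi) * B + 1 > 0" using Bpos by (intro add_nonneg_pos) auto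
    fix \<Xi> \<Xi>' :: xi assume b: "norm \<Xi>' \<le> M"
    let ?v = "grad G \<Xi> - grad G \<Xi>' - dderiv (\<Xi> - \<Xi>') (grad G) \<Xi>'"
    let ?r = "(norm (\<Xi> - \<Xi>'))\<^sup>2 + norm (fst \<Xi> - fst \<Xi>') powr p"
    have d: "grad G differentiable (at x)" for x using Ck_on_differentiable[OF grad_G_C2] by auto
    have "?v \<bullet> a = dderiv a G \<Xi> - dderiv a G \<Xi>' - dderiv (\<Xi> - \<Xi>') (dderiv a G) \<Xi>'" if "a \<in> Basis" for a
    proof -
      have "(\<lambda>x. grad G x \<bullet> a) = dderiv a G" using grad_inner_Basis[OF that] by blast
      with dderiv_linear_compose[OF bounded_linear_inner_left d, of "\<Xi> - \<Xi>'" a "\<Xi>'"]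
      have "dderiv (\<Xi> - \<Xi>') (grad G) \<Xi>' \<bullet> a = dderiv (\<Xi> - \<Xi>') (dderiv a G) \<Xi>'" by (simp only:)
      then show ?thesis by (simp only: inner_diff_left grad_inner_Basis[OF that])
    qed
    note va = this
    have "norm ?v \<le> (\<Sum>a\<in>(Basis :: xi set). B * ?r)"
    proof (intro order_trans[OF norm_le_l1 sum_mono])
      fix a :: xi assume a: "a \<in> Basis"
      show "\<bar>?v \<bullet> a\<bar> \<le> B * ?r" unfolding va[OF a] by (rule comp[OF a b])
    qed
    also have "\<dots> = (real DIM(xi) * B) * ?r" by simp
    also have "\<dots> \<le> (real DIM(xi) * B + 1) * ?r" by (intro mult_right_mono) auto
    finally show "norm ?v \<le> (real DIM(xi) * B + 1) * ?r" .
  qed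
qed

lemma hess_R: "hess_form R \<Xi> z = dderiv z (dderiv z R) \<Xi>"
proof -
  have C: "dderiv b R differentiable (at y)" for y b
    using Ck_on_differentiable[OF dR_C2] by auto
  show ?thesis
    unfolding hess_form_def dderiv_dderiv_sum[OF R_C2, of z z]
    by (subst sum.swap, rule sum.cong[OF refl])
      (simp add: dderiv_Basis_sum[OF C, of z] sum_distrib_left mult_ac)
qed

text \<open>The bounds on the quadratic form give bounds on the off-diagonal entries by polarisation.\<close>

lemma R_second:
  assumes "a \<in> Basis" "b \<in> Basis"
  shows "\<bar>dderiv a (dderiv b R) \<Xi>\<bar> \<le> \<gamma>'"
proof -
  have h: "0 \<le> hess_form R \<Xi> z" "hess_form R \<Xi> z \<le> \<gamma>' * (norm z)\<^sup>2" for z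
  proof -
    have "\<gamma> > 0" "\<gamma> * (norm z)\<^sup>2 \<le> hess_form R \<Xi> z" using H1 unfolding H1_def by blast+
    moreover have "\<gamma> * (norm z)\<^sup>2 \<ge> 0" using calculation(1) by simp
    ultimately show "0 \<le> hess_form R \<Xi> z" by linarith
    show "hess_form R \<Xi> z \<le> \<gamma>' * (norm z)\<^sup>2" using H1 unfolding H1_def by blast
  qed
  have diag: "0 \<le> dderiv a (dderiv a R) \<Xi> \<and> dderiv a (dderiv a R) \<Xi> \<le> \<gamma>'" if "a \<in> Basis" for a
    using h[of a] that by (simp add: hess_R)
  show ?thesis
  proof (cases "a = b")
    case True
    then show ?thesis using diag[OF assms(1)] by simp
  next
    case False
    have C: "dderiv u R differentiable (at y)" for y u
      using Ck_on_differentiable[OF dR_C2] by auto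
    have add: "dderiv (u + w) f x = dderiv u f x + dderiv w f x" if "f differentiable (at x)" for f :: "xi \<Rightarrow> real" and u w x
      using linear_frechet_derivative[OF that] by (simp add: dderiv_def linear_add)
    have "dderiv (a + b) R = (\<lambda>x. dderiv a R x + dderiv b R x)"
      by (rule ext) (rule add[OF R_diff])
    then have "dderiv (a + b) (dderiv (a + b) R) \<Xi> = dderiv (a + b) (dderiv a R) \<Xi> + dderiv (a + b) (dderiv b R) \<Xi>"
      using dderiv_add[OF C C] by simp
    also have "\<dots> = dderiv a (dderiv a R) \<Xi> + dderiv b (dderiv a R) \<Xi> + (dderiv a (dderiv b R) \<Xi> + dderiv b (dderiv b R) \<Xi>)"
      by (simp add: add[OF C])
    also have "dderiv b (dderiv a R) \<Xi> = dderiv a (dderiv b R) \<Xi>"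
      by (rule dderiv_commute[OF open_UNIV UNIV_I R_C2])
    finally have "hess_form R \<Xi> (a + b) = dderiv a (dderiv a R) \<Xi> + 2 * dderiv a (dderiv b R) \<Xi> + dderiv b (dderiv b R) \<Xi>"
      by (simp add: hess_R)
    moreover have "(norm (a + b))\<^sup>2 = 2"
      using assms False by (simp add: power2_norm_eq_inner inner_add_left inner_add_right inner_Basis)
    ultimately have "0 \<le> dderiv a (dderiv a R) \<Xi> + 2 * dderiv a (dderiv b R) \<Xi> + dderiv b (dderiv b R) \<Xi>"
      "dderiv a (dderiv a R) \<Xi> + 2 * dderiv a (dderiv b R) \<Xi> + dderiv b (dderiv b R) \<Xi> \<le> \<gamma>' * 2"
      using h[of "a + b"] by simp_all
    then show ?thesis
      using conjunct1[OF diag[OF assms(1)]] conjunct2[OF diag[OF assms(1)]]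
        conjunct1[OF diag[OF assms(2)]] conjunct2[OF diag[OF assms(2)]] by linarith
  qed
qed

text \<open>The components of \<open>grad G\<close> belonging to \<open>Z\<close> and \<open>w\<close> are those of \<open>grad R\<close>, as \<open>H\<close> depends on \<open>F\<close> only.\<close>

lemma dG_lipschitz:
  "\<exists>C>0. \<forall>\<Xi> \<Xi>'. norm (snd (grad G \<Xi> - grad G \<Xi>')) \<le> C * norm (\<Xi> - \<Xi>')"
proof -
  have g': "\<gamma>' > 0" using H1 by (simp add: H1_def)
  let ?D = "real DIM(xi) * \<gamma>'"
  have comp: "\<bar>(grad G \<Xi> - grad G \<Xi>') \<bullet> a\<bar> \<le> ?D * norm (\<Xi> - \<Xi>')"
    if a: "a \<in> Basis" "fst a = 0" for a \<Xi> \<Xi>'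
  proof -
    let ?z = "\<Xi> - \<Xi>'"
    have C: "dderiv a R differentiable (at y)" for y
      using Ck_on_differentiable[OF dR_C2] by auto
    have z0: "dderiv 0 H y = 0" for y using dderiv_scale[OF H_diff, of 0] by auto
    have "(grad G \<Xi> - grad G \<Xi>') \<bullet> a = dderiv a R (\<Xi>' + ?z) - dderiv a R \<Xi>'"
      using a by (simp add: inner_diff_left grad_inner_Basis dderiv_G z0)
    moreover obtain s where "dderiv a R (\<Xi>' + ?z) - dderiv a R \<Xi>' = dderiv ?z (dderiv a R) (\<Xi>' + s *\<^sub>R ?z)"
      using dderiv_mvt[OF C] by blast
    moreover have "\<bar>dderiv ?z (dderiv a R) y\<bar> \<le> ?D * norm ?z" for y
    proof -
      have "\<bar>dderiv ?z (dderiv a R) y\<bar> \<le> (\<Sum>b\<in>(Basis :: xi set). norm ?z * \<gamma>')"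
        unfolding dderiv_Basis_sum[OF C, of ?z]
      proof (rule order_trans[OF sum_abs], rule sum_mono)
        fix b :: xi assume "b \<in> Basis"
        then show "\<bar>(?z \<bullet> b) *\<^sub>R dderiv b (dderiv a R) y\<bar> \<le> norm ?z * \<gamma>'"
          unfolding real_scaleR_def abs_mult by (intro mult_mono Basis_le_norm R_second a(1)) auto
      qed
      then show ?thesis by (simp add: mult_ac)
    qed
    ultimately show ?thesis by simp
  qed
  show ?thesis
  proof (intro exI[of _ "real DIM(mat3 \<times> real) * ?D"] conjI allI)
    show "real DIM(mat3 \<times> real) * ?D > 0" using g' by simp
    fix \<Xi> \<Xi>' :: xi
    have "\<bar>snd (grad G \<Xi> - grad G \<Xi>') \<bullet> b\<bar> \<le> ?D * norm (\<Xi> - \<Xi>')" if "b \<in> Basis" for b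
    proof -
      have "(0::mat3, b) \<in> Basis" using that unfolding Basis_prod_def[where 'a = mat3 and 'b = "mat3 \<times> real"] by blast
      from comp[OF this, of \<Xi> \<Xi>'] show ?thesis by (simp add: inner_prod_def[where 'a = mat3 and 'b = "mat3 \<times> real"])
    qed
    then have "norm (snd (grad G \<Xi> - grad G \<Xi>')) \<le> (\<Sum>b\<in>(Basis :: (mat3 \<times> real) set). ?D * norm (\<Xi> - \<Xi>'))"
      by (intro order_trans[OF norm_le_l1 sum_mono])
    then show "norm (snd (grad G \<Xi> - grad G \<Xi>')) \<le> real DIM(mat3 \<times> real) * ?D * norm (\<Xi> - \<Xi>')"
      by simp
  qed
qed

end

section \<open>The smooth solution\<close>

lemma DPhi_expand: "DPhi F A = (\<Sum>i\<in>UNIV. \<Sum>\<alpha>\<in>UNIV. A $ i $ \<alpha> *\<^sub>R dPhi F i \<alpha>)"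
proof -
  interpret bounded_linear "DPhi F" by (rule bounded_linear_DPhi)
  have "A = (\<Sum>i\<in>UNIV. \<Sum>\<alpha>\<in>UNIV. A $ i $ \<alpha> *\<^sub>R axis i (axis \<alpha> 1))"
    by (simp add: vec_eq_iff sum_3 forall_3 axis_def)
  then have "DPhi F A = DPhi F (\<Sum>i\<in>UNIV. \<Sum>\<alpha>\<in>UNIV. A $ i $ \<alpha> *\<^sub>R axis i (axis \<alpha> 1))" by simp
  also have "\<dots> = (\<Sum>i\<in>UNIV. \<Sum>\<alpha>\<in>UNIV. A $ i $ \<alpha> *\<^sub>R dPhi F i \<alpha>)"
    by (simp only: sum scaleR dPhi_eq)
  finally show ?thesis .
qed

text \<open>The Piola identity: along gradient fields the derivatives of the minors are solenoidal.\<close>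

lemma div_dPhi:
  assumes F: "Ck_on 1 UNIV F" "\<And>j. curl_free (\<lambda>x. F x $ j)"
  shows "(\<Sum>\<alpha>\<in>UNIV. partial \<alpha> (\<lambda>y. m \<bullet> dPhi (F y) i \<alpha>) x) = 0"
proof -
  obtain a b c where m: "m = (a, b, c)" by (cases m)
  have Fc: "Ck_on 1 UNIV (\<lambda>x. F x $ j)" for j by (rule Ck_on_nth[OF open_UNIV F(1)])
  have kc: "Ck_on 1 UNIV (\<lambda>x::vec3. d)" for d :: vec3 by (rule Ck_on_const)
  let ?Y1 = "\<lambda>y. cross3 (b $ (i + 1)) (F y $ (i + 2))" and ?Y2 = "\<lambda>y. cross3 (F y $ (i + 1)) (b $ (i + 2))"
    and ?Y3 = "\<lambda>y. cross3 (F y $ (i + 1)) (F y $ (i + 2))"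
  have Y: "Ck_on 1 UNIV ?Y1" "Ck_on 1 UNIV ?Y2" "Ck_on 1 UNIV ?Y3"
    by (intro cross.Ck_on_prod[OF open_UNIV] Fc kc)+
  have Yd: "(\<lambda>y. ?Y1 y $ \<alpha>) differentiable (at x)" "(\<lambda>y. ?Y2 y $ \<alpha>) differentiable (at x)"
     "(\<lambda>y. ?Y3 y $ \<alpha>) differentiable (at x)" for \<alpha>
    using Ck_on_nth[OF open_UNIV Y(1), of \<alpha>] Ck_on_nth[OF open_UNIV Y(2), of \<alpha>] Ck_on_nth[OF open_UNIV Y(3), of \<alpha>]
    by (auto simp del: cross_components)
  have tri: "s \<bullet> cross3 (axis \<alpha> 1) u = cross3 u s $ \<alpha>" "s \<bullet> cross3 u (axis \<alpha> 1) = cross3 s u $ \<alpha>"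
    "axis \<alpha> 1 \<bullet> s = s $ \<alpha>" for s u :: vec3 and \<alpha>
    using exhaust_3[of \<alpha>]
    by (auto simp: cross3_def inner_vec_def sum_3 axis_def algebra_simps)
  have "m \<bullet> dPhi (F y) i \<alpha> = a $ i $ \<alpha> + ((?Y1 y $ \<alpha> + ?Y2 y $ \<alpha>) + c * ?Y3 y $ \<alpha>)" for y \<alpha>
    unfolding m dPhi_eq inner_DPhi_row by (simp add: tri inner_axis)
  then have "partial \<alpha> (\<lambda>y. m \<bullet> dPhi (F y) i \<alpha>) x
     = partial \<alpha> (\<lambda>y. ?Y1 y $ \<alpha>) x + partial \<alpha> (\<lambda>y. ?Y2 y $ \<alpha>) x + c * partial \<alpha> (\<lambda>y. ?Y3 y $ \<alpha>) x" for \<alpha>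
  proof -
    have "((\<lambda>y. a $ i $ \<alpha> + ((?Y1 y $ \<alpha> + ?Y2 y $ \<alpha>) + c * ?Y3 y $ \<alpha>)) has_derivative
      (\<lambda>u. 0 + ((dderiv u (\<lambda>y. ?Y1 y $ \<alpha>) x + dderiv u (\<lambda>y. ?Y2 y $ \<alpha>) x) + c * dderiv u (\<lambda>y. ?Y3 y $ \<alpha>) x))) (at x)"
      by (intro has_derivative_add has_derivative_mult_right has_derivative_dderiv has_derivative_const Yd)
    from dderiv_eq[OF this, of "axis \<alpha> 1"] show ?thesis
      using \<open>\<And>y \<alpha>. m \<bullet> dPhi (F y) i \<alpha> = _ y \<alpha>\<close> by simp
  qed
  then have "(\<Sum>\<alpha>\<in>UNIV. partial \<alpha> (\<lambda>y. m \<bullet> dPhi (F y) i \<alpha>) x) = divv ?Y1 x + divv ?Y2 x + c * divv ?Y3 x"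
    by (simp add: divv_def sum.distrib sum_distrib_left)
  also have "\<dots> = 0"
    using divv_cross[OF kc Fc curl_free_const F(2)] divv_cross[OF Fc kc F(2) curl_free_const]
      divv_cross[OF Fc Fc F(2) F(2)] by simp
  finally show ?thesis .
qed

lemma time_derivative:
  fixes f :: "real \<times> vec3 \<Rightarrow> 'b::real_normed_vector"
  assumes "f differentiable (at (t, x))"
  shows "((\<lambda>s. f (s, x)) has_vector_derivative dderiv (1, 0) f (t, x)) (at t within S)"
proof -
  have "(t, x) = (0, x) + t *\<^sub>R (1, 0)" by simp
  then have "((\<lambda>s. f ((0, x) + s *\<^sub>R (1, 0))) has_vector_derivative dderiv (1, 0) f ((0, x) + t *\<^sub>R (1, 0))) (at t within S)"
    using assms by (intro dderiv_line) simp
  then show ?thesis by simp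
qed

text \<open>The functions \<open>Vb\<close> and \<open>Fb\<close> of time and space are smooth on a neighbourhood \<open>U\<close> of
  \<open>[0,T] \<times> \<real>^3\<close>; they solve the equations on \<open>[0,T]\<close> only. Points of time and space are pairs \<open>(t, x)\<close>.\<close>

locale smooth_flow = stored_energy +
  fixes T :: real and U :: "(real \<times> vec3) set" and Vb :: "real \<times> vec3 \<Rightarrow> vec3" and Fb :: "real \<times> vec3 \<Rightarrow> mat3"
  assumes T_pos: "T > 0" and U_open: "open U" and U_sub: "{0..T} \<times> UNIV \<subseteq> U"
    and Vb_smooth: "\<And>k. Ck_on k U Vb" and Fb_smooth: "\<And>k. Ck_on k U Fb"
    and Vb_periodic: "\<And>t. t \<in> {0..T} \<Longrightarrow> periodic (\<lambda>x. Vb (t, x))"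
    and Fb_periodic: "\<And>t. t \<in> {0..T} \<Longrightarrow> periodic (\<lambda>x. Fb (t, x))"
    and momentum_eq: "\<And>t x i. t \<in> {0..T} \<Longrightarrow> dderiv (1, 0) Vb (t, x) $ i =
       (\<Sum>\<alpha>\<in>UNIV. partial \<alpha> (\<lambda>y. grad G (Phi (Fb (t, y))) \<bullet> dPhi (Fb (t, y)) i \<alpha>) x)"
    and kinematic_eq: "\<And>t x i \<alpha>. t \<in> {0..T} \<Longrightarrow>
       dderiv (1, 0) Fb (t, x) $ i $ \<alpha> = partial \<alpha> (\<lambda>y. Vb (t, y) $ i) x"
    and curl_free_0: "\<And>i. curl_free (\<lambda>x. Fb (0, x) $ i)"
begin

text \<open>The smooth solution in the variables \<open>\<Xi>\<close>, and the derivative of \<open>G\<close> along it.\<close>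

definition Xb :: "real \<times> vec3 \<Rightarrow> xi" where "Xb z = Phi (Fb z)"

definition gb :: "real \<times> vec3 \<Rightarrow> xi" where "gb z = grad G (Xb z)"

lemma in_U: "t \<in> {0..T} \<Longrightarrow> (t, x) \<in> U" using U_sub by auto

lemma Xb_smooth: "Ck_on k U Xb"
  unfolding Xb_def[abs_def] by (rule Ck_on_compose[OF U_open Ck_on_Phi Fb_smooth]) simp

lemma gb_C2: "Ck_on 2 U gb"
  unfolding gb_def[abs_def] by (rule Ck_on_compose[OF U_open grad_G_C2 Xb_smooth]) simp

lemma fst_Xb [simp]: "fst (Xb z) = Fb z" by (simp add: Xb_def Phi_def)

lemma slab_bounded:
  fixes f :: "real \<times> vec3 \<Rightarrow> 'b::real_normed_vector"
  assumes "continuous_on U f"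
  shows "\<exists>M>0. \<forall>t\<in>{0..T}. \<forall>x\<in>cbox 0 1. norm (f (t, x)) \<le> M"
proof -
  have "compact ({0..T} \<times> (cbox 0 1 :: vec3 set))" by (intro compact_Times compact_Icc compact_cbox)
  moreover have "continuous_on ({0..T} \<times> cbox 0 1) f"
    by (rule continuous_on_subset[OF assms]) (use U_sub in auto)
  ultimately have "bounded (f ` ({0..T} \<times> cbox 0 1))"
    by (intro compact_imp_bounded compact_continuous_image)
  then obtain M where "M > 0" "\<forall>y\<in>f ` ({0..T} \<times> cbox 0 1). norm y \<le> M"
    unfolding bounded_pos by blast
  then show ?thesis by blast
qed

lemma Ck_on_slice:
  fixes f :: "real \<times> vec3 \<Rightarrow> 'b::real_normed_vector"
  assumes "t \<in> {0..T}" "Ck_on k U f"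
  shows "Ck_on k UNIV (\<lambda>x. f (t, x))"
proof (rule Ck_on_compose[OF open_UNIV assms(2)])
  show "Ck_on k UNIV (\<lambda>x::vec3. (t, x))"
    by (intro Ck_on_Pair[OF open_UNIV Ck_on_const] Ck_on_linear[OF bounded_linear_ident])
  show "range (\<lambda>x::vec3. (t, x)) \<subseteq> U" using in_U[OF assms(1)] by auto
qed

lemma dderiv_slice:
  assumes "f differentiable (at (t, x))"
  shows "dderiv u (\<lambda>x. f (t, x)) x = dderiv (0, u) f (t, x)"
proof -
  have "((\<lambda>x. (t, x)) has_derivative (\<lambda>u. (0, u))) (at x)"
    by (intro has_derivative_Pair has_derivative_const has_derivative_ident)
  from dderiv_eq[OF has_derivative_compose[OF this has_derivative_dderiv[OF assms]]] show ?thesis .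
qed

lemma time_taylor_real:
  fixes f :: "real \<times> vec3 \<Rightarrow> real"
  assumes "Ck_on 2 U f"
  shows "\<exists>K\<ge>0. \<forall>t h x. 0 \<le> t \<longrightarrow> 0 \<le> h \<longrightarrow> t + h \<le> T \<longrightarrow> x \<in> cbox 0 1 \<longrightarrow>
    \<bar>f (t + h, x) - f (t, x) - h * dderiv (1, 0) f (t, x)\<bar> \<le> K * h\<^sup>2"
proof -
  let ?e = "(1, 0) :: real \<times> vec3"
  have C: "f differentiable (at z)" "dderiv ?e f differentiable (at z)" if "z \<in> U" for z
    using assms that by (auto simp: numeral_2_eq_2)
  have "continuous_on U (dderiv ?e (dderiv ?e f))" using assms by (auto simp: numeral_2_eq_2)
  then obtain M where M: "M > 0" "\<And>t x. t \<in> {0..T} \<Longrightarrow> x \<in> cbox 0 1 \<Longrightarrow> norm (dderiv ?e (dderiv ?e f) (t, x)) \<le> M"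
    using slab_bounded by blast
  have "\<bar>f (t + h, x) - f (t, x) - h * dderiv ?e f (t, x)\<bar> \<le> M * h\<^sup>2"
    if t: "0 \<le> t" "0 \<le> h" "t + h \<le> T" "x \<in> cbox 0 1" for t h x
  proof (cases "h = 0")
    case False
    then have h: "h > 0" using t by simp
    define d where "d m s = (if m = 0 then f (t + s, x) else if m = 1 then dderiv ?e f (t + s, x)
      else dderiv ?e (dderiv ?e f) (t + s, x))" for m :: nat and s
    have sh: "((\<lambda>s. g (t + s, x)) has_real_derivative dderiv ?e g (t + s, x)) (at s)"
      if g: "g differentiable (at (t + s, x))" for g s
    proof -
      have "((\<lambda>s. g (s, x)) has_real_derivative dderiv ?e g (s + t, x)) (at (s + t))"
        using time_derivative[of g "s + t" x UNIV] g
        by (simp add: has_real_derivative_iff_has_vector_derivative add.commute)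
      then show ?thesis unfolding DERIV_shift by (simp add: add.commute)
    qed
    have der: "DERIV (d m) s :> d (Suc m) s" if "m < 2 \<and> 0 \<le> s \<and> s \<le> h" for m s
    proof -
      have "(t + s, x) \<in> U" using that t by (intro in_U) auto
      then show ?thesis using that sh[OF C(1), of s] sh[OF C(2), of s]
        by (cases m) (auto simp: d_def[abs_def])
    qed
    have "\<exists>s>0. s < h \<and> d 0 h = (\<Sum>m<2. d m 0 / fact m * h ^ m) + d 2 s / fact 2 * h ^ 2"
      by (rule Maclaurin[OF h]) (use der in auto)
    then obtain s where s: "0 < s" "s < h" "f (t + h, x) = f (t, x) + dderiv ?e f (t, x) * h + dderiv ?e (dderiv ?e f) (t + s, x) / 2 * h\<^sup>2"
      by (auto simp: d_def numeral_2_eq_2)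
    then have "\<bar>f (t + h, x) - f (t, x) - h * dderiv ?e f (t, x)\<bar> = \<bar>dderiv ?e (dderiv ?e f) (t + s, x)\<bar> / 2 * h\<^sup>2"
      by (simp add: abs_mult)
    also have "\<dots> \<le> M * h\<^sup>2"
      using M(2)[of "t + s" x] M(1) s(1,2) t by (intro mult_right_mono) auto
    finally show ?thesis .
  qed simp
  then show ?thesis using M(1) by (intro exI[of _ M]) auto
qed

lemma time_taylor:
  fixes f :: "real \<times> vec3 \<Rightarrow> 'b::euclidean_space"
  assumes "Ck_on 2 U f"
  shows "\<exists>K\<ge>0. \<forall>t h x. 0 \<le> t \<longrightarrow> 0 \<le> h \<longrightarrow> t + h \<le> T \<longrightarrow> x \<in> cbox 0 1 \<longrightarrow>
    norm (f (t + h, x) - f (t, x) - h *\<^sub>R dderiv (1, 0) f (t, x)) \<le> K * h\<^sup>2"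
proof -
  have C: "Ck_on 2 U (\<lambda>z. f z \<bullet> b)" for b
    by (rule Ck_on_linear_compose[OF U_open bounded_linear_inner_left assms])
  have "\<forall>b. \<exists>K\<ge>0. \<forall>t h x. 0 \<le> t \<longrightarrow> 0 \<le> h \<longrightarrow> t + h \<le> T \<longrightarrow> x \<in> cbox 0 1 \<longrightarrow>
    \<bar>f (t + h, x) \<bullet> b - f (t, x) \<bullet> b - h * dderiv (1, 0) (\<lambda>z. f z \<bullet> b) (t, x)\<bar> \<le> K * h\<^sup>2"
    using time_taylor_real[OF C] by blast
  then obtain K where K: "\<And>b. K b \<ge> 0" "\<And>b t h x. 0 \<le> t \<Longrightarrow> 0 \<le> h \<Longrightarrow> t + h \<le> T \<Longrightarrow> x \<in> cbox 0 1 \<Longrightarrow>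
    \<bar>f (t + h, x) \<bullet> b - f (t, x) \<bullet> b - h * dderiv (1, 0) (\<lambda>z. f z \<bullet> b) (t, x)\<bar> \<le> K b * h\<^sup>2"
    by metis
  show ?thesis
  proof (intro exI[of _ "\<Sum>b\<in>Basis. K b"] conjI allI impI)
    show "(\<Sum>b\<in>Basis. K b) \<ge> 0" by (intro sum_nonneg K)
    fix t h x assume t: "0 \<le> t" "0 \<le> h" "t + h \<le> T" "x \<in> (cbox 0 1 :: vec3 set)"
    have "(t, x) \<in> U" using t by (intro in_U) auto
    then have "f differentiable (at (t, x))" using assms by (auto simp: numeral_2_eq_2)
    then have d: "dderiv (1, 0) (\<lambda>z. f z \<bullet> b) (t, x) = dderiv (1, 0) f (t, x) \<bullet> b" for b
      by (rule dderiv_linear_compose[OF bounded_linear_inner_left])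
    have "norm (f (t + h, x) - f (t, x) - h *\<^sub>R dderiv (1, 0) f (t, x))
       \<le> (\<Sum>b\<in>Basis. \<bar>(f (t + h, x) - f (t, x) - h *\<^sub>R dderiv (1, 0) f (t, x)) \<bullet> b\<bar>)"
      by (rule norm_le_l1)
    also have "\<dots> \<le> (\<Sum>b\<in>Basis. K b * h\<^sup>2)"
      using K(2)[OF t] by (intro sum_mono) (simp add: inner_diff_left d)
    finally show "norm (f (t + h, x) - f (t, x) - h *\<^sub>R dderiv (1, 0) f (t, x)) \<le> (\<Sum>b\<in>Basis. K b) * h\<^sup>2"
      by (simp add: sum_distrib_right)
  qed
qed

lemma time_lipschitz:
  fixes f :: "real \<times> vec3 \<Rightarrow> 'b::euclidean_space"
  assumes "Ck_on 2 U f"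
  shows "\<exists>K\<ge>0. \<forall>t h x. 0 \<le> t \<longrightarrow> 0 \<le> h \<longrightarrow> t + h \<le> T \<longrightarrow> x \<in> cbox 0 1 \<longrightarrow>
    norm (f (t + h, x) - f (t, x)) \<le> K * h"
proof -
  obtain K where K: "K \<ge> 0" "\<And>t h x. 0 \<le> t \<Longrightarrow> 0 \<le> h \<Longrightarrow> t + h \<le> T \<Longrightarrow> x \<in> cbox 0 1 \<Longrightarrow>
    norm (f (t + h, x) - f (t, x) - h *\<^sub>R dderiv (1, 0) f (t, x)) \<le> K * h\<^sup>2"
    using time_taylor[OF assms] by blast
  have "continuous_on U (dderiv (1, 0) f)" 
    using Ck_on_continuous[of 1] assms by (auto simp: numeral_2_eq_2 intro!: continuous_at_imp_continuous_on differentiable_imp_continuous_within)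
  then obtain M where M: "M > 0" "\<And>t x. t \<in> {0..T} \<Longrightarrow> x \<in> cbox 0 1 \<Longrightarrow> norm (dderiv (1, 0) f (t, x)) \<le> M"
    using slab_bounded by blast
  have "norm (f (t + h, x) - f (t, x)) \<le> (K * T + M) * h"
    if t: "0 \<le> t" "0 \<le> h" "t + h \<le> T" "x \<in> cbox 0 1" for t h x
  proof -
    have "norm (f (t + h, x) - f (t, x)) \<le> K * h\<^sup>2 + norm (h *\<^sub>R dderiv (1, 0) f (t, x))"
      using K(2)[OF t] norm_triangle_ineq2[of "f (t + h, x) - f (t, x)" "h *\<^sub>R dderiv (1, 0) f (t, x)"] by linarith
    also have "\<dots> \<le> K * (h * T) + h * M"
    proof (rule add_mono)
      show "K * h\<^sup>2 \<le> K * (h * T)" using K(1) t by (intro mult_left_mono) (auto simp: power2_eq_square intro!: mult_left_mono)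
      show "norm (h *\<^sub>R dderiv (1, 0) f (t, x)) \<le> h * M" using M(2)[of t x] t by (simp add: mult_left_mono)
    qed
    finally show ?thesis by (simp add: algebra_simps)
  qed
  then show ?thesis using K(1) M(1) T_pos by (intro exI[of _ "K * T + M"]) auto
qed

text \<open>The time derivative of \<open>Fb\<close> is a spatial gradient, so the curl of \<open>Fb\<close> does not depend on time.\<close>

lemma curl_free_Fb:
  assumes "t \<in> {0..T}"
  shows "curl_free (\<lambda>x. Fb (t, x) $ i)"
  unfolding curl_free_def
proof (intro allI)
  fix x \<alpha> \<beta>
  have C: "Ck_on k U (\<lambda>z. Fb z $ i $ \<alpha>)" for k \<alpha>
    by (intro Ck_on_nth[OF U_open] Fb_smooth)
  have diff: "(\<lambda>z. Fb z $ i $ \<alpha>) differentiable (at z)" "dderiv u (\<lambda>z. Fb z $ i $ \<alpha>) differentiable (at z)" if "z \<in> U" for z \<alpha> u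
    by (rule Ck_on_differentiable[OF C[of 1] _ that] Ck_on_differentiable[OF Ck_on_dderiv[OF C[of "Suc 1"]] _ that], simp)+
  let ?f = "\<lambda>\<alpha> \<beta> s. dderiv (0, axis \<beta> 1) (\<lambda>z. Fb z $ i $ \<alpha>) (s, x)"
  have slice: "partial \<beta> (\<lambda>x. Fb (s, x) $ i $ \<alpha>) x = ?f \<alpha> \<beta> s" if "s \<in> {0..T}" for s \<alpha> \<beta>
    using dderiv_slice[OF diff(1)[OF in_U[OF that]]] .
  have dt: "dderiv (1, 0) (\<lambda>z. Fb z $ i $ \<alpha>) (s, y) = partial \<alpha> (\<lambda>y. Vb (s, y) $ i) y" if "s \<in> {0..T}" for s y \<alpha>
  proof -
    have "Fb differentiable (at (s, y))" using Ck_on_differentiable[OF Fb_smooth[of 1]] in_U[OF that] by auto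
    from dderiv_linear_compose[OF bounded_linear_compose[OF bounded_linear_vec_nth bounded_linear_vec_nth] this, of "(1, 0)" i \<alpha>]
    show ?thesis using kinematic_eq[OF that, of y i \<alpha>] by simp
  qed
  have der: "((\<lambda>s. ?f \<alpha> \<beta> s) has_real_derivative partial \<beta> (partial \<alpha> (\<lambda>y. Vb (s, y) $ i)) x) (at s within {0..T})"
    if s: "s \<in> {0..T}" for s \<alpha> \<beta>
  proof -
    have "((\<lambda>s. ?f \<alpha> \<beta> s) has_real_derivative dderiv (1, 0) (dderiv (0, axis \<beta> 1) (\<lambda>z. Fb z $ i $ \<alpha>)) (s, x)) (at s within {0..T})"
      using time_derivative[OF diff(2)[OF in_U[OF s]]] by (simp add: has_real_derivative_iff_has_vector_derivative)
    also have "dderiv (1, 0) (dderiv (0, axis \<beta> 1) (\<lambda>z. Fb z $ i $ \<alpha>)) (s, x)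
        = dderiv (0, axis \<beta> 1) (dderiv (1, 0) (\<lambda>z. Fb z $ i $ \<alpha>)) (s, x)"
      by (rule dderiv_commute[OF U_open in_U[OF s] C])
    also have "\<dots> = partial \<beta> (\<lambda>y. dderiv (1, 0) (\<lambda>z. Fb z $ i $ \<alpha>) (s, y)) x"
      by (rule dderiv_slice[OF diff(2)[OF in_U[OF s]], symmetric])
    also have "(\<lambda>y. dderiv (1, 0) (\<lambda>z. Fb z $ i $ \<alpha>) (s, y)) = partial \<alpha> (\<lambda>y. Vb (s, y) $ i)"
      using dt[OF s] by blast
    finally show ?thesis .
  qed
  have VC: "Ck_on 2 UNIV (\<lambda>y. Vb (s, y) $ i)" if "s \<in> {0..T}" for s
    by (rule Ck_on_slice[OF that Ck_on_nth[OF U_open Vb_smooth]])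
  have "((\<lambda>s. ?f \<alpha> \<beta> s - ?f \<beta> \<alpha> s) has_real_derivative 0) (at s within {0..T})" if s: "s \<in> {0..T}" for s
  proof -
    have "((\<lambda>s. ?f \<alpha> \<beta> s - ?f \<beta> \<alpha> s) has_real_derivative
       partial \<beta> (partial \<alpha> (\<lambda>y. Vb (s, y) $ i)) x - partial \<alpha> (partial \<beta> (\<lambda>y. Vb (s, y) $ i)) x) (at s within {0..T})"
      by (intro DERIV_diff der s)
    then show ?thesis using dderiv_commute[OF open_UNIV UNIV_I VC[OF s]] by simp
  qed
  then obtain c where c: "\<And>s. s \<in> {0..T} \<Longrightarrow> ?f \<alpha> \<beta> s - ?f \<beta> \<alpha> s = c"
    using has_field_derivative_zero_constant[of "{0..T}" "\<lambda>s. ?f \<alpha> \<beta> s - ?f \<beta> \<alpha> s"] by (auto simp: convex_real_interval)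
  have 0: "0 \<in> {0..T}" using T_pos by simp
  have "?f \<alpha> \<beta> 0 - ?f \<beta> \<alpha> 0 = 0"
    using curl_free_0[of i] slice[OF 0] unfolding curl_free_def by (metis diff_self)
  then have "?f \<alpha> \<beta> t - ?f \<beta> \<alpha> t = 0" using c[OF 0] c[OF assms] by simp
  then show "partial \<beta> (\<lambda>x. Fb (t, x) $ i $ \<alpha>) x = partial \<alpha> (\<lambda>x. Fb (t, x) $ i $ \<beta>) x"
    using slice[OF assms] by simp
qed

text \<open>By the Piola identity only the derivatives of \<open>gb\<close> contribute to the stress divergence.\<close>

lemma momentum_eq':
  assumes t: "t \<in> {0..T}"
  shows "dderiv (1, 0) Vb (t, x) $ i = (\<Sum>\<alpha>\<in>UNIV. partial \<alpha> (\<lambda>y. gb (t, y)) x \<bullet> dPhi (Fb (t, x)) i \<alpha>)"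
proof -
  have gC: "Ck_on 1 UNIV (\<lambda>y. gb (t, y))" by (rule Ck_on_slice[OF t Ck_on_le[OF gb_C2]]) simp
  have FC: "Ck_on 1 UNIV (\<lambda>y. Fb (t, y))" by (rule Ck_on_slice[OF t Fb_smooth])
  have PC: "Ck_on 1 UNIV (\<lambda>y. dPhi (Fb (t, y)) i \<alpha>)" for \<alpha>
    unfolding dPhi_def
    by (rule Ck_on_compose[OF open_UNIV _ FC, of UNIV]) (use Ck_on_dderiv[of 1] Ck_on_Phi[of "Suc 1"] in auto)
  have gd: "(\<lambda>y. gb (t, y)) differentiable (at x)" and Pd: "(\<lambda>y. dPhi (Fb (t, y)) i \<alpha>) differentiable (at x)" for \<alpha>
    using Ck_on_differentiable[OF gC] Ck_on_differentiable[OF PC] by auto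
  have "partial \<alpha> (\<lambda>y. gb (t, y) \<bullet> dPhi (Fb (t, y)) i \<alpha>) x
     = partial \<alpha> (\<lambda>y. gb (t, x) \<bullet> dPhi (Fb (t, y)) i \<alpha>) x + partial \<alpha> (\<lambda>y. gb (t, y)) x \<bullet> dPhi (Fb (t, x)) i \<alpha>" for \<alpha>
    using bounded_bilinear.dderiv_prod[OF bounded_bilinear_inner gd Pd, of "axis \<alpha> 1"]
      dderiv_linear_compose[OF bounded_linear_inner_right Pd, of "axis \<alpha> 1" "gb (t, x)"] by simp
  then have "dderiv (1, 0) Vb (t, x) $ i =
      (\<Sum>\<alpha>\<in>UNIV. partial \<alpha> (\<lambda>y. gb (t, x) \<bullet> dPhi (Fb (t, y)) i \<alpha>) x)
      + (\<Sum>\<alpha>\<in>UNIV. partial \<alpha> (\<lambda>y. gb (t, y)) x \<bullet> dPhi (Fb (t, x)) i \<alpha>)"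
    unfolding momentum_eq[OF t] by (simp add: gb_def Xb_def sum.distrib)
  then show ?thesis using div_dPhi[OF FC curl_free_Fb[OF t], of "gb (t, x)" i x] by simp
qed

lemma hess_symmetric: "dderiv u (grad G) X \<bullet> w = dderiv w (grad G) X \<bullet> u"
proof -
  have d: "grad G differentiable (at X)" using Ck_on_differentiable[OF grad_G_C2] by auto
  have g: "(\<lambda>x. grad G x \<bullet> w) = dderiv w G" for w using grad_inner[OF G_diff] by blast
  have "dderiv u (grad G) X \<bullet> w = dderiv u (dderiv w G) X" for u w
    using dderiv_linear_compose[OF bounded_linear_inner_left d, of u w] g[of w] by (simp only:)
  then show ?thesis using dderiv_commute[OF open_UNIV UNIV_I G_C2] by simp
qed

text \<open>The spatial gradient of the velocity.\<close>

definition Ab :: "real \<times> vec3 \<Rightarrow> mat3" where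
  "Ab z = (\<chi> i \<alpha>. partial \<alpha> (\<lambda>y. Vb (fst z, y) $ i) (snd z))"

lemma dt_Fb: "t \<in> {0..T} \<Longrightarrow> dderiv (1, 0) Fb (t, x) = Ab (t, x)"
  by (simp add: vec_eq_iff kinematic_eq Ab_def)

lemma dt_Xb:
  assumes t: "t \<in> {0..T}"
  shows "dderiv (1, 0) Xb (t, x) = DPhi (Fb (t, x)) (Ab (t, x))"
proof -
  have d: "Fb differentiable (at (t, x))" using Ck_on_differentiable[OF Fb_smooth[of 1]] in_U[OF t] by auto
  from dderiv_eq[OF has_derivative_compose[OF has_derivative_dderiv[OF d] Phi_has_derivative]]
  show ?thesis by (simp add: Xb_def[abs_def] dt_Fb[OF t])
qed

lemma dt_gb:
  assumes t: "t \<in> {0..T}"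
  shows "dderiv (1, 0) gb (t, x) = dderiv (DPhi (Fb (t, x)) (Ab (t, x))) (grad G) (Xb (t, x))"
proof -
  have d: "Xb differentiable (at (t, x))" using Ck_on_differentiable[OF Xb_smooth[of 1]] in_U[OF t] by auto
  have "grad G differentiable (at (Xb (t, x)))" using Ck_on_differentiable[OF grad_G_C2] by auto
  from dderiv_compose[OF d this] show ?thesis by (simp add: gb_def[abs_def] dt_Xb[OF t])
qed

end

section \<open>The relative entropy and its pointwise estimates\<close>

lemma le_one_plus_square: "s \<le> 1 + s\<^sup>2" for s :: real
  using zero_le_power2[of "s - 1 / 2"] by (simp add: power2_eq_square algebra_simps)

lemma mult_le_sum_squares: "s * k \<le> s\<^sup>2 + k\<^sup>2" for s k :: real
  using sum_squares_bound[of s k] zero_le_power2[of s] zero_le_power2[of k] by linarith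

lemma norm_snd: "norm (snd z) \<le> norm z"
  by (cases z) (simp add: norm_snd_le)

text \<open>The derivative of the minors is quadratic in \<open>F\<close>.\<close>

lemma DPhi_diff_bound:
  assumes "M \<ge> 0"
  shows "\<exists>c>0. \<forall>F F' E. norm F' \<le> M \<longrightarrow>
    norm (DPhi F E - DPhi F' E) \<le> c * (norm (F - F') + (norm (F - F'))\<^sup>2) * norm E"
proof -
  obtain k where k: "k > 0" "\<And>A B. norm (cofb A B) \<le> norm A * norm B * k"
    using cofb.pos_bounded by blast
  have "norm (DPhi F E - DPhi F' E) \<le> (k * (2 + M)) * (norm (F - F') + (norm (F - F'))\<^sup>2) * norm E"
    if b: "norm F' \<le> M" for F F' E
  proof -
    let ?K = "F - F'"
    have "norm (DPhi F E - DPhi F' E) \<le> norm (cofb ?K E) + \<bar>(cof F - cof F') \<bullet> E\<bar>"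
      unfolding DPhi_diff by (simp add: norm_Pair norm_Pair1 sqrt_sum_squares_le_sum_abs[of "norm (cofb ?K E)" "(cof F - cof F') \<bullet> E", simplified])
    also have "norm (cofb ?K E) \<le> norm ?K * norm E * k" by (rule k)
    also have "\<bar>(cof F - cof F') \<bullet> E\<bar> \<le> norm (cof F - cof F') * norm E" by (rule Cauchy_Schwarz_ineq2)
    also have "norm (cof F - cof F') \<le> M * norm ?K * k + norm ?K * norm ?K * k"
    proof -
      have "norm (cof F - cof F') \<le> norm (cofb F' ?K) + norm ((1 / 2) *\<^sub>R cofb ?K ?K)"
        unfolding cof_diff by (rule norm_triangle_ineq)
      also have "\<dots> \<le> norm (cofb F' ?K) + norm (cofb ?K ?K)" by simp
      also have "\<dots> \<le> norm F' * norm ?K * k + norm ?K * norm ?K * k" by (intro add_mono k)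
      also have "\<dots> \<le> M * norm ?K * k + norm ?K * norm ?K * k"
        using b k(1) by (intro add_mono mult_right_mono) auto
      finally show ?thesis .
    qed
    finally have "norm (DPhi F E - DPhi F' E) \<le> norm ?K * norm E * k + (M * norm ?K * k + norm ?K * norm ?K * k) * norm E"
      by (simp add: mult_right_mono)
    also have "\<dots> \<le> (k * (2 + M)) * (norm ?K + (norm ?K)\<^sup>2) * norm E"
    proof -
      have "0 \<le> k * norm E * norm ?K" "0 \<le> k * norm E * (norm ?K)\<^sup>2" "0 \<le> k * norm E * (M * (norm ?K)\<^sup>2)"
        using k(1) assms by simp_all
      then show ?thesis by (simp add: algebra_simps power2_eq_square)
    qed
    finally show ?thesis .
  qed
  then show ?thesis using k(1) assms by (intro exI[of _ "k * (2 + M)"]) auto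
qed

context smooth_flow
begin

text \<open>The density of the relative entropy of the state \<open>(v, \<Xi>)\<close> at the point \<open>z\<close> of time and space.\<close>

definition eta :: "vec3 \<Rightarrow> xi \<Rightarrow> real \<times> vec3 \<Rightarrow> real" where
  "eta v \<Xi> z = (norm (v - Vb z))\<^sup>2 / 2 + Grel \<Xi> (Xb z)"

text \<open>The error that the relative entropy controls.\<close>

definition err :: "vec3 \<Rightarrow> xi \<Rightarrow> real \<times> vec3 \<Rightarrow> real" where
  "err v \<Xi> z = (norm (v - Vb z))\<^sup>2 + (norm (\<Xi> - Xb z))\<^sup>2 + norm (fst \<Xi> - Fb z) powr p"

lemma err_nonneg: "err v \<Xi> z \<ge> 0"
  unfolding err_def by (intro add_nonneg_nonneg) auto

lemma continuous_Vb: "continuous_on U Vb" and continuous_Fb: "continuous_on U Fb"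
  and continuous_Xb: "continuous_on U Xb" and continuous_gb: "continuous_on U gb"
  using Ck_on_continuous[OF Vb_smooth] Ck_on_continuous[OF Fb_smooth] Ck_on_continuous[OF Xb_smooth]
    Ck_on_continuous[OF gb_C2] by blast+

lemma continuous_dgb: "continuous_on U (dderiv u gb)" and continuous_dVb: "continuous_on U (dderiv u Vb)"
  and continuous_dFb: "continuous_on U (dderiv u Fb)"
proof -
  have "Ck_on (Suc 1) U gb" using gb_C2 by (simp only: Suc_1)
  then show "continuous_on U (dderiv u gb)" by (intro Ck_on_continuous[OF Ck_on_dderiv])
  show "continuous_on U (dderiv u Vb)" by (rule Ck_on_continuous[OF Ck_on_dderiv[OF Vb_smooth[of 1, simplified One_nat_def]]])
  show "continuous_on U (dderiv u Fb)" by (rule Ck_on_continuous[OF Ck_on_dderiv[OF Fb_smooth[of 1, simplified One_nat_def]]])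
qed

lemma eta_coercive:
  "\<exists>C>0. \<forall>t\<in>{0..T}. \<forall>x\<in>cbox 0 1. \<forall>v \<Xi>. err v \<Xi> (t, x) \<le> C * eta v \<Xi> (t, x)"
proof -
  have cG: "continuous_on UNIV G" by (rule Ck_on_continuous[OF G_C3])
  have "continuous_on U (\<lambda>z. G (Xb z))" by (rule continuous_on_compose2[OF cG continuous_Xb]) simp
  then obtain M1 where M1: "M1 > 0" "\<And>t x. t \<in> {0..T} \<Longrightarrow> x \<in> cbox 0 1 \<Longrightarrow> norm (G (Xb (t, x))) \<le> M1"
    using slab_bounded by blast
  obtain M2 where M2: "M2 > 0" "\<And>t x. t \<in> {0..T} \<Longrightarrow> x \<in> cbox 0 1 \<Longrightarrow> norm (Xb (t, x)) \<le> M2"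
    using slab_bounded[OF continuous_Xb] by blast
  obtain M3 where M3: "M3 > 0" "\<And>t x. t \<in> {0..T} \<Longrightarrow> x \<in> cbox 0 1 \<Longrightarrow> norm (gb (t, x)) \<le> M3"
    using slab_bounded[OF continuous_gb] by blast
  have "M1 + M2 + M3 \<ge> 0" using M1 M2 M3 by simp
  from Grel_coercive[OF this] obtain C where C: "C > 0" "\<And>\<Xi> \<Xi>'. norm \<Xi>' \<le> M1 + M2 + M3 \<Longrightarrow> G \<Xi>' \<le> M1 + M2 + M3 \<Longrightarrow>
    norm (grad G \<Xi>') \<le> M1 + M2 + M3 \<Longrightarrow> (norm (\<Xi> - \<Xi>'))\<^sup>2 + norm (fst \<Xi> - fst \<Xi>') powr p \<le> C * Grel \<Xi> \<Xi>'"
    by blast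
  have "err v \<Xi> (t, x) \<le> (C + 2) * eta v \<Xi> (t, x)" if tx: "t \<in> {0..T}" "x \<in> cbox 0 1" for t x v \<Xi>
  proof -
    have "norm (Xb (t, x)) \<le> M1 + M2 + M3" "G (Xb (t, x)) \<le> M1 + M2 + M3" "norm (grad G (Xb (t, x))) \<le> M1 + M2 + M3"
      using M1(1) M2(1) M3(1) M1(2)[OF tx] M2(2)[OF tx] M3(2)[OF tx] by (simp_all add: gb_def)
    from C(2)[OF this, of \<Xi>] have g: "(norm (\<Xi> - Xb (t, x)))\<^sup>2 + norm (fst \<Xi> - Fb (t, x)) powr p \<le> C * Grel \<Xi> (Xb (t, x))"
      by simp
    moreover have "0 \<le> (norm (\<Xi> - Xb (t, x)))\<^sup>2 + norm (fst \<Xi> - Fb (t, x)) powr p" by simp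
    ultimately have "0 \<le> C * Grel \<Xi> (Xb (t, x))" by linarith
    then have "Grel \<Xi> (Xb (t, x)) \<ge> 0" using C(1) by (simp add: zero_le_mult_iff)
    moreover have "(C + 2) * eta v \<Xi> (t, x) = C * (norm (v - Vb (t, x)))\<^sup>2 / 2 + (norm (v - Vb (t, x)))\<^sup>2
        + C * Grel \<Xi> (Xb (t, x)) + 2 * Grel \<Xi> (Xb (t, x))"
      by (simp add: eta_def algebra_simps)
    moreover have "0 \<le> C * (norm (v - Vb (t, x)))\<^sup>2" using C(1) by simp
    ultimately show ?thesis using g unfolding err_def by linarith
  qed
  then show ?thesis using C(1) by (intro exI[of _ "C + 2"]) auto
qed

text \<open>Minus the time derivative of \<open>eta\<close> for a fixed state.\<close>

definition drift :: "vec3 \<Rightarrow> xi \<Rightarrow> real \<times> vec3 \<Rightarrow> real" where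
  "drift v \<Xi> z = dderiv (1, 0) Vb z \<bullet> (v - Vb z) + dderiv (1, 0) gb z \<bullet> (\<Xi> - Xb z)"

text \<open>The part of \<open>eta\<close> that does not depend on the state; what remains besides the energy is linear in the
  state.\<close>

definition eta0 :: "real \<times> vec3 \<Rightarrow> real" where
  "eta0 z = (1 / 2) * (Vb z \<bullet> Vb z) - G (Xb z) + gb z \<bullet> Xb z"

lemma eta_expand: "eta v \<Xi> z = (norm v)\<^sup>2 / 2 + G \<Xi> + eta0 z - Vb z \<bullet> v - gb z \<bullet> \<Xi>"
proof -
  have "(norm (v - Vb z))\<^sup>2 = (norm v)\<^sup>2 - 2 * (Vb z \<bullet> v) + Vb z \<bullet> Vb z"
    by (simp add: power2_norm_eq_inner inner_diff_left inner_diff_right inner_commute)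
  then show ?thesis
    by (simp add: eta_def Grel_def eta0_def gb_def inner_diff_right)
qed

lemma eta0_C2: "Ck_on 2 U eta0"
proof -
  have "Ck_on 2 U (\<lambda>z. G (Xb z))" by (rule Ck_on_compose[OF U_open G_C2 Xb_smooth]) simp
  then show ?thesis unfolding eta0_def[abs_def]
    by (intro Ck_on_add[OF U_open Ck_on_diff[OF U_open Ck_on_mult[OF U_open Ck_on_const Ck_on_inner[OF U_open Vb_smooth Vb_smooth]]]]
        Ck_on_inner[OF U_open gb_C2 Xb_smooth])
qed

lemma dt_eta0:
  assumes "t \<in> {0..T}"
  shows "dderiv (1, 0) eta0 (t, x) = dderiv (1, 0) Vb (t, x) \<bullet> Vb (t, x) + dderiv (1, 0) gb (t, x) \<bullet> Xb (t, x)"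
proof -
  note U = in_U[OF assms, of x]
  have d: "Vb differentiable (at (t, x))" "Xb differentiable (at (t, x))" "gb differentiable (at (t, x))"
    using Ck_on_differentiable[OF Vb_smooth[of 1] _ U] Ck_on_differentiable[OF Xb_smooth[of 1] _ U]
      Ck_on_differentiable[OF gb_C2 _ U] by simp_all
  have "(eta0 has_derivative (\<lambda>u. (1 / 2) * (Vb (t, x) \<bullet> dderiv u Vb (t, x) + dderiv u Vb (t, x) \<bullet> Vb (t, x))
     - dderiv (dderiv u Xb (t, x)) G (Xb (t, x))
     + (gb (t, x) \<bullet> dderiv u Xb (t, x) + dderiv u gb (t, x) \<bullet> Xb (t, x)))) (at (t, x))"
    unfolding eta0_def[abs_def]
    by (intro has_derivative_add has_derivative_diff has_derivative_mult_right has_derivative_inner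
        has_derivative_dderiv d has_derivative_compose[OF has_derivative_dderiv[OF d(2)] has_derivative_dderiv[OF G_diff]])
  from dderiv_eq[OF this, of "(1, 0)"] show ?thesis
    unfolding gb_def grad_inner[OF G_diff] by (simp add: inner_commute[of "Vb (t, x)"])
qed

text \<open>As \<open>eta\<close> depends on time only through \<open>eta0\<close> and the coefficients of the linear part, the remainder
  grows linearly in the state.\<close>

lemma eta_time_step:
  "\<exists>K\<ge>0. \<forall>t h x v \<Xi>. 0 \<le> t \<longrightarrow> 0 \<le> h \<longrightarrow> t + h \<le> T \<longrightarrow> x \<in> cbox 0 1 \<longrightarrow>
     \<bar>eta v \<Xi> (t + h, x) - eta v \<Xi> (t, x) + h * drift v \<Xi> (t, x)\<bar> \<le> K * h\<^sup>2 * (1 + norm v + norm \<Xi>)"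
proof -
  obtain K1 where K1: "K1 \<ge> 0" "\<And>t h x. 0 \<le> t \<Longrightarrow> 0 \<le> h \<Longrightarrow> t + h \<le> T \<Longrightarrow> x \<in> cbox 0 1 \<Longrightarrow>
    norm (eta0 (t + h, x) - eta0 (t, x) - h *\<^sub>R dderiv (1, 0) eta0 (t, x)) \<le> K1 * h\<^sup>2"
    using time_taylor[OF eta0_C2] by blast
  obtain K2 where K2: "K2 \<ge> 0" "\<And>t h x. 0 \<le> t \<Longrightarrow> 0 \<le> h \<Longrightarrow> t + h \<le> T \<Longrightarrow> x \<in> cbox 0 1 \<Longrightarrow>
    norm (Vb (t + h, x) - Vb (t, x) - h *\<^sub>R dderiv (1, 0) Vb (t, x)) \<le> K2 * h\<^sup>2"
    using time_taylor[OF Vb_smooth] by blast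
  obtain K3 where K3: "K3 \<ge> 0" "\<And>t h x. 0 \<le> t \<Longrightarrow> 0 \<le> h \<Longrightarrow> t + h \<le> T \<Longrightarrow> x \<in> cbox 0 1 \<Longrightarrow>
    norm (gb (t + h, x) - gb (t, x) - h *\<^sub>R dderiv (1, 0) gb (t, x)) \<le> K3 * h\<^sup>2"
    using time_taylor[OF gb_C2] by blast
  have "\<bar>eta v \<Xi> (t + h, x) - eta v \<Xi> (t, x) + h * drift v \<Xi> (t, x)\<bar> \<le> (K1 + K2 + K3) * h\<^sup>2 * (1 + norm v + norm \<Xi>)"
    if t: "0 \<le> t" "0 \<le> h" "t + h \<le> T" "x \<in> cbox 0 1" for t h x v \<Xi>
  proof -
    have tT: "t \<in> {0..T}" using t by auto
    let ?a = "eta0 (t + h, x) - eta0 (t, x) - h *\<^sub>R dderiv (1, 0) eta0 (t, x)"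
    let ?b = "Vb (t + h, x) - Vb (t, x) - h *\<^sub>R dderiv (1, 0) Vb (t, x)"
    let ?c = "gb (t + h, x) - gb (t, x) - h *\<^sub>R dderiv (1, 0) gb (t, x)"
    have eq: "eta v \<Xi> (t + h, x) - eta v \<Xi> (t, x) + h * drift v \<Xi> (t, x) = ?a - ?b \<bullet> v - ?c \<bullet> \<Xi>"
      unfolding eta_expand drift_def dt_eta0[OF tT]
      by (simp only: inner_diff_left inner_diff_right inner_scaleR_left real_scaleR_def)
        (simp add: algebra_simps)
    have tri: "\<bar>a - b - c\<bar> \<le> A + B + C" if "norm a \<le> A" "\<bar>b\<bar> \<le> B" "\<bar>c\<bar> \<le> C" for a b c A B C :: real
      using that by simp
    have "\<bar>?a - ?b \<bullet> v - ?c \<bullet> \<Xi>\<bar> \<le> K1 * h\<^sup>2 + K2 * h\<^sup>2 * norm v + K3 * h\<^sup>2 * norm \<Xi>"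
      by (rule tri[OF K1(2)[OF t] order_trans[OF Cauchy_Schwarz_ineq2 mult_right_mono[OF K2(2)[OF t] norm_ge_zero]]
            order_trans[OF Cauchy_Schwarz_ineq2 mult_right_mono[OF K3(2)[OF t] norm_ge_zero]]])
    also have "\<dots> \<le> (K1 + K2 + K3) * h\<^sup>2 * (1 + norm v + norm \<Xi>)"
    proof -
      have "0 \<le> K1 * h\<^sup>2 * norm v" "0 \<le> K1 * h\<^sup>2 * norm \<Xi>" "0 \<le> K2 * h\<^sup>2" "0 \<le> K2 * h\<^sup>2 * norm \<Xi>" "0 \<le> K3 * h\<^sup>2" "0 \<le> K3 * h\<^sup>2 * norm v"
        using K1(1) K2(1) K3(1) by simp_all
      then show ?thesis by (simp add: algebra_simps)
    qed
    finally have "\<bar>?a - ?b \<bullet> v - ?c \<bullet> \<Xi>\<bar> \<le> (K1 + K2 + K3) * h\<^sup>2 * (1 + norm v + norm \<Xi>)" .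
    then show ?thesis unfolding eq .
  qed
  then show ?thesis using K1(1) K2(1) K3(1) by (intro exI[of _ "K1 + K2 + K3"]) auto
qed

lemma norm_le_err:
  "\<exists>K>0. \<forall>t\<in>{0..T}. \<forall>x\<in>cbox 0 1. \<forall>v \<Xi>. 1 + norm v + norm \<Xi> \<le> K * (1 + err v \<Xi> (t, x))"
proof -
  obtain M1 where M1: "M1 > 0" "\<And>t x. t \<in> {0..T} \<Longrightarrow> x \<in> cbox 0 1 \<Longrightarrow> norm (Vb (t, x)) \<le> M1"
    using slab_bounded[OF continuous_Vb] by blast
  obtain M2 where M2: "M2 > 0" "\<And>t x. t \<in> {0..T} \<Longrightarrow> x \<in> cbox 0 1 \<Longrightarrow> norm (Xb (t, x)) \<le> M2"
    using slab_bounded[OF continuous_Xb] by blast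
  have "1 + norm v + norm \<Xi> \<le> (3 + M1 + M2) * (1 + err v \<Xi> (t, x))" if tx: "t \<in> {0..T}" "x \<in> cbox 0 1" for t x v \<Xi>
  proof -
    have "norm v \<le> M1 + norm (v - Vb (t, x))"
      using norm_triangle_sub[of v "Vb (t, x)"] M1(2)[OF tx] by linarith
    moreover have "norm \<Xi> \<le> M2 + norm (\<Xi> - Xb (t, x))"
      using norm_triangle_sub[of \<Xi> "Xb (t, x)"] M2(2)[OF tx] by linarith
    ultimately have "1 + norm v + norm \<Xi> \<le> 3 + M1 + M2 + ((norm (v - Vb (t, x)))\<^sup>2 + (norm (\<Xi> - Xb (t, x)))\<^sup>2)"
      using le_one_plus_square[of "norm (v - Vb (t, x))"] le_one_plus_square[of "norm (\<Xi> - Xb (t, x))"] by linarith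
    also have "\<dots> \<le> 3 + M1 + M2 + err v \<Xi> (t, x)" by (simp add: err_def)
    also have "\<dots> \<le> (3 + M1 + M2) * (1 + err v \<Xi> (t, x))"
    proof -
      have "0 \<le> (2 + M1 + M2) * err v \<Xi> (t, x)" using M1(1) M2(1) err_nonneg[of v \<Xi> "(t, x)"] by (intro mult_nonneg_nonneg) auto
      then show ?thesis by (simp add: algebra_simps)
    qed
    finally show ?thesis .
  qed
  then show ?thesis using M1(1) M2(1) by (intro exI[of _ "3 + M1 + M2"]) auto
qed

lemma drift_bound:
  "\<exists>K>0. \<forall>t\<in>{0..T}. \<forall>x\<in>cbox 0 1. \<forall>v \<Xi>. \<bar>drift v \<Xi> (t, x)\<bar> \<le> K * (1 + err v \<Xi> (t, x))"
proof -
  obtain M1 where M1: "M1 > 0" "\<And>t x. t \<in> {0..T} \<Longrightarrow> x \<in> cbox 0 1 \<Longrightarrow> norm (dderiv (1, 0) Vb (t, x)) \<le> M1"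
    using slab_bounded[OF continuous_dVb] by blast
  obtain M2 where M2: "M2 > 0" "\<And>t x. t \<in> {0..T} \<Longrightarrow> x \<in> cbox 0 1 \<Longrightarrow> norm (dderiv (1, 0) gb (t, x)) \<le> M2"
    using slab_bounded[OF continuous_dgb] by blast
  have "\<bar>drift v \<Xi> (t, x)\<bar> \<le> (M1 + M2) * (1 + err v \<Xi> (t, x))" if tx: "t \<in> {0..T}" "x \<in> cbox 0 1" for t x v \<Xi>
  proof -
    have e: "norm (v - Vb (t, x)) \<le> 1 + err v \<Xi> (t, x)" "norm (\<Xi> - Xb (t, x)) \<le> 1 + err v \<Xi> (t, x)"
      using le_one_plus_square[of "norm (v - Vb (t, x))"] le_one_plus_square[of "norm (\<Xi> - Xb (t, x))"] zero_le_power2[of "norm (v - Vb (t, x))"]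
        zero_le_power2[of "norm (\<Xi> - Xb (t, x))"] powr_ge_zero[of "norm (fst \<Xi> - Fb (t, x))" p]
      unfolding err_def by linarith+
    have "\<bar>drift v \<Xi> (t, x)\<bar> \<le> norm (dderiv (1, 0) Vb (t, x)) * norm (v - Vb (t, x)) + norm (dderiv (1, 0) gb (t, x)) * norm (\<Xi> - Xb (t, x))"
      unfolding drift_def
      by (rule order_trans[OF abs_triangle_ineq add_mono[OF Cauchy_Schwarz_ineq2 Cauchy_Schwarz_ineq2]])
    also have "\<dots> \<le> M1 * (1 + err v \<Xi> (t, x)) + M2 * (1 + err v \<Xi> (t, x))"
      using M1 M2 tx e by (intro add_mono mult_mono) auto
    finally show ?thesis by (simp add: algebra_simps)
  qed
  then show ?thesis using M1(1) M2(1) by (intro exI[of _ "M1 + M2"]) auto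
qed

text \<open>The rate of change that the scheme produces in the terms of \<open>eta\<close> linear in the state, and
  its part that is a null Lagrangian in \<open>F\<^sub>0\<close>.\<close>

definition flux :: "vec3 \<Rightarrow> xi \<Rightarrow> mat3 \<Rightarrow> real \<times> vec3 \<Rightarrow> real" where
  "flux v \<Xi> F\<^sub>0 z = grad G \<Xi> \<bullet> DPhi F\<^sub>0 (Ab z)
     + (\<Sum>i\<in>UNIV. \<Sum>\<alpha>\<in>UNIV. v $ i * (dderiv (0, axis \<alpha> 1) gb z \<bullet> dPhi F\<^sub>0 i \<alpha>))"

definition null_part :: "mat3 \<Rightarrow> real \<times> vec3 \<Rightarrow> real" where
  "null_part F\<^sub>0 z = flux (Vb z) (Xb z) F\<^sub>0 z"

lemma spatial_gb:
  assumes "t \<in> {0..T}"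
  shows "partial \<alpha> (\<lambda>y. gb (t, y)) x = dderiv (0, axis \<alpha> 1) gb (t, x)"
  by (rule dderiv_slice) (use Ck_on_differentiable[OF gb_C2 _ in_U[OF assms]] in simp)

lemma Ab_bounded: "\<exists>M>0. \<forall>t\<in>{0..T}. \<forall>x\<in>cbox 0 1. norm (Ab (t, x)) \<le> M"
  using slab_bounded[OF continuous_dFb, of "(1, 0)"] by (simp add: dt_Fb)

text \<open>The error of the minors is quadratic in the error of \<open>F\<close>; its square is controlled as \<open>4 \<le> p\<close>.\<close>

lemma minors_error:
  "s * (norm (fst \<Xi>\<^sub>0 - Fb z) + (norm (fst \<Xi>\<^sub>0 - Fb z))\<^sup>2) \<le> 3 * (s\<^sup>2 + err v\<^sub>0 \<Xi>\<^sub>0 z)"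
proof -
  let ?K = "fst \<Xi>\<^sub>0 - Fb z"
  have K4: "(norm ?K)\<^sup>2 * (norm ?K)\<^sup>2 \<le> (norm ?K)\<^sup>2 + norm ?K powr p"
  proof -
    have "norm ?K powr 4 \<le> (norm ?K)\<^sup>2 + norm ?K powr p" using p6 by (intro powr_between) auto
    moreover have "norm ?K powr 4 = (norm ?K)\<^sup>2 * (norm ?K)\<^sup>2"
      by (cases "norm ?K = 0") (auto simp: powr_numeral power_add[symmetric])
    ultimately show ?thesis by simp
  qed
  have KX: "(norm ?K)\<^sup>2 \<le> (norm (\<Xi>\<^sub>0 - Xb z))\<^sup>2"
    using norm_fst[of "\<Xi>\<^sub>0 - Xb z"] by (intro power_mono) auto
  have "s * norm ?K \<le> s\<^sup>2 + (norm ?K)\<^sup>2"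
    by (rule mult_le_sum_squares)
  moreover have "s * (norm ?K)\<^sup>2 \<le> s\<^sup>2 + (norm ?K)\<^sup>2 * (norm ?K)\<^sup>2"
    using mult_le_sum_squares[of s "(norm ?K)\<^sup>2"] by (simp add: power2_eq_square)
  ultimately have "s * (norm ?K + (norm ?K)\<^sup>2) \<le> 2 * s\<^sup>2 + (2 * (norm ?K)\<^sup>2 + norm ?K powr p)" using K4 by (simp add: distrib_left)
  also have "\<dots> \<le> 3 * s\<^sup>2 + 3 * err v\<^sub>0 \<Xi>\<^sub>0 z"
    using KX zero_le_power2[of s] zero_le_power2[of "norm (v\<^sub>0 - Vb z)"] powr_ge_zero[of "norm ?K" p]
      zero_le_power2[of "norm (\<Xi>\<^sub>0 - Xb z)"]
    unfolding err_def distrib_left by linarith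
  finally show ?thesis by simp
qed

text \<open>Up to the null Lagrangian the flux agrees with the drift to second order in the error. There are
  three remainders: the Taylor remainder of \<open>grad G\<close>, the product of the errors of \<open>grad G\<close> and of the
  derivative of the minors, and the product of the errors of the velocity and of the derivative of
  the minors. In the second only the components belonging to \<open>Z\<close> and \<open>w\<close> occur, in which \<open>grad G\<close> is
  Lipschitz continuous.\<close>

lemma flux_drift:
  "\<exists>C>0. \<forall>t\<in>{0..T}. \<forall>x\<in>cbox 0 1. \<forall>v \<Xi> v\<^sub>0 \<Xi>\<^sub>0.
     \<bar>flux v \<Xi> (fst \<Xi>\<^sub>0) (t, x) - drift v \<Xi> (t, x) - null_part (fst \<Xi>\<^sub>0) (t, x)\<bar>
       \<le> C * (err v \<Xi> (t, x) + err v\<^sub>0 \<Xi>\<^sub>0 (t, x))"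
proof -
  obtain M1 where M1: "M1 > 0" "\<And>t x. t \<in> {0..T} \<Longrightarrow> x \<in> cbox 0 1 \<Longrightarrow> norm (Fb (t, x)) \<le> M1"
    using slab_bounded[OF continuous_Fb] by blast
  obtain M2 where M2: "M2 > 0" "\<And>t x. t \<in> {0..T} \<Longrightarrow> x \<in> cbox 0 1 \<Longrightarrow> norm (Xb (t, x)) \<le> M2"
    using slab_bounded[OF continuous_Xb] by blast
  obtain M3 where M3: "M3 > 0" "\<And>t x. t \<in> {0..T} \<Longrightarrow> x \<in> cbox 0 1 \<Longrightarrow> norm (Ab (t, x)) \<le> M3"
    using Ab_bounded by blast
  have dX: "continuous_on U (dderiv u Xb)" for u
    by (rule Ck_on_continuous[OF Ck_on_dderiv[OF Xb_smooth[of 1, simplified One_nat_def]]])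
  obtain M4 where M4: "M4 > 0" "\<And>t x. t \<in> {0..T} \<Longrightarrow> x \<in> cbox 0 1 \<Longrightarrow> norm (DPhi (Fb (t, x)) (Ab (t, x))) \<le> M4"
    using slab_bounded[OF dX, of "(1, 0)"] by (auto simp: dt_Xb)
  have "\<forall>\<alpha>. \<exists>M>0. \<forall>t\<in>{0..T}. \<forall>x\<in>cbox 0 1. norm (dderiv (0, axis \<alpha> 1) gb (t, x)) \<le> M"
    using slab_bounded[OF continuous_dgb] by blast
  then obtain Mg where Mg: "\<And>\<alpha>. Mg \<alpha> > 0" "\<And>\<alpha> t x. t \<in> {0..T} \<Longrightarrow> x \<in> cbox 0 1 \<Longrightarrow> norm (dderiv (0, axis \<alpha> 1) gb (t, x)) \<le> Mg \<alpha>"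
    by metis
  obtain c where c: "c > 0" "\<And>F F' E. norm F' \<le> M1 \<Longrightarrow>
     norm (DPhi F E - DPhi F' E) \<le> c * (norm (F - F') + (norm (F - F'))\<^sup>2) * norm E"
    using DPhi_diff_bound[of M1] M1(1) by (metis less_imp_le)
  obtain C1 where C1: "C1 > 0" "\<And>\<Xi> \<Xi>'. norm \<Xi>' \<le> M2 \<Longrightarrow>
    norm (grad G \<Xi> - grad G \<Xi>' - dderiv (\<Xi> - \<Xi>') (grad G) \<Xi>') \<le> C1 * ((norm (\<Xi> - \<Xi>'))\<^sup>2 + norm (fst \<Xi> - fst \<Xi>') powr p)"
    using dG_taylor[of M2] M2(1) by (metis less_imp_le)
  obtain C2 where C2: "C2 > 0" "\<And>\<Xi> \<Xi>'. norm (snd (grad G \<Xi> - grad G \<Xi>')) \<le> C2 * norm (\<Xi> - \<Xi>')"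
    using dG_lipschitz by blast
  define C3 where "C3 = 3 * (\<Sum>\<alpha>\<in>UNIV. Mg \<alpha> * c)"
  have C3: "C3 > 0" unfolding C3_def using Mg(1) c(1) by (simp add: sum_pos)
  have main: "\<bar>flux v \<Xi> (fst \<Xi>\<^sub>0) (t, x) - drift v \<Xi> (t, x) - null_part (fst \<Xi>\<^sub>0) (t, x)\<bar>
       \<le> (C1 * M4 + (C2 * c * M3 + C3) * 3) * (err v \<Xi> (t, x) + err v\<^sub>0 \<Xi>\<^sub>0 (t, x))"
    if tx: "t \<in> {0..T}" "x \<in> cbox 0 1" for t x v \<Xi> v\<^sub>0 \<Xi>\<^sub>0
  proof -
    let ?z = "(t, x)" and ?F = "fst \<Xi>\<^sub>0"
    let ?Z = "\<Xi> - Xb ?z" and ?K = "fst \<Xi>\<^sub>0 - Fb ?z" and ?w = "v - Vb ?z"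
    let ?k = "norm ?K + (norm ?K)\<^sup>2"
    let ?r1 = "(grad G \<Xi> - grad G (Xb ?z) - dderiv ?Z (grad G) (Xb ?z)) \<bullet> DPhi (Fb ?z) (Ab ?z)"
    let ?r2 = "(grad G \<Xi> - grad G (Xb ?z)) \<bullet> (DPhi ?F (Ab ?z) - DPhi (Fb ?z) (Ab ?z))"
    let ?r3 = "\<Sum>i\<in>UNIV. \<Sum>\<alpha>\<in>UNIV. ?w $ i * (dderiv (0, axis \<alpha> 1) gb ?z \<bullet> (dPhi ?F i \<alpha> - dPhi (Fb ?z) i \<alpha>))"
    have dV: "dderiv (1, 0) Vb ?z \<bullet> ?w = (\<Sum>i\<in>UNIV. \<Sum>\<alpha>\<in>UNIV. ?w $ i * (dderiv (0, axis \<alpha> 1) gb ?z \<bullet> dPhi (Fb ?z) i \<alpha>))"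
      unfolding inner_vec_def[where 'a = real] momentum_eq'[OF tx(1)] spatial_gb[OF tx(1)]
      by (simp add: sum_distrib_left mult.commute)
    have dg: "dderiv (1, 0) gb ?z \<bullet> ?Z = dderiv ?Z (grad G) (Xb ?z) \<bullet> DPhi (Fb ?z) (Ab ?z)"
      unfolding dt_gb[OF tx(1)] by (rule hess_symmetric)
    have sum3: "(\<Sum>i\<in>UNIV. \<Sum>\<alpha>\<in>UNIV. v $ i * (dderiv (0, axis \<alpha> 1) gb ?z \<bullet> dPhi ?F i \<alpha>))
       - (\<Sum>i\<in>UNIV. \<Sum>\<alpha>\<in>UNIV. ?w $ i * (dderiv (0, axis \<alpha> 1) gb ?z \<bullet> dPhi (Fb ?z) i \<alpha>))
       - (\<Sum>i\<in>UNIV. \<Sum>\<alpha>\<in>UNIV. Vb ?z $ i * (dderiv (0, axis \<alpha> 1) gb ?z \<bullet> dPhi ?F i \<alpha>)) = ?r3"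
      by (simp add: sum_subtractf[symmetric] inner_diff_right algebra_simps)
    have eq: "flux v \<Xi> ?F ?z - drift v \<Xi> ?z - null_part ?F ?z = ?r1 + ?r2 + ?r3"
      unfolding flux_def null_part_def drift_def dV dg sum3[symmetric]
      by (simp add: inner_diff_left inner_diff_right)
    have e: "norm (fst \<Xi> - Fb ?z) powr p \<ge> 0" by simp
    have "\<bar>?r1\<bar> \<le> C1 * ((norm ?Z)\<^sup>2 + norm (fst \<Xi> - Fb ?z) powr p) * M4"
    proof -
      have "\<bar>?r1\<bar> \<le> norm (grad G \<Xi> - grad G (Xb ?z) - dderiv ?Z (grad G) (Xb ?z)) * norm (DPhi (Fb ?z) (Ab ?z))"
        by (rule Cauchy_Schwarz_ineq2)
      also have "\<dots> \<le> C1 * ((norm ?Z)\<^sup>2 + norm (fst \<Xi> - Fb ?z) powr p) * M4"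
        using C1(2)[OF M2(2)[OF tx], of \<Xi>] M4(2)[OF tx] C1(1) by (intro mult_mono) auto
      finally show ?thesis .
    qed
    also have "\<dots> \<le> (C1 * M4) * err v \<Xi> ?z"
    proof -
      have "(norm ?Z)\<^sup>2 + norm (fst \<Xi> - Fb ?z) powr p \<le> err v \<Xi> ?z" by (simp add: err_def)
      from mult_left_mono[OF this, of "C1 * M4"] show ?thesis using C1(1) M4(1) by (simp add: mult_ac)
    qed
    finally have r1: "\<bar>?r1\<bar> \<le> (C1 * M4) * err v \<Xi> ?z" .
    have r2: "\<bar>?r2\<bar> \<le> C2 * c * M3 * (norm ?Z * ?k)"
    proof -
      have "fst (DPhi ?F (Ab ?z) - DPhi (Fb ?z) (Ab ?z)) = 0" by (simp add: DPhi_diff)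
      then have "?r2 = snd (grad G \<Xi> - grad G (Xb ?z)) \<bullet> snd (DPhi ?F (Ab ?z) - DPhi (Fb ?z) (Ab ?z))"
        by (simp add: inner_prod_def[of "grad G \<Xi> - grad G (Xb ?z)"])
      also have "\<bar>\<dots>\<bar> \<le> norm (snd (grad G \<Xi> - grad G (Xb ?z))) * norm (snd (DPhi ?F (Ab ?z) - DPhi (Fb ?z) (Ab ?z)))"
        by (rule Cauchy_Schwarz_ineq2)
      also have "\<dots> \<le> (C2 * norm ?Z) * (c * ?k * M3)"
      proof (rule mult_mono[OF C2(2)])
        have "norm (snd (DPhi ?F (Ab ?z) - DPhi (Fb ?z) (Ab ?z))) \<le> norm (DPhi ?F (Ab ?z) - DPhi (Fb ?z) (Ab ?z))"
          by (rule norm_snd)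
        also have "\<dots> \<le> c * ?k * norm (Ab ?z)" by (rule c(2)[OF M1(2)[OF tx]])
        also have "\<dots> \<le> c * ?k * M3" using M3(2)[OF tx] c(1) by (intro mult_left_mono) auto
        finally show "norm (snd (DPhi ?F (Ab ?z) - DPhi (Fb ?z) (Ab ?z))) \<le> c * ?k * M3" .
      qed (use C2(1) in auto)
      finally show ?thesis by (simp add: mult_ac)
    qed
    have r3: "\<bar>?r3\<bar> \<le> C3 * (norm ?w * ?k)"
    proof -
      have "\<bar>?r3\<bar> \<le> (\<Sum>i\<in>(UNIV::3 set). \<Sum>\<alpha>\<in>UNIV. norm ?w * (Mg \<alpha> * (c * ?k)))"
      proof (rule order_trans[OF sum_abs], rule sum_mono, rule order_trans[OF sum_abs], rule sum_mono)
        fix i \<alpha> :: 3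
        have "norm (dPhi ?F i \<alpha> - dPhi (Fb ?z) i \<alpha>) \<le> c * ?k * norm (axis i (axis \<alpha> 1) :: mat3)"
          unfolding dPhi_eq by (rule c(2)[OF M1(2)[OF tx]])
        moreover have "norm (axis i (axis \<alpha> 1) :: mat3) = 1"
          by (simp add: norm_eq_sqrt_inner inner_axis_axis)
        ultimately have "norm (dPhi ?F i \<alpha> - dPhi (Fb ?z) i \<alpha>) \<le> c * ?k" by simp
        then have "norm (dderiv (0, axis \<alpha> 1) gb ?z) * norm (dPhi ?F i \<alpha> - dPhi (Fb ?z) i \<alpha>) \<le> Mg \<alpha> * (c * ?k)"
          using Mg(1)[of \<alpha>] Mg(2)[OF tx, of \<alpha>] by (intro mult_mono) auto
        then have "\<bar>dderiv (0, axis \<alpha> 1) gb ?z \<bullet> (dPhi ?F i \<alpha> - dPhi (Fb ?z) i \<alpha>)\<bar> \<le> Mg \<alpha> * (c * ?k)"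
          by (rule order_trans[OF Cauchy_Schwarz_ineq2])
        from mult_mono[OF component_le_norm_cart[of ?w i] this]
        show "\<bar>?w $ i * (dderiv (0, axis \<alpha> 1) gb ?z \<bullet> (dPhi ?F i \<alpha> - dPhi (Fb ?z) i \<alpha>))\<bar> \<le> norm ?w * (Mg \<alpha> * (c * ?k))"
          by (simp add: abs_mult)
      qed
      also have "\<dots> = C3 * (norm ?w * ?k)"
      proof -
        have "(\<Sum>i\<in>(UNIV::3 set). \<Sum>\<alpha>\<in>UNIV. n * (Mg \<alpha> * (c * k))) = C3 * (n * k)" for n k
          by (simp add: C3_def sum_distrib_left sum_distrib_right mult_ac)
        then show ?thesis .
      qed
      finally show ?thesis .
    qed
    have prod: "s * ?k \<le> 3 * (s\<^sup>2 + err v\<^sub>0 \<Xi>\<^sub>0 ?z)" if "s \<ge> 0" for s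
      by (rule minors_error)
    have pz: "norm ?Z * ?k \<le> 3 * (err v \<Xi> ?z + err v\<^sub>0 \<Xi>\<^sub>0 ?z)"
    proof -
      have "(norm ?Z)\<^sup>2 \<le> err v \<Xi> ?z" by (simp add: err_def)
      then show ?thesis by (intro order_trans[OF prod[OF norm_ge_zero[of ?Z]]]) simp
    qed
    have pw: "norm ?w * ?k \<le> 3 * (err v \<Xi> ?z + err v\<^sub>0 \<Xi>\<^sub>0 ?z)"
    proof -
      have "(norm ?w)\<^sup>2 \<le> err v \<Xi> ?z" by (simp add: err_def)
      then show ?thesis by (intro order_trans[OF prod[OF norm_ge_zero[of ?w]]]) simp
    qed
    have "\<bar>?r1 + ?r2 + ?r3\<bar> \<le> (C1 * M4) * err v \<Xi> ?z + C2 * c * M3 * (norm ?Z * ?k) + C3 * (norm ?w * ?k)"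
      by (rule order_trans[OF abs_triangle_ineq add_mono[OF order_trans[OF abs_triangle_ineq add_mono[OF r1 r2]] r3]])
    also have "\<dots> \<le> (C1 * M4) * (err v \<Xi> ?z + err v\<^sub>0 \<Xi>\<^sub>0 ?z) + C2 * c * M3 * (3 * (err v \<Xi> ?z + err v\<^sub>0 \<Xi>\<^sub>0 ?z))
        + C3 * (3 * (err v \<Xi> ?z + err v\<^sub>0 \<Xi>\<^sub>0 ?z))"
      using pz pw C1(1) C2(1) C3 c(1) M3(1) M4(1) err_nonneg[of v\<^sub>0 \<Xi>\<^sub>0 ?z]
      by (intro add_mono mult_left_mono) auto
    finally show ?thesis unfolding eq by (simp add: algebra_simps)
  qed
  have "C1 * M4 + (C2 * c * M3 + C3) * 3 > 0"
    using C1(1) C2(1) C3 c(1) M3(1) M4(1) by (intro add_pos_pos mult_pos_pos) auto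
  then show ?thesis using main by blast
qed

end

section \<open>Integrability\<close>

lemma torus_integrable_bound:
  fixes f :: "vec3 \<Rightarrow> 'b::euclidean_space" and g :: "vec3 \<Rightarrow> real"
  assumes "integrable torus g" "f \<in> borel_measurable torus" "\<And>x. x \<in> cbox 0 1 \<Longrightarrow> norm (f x) \<le> g x"
  shows "integrable torus f"
proof (rule Bochner_Integration.integrable_bound[OF assms(1,2)])
  have "norm (f x) \<le> norm (g x)" if "x \<in> cbox 0 1" for x
    using assms(3)[OF that] by (simp add: order_trans[OF _ abs_ge_self])
  then show "AE x in torus. norm (f x) \<le> norm (g x)" by (intro AE_I2) simp
qed

lemma torus_integrable_const: "integrable torus (\<lambda>x. c :: real)"
  by (rule torus_integrable_continuous) simp

lemma norm_powr_2: "norm x powr 2 = (norm x)\<^sup>2"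
  by (cases "norm x = 0") (auto simp: powr_numeral)

lemma Lp_2_integrable: "Lp 2 f \<Longrightarrow> integrable torus (\<lambda>x. (norm (f x))\<^sup>2)"
  by (simp add: Lp_def norm_powr_2)

lemma Lp_lincomb:
  assumes "Lp q f" "Lp q g" "q \<ge> 0"
  shows "Lp q (\<lambda>x. a *\<^sub>R f x + b *\<^sub>R g x)"
proof -
  have m: "f \<in> borel_measurable lebesgue" "g \<in> borel_measurable lebesgue" using assms by (auto simp: Lp_def)
  then have m2: "(\<lambda>x. a *\<^sub>R f x + b *\<^sub>R g x) \<in> borel_measurable lebesgue" by measurable
  have "integrable torus (\<lambda>x. 2 powr q * (\<bar>a\<bar> powr q * norm (f x) powr q + \<bar>b\<bar> powr q * norm (g x) powr q))"
    using assms by (auto simp: Lp_def)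
  then have "integrable torus (\<lambda>x. norm (a *\<^sub>R f x + b *\<^sub>R g x) powr q)"
  proof (rule torus_integrable_bound)
    show "(\<lambda>x. norm (a *\<^sub>R f x + b *\<^sub>R g x) powr q) \<in> borel_measurable torus"
      using torus_measurable[OF m2] by measurable
    fix x
    have "norm (a *\<^sub>R f x + b *\<^sub>R g x) powr q \<le> (norm (a *\<^sub>R f x) + norm (b *\<^sub>R g x)) powr q"
      using assms(3) by (intro powr_mono2 norm_triangle_ineq) auto
    also have "\<dots> \<le> 2 powr q * (norm (a *\<^sub>R f x) powr q + norm (b *\<^sub>R g x) powr q)"
      using assms(3) by (intro powr_sum_le) auto
    finally show "norm (norm (a *\<^sub>R f x + b *\<^sub>R g x) powr q)
        \<le> 2 powr q * (\<bar>a\<bar> powr q * norm (f x) powr q + \<bar>b\<bar> powr q * norm (g x) powr q)"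
      by (simp add: powr_mult)
  qed
  moreover have "periodic (\<lambda>x. a *\<^sub>R f x + b *\<^sub>R g x)" using assms by (simp add: Lp_def periodic_def)
  ultimately show ?thesis using m2 by (simp add: Lp_def)
qed

lemma state_space_lincomb:
  assumes "(v, \<Xi>) \<in> state_space p" "(v', \<Xi>') \<in> state_space p" "p \<ge> 0"
  shows "(\<lambda>x. a *\<^sub>R v x + b *\<^sub>R v' x, \<lambda>x. a *\<^sub>R \<Xi> x + b *\<^sub>R \<Xi>' x) \<in> state_space p"
  using assms Lp_lincomb[of 2 v v' a b] Lp_lincomb[of p "\<lambda>x. fst (\<Xi> x)" "\<lambda>x. fst (\<Xi>' x)" a b]
    Lp_lincomb[of 2 "\<lambda>x. fst (snd (\<Xi> x))" "\<lambda>x. fst (snd (\<Xi>' x))" a b]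
    Lp_lincomb[of 2 "\<lambda>x. snd (snd (\<Xi> x))" "\<lambda>x. snd (snd (\<Xi>' x))" a b]
  by (simp add: state_space_def fst_add snd_add)

lemma state_measurable:
  assumes "(v, \<Xi>) \<in> state_space p"
  shows "v \<in> borel_measurable torus" "\<Xi> \<in> borel_measurable torus" "(\<lambda>x. fst (\<Xi> x)) \<in> borel_measurable torus"
proof -
  have m: "v \<in> borel_measurable torus" "(\<lambda>x. fst (\<Xi> x)) \<in> borel_measurable torus"
    "(\<lambda>x. fst (snd (\<Xi> x))) \<in> borel_measurable torus" "(\<lambda>x. snd (snd (\<Xi> x))) \<in> borel_measurable torus"
    using assms by (auto simp: state_space_def Lp_def intro: torus_measurable)
  then show "v \<in> borel_measurable torus" "(\<lambda>x. fst (\<Xi> x)) \<in> borel_measurable torus" by auto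
  have "(\<lambda>x. (fst (\<Xi> x), fst (snd (\<Xi> x)), snd (snd (\<Xi> x)))) \<in> borel_measurable torus"
    by (intro borel_measurable_Pair m)
  then show "\<Xi> \<in> borel_measurable torus" by simp
qed

lemma state_integrable:
  assumes "(v, \<Xi>) \<in> state_space p" "p \<ge> 2"
  shows "integrable torus (\<lambda>x. (norm (v x))\<^sup>2)" "integrable torus (\<lambda>x. norm (fst (\<Xi> x)) powr p)"
    "integrable torus (\<lambda>x. (norm (fst (\<Xi> x)))\<^sup>2)" "integrable torus (\<lambda>x. (norm (\<Xi> x))\<^sup>2)"
proof -
  have L: "Lp 2 v" "Lp p (\<lambda>x. fst (\<Xi> x))" "Lp 2 (\<lambda>x. fst (snd (\<Xi> x)))" "Lp 2 (\<lambda>x. snd (snd (\<Xi> x)))"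
    using assms by (auto simp: state_space_def)
  show v: "integrable torus (\<lambda>x. (norm (v x))\<^sup>2)" by (rule Lp_2_integrable[OF L(1)])
  show Fp: "integrable torus (\<lambda>x. norm (fst (\<Xi> x)) powr p)" using L(2) by (simp add: Lp_def)
  have "integrable torus (\<lambda>x. 1 + norm (fst (\<Xi> x)) powr p)"
    by (intro Bochner_Integration.integrable_add torus_integrable_const Fp)
  then show F2: "integrable torus (\<lambda>x. (norm (fst (\<Xi> x)))\<^sup>2)"
  proof (rule torus_integrable_bound)
    show "(\<lambda>x. (norm (fst (\<Xi> x)))\<^sup>2) \<in> borel_measurable torus"
      using state_measurable(3)[OF assms(1)] by measurable
    fix x
    show "norm ((norm (fst (\<Xi> x)))\<^sup>2) \<le> 1 + norm (fst (\<Xi> x)) powr p"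
    proof (cases "norm (fst (\<Xi> x)) \<le> 1")
      case True
      then have "(norm (fst (\<Xi> x)))\<^sup>2 \<le> 1" by (simp add: power_le_one)
      then show ?thesis by (simp add: add_increasing2)
    next
      case False
      then have "norm (fst (\<Xi> x)) powr 2 \<le> norm (fst (\<Xi> x)) powr p" using assms(2) by (intro powr_mono) auto
      then show ?thesis by (simp add: norm_powr_2 add_increasing)
    qed
  qed
  have "integrable torus (\<lambda>x. (norm (fst (\<Xi> x)))\<^sup>2 + ((norm (fst (snd (\<Xi> x))))\<^sup>2 + (norm (snd (snd (\<Xi> x))))\<^sup>2))"
    by (intro Bochner_Integration.integrable_add F2 Lp_2_integrable L)
  moreover have "(norm X)\<^sup>2 = (norm (fst X))\<^sup>2 + ((norm (fst (snd X)))\<^sup>2 + (norm (snd (snd X)))\<^sup>2)" for X :: xi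
    by (simp add: norm_prod_def)
  ultimately show "integrable torus (\<lambda>x. (norm (\<Xi> x))\<^sup>2)" by simp
qed

lemma integrable_square_add:
  fixes f g :: "vec3 \<Rightarrow> 'b::euclidean_space"
  assumes "f \<in> borel_measurable torus" "g \<in> borel_measurable torus"
    "integrable torus (\<lambda>x. (norm (f x))\<^sup>2)" "integrable torus (\<lambda>x. (norm (g x))\<^sup>2)"
  shows "integrable torus (\<lambda>x. (norm (f x - g x))\<^sup>2)" "integrable torus (\<lambda>x. f x \<bullet> g x)"
proof -
  have i: "integrable torus (\<lambda>x. 2 * ((norm (f x))\<^sup>2 + (norm (g x))\<^sup>2))" using assms by auto
  show "integrable torus (\<lambda>x. (norm (f x - g x))\<^sup>2)"
  proof (rule torus_integrable_bound[OF i])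
    show "(\<lambda>x. (norm (f x - g x))\<^sup>2) \<in> borel_measurable torus" using assms by measurable
    fix x
    have "(norm (f x - g x))\<^sup>2 \<le> (norm (f x) + norm (g x))\<^sup>2"
      by (intro power_mono norm_triangle_ineq4) auto
    also have "\<dots> \<le> 2 * ((norm (f x))\<^sup>2 + (norm (g x))\<^sup>2)"
      using sum_squares_bound[of "norm (f x)" "norm (g x)"] by (simp add: power2_sum)
    finally show "norm ((norm (f x - g x))\<^sup>2) \<le> 2 * ((norm (f x))\<^sup>2 + (norm (g x))\<^sup>2)" by simp
  qed
  show "integrable torus (\<lambda>x. f x \<bullet> g x)"
  proof (rule torus_integrable_bound[OF i])
    show "(\<lambda>x. f x \<bullet> g x) \<in> borel_measurable torus" by (intro borel_measurable_inner assms)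
    fix x
    have "\<bar>f x \<bullet> g x\<bar> \<le> norm (f x) * norm (g x)" by (rule Cauchy_Schwarz_ineq2)
    also have "\<dots> \<le> 2 * ((norm (f x))\<^sup>2 + (norm (g x))\<^sup>2)"
      using mult_le_sum_squares[of "norm (f x)" "norm (g x)"] zero_le_power2[of "norm (f x)"] zero_le_power2[of "norm (g x)"]
      unfolding distrib_left by linarith
    finally show "norm (f x \<bullet> g x) \<le> 2 * ((norm (f x))\<^sup>2 + (norm (g x))\<^sup>2)" by simp
  qed
qed

lemma dPhi_bound: "\<exists>K>0. \<forall>F i \<alpha>. norm (dPhi F i \<alpha>) \<le> K * (1 + (norm F)\<^sup>2)"
proof -
  obtain c where c: "c > 0" "\<And>F E. norm (DPhi F E - DPhi 0 E) \<le> c * (norm F + (norm F)\<^sup>2) * norm E"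
    using DPhi_diff_bound[of 0] by (metis diff_zero norm_zero order_refl)
  define N where "N = (\<Sum>i\<in>(UNIV::3 set). \<Sum>\<alpha>\<in>UNIV. norm (dPhi 0 i \<alpha>))"
  have "norm (dPhi F i \<alpha>) \<le> (2 * c + N) * (1 + (norm F)\<^sup>2)" for F i \<alpha>
  proof -
    have n: "norm (axis i (axis \<alpha> 1) :: mat3) = 1" by (simp add: norm_eq_sqrt_inner inner_axis_axis)
    have "norm (dPhi 0 i \<alpha>) \<le> (\<Sum>\<alpha>\<in>UNIV. norm (dPhi 0 i \<alpha>))" by (rule member_le_sum) auto
    also have "\<dots> \<le> N" unfolding N_def
      by (rule member_le_sum[where f = "\<lambda>i. \<Sum>\<alpha>\<in>UNIV. norm (dPhi 0 i \<alpha>)"]) (auto intro: sum_nonneg)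
    finally have N: "norm (dPhi 0 i \<alpha>) \<le> N" .
    then have N0: "N \<ge> 0" by (rule order_trans[OF norm_ge_zero])
    have "norm (dPhi F i \<alpha>) \<le> c * (norm F + (norm F)\<^sup>2) + N"
      using c(2)[of F "axis i (axis \<alpha> 1)"] norm_triangle_sub[of "dPhi F i \<alpha>" "dPhi 0 i \<alpha>"] N
      by (simp add: dPhi_eq n)
    also have "\<dots> \<le> c * (2 * (1 + (norm F)\<^sup>2)) + N * (1 + (norm F)\<^sup>2)"
    proof (rule add_mono)
      show "c * (norm F + (norm F)\<^sup>2) \<le> c * (2 * (1 + (norm F)\<^sup>2))"
        using c(1) le_one_plus_square[of "norm F"] by (intro mult_left_mono) auto
      show "N \<le> N * (1 + (norm F)\<^sup>2)" using N0 by (simp add: distrib_left)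
    qed
    finally show ?thesis by (simp add: algebra_simps)
  qed
  moreover have "2 * c + N > 0" unfolding N_def using c(1) by (intro add_pos_nonneg sum_nonneg) auto
  ultimately show ?thesis by blast
qed

lemma continuous_dPhi: "continuous_on UNIV (\<lambda>F. dPhi F i \<alpha>)"
  unfolding dPhi_def using Ck_on_continuous[OF Ck_on_dderiv[OF Ck_on_Phi[of "Suc 0"]]] by blast

lemma measurable_dPhi:
  "f \<in> borel_measurable torus \<Longrightarrow> (\<lambda>x. dPhi (f x) i \<alpha>) \<in> borel_measurable torus"
  by (rule measurable_compose[OF _ borel_measurable_continuous_onI[OF continuous_dPhi]])

context stored_energy
begin

lemma G_measurable: "\<Xi> \<in> borel_measurable torus \<Longrightarrow> (\<lambda>x. G (\<Xi> x)) \<in> borel_measurable torus"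
  by (rule measurable_compose[OF _ borel_measurable_continuous_onI[OF Ck_on_continuous[OF G_C3]]])

lemma grad_G_measurable: "\<Xi> \<in> borel_measurable torus \<Longrightarrow> (\<lambda>x. grad G (\<Xi> x)) \<in> borel_measurable torus"
  by (rule measurable_compose[OF _ borel_measurable_continuous_onI[OF Ck_on_continuous[OF grad_G_C2]]])

lemma G_integrable:
  assumes s: "(v, \<Xi>) \<in> state_space p"
  shows "integrable torus (\<lambda>x. G (\<Xi> x))"
proof -
  have "p \<ge> 2" using p6 by simp
  note i = state_integrable[OF s this]
  have c5: "c5 > 0" "\<And>F Z w. G (F, Z, w) \<le> c5 * (norm F powr p + (norm Z)\<^sup>2 + \<bar>w\<bar>\<^sup>2 + 1)"
    using H3 by (simp_all add: H3_def)
  have "integrable torus (\<lambda>x. c5 * (norm (fst (\<Xi> x)) powr p + (norm (\<Xi> x))\<^sup>2 + 1))"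
    using i torus_integrable_const[of 1] by auto
  then show ?thesis
  proof (rule torus_integrable_bound[OF _ G_measurable[OF state_measurable(2)[OF s]]])
    fix x
    obtain F Z w where X: "\<Xi> x = (F, Z, w)" by (cases "\<Xi> x")
    have "G (\<Xi> x) \<le> c5 * (norm F powr p + (norm Z)\<^sup>2 + \<bar>w\<bar>\<^sup>2 + 1)" unfolding X by (rule c5)
    also have "\<dots> \<le> c5 * (norm (fst (\<Xi> x)) powr p + (norm (\<Xi> x))\<^sup>2 + 1)"
      using c5(1) by (intro mult_left_mono) (auto simp: X norm_prod_def)
    finally show "norm (G (\<Xi> x)) \<le> c5 * (norm (fst (\<Xi> x)) powr p + (norm (\<Xi> x))\<^sup>2 + 1)"
      using G_nonneg[of "\<Xi> x"] by simp
  qed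
qed

text \<open>Comparing the minimiser with the competitors \<open>((1 - \<theta>) v, (1 - \<theta>) \<Xi> + \<theta> \<Xi>\<^sub>0)\<close>, which are
  admissible because \<open>(0, \<Xi>\<^sub>0)\<close> is, gives the decrease of the energy as \<open>\<theta> \<rightarrow> 0\<close>. No regularity of
  \<open>v\<close> enters, as it would in testing the momentum balance with \<open>v\<close>.\<close>

lemma energy_decrease:
  assumes s0: "(v\<^sub>0, \<Xi>\<^sub>0) \<in> state_space p" and s: "(v, \<Xi>) \<in> state_space p"
    and um: "unique_minimizer p G h v\<^sub>0 \<Xi>\<^sub>0 v \<Xi>"
  shows "(LINT x|torus. (norm (v x))\<^sup>2 / 2 + G (\<Xi> x)) \<le> (LINT x|torus. (norm (v\<^sub>0 x))\<^sup>2 / 2 + G (\<Xi>\<^sub>0 x))"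
proof -
  have p2: "p \<ge> 2" "p \<ge> 0" using p6 by simp_all
  note m = state_measurable[OF s] and m0 = state_measurable[OF s0]
  note i = state_integrable[OF s p2(1)] and i0 = state_integrable[OF s0 p2(1)]
  have J: "functional_J G v\<^sub>0 v' \<Xi>' = ennreal (LINT x|torus. (norm (v' x - v\<^sub>0 x))\<^sup>2 / 2 + G (\<Xi>' x))"
    and Jint: "integrable torus (\<lambda>x. (norm (v' x - v\<^sub>0 x))\<^sup>2 / 2 + G (\<Xi>' x))"
    if "(v', \<Xi>') \<in> state_space p" for v' \<Xi>'
  proof -
    note m' = state_measurable[OF that] and i' = state_integrable[OF that p2(1)]
    show int: "integrable torus (\<lambda>x. (norm (v' x - v\<^sub>0 x))\<^sup>2 / 2 + G (\<Xi>' x))"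
      using integrable_square_add(1)[OF m'(1) m0(1) i'(1) i0(1)] G_integrable[OF that] by auto
    show "functional_J G v\<^sub>0 v' \<Xi>' = ennreal (LINT x|torus. (norm (v' x - v\<^sub>0 x))\<^sup>2 / 2 + G (\<Xi>' x))"
      unfolding functional_J_def by (rule nn_integral_eq_integral[OF int]) (use G_nonneg in auto)
  qed
  have kc: "kinematic_constraint h \<Xi>\<^sub>0 v \<Xi>" using um by (simp add: unique_minimizer_def admissible_def)
  let ?I = "\<lambda>v \<Xi>. LINT x|torus. (norm (v x - v\<^sub>0 x))\<^sup>2 / 2 + G (\<Xi> x)"
  define E where "E = (LINT x|torus. (norm (v x))\<^sup>2 / 2 + G (\<Xi> x))"
  define E0 where "E0 = (LINT x|torus. (norm (v\<^sub>0 x))\<^sup>2 / 2 + G (\<Xi>\<^sub>0 x))"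
  define D where "D = (LINT x|torus. (norm (v x - v\<^sub>0 x))\<^sup>2 / 2)"
  define N where "N = (LINT x|torus. (norm (v x))\<^sup>2 / 2)"
  have vi: "integrable torus (\<lambda>x. (norm (v x))\<^sup>2 / 2)" "integrable torus (\<lambda>x. (norm (v\<^sub>0 x))\<^sup>2 / 2)"
    "integrable torus (\<lambda>x. (norm (v x - v\<^sub>0 x))\<^sup>2 / 2)"
    using i(1) i0(1) integrable_square_add(1)[OF m(1) m0(1) i(1) i0(1)] by auto
  note Gi = G_integrable[OF s] G_integrable[OF s0]
  have key: "E - E0 + D \<le> \<theta> * N" if \<theta>: "0 < \<theta>" "\<theta> < 1" for \<theta>
  proof -
    let ?v = "\<lambda>x. (1 - \<theta>) *\<^sub>R v x" and ?X = "\<lambda>x. (1 - \<theta>) *\<^sub>R \<Xi> x + \<theta> *\<^sub>R \<Xi>\<^sub>0 x"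
    have st: "(?v, ?X) \<in> state_space p"
    proof -
      have "(\<lambda>x. (1 - \<theta>) *\<^sub>R v x + 0 *\<^sub>R v\<^sub>0 x, \<lambda>x. (1 - \<theta>) *\<^sub>R \<Xi> x + 0 *\<^sub>R \<Xi>\<^sub>0 x) \<in> state_space p"
        by (rule state_space_lincomb[OF s s0 p2(2)])
      moreover have "(\<lambda>x. (1 - \<theta>) *\<^sub>R v x + \<theta> *\<^sub>R v\<^sub>0 x, ?X) \<in> state_space p"
        by (rule state_space_lincomb[OF s s0 p2(2)])
      ultimately show ?thesis by (simp add: state_space_def)
    qed
    have "kinematic_constraint h \<Xi>\<^sub>0 ?v ?X"
      unfolding kinematic_constraint_def weak_div_def
    proof (intro ballI allI impI)
      fix A :: xi and \<phi> assume A: "A \<in> Basis" and \<phi>: "test_function \<phi>"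
      let ?f = "\<lambda>x. (\<Xi> x \<bullet> A - \<Xi>\<^sub>0 x \<bullet> A) / h * \<phi> x"
      let ?g = "\<lambda>x. \<Sum>\<alpha>\<in>UNIV. (\<Sum>i\<in>UNIV. (dPhi (fst (\<Xi>\<^sub>0 x)) i \<alpha> \<bullet> A) * v x $ i) * partial \<alpha> \<phi> x"
      have "(LINT x|torus. ?f x) = - (LINT x|torus. ?g x)"
        using kc A \<phi> by (simp add: kinematic_constraint_def weak_div_def)
      then have "(LINT x|torus. (1 - \<theta>) * ?f x) = - (LINT x|torus. (1 - \<theta>) * ?g x)"
        by (simp only: integral_mult_right_zero mult_minus_right)
      moreover have "(?X x \<bullet> A - \<Xi>\<^sub>0 x \<bullet> A) / h * \<phi> x = (1 - \<theta>) * ?f x" for x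
        by (simp add: inner_add_left diff_divide_distrib add_divide_distrib algebra_simps)
      moreover have "(\<Sum>\<alpha>\<in>UNIV. (\<Sum>i\<in>UNIV. (dPhi (fst (\<Xi>\<^sub>0 x)) i \<alpha> \<bullet> A) * ?v x $ i) * partial \<alpha> \<phi> x) = (1 - \<theta>) * ?g x" for x
        by (simp add: sum_distrib_left sum_distrib_right mult_ac)
      ultimately show "(LINT x|torus. (?X x \<bullet> A - \<Xi>\<^sub>0 x \<bullet> A) / h * \<phi> x) =
          - (LINT x|torus. (\<Sum>\<alpha>\<in>UNIV. (\<Sum>i\<in>UNIV. (dPhi (fst (\<Xi>\<^sub>0 x)) i \<alpha> \<bullet> A) * ?v x $ i) * partial \<alpha> \<phi> x))"
        by (simp only:)
    qed
    then have "(?v, ?X) \<in> admissible p h \<Xi>\<^sub>0" using st by (simp add: admissible_def)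
    then have "functional_J G v\<^sub>0 v \<Xi> \<le> functional_J G v\<^sub>0 ?v ?X" using um by (auto simp: unique_minimizer_def)
    then have "?I v \<Xi> \<le> ?I ?v ?X"
      unfolding J[OF s] J[OF st]
      by (subst (asm) ennreal_le_iff) (auto intro!: Bochner_Integration.integral_nonneg add_nonneg_nonneg G_nonneg)
    also have "\<dots> \<le> (LINT x|torus. (1 - \<theta>) * ((norm (v x - v\<^sub>0 x))\<^sup>2 / 2) + \<theta> * ((norm (v\<^sub>0 x))\<^sup>2 / 2)
        - \<theta> * (1 - \<theta>) * ((norm (v x))\<^sup>2 / 2) + (1 - \<theta>) * G (\<Xi> x) + \<theta> * G (\<Xi>\<^sub>0 x))"
    proof (rule integral_mono[OF Jint[OF st]])
      show "integrable torus (\<lambda>x. (1 - \<theta>) * ((norm (v x - v\<^sub>0 x))\<^sup>2 / 2) + \<theta> * ((norm (v\<^sub>0 x))\<^sup>2 / 2)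
        - \<theta> * (1 - \<theta>) * ((norm (v x))\<^sup>2 / 2) + (1 - \<theta>) * G (\<Xi> x) + \<theta> * G (\<Xi>\<^sub>0 x))"
        by (intro Bochner_Integration.integrable_add Bochner_Integration.integrable_diff integrable_mult_right vi Gi)
      fix x
      have "(norm (?v x - v\<^sub>0 x))\<^sup>2 = (1 - \<theta>) * (norm (v x - v\<^sub>0 x))\<^sup>2 + \<theta> * (norm (v\<^sub>0 x))\<^sup>2 - \<theta> * (1 - \<theta>) * (norm (v x))\<^sup>2"
        by (simp add: power2_norm_eq_inner inner_diff_left inner_diff_right inner_commute algebra_simps)
      moreover have "G (?X x) \<le> (1 - \<theta>) * G (\<Xi> x) + \<theta> * G (\<Xi>\<^sub>0 x)"
      proof -
        obtain m where m: "m > 0" "\<And>x y t. 0 \<le> t \<Longrightarrow> t \<le> 1 \<Longrightarrow>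
            G ((1 - t) *\<^sub>R x + t *\<^sub>R y) \<le> (1 - t) * G x + t * G y - m / 2 * t * (1 - t) * (norm (x - y))\<^sup>2"
          using G_convex by blast
        have "0 \<le> m / 2 * \<theta> * (1 - \<theta>) * (norm (\<Xi> x - \<Xi>\<^sub>0 x))\<^sup>2" using m(1) \<theta> by simp
        then show ?thesis using m(2)[of \<theta> "\<Xi> x" "\<Xi>\<^sub>0 x"] \<theta> by linarith
      qed
      ultimately show "(norm (?v x - v\<^sub>0 x))\<^sup>2 / 2 + G (?X x) \<le> (1 - \<theta>) * ((norm (v x - v\<^sub>0 x))\<^sup>2 / 2) + \<theta> * ((norm (v\<^sub>0 x))\<^sup>2 / 2)
        - \<theta> * (1 - \<theta>) * ((norm (v x))\<^sup>2 / 2) + (1 - \<theta>) * G (\<Xi> x) + \<theta> * G (\<Xi>\<^sub>0 x)"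
        by (simp add: diff_divide_distrib add_divide_distrib)
    qed
    also have "\<dots> = (1 - \<theta>) * D + \<theta> * (LINT x|torus. (norm (v\<^sub>0 x))\<^sup>2 / 2) - \<theta> * (1 - \<theta>) * N
        + (1 - \<theta>) * (LINT x|torus. G (\<Xi> x)) + \<theta> * (LINT x|torus. G (\<Xi>\<^sub>0 x))"
    proof -
      have "(LINT x|torus. k1 * a x + k2 * b x - k3 * c x + k4 * d x + k5 * e x) =
          k1 * (LINT x|torus. a x) + k2 * (LINT x|torus. b x) - k3 * (LINT x|torus. c x)
          + k4 * (LINT x|torus. d x) + k5 * (LINT x|torus. e x)"
        if "integrable torus a" "integrable torus b" "integrable torus c" "integrable torus d" "integrable torus e"
        for k1 k2 k3 k4 k5 :: real and a b c d e
        using that by simp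
      from this[OF vi(3) vi(2) vi(1) Gi] show ?thesis unfolding D_def N_def .
    qed
    finally have "D + (LINT x|torus. G (\<Xi> x)) \<le> \<dots>" using vi Gi by (simp add: D_def)
    moreover have "E = N + (LINT x|torus. G (\<Xi> x))" "E0 = (LINT x|torus. (norm (v\<^sub>0 x))\<^sup>2 / 2) + (LINT x|torus. G (\<Xi>\<^sub>0 x))"
      using vi Gi by (simp_all add: E_def E0_def N_def)
    ultimately have "\<theta> * (E - E0 + D) \<le> \<theta> * (\<theta> * N)" by (simp add: algebra_simps)
    then show ?thesis using \<theta> by simp
  qed
  have D0: "D \<ge> 0" and N0: "N \<ge> 0" unfolding D_def N_def by (simp_all add: Bochner_Integration.integral_nonneg)
  have "E \<le> E0 + e" if "e > 0" for e
  proof -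
    define \<theta> where "\<theta> = min (1 / 2) (e / (N + 1))"
    have \<theta>: "0 < \<theta>" "\<theta> < 1" "\<theta> \<le> e / (N + 1)" using that N0 by (auto simp: \<theta>_def)
    have "\<theta> * N \<le> e / (N + 1) * (N + 1)" using \<theta> N0 by (intro mult_mono) auto
    then have "\<theta> * N \<le> e" using N0 by simp
    then show ?thesis using key[OF \<theta>(1,2)] D0 by linarith
  qed
  then have "E \<le> E0" by (rule field_le_epsilon)
  then show ?thesis by (simp add: E_def E0_def)
qed

end

section \<open>One step of the scheme\<close>

lemma axis_row: "axis i w = (\<Sum>\<alpha>\<in>UNIV. w $ \<alpha> *\<^sub>R axis i (axis \<alpha> 1))" for w :: vec3 and i :: 3
  by (simp add: vec_eq_iff sum_3 forall_3 axis_def)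

lemma DPhi_row: "DPhi F (axis i w) = (\<Sum>\<alpha>\<in>UNIV. w $ \<alpha> *\<^sub>R dPhi F i \<alpha>)"
proof -
  interpret bounded_linear "DPhi F" by (rule bounded_linear_DPhi)
  show ?thesis by (subst axis_row) (simp only: sum scaleR dPhi_eq)
qed

context smooth_flow
begin

lemma slice_continuous:
  fixes f :: "real \<times> vec3 \<Rightarrow> 'b::topological_space"
  assumes "t \<in> {0..T}" "continuous_on U f"
  shows "continuous_on (cbox 0 1) (\<lambda>x. f (t, x))"
  by (rule continuous_on_compose2[OF assms(2)]) (use in_U[OF assms(1)] in \<open>auto intro!: continuous_intros\<close>)

lemma slice_integrable:
  fixes f :: "real \<times> vec3 \<Rightarrow> 'b::euclidean_space"
  assumes "t \<in> {0..T}" "continuous_on U f"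
  shows "integrable torus (\<lambda>x. f (t, x))" "(\<lambda>x. f (t, x)) \<in> borel_measurable torus"
    "integrable torus (\<lambda>x. (norm (f (t, x)))\<^sup>2)"
  using slice_continuous[OF assms]
  by (auto intro!: torus_integrable_continuous torus_measurable_continuous continuous_intros)

lemma eta_integrable:
  assumes t: "t \<in> {0..T}" and s: "(v, \<Xi>) \<in> state_space p"
  shows "integrable torus (\<lambda>x. eta (v x) (\<Xi> x) (t, x))"
proof -
  have "p \<ge> 2" using p6 by simp
  note m = state_measurable[OF s] and i = state_integrable[OF s this]
  have "integrable torus (\<lambda>x. Vb (t, x) \<bullet> v x)"
    by (rule integrable_square_add(2)[OF slice_integrable(2)[OF t continuous_Vb] m(1) slice_integrable(3)[OF t continuous_Vb] i(1)])
  moreover have "integrable torus (\<lambda>x. gb (t, x) \<bullet> \<Xi> x)"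
    by (rule integrable_square_add(2)[OF slice_integrable(2)[OF t continuous_gb] m(2) slice_integrable(3)[OF t continuous_gb] i(4)])
  moreover have "integrable torus (\<lambda>x. eta0 (t, x))"
    by (rule slice_integrable(1)[OF t Ck_on_continuous[OF eta0_C2]])
  ultimately show ?thesis unfolding eta_expand using i(1) G_integrable[OF s] by simp
qed

lemma err_integrable:
  assumes t: "t \<in> {0..T}" and s: "(v, \<Xi>) \<in> state_space p"
  shows "integrable torus (\<lambda>x. err (v x) (\<Xi> x) (t, x))"
proof -
  obtain C where C: "C > 0" "\<And>t x v \<Xi>. t \<in> {0..T} \<Longrightarrow> x \<in> cbox 0 1 \<Longrightarrow> err v \<Xi> (t, x) \<le> C * eta v \<Xi> (t, x)"
    using eta_coercive by blast
  note m = state_measurable[OF s]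
  have "integrable torus (\<lambda>x. C * eta (v x) (\<Xi> x) (t, x))" using eta_integrable[OF assms] by simp
  then show ?thesis
  proof (rule torus_integrable_bound)
    note [measurable] = m slice_integrable(2)[OF t continuous_Vb] slice_integrable(2)[OF t continuous_Xb]
      slice_integrable(2)[OF t continuous_Fb]
    show "(\<lambda>x. err (v x) (\<Xi> x) (t, x)) \<in> borel_measurable torus"
      unfolding err_def by measurable
    show "norm (err (v x) (\<Xi> x) (t, x)) \<le> C * eta (v x) (\<Xi> x) (t, x)" if "x \<in> cbox 0 1" for x
      using C(2)[OF t that] err_nonneg by simp
  qed
qed

text \<open>The relative entropy of a state with respect to the smooth solution at time \<open>t\<close>.\<close>

definition ent :: "(vec3 \<Rightarrow> vec3) \<Rightarrow> (vec3 \<Rightarrow> xi) \<Rightarrow> real \<Rightarrow> real" where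
  "ent v \<Xi> t = (LINT x|torus. eta (v x) (\<Xi> x) (t, x))"

text \<open>Near infinity \<open>grad G\<close> is only of order \<open>p - 1\<close> in its component belonging to \<open>F\<close>, but there the
  derivative of the minors is constant; in the other components \<open>grad G\<close> grows linearly and the
  derivative of the minors quadratically in \<open>F\<close>.\<close>

lemma stress_bound:
  "\<exists>C>0. \<forall>t\<in>{0..T}. \<forall>x\<in>cbox 0 1. \<forall>v \<Xi> v\<^sub>0 \<Xi>\<^sub>0 i \<alpha>.
     \<bar>grad G \<Xi> \<bullet> dPhi (fst \<Xi>\<^sub>0) i \<alpha>\<bar> \<le> C * (1 + err v \<Xi> (t, x) + err v\<^sub>0 \<Xi>\<^sub>0 (t, x))"
proof -
  obtain M1 where M1: "M1 > 0" "\<And>t x. t \<in> {0..T} \<Longrightarrow> x \<in> cbox 0 1 \<Longrightarrow> norm (Fb (t, x)) \<le> M1"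
    using slab_bounded[OF continuous_Fb] by blast
  obtain M2 where M2: "M2 > 0" "\<And>t x. t \<in> {0..T} \<Longrightarrow> x \<in> cbox 0 1 \<Longrightarrow> norm (Xb (t, x)) \<le> M2"
    using slab_bounded[OF continuous_Xb] by blast
  obtain M3 where M3: "M3 > 0" "\<And>t x. t \<in> {0..T} \<Longrightarrow> x \<in> cbox 0 1 \<Longrightarrow> norm (gb (t, x)) \<le> M3"
    using slab_bounded[OF continuous_gb] by blast
  have "\<forall>b. \<exists>M>0. \<forall>t\<in>{0..T}. \<forall>x\<in>cbox 0 1. norm (dderiv b (grad G) (Xb (t, x))) \<le> M"
  proof
    fix b
    have "Ck_on (Suc 1) UNIV (grad G)" using grad_G_C2 by (simp only: Suc_1)
    from Ck_on_continuous[OF Ck_on_dderiv[OF this]]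
    have "continuous_on U (\<lambda>z. dderiv b (grad G) (Xb z))"
      by (rule continuous_on_compose2[OF _ continuous_Xb]) simp
    then show "\<exists>M>0. \<forall>t\<in>{0..T}. \<forall>x\<in>cbox 0 1. norm (dderiv b (grad G) (Xb (t, x))) \<le> M"
      by (rule slab_bounded)
  qed
  then obtain MH where MH: "\<And>b. MH b > 0" "\<And>b t x. t \<in> {0..T} \<Longrightarrow> x \<in> cbox 0 1 \<Longrightarrow> norm (dderiv b (grad G) (Xb (t, x))) \<le> MH b"
    by metis
  define M4 where "M4 = (\<Sum>b\<in>Basis. MH b)"
  have M4: "M4 \<ge> 0" unfolding M4_def by (intro sum_nonneg less_imp_le MH(1))
  have hess: "norm (dderiv z (grad G) (Xb (t, x))) \<le> M4 * norm z" if tx: "t \<in> {0..T}" "x \<in> cbox 0 1" for t x z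
  proof -
    have d: "grad G differentiable (at X)" for X using Ck_on_differentiable[OF grad_G_C2] by simp
    have "norm (dderiv z (grad G) (Xb (t, x))) \<le> (\<Sum>b\<in>Basis. norm ((z \<bullet> b) *\<^sub>R dderiv b (grad G) (Xb (t, x))))"
      unfolding dderiv_Basis_sum[OF d, of z] by (rule norm_sum)
    also have "\<dots> \<le> (\<Sum>b\<in>Basis. norm z * MH b)"
      unfolding norm_scaleR by (intro sum_mono mult_mono Basis_le_norm MH(2) tx) auto
    finally show ?thesis by (simp add: M4_def sum_distrib_left sum_distrib_right mult.commute)
  qed
  obtain c where c: "c > 0" "\<And>F F' E. norm F' \<le> M1 \<Longrightarrow>
     norm (DPhi F E - DPhi F' E) \<le> c * (norm (F - F') + (norm (F - F'))\<^sup>2) * norm E"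
    using DPhi_diff_bound[of M1] M1(1) by (metis less_imp_le)
  obtain C1 where C1: "C1 > 0" "\<And>\<Xi> \<Xi>'. norm \<Xi>' \<le> M2 \<Longrightarrow>
    norm (grad G \<Xi> - grad G \<Xi>' - dderiv (\<Xi> - \<Xi>') (grad G) \<Xi>') \<le> C1 * ((norm (\<Xi> - \<Xi>'))\<^sup>2 + norm (fst \<Xi> - fst \<Xi>') powr p)"
    using dG_taylor[of M2] M2(1) by (metis less_imp_le)
  obtain C2 where C2: "C2 > 0" "\<And>\<Xi> \<Xi>'. norm (snd (grad G \<Xi> - grad G \<Xi>')) \<le> C2 * norm (\<Xi> - \<Xi>')"
    using dG_lipschitz by blast
  obtain K where K: "K > 0" "\<And>F i \<alpha>. norm (dPhi F i \<alpha>) \<le> K * (1 + (norm F)\<^sup>2)"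
    using dPhi_bound by blast
  define MP where "MP = K * (1 + M1\<^sup>2)"
  have MP: "MP > 0" unfolding MP_def using K(1) by (intro mult_pos_pos add_pos_nonneg) auto
  define D where "D = C2 * c * 3 + C1 * MP + M4 * MP + M3 * K * (3 + 2 * M1\<^sup>2)"
  have "\<bar>grad G \<Xi> \<bullet> dPhi (fst \<Xi>\<^sub>0) i \<alpha>\<bar> \<le> D * (1 + err v \<Xi> (t, x) + err v\<^sub>0 \<Xi>\<^sub>0 (t, x))"
    if tx: "t \<in> {0..T}" "x \<in> cbox 0 1" for t x v \<Xi> v\<^sub>0 \<Xi>\<^sub>0 i \<alpha>
  proof -
    let ?z = "(t, x)" and ?Q = "dPhi (fst \<Xi>\<^sub>0) i \<alpha>" and ?P = "dPhi (Fb (t, x)) i \<alpha>"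
    let ?Z = "\<Xi> - Xb ?z" and ?K = "fst \<Xi>\<^sub>0 - Fb ?z"
    let ?a = "grad G \<Xi> - grad G (Xb ?z)" and ?d = "dderiv (\<Xi> - Xb ?z) (grad G) (Xb ?z)"
    let ?e = "1 + err v \<Xi> ?z + err v\<^sub>0 \<Xi>\<^sub>0 ?z"
    have e0: "err v \<Xi> ?z \<ge> 0" "err v\<^sub>0 \<Xi>\<^sub>0 ?z \<ge> 0" by (rule err_nonneg)+
    have Zsq: "(norm ?Z)\<^sup>2 + norm (fst \<Xi> - Fb ?z) powr p \<le> err v \<Xi> ?z" by (simp add: err_def)
    have Zsq': "(norm ?Z)\<^sup>2 \<le> err v \<Xi> ?z" by (simp add: err_def)
    have P: "norm ?P \<le> MP"
    proof -
      have "norm ?P \<le> K * (1 + (norm (Fb ?z))\<^sup>2)" by (rule K)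
      also have "\<dots> \<le> MP" unfolding MP_def using M1(2)[OF tx] K(1) by (intro mult_left_mono add_left_mono power_mono) auto
      finally show ?thesis .
    qed
    have b1: "\<bar>?a \<bullet> (?Q - ?P)\<bar> \<le> C2 * c * 3 * ?e"
    proof -
      have f0: "fst (?Q - ?P) = 0" unfolding dPhi_eq DPhi_diff by simp
      have "?a \<bullet> (?Q - ?P) = fst ?a \<bullet> fst (?Q - ?P) + snd ?a \<bullet> snd (?Q - ?P)" by (rule inner_prod_def)
      also have "\<dots> = snd ?a \<bullet> snd (?Q - ?P)" unfolding f0 by simp
      finally have "\<bar>?a \<bullet> (?Q - ?P)\<bar> \<le> norm (snd ?a) * norm (snd (?Q - ?P))" using Cauchy_Schwarz_ineq2 by metis
      also have "\<dots> \<le> (C2 * norm ?Z) * (c * (norm ?K + (norm ?K)\<^sup>2))"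
      proof (rule mult_mono[OF C2(2)])
        have n: "norm (axis i (axis \<alpha> 1) :: mat3) = 1" by (simp add: norm_eq_sqrt_inner inner_axis_axis)
        have "norm (?Q - ?P) \<le> c * (norm ?K + (norm ?K)\<^sup>2) * norm (axis i (axis \<alpha> 1) :: mat3)"
          unfolding dPhi_eq by (rule c(2)[OF M1(2)[OF tx]])
        then have "norm (?Q - ?P) \<le> c * (norm ?K + (norm ?K)\<^sup>2)" by (simp only: n mult_1_right)
        then show "norm (snd (?Q - ?P)) \<le> c * (norm ?K + (norm ?K)\<^sup>2)"
          by (rule order_trans[OF norm_snd])
      qed (use C2(1) in simp_all)
      also have "\<dots> = C2 * c * (norm ?Z * (norm ?K + (norm ?K)\<^sup>2))" by (simp only: mult_ac)
      also have "\<dots> \<le> C2 * c * (3 * ?e)"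
      proof (rule mult_left_mono)
        have "norm ?Z * (norm ?K + (norm ?K)\<^sup>2) \<le> 3 * ((norm ?Z)\<^sup>2 + err v\<^sub>0 \<Xi>\<^sub>0 ?z)" by (rule minors_error)
        also have "\<dots> \<le> 3 * ?e" using Zsq' by simp
        finally show "norm ?Z * (norm ?K + (norm ?K)\<^sup>2) \<le> 3 * ?e" .
      qed (use C2(1) c(1) in simp)
      finally show ?thesis by (simp only: mult.assoc)
    qed
    have b2: "\<bar>(?a - ?d) \<bullet> ?P\<bar> \<le> C1 * MP * ?e"
    proof -
      have "\<bar>(?a - ?d) \<bullet> ?P\<bar> \<le> norm (?a - ?d) * norm ?P" by (rule Cauchy_Schwarz_ineq2)
      also have "\<dots> \<le> (C1 * ?e) * MP"
      proof (rule mult_mono[OF _ P])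
        have "norm (?a - ?d) \<le> C1 * ((norm ?Z)\<^sup>2 + norm (fst \<Xi> - Fb ?z) powr p)"
          using C1(2)[OF M2(2)[OF tx], of \<Xi>] by simp
        also have "\<dots> \<le> C1 * ?e" using Zsq e0 C1(1) by (intro mult_left_mono) auto
        finally show "norm (?a - ?d) \<le> C1 * ?e" .
      qed (use C1(1) e0 in auto)
      finally show ?thesis by (simp only: mult_ac)
    qed
    have b3: "\<bar>?d \<bullet> ?P\<bar> \<le> M4 * MP * ?e"
    proof -
      have "\<bar>?d \<bullet> ?P\<bar> \<le> norm ?d * norm ?P" by (rule Cauchy_Schwarz_ineq2)
      also have "\<dots> \<le> (M4 * ?e) * MP"
      proof (rule mult_mono[OF _ P])
        have "norm ?Z \<le> ?e" using le_one_plus_square[of "norm ?Z"] Zsq' e0 by linarith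
        then show "norm ?d \<le> M4 * ?e" using hess[OF tx, of ?Z] M4 by (meson mult_left_mono order_trans)
      qed (use M4 e0 in auto)
      finally show ?thesis by (simp only: mult_ac)
    qed
    have b4: "\<bar>grad G (Xb ?z) \<bullet> ?Q\<bar> \<le> M3 * K * (3 + 2 * M1\<^sup>2) * ?e"
    proof -
      have "\<bar>grad G (Xb ?z) \<bullet> ?Q\<bar> \<le> norm (grad G (Xb ?z)) * norm ?Q" by (rule Cauchy_Schwarz_ineq2)
      also have "\<dots> \<le> M3 * (K * ((3 + 2 * M1\<^sup>2) * ?e))"
      proof (rule mult_mono)
        show "norm (grad G (Xb ?z)) \<le> M3" using M3(2)[OF tx] by (simp add: gb_def)
        have "norm (fst \<Xi>\<^sub>0) \<le> norm ?K + M1"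
          using norm_triangle_sub[of "fst \<Xi>\<^sub>0" "Fb ?z"] M1(2)[OF tx] by linarith
        then have "(norm (fst \<Xi>\<^sub>0))\<^sup>2 \<le> (norm ?K + M1)\<^sup>2" by (intro power_mono) auto
        also have "\<dots> \<le> 2 * (norm ?K)\<^sup>2 + 2 * M1\<^sup>2"
          using sum_squares_bound[of "norm ?K" M1] by (simp add: power2_sum)
        also have "(norm ?K)\<^sup>2 \<le> err v\<^sub>0 \<Xi>\<^sub>0 ?z"
        proof -
          have "(norm ?K)\<^sup>2 \<le> (norm (\<Xi>\<^sub>0 - Xb ?z))\<^sup>2" using norm_fst[of "\<Xi>\<^sub>0 - Xb ?z"] by (intro power_mono) auto
          also have "\<dots> \<le> err v\<^sub>0 \<Xi>\<^sub>0 ?z" by (simp add: err_def)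
          finally show ?thesis .
        qed
        finally have "1 + (norm (fst \<Xi>\<^sub>0))\<^sup>2 \<le> 1 + 2 * M1\<^sup>2 + 2 * err v\<^sub>0 \<Xi>\<^sub>0 ?z" by simp
        also have "\<dots> \<le> (3 + 2 * M1\<^sup>2) * ?e"
        proof -
          have "0 \<le> M1\<^sup>2 * err v \<Xi> ?z" "0 \<le> M1\<^sup>2 * err v\<^sub>0 \<Xi>\<^sub>0 ?z" using e0 by simp_all
          then show ?thesis using e0 by (simp add: algebra_simps)
        qed
        finally have "K * (1 + (norm (fst \<Xi>\<^sub>0))\<^sup>2) \<le> K * ((3 + 2 * M1\<^sup>2) * ?e)" using K(1) by (intro mult_left_mono) auto
        then show "norm ?Q \<le> K * ((3 + 2 * M1\<^sup>2) * ?e)" by (rule order_trans[OF K(2)])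
      qed (use M3(1) in auto)
      finally show ?thesis by (simp only: mult.assoc)
    qed
    have eq: "grad G \<Xi> \<bullet> ?Q = ?a \<bullet> (?Q - ?P) + (?a - ?d) \<bullet> ?P + ?d \<bullet> ?P + grad G (Xb ?z) \<bullet> ?Q"
      by (simp only: inner_diff_left inner_diff_right)
    have "\<bar>grad G \<Xi> \<bullet> ?Q\<bar> \<le> C2 * c * 3 * ?e + C1 * MP * ?e + M4 * MP * ?e + M3 * K * (3 + 2 * M1\<^sup>2) * ?e"
      unfolding eq
      by (rule order_trans[OF abs_triangle_ineq add_mono[OF order_trans[OF abs_triangle_ineq
            add_mono[OF order_trans[OF abs_triangle_ineq add_mono[OF b1 b2]] b3]] b4]])
    then show ?thesis by (simp only: D_def distrib_right)
  qed
  moreover have "D > 0" unfolding D_def using C1(1) C2(1) c(1) M3(1) M4 MP K(1)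
    by (intro add_nonneg_pos add_nonneg_nonneg mult_nonneg_nonneg mult_pos_pos add_pos_nonneg) auto
  ultimately show ?thesis by blast
qed

lemma stress_integrable:
  assumes s: "(v, \<Xi>) \<in> state_space p" and s0: "(v\<^sub>0, \<Xi>\<^sub>0) \<in> state_space p"
  shows "integrable torus (\<lambda>x. grad G (\<Xi> x) \<bullet> dPhi (fst (\<Xi>\<^sub>0 x)) i \<alpha>)"
proof -
  obtain C where C: "\<And>t x v \<Xi> v\<^sub>0 \<Xi>\<^sub>0 i \<alpha>. t \<in> {0..T} \<Longrightarrow> x \<in> cbox 0 1 \<Longrightarrow>
     \<bar>grad G \<Xi> \<bullet> dPhi (fst \<Xi>\<^sub>0) i \<alpha>\<bar> \<le> C * (1 + err v \<Xi> (t, x) + err v\<^sub>0 \<Xi>\<^sub>0 (t, x))"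
    using stress_bound by blast
  have t: "0 \<in> {0..T}" using T_pos by simp
  have "integrable torus (\<lambda>x. C * (1 + err (v x) (\<Xi> x) (0, x) + err (v\<^sub>0 x) (\<Xi>\<^sub>0 x) (0, x)))"
    using err_integrable[OF t s] err_integrable[OF t s0] torus_integrable_const[of 1] by auto
  then show ?thesis
  proof (rule torus_integrable_bound)
    show "(\<lambda>x. grad G (\<Xi> x) \<bullet> dPhi (fst (\<Xi>\<^sub>0 x)) i \<alpha>) \<in> borel_measurable torus"
      by (intro borel_measurable_inner grad_G_measurable measurable_dPhi state_measurable[OF s] state_measurable[OF s0])
    show "norm (grad G (\<Xi> x) \<bullet> dPhi (fst (\<Xi>\<^sub>0 x)) i \<alpha>) \<le> C * (1 + err (v x) (\<Xi> x) (0, x) + err (v\<^sub>0 x) (\<Xi>\<^sub>0 x) (0, x))"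
      if "x \<in> cbox 0 1" for x using C[OF t that] by simp
  qed
qed

lemma dPhi_integrable:
  assumes s0: "(v\<^sub>0, \<Xi>\<^sub>0) \<in> state_space p"
  shows "integrable torus (\<lambda>x. dPhi (fst (\<Xi>\<^sub>0 x)) i \<alpha> \<bullet> A)"
    "(v, \<Xi>) \<in> state_space p \<Longrightarrow> integrable torus (\<lambda>x. (dPhi (fst (\<Xi>\<^sub>0 x)) i \<alpha> \<bullet> A) * v x $ i)"
proof -
  have p2: "p \<ge> 2" using p6 by simp
  obtain K where K: "K > 0" "\<And>F i \<alpha>. norm (dPhi F i \<alpha>) \<le> K * (1 + (norm F)\<^sup>2)"
    using dPhi_bound by blast
  note i0 = state_integrable[OF s0 p2]
  have b: "\<bar>dPhi F i \<alpha> \<bullet> A\<bar> \<le> (K * norm A) * (1 + (norm F)\<^sup>2)" for F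
    using order_trans[OF Cauchy_Schwarz_ineq2 mult_right_mono[OF K(2)[of F i \<alpha>] norm_ge_zero[of A]]]
    by (simp only: mult_ac)
  have m: "(\<lambda>x. dPhi (fst (\<Xi>\<^sub>0 x)) i \<alpha> \<bullet> A) \<in> borel_measurable torus"
    using measurable_dPhi[OF state_measurable(3)[OF s0]] by (intro borel_measurable_inner) auto
  have "integrable torus (\<lambda>x. (K * norm A) * (1 + (norm (fst (\<Xi>\<^sub>0 x)))\<^sup>2))"
    using i0 torus_integrable_const[of 1] by auto
  then show "integrable torus (\<lambda>x. dPhi (fst (\<Xi>\<^sub>0 x)) i \<alpha> \<bullet> A)"
    by (rule torus_integrable_bound[OF _ m]) (use b in simp)
  assume s: "(v, \<Xi>) \<in> state_space p"
  let ?F = "\<lambda>x. fst (\<Xi>\<^sub>0 x)"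
  have "integrable torus (\<lambda>x. (K * norm A) * (2 + 4 * (norm (?F x))\<^sup>2 + 2 * norm (?F x) powr p + (norm (v x))\<^sup>2))"
    using i0 state_integrable[OF s p2] torus_integrable_const[of 2] by auto
  then show "integrable torus (\<lambda>x. (dPhi (?F x) i \<alpha> \<bullet> A) * v x $ i)"
  proof (rule torus_integrable_bound)
    have "(\<lambda>x. v x $ i) \<in> borel_measurable torus"
      by (rule measurable_compose[OF state_measurable(1)[OF s]])
        (rule borel_measurable_continuous_onI[OF linear_continuous_on[OF bounded_linear_vec_nth]])
    then show "(\<lambda>x. (dPhi (?F x) i \<alpha> \<bullet> A) * v x $ i) \<in> borel_measurable torus"
      using m by measurable
    fix x
    let ?n = "norm (?F x)"
    have n4: "?n\<^sup>2 * ?n\<^sup>2 \<le> ?n\<^sup>2 + ?n powr p"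
    proof -
      have "?n powr 4 \<le> ?n\<^sup>2 + ?n powr p" using p6 by (intro powr_between) auto
      moreover have "?n powr 4 = ?n\<^sup>2 * ?n\<^sup>2"
        by (cases "?n = 0") (auto simp: powr_numeral power_add[symmetric])
      ultimately show ?thesis by simp
    qed
    have "\<bar>(dPhi (?F x) i \<alpha> \<bullet> A) * v x $ i\<bar> \<le> ((K * norm A) * (1 + ?n\<^sup>2)) * norm (v x)"
      unfolding abs_mult using K(1) by (intro mult_mono b component_le_norm_cart) auto
    also have "\<dots> = (K * norm A) * ((1 + ?n\<^sup>2) * norm (v x))" by (simp only: mult.assoc)
    also have "\<dots> \<le> (K * norm A) * (2 + 4 * ?n\<^sup>2 + 2 * ?n powr p + (norm (v x))\<^sup>2)"
    proof (rule mult_left_mono)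
      have "(1 + ?n\<^sup>2) * norm (v x) \<le> (1 + ?n\<^sup>2)\<^sup>2 + (norm (v x))\<^sup>2" by (rule mult_le_sum_squares)
      also have "(1 + ?n\<^sup>2)\<^sup>2 \<le> 2 + 4 * ?n\<^sup>2 + 2 * ?n powr p"
      proof -
        have "(1 + ?n\<^sup>2)\<^sup>2 = 1 + 2 * ?n\<^sup>2 + ?n\<^sup>2 * ?n\<^sup>2"
          by (simp only: power2_sum) (simp add: power2_eq_square)
        then show ?thesis using n4 zero_le_power2[of ?n] powr_ge_zero[of ?n p] by linarith
      qed
      finally show "(1 + ?n\<^sup>2) * norm (v x) \<le> 2 + 4 * ?n\<^sup>2 + 2 * ?n powr p + (norm (v x))\<^sup>2" by simp
    qed (use K(1) in simp)
    finally show "norm ((dPhi (?F x) i \<alpha> \<bullet> A) * v x $ i) \<le> (K * norm A) * (2 + 4 * ?n\<^sup>2 + 2 * ?n powr p + (norm (v x))\<^sup>2)"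
      by simp
  qed
qed

lemma state_component_integrable:
  assumes s: "(v, \<Xi>) \<in> state_space p"
  shows "integrable torus (\<lambda>x. v x $ i)" "integrable torus (\<lambda>x. \<Xi> x \<bullet> A)" "integrable torus (\<lambda>x. fst (\<Xi> x) $ j $ \<beta>)"
proof -
  have p2: "p \<ge> 2" using p6 by simp
  note m = state_measurable[OF s] and ii = state_integrable[OF s p2]
  have c: "(\<lambda>x. c) \<in> borel_measurable torus" "integrable torus (\<lambda>x. (norm c)\<^sup>2)" for c :: "'z::euclidean_space"
    using torus_integrable_const by auto
  show "integrable torus (\<lambda>x. v x $ i)"
    using integrable_square_add(2)[OF m(1) c(1) ii(1) c(2), of "axis i 1"] by (simp add: inner_axis)
  show X: "integrable torus (\<lambda>x. \<Xi> x \<bullet> A)" for A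
    by (rule integrable_square_add(2)[OF m(2) c(1) ii(4) c(2)])
  show "integrable torus (\<lambda>x. fst (\<Xi> x) $ j $ \<beta>)"
    using integrable_square_add(2)[OF m(3) c(1) ii(3) c(2), of "axis j (axis \<beta> 1)"] by (simp add: inner_axis)
qed

text \<open>The linear terms of \<open>eta\<close> are obtained by testing the discrete equations with the components of
  \<open>Vb\<close> and \<open>gb\<close>; for the energy an inequality suffices.\<close>

lemma entropy_step:
  assumes t: "t \<in> {0..T}" and h: "h > 0"
    and s0: "(v\<^sub>0, \<Xi>\<^sub>0) \<in> state_space p" and s: "(v, \<Xi>) \<in> state_space p"
    and um: "unique_minimizer p G h v\<^sub>0 \<Xi>\<^sub>0 v \<Xi>"
    and mb: "momentum_balance G h v\<^sub>0 \<Xi>\<^sub>0 v \<Xi>" and kc: "kinematic_constraint h \<Xi>\<^sub>0 v \<Xi>"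
  shows "integrable torus (\<lambda>x. flux (v x) (\<Xi> x) (fst (\<Xi>\<^sub>0 x)) (t, x))"
    "ent v \<Xi> t - ent v\<^sub>0 \<Xi>\<^sub>0 t \<le> h * (LINT x|torus. flux (v x) (\<Xi> x) (fst (\<Xi>\<^sub>0 x)) (t, x))"
proof -
  have p2: "p \<ge> 2" using p6 by simp
  note ii = state_integrable[OF s p2] and ii0 = state_integrable[OF s0 p2]
  note ci = state_component_integrable[OF s] and ci0 = state_component_integrable[OF s0]
  let ?\<sigma> = "\<lambda>i \<alpha> x. grad G (\<Xi> x) \<bullet> dPhi (fst (\<Xi>\<^sub>0 x)) i \<alpha>"
  let ?\<kappa> = "\<lambda>A \<alpha> x. \<Sum>i\<in>UNIV. (dPhi (fst (\<Xi>\<^sub>0 x)) i \<alpha> \<bullet> A) * v x $ i"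
  let ?d = "\<lambda>\<alpha> x. dderiv (0, axis \<alpha> 1) gb (t, x)"
  let ?m = "\<lambda>i x. \<Sum>\<alpha>\<in>UNIV. ?\<sigma> i \<alpha> x * Ab (t, x) $ i $ \<alpha>"
  let ?n = "\<lambda>A x. \<Sum>\<alpha>\<in>UNIV. ?\<kappa> A \<alpha> x * (?d \<alpha> x \<bullet> A)"
  let ?V = "\<lambda>i x. Vb (t, x) $ i" and ?g = "\<lambda>A x. gb (t, x) \<bullet> A"
  have VC: "Ck_on 1 UNIV (?V i)" for i by (rule Ck_on_slice[OF t Ck_on_nth[OF U_open Vb_smooth]])
  have gC: "Ck_on 1 UNIV (?g A)" for A
    by (rule Ck_on_slice[OF t Ck_on_linear_compose[OF U_open bounded_linear_inner_left Ck_on_le[OF gb_C2]]]) simp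
  have Vp: "periodic (?V i)" for i using Vb_periodic[OF t] by (simp add: periodic_def)
  have gp: "periodic (?g A)" for A using Fb_periodic[OF t] by (simp add: periodic_def gb_def Xb_def)
  have dV: "partial \<alpha> (?V i) x = Ab (t, x) $ i $ \<alpha>" for \<alpha> i x by (simp add: Ab_def)
  have dg: "partial \<alpha> (?g A) x = ?d \<alpha> x \<bullet> A" for \<alpha> A x
  proof -
    have "(\<lambda>y. gb (t, y)) differentiable (at x)"
      using Ck_on_differentiable[OF Ck_on_slice[OF t gb_C2]] by simp
    from dderiv_linear_compose[OF bounded_linear_inner_left this] show ?thesis by (simp add: spatial_gb[OF t])
  qed
  have cV: "continuous_on (cbox 0 1) (\<lambda>x. Ab (t, x) $ i $ \<alpha>)" for i \<alpha>
  proof -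
    have "continuous_on UNIV (partial \<alpha> (?V i))" using VC[of i] by simp
    then have "continuous_on (cbox 0 1) (partial \<alpha> (?V i))" by (rule continuous_on_subset) simp
    then show ?thesis by (simp add: dV)
  qed
  have cg: "continuous_on (cbox 0 1) (\<lambda>x. ?d \<alpha> x \<bullet> A)" for \<alpha> A
    by (intro continuous_intros slice_continuous[OF t continuous_dgb])
  have \<sigma>i: "integrable torus (?\<sigma> i \<alpha>)" for i \<alpha> by (rule stress_integrable[OF s s0])
  have \<kappa>i: "integrable torus (?\<kappa> A \<alpha>)" for A \<alpha>
    by (intro Bochner_Integration.integrable_sum dPhi_integrable(2)[OF s0 s])
  have mi: "integrable torus (?m i)" for i
    by (intro Bochner_Integration.integrable_sum torus_integrable_mult[OF \<sigma>i cV])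
  have ni: "integrable torus (?n A)" for A
    by (intro Bochner_Integration.integrable_sum torus_integrable_mult[OF \<kappa>i cg])
  have flux: "flux (v x) (\<Xi> x) (fst (\<Xi>\<^sub>0 x)) (t, x) = (\<Sum>i\<in>UNIV. ?m i x) + (\<Sum>A\<in>Basis. ?n A x)" for x
  proof -
    have 1: "grad G (\<Xi> x) \<bullet> DPhi (fst (\<Xi>\<^sub>0 x)) (Ab (t, x)) = (\<Sum>i\<in>UNIV. ?m i x)"
      unfolding DPhi_expand[of _ "Ab (t, x)"] by (simp only: inner_sum_right inner_scaleR_right mult.commute)
    have "(\<Sum>A\<in>Basis. ?n A x) = (\<Sum>\<alpha>\<in>UNIV. \<Sum>i\<in>UNIV. \<Sum>A\<in>Basis. v x $ i * ((?d \<alpha> x \<bullet> A) * (dPhi (fst (\<Xi>\<^sub>0 x)) i \<alpha> \<bullet> A)))"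
      by (subst sum.swap, rule sum.cong[OF refl], simp only: sum_distrib_right, subst sum.swap)
        (simp only: mult_ac)
    also have "\<dots> = (\<Sum>\<alpha>\<in>UNIV. \<Sum>i\<in>UNIV. v x $ i * (?d \<alpha> x \<bullet> dPhi (fst (\<Xi>\<^sub>0 x)) i \<alpha>))"
      by (simp only: sum_distrib_left[symmetric] euclidean_inner[symmetric])
    also have "\<dots> = (\<Sum>i\<in>UNIV. \<Sum>\<alpha>\<in>UNIV. v x $ i * (?d \<alpha> x \<bullet> dPhi (fst (\<Xi>\<^sub>0 x)) i \<alpha>))" by (rule sum.swap)
    finally show ?thesis unfolding flux_def 1 by simp
  qed
  show fi: "integrable torus (\<lambda>x. flux (v x) (\<Xi> x) (fst (\<Xi>\<^sub>0 x)) (t, x))"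
    unfolding flux by (intro Bochner_Integration.integrable_add Bochner_Integration.integrable_sum mi ni)
  have fl: "(LINT x|torus. flux (v x) (\<Xi> x) (fst (\<Xi>\<^sub>0 x)) (t, x)) = (\<Sum>i\<in>UNIV. LINT x|torus. ?m i x) + (\<Sum>A\<in>Basis. LINT x|torus. ?n A x)"
    unfolding flux using mi ni by (simp add: Bochner_Integration.integral_add Bochner_Integration.integral_sum Bochner_Integration.integrable_sum)
  have iV: "integrable torus (\<lambda>x. (v x $ i - v\<^sub>0 x $ i) / h)" for i using ci(1) ci0(1) by auto
  have iX: "integrable torus (\<lambda>x. (\<Xi> x \<bullet> A - \<Xi>\<^sub>0 x \<bullet> A) / h)" for A using ci(2) ci0(2) by auto
  have cVb: "continuous_on (cbox 0 1) (?V i)" and cgb: "continuous_on (cbox 0 1) (?g A)" for i A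
    using Ck_on_continuous[OF VC[of i]] Ck_on_continuous[OF gC[of A]] continuous_on_subset by blast+
  have eV: "(LINT x|torus. (v x $ i - v\<^sub>0 x $ i) * ?V i x) = - h * (LINT x|torus. ?m i x)" for i
  proof -
    have "(LINT x|torus. (v x $ i - v\<^sub>0 x $ i) / h * ?V i x) = - (LINT x|torus. ?m i x)"
      using weak_div_C1[OF mb[unfolded momentum_balance_def, rule_format] iV \<sigma>i Vp VC] unfolding dV .
    moreover have "(v x $ i - v\<^sub>0 x $ i) * ?V i x = h * ((v x $ i - v\<^sub>0 x $ i) / h * ?V i x)" for x using h by simp
    ultimately show ?thesis by (simp only: integral_mult_right_zero mult_minus_left mult_minus_right)
  qed
  have eX: "(LINT x|torus. (\<Xi> x \<bullet> A - \<Xi>\<^sub>0 x \<bullet> A) * ?g A x) = - h * (LINT x|torus. ?n A x)" if "A \<in> Basis" for A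
  proof -
    have "(LINT x|torus. (\<Xi> x \<bullet> A - \<Xi>\<^sub>0 x \<bullet> A) / h * ?g A x) = - (LINT x|torus. ?n A x)"
      using weak_div_C1[OF kc[unfolded kinematic_constraint_def, rule_format, OF that] iX \<kappa>i gp gC] unfolding dg .
    moreover have "(\<Xi> x \<bullet> A - \<Xi>\<^sub>0 x \<bullet> A) * ?g A x = h * ((\<Xi> x \<bullet> A - \<Xi>\<^sub>0 x \<bullet> A) / h * ?g A x)" for x using h by simp
    ultimately show ?thesis by (simp only: integral_mult_right_zero mult_minus_left mult_minus_right)
  qed
  have iVV: "integrable torus (\<lambda>x. (v x $ i - v\<^sub>0 x $ i) * ?V i x)" for i
    by (rule torus_integrable_mult[OF _ cVb]) (use ci(1) ci0(1) in auto)
  have iXX: "integrable torus (\<lambda>x. (\<Xi> x \<bullet> A - \<Xi>\<^sub>0 x \<bullet> A) * ?g A x)" for A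
    by (rule torus_integrable_mult[OF _ cgb]) (use ci(2) ci0(2) in auto)
  let ?E = "\<lambda>x. (norm (v x))\<^sup>2 / 2 + G (\<Xi> x)" and ?H = "\<lambda>x. (norm (v\<^sub>0 x))\<^sup>2 / 2 + G (\<Xi>\<^sub>0 x)"
  have Ei: "integrable torus ?E" "integrable torus ?H"
    using ii(1) ii0(1) G_integrable[OF s] G_integrable[OF s0] by auto
  have pt: "eta (v x) (\<Xi> x) (t, x) - eta (v\<^sub>0 x) (\<Xi>\<^sub>0 x) (t, x) = ?E x - ?H x
     - (\<Sum>i\<in>UNIV. (v x $ i - v\<^sub>0 x $ i) * ?V i x) - (\<Sum>A\<in>Basis. (\<Xi> x \<bullet> A - \<Xi>\<^sub>0 x \<bullet> A) * ?g A x)" for x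
  proof -
    have "Vb (t, x) \<bullet> v x - Vb (t, x) \<bullet> v\<^sub>0 x = (\<Sum>i\<in>UNIV. (v x $ i - v\<^sub>0 x $ i) * ?V i x)"
      unfolding inner_diff_right[symmetric] by (simp add: inner_vec_def mult.commute)
    moreover have "gb (t, x) \<bullet> \<Xi> x - gb (t, x) \<bullet> \<Xi>\<^sub>0 x = (\<Sum>A\<in>Basis. (\<Xi> x \<bullet> A - \<Xi>\<^sub>0 x \<bullet> A) * ?g A x)"
    proof -
      have "gb (t, x) \<bullet> (\<Xi> x - \<Xi>\<^sub>0 x) = (\<Sum>A\<in>Basis. (gb (t, x) \<bullet> A) * ((\<Xi> x - \<Xi>\<^sub>0 x) \<bullet> A))"
        by (rule euclidean_inner)
      then show ?thesis by (simp only: inner_diff_left inner_diff_right mult.commute)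
    qed
    ultimately show ?thesis unfolding eta_expand by linarith
  qed
  have "ent v \<Xi> t - ent v\<^sub>0 \<Xi>\<^sub>0 t = (LINT x|torus. eta (v x) (\<Xi> x) (t, x) - eta (v\<^sub>0 x) (\<Xi>\<^sub>0 x) (t, x))"
    unfolding ent_def by (rule Bochner_Integration.integral_diff[OF eta_integrable[OF t s] eta_integrable[OF t s0], symmetric])
  also have "\<dots> = (LINT x|torus. ?E x) - (LINT x|torus. ?H x)
     - (\<Sum>i\<in>UNIV. LINT x|torus. (v x $ i - v\<^sub>0 x $ i) * ?V i x) - (\<Sum>A\<in>Basis. LINT x|torus. (\<Xi> x \<bullet> A - \<Xi>\<^sub>0 x \<bullet> A) * ?g A x)"
  proof -
    have "(LINT x|torus. a x - b x - (\<Sum>i\<in>I. c i x) - (\<Sum>i\<in>J. d i x)) =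
        (LINT x|torus. a x) - (LINT x|torus. b x) - (\<Sum>i\<in>I. LINT x|torus. c i x) - (\<Sum>i\<in>J. LINT x|torus. d i x)"
      if "integrable torus a" "integrable torus b" "\<And>i. integrable torus (c i)" "\<And>i. integrable torus (d i)"
      for a b :: "vec3 \<Rightarrow> real" and c :: "3 \<Rightarrow> vec3 \<Rightarrow> real" and d :: "xi \<Rightarrow> vec3 \<Rightarrow> real" and I J
      using that by (simp add: Bochner_Integration.integral_diff Bochner_Integration.integrable_sum Bochner_Integration.integral_sum Bochner_Integration.integrable_diff)
    from this[OF Ei iVV iXX] show ?thesis unfolding pt .
  qed
  also have "\<dots> = (LINT x|torus. ?E x) - (LINT x|torus. ?H x) + h * (LINT x|torus. flux (v x) (\<Xi> x) (fst (\<Xi>\<^sub>0 x)) (t, x))"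
    unfolding fl using eX by (simp add: eV sum_distrib_left distrib_left sum_negf)
  finally show "ent v \<Xi> t - ent v\<^sub>0 \<Xi>\<^sub>0 t \<le> h * (LINT x|torus. flux (v x) (\<Xi> x) (fst (\<Xi>\<^sub>0 x)) (t, x))"
    using energy_decrease[OF s0 s um] by linarith
qed

end

section \<open>The null Lagrangian part\<close>

context smooth_flow
begin

text \<open>The functions whose gradients the null Lagrangian is tested with, see \<open>null_part_eq\<close>.\<close>

definition test_fun :: "xi \<Rightarrow> 3 \<Rightarrow> real \<Rightarrow> vec3 \<Rightarrow> real" where
  "test_fun A i t y = Vb (t, y) $ i * (gb (t, y) \<bullet> A)"

lemma test_fun_C2:
  assumes t: "t \<in> {0..T}"
  shows "Ck_on 2 UNIV (test_fun A i t)" "periodic (test_fun A i t)"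
proof -
  have "Ck_on 2 U (\<lambda>z. Vb z $ i * (gb z \<bullet> A))"
    by (intro Ck_on_mult[OF U_open] Ck_on_nth[OF U_open Vb_smooth] Ck_on_linear_compose[OF U_open bounded_linear_inner_left gb_C2])
  from Ck_on_slice[OF t this] show "Ck_on 2 UNIV (test_fun A i t)" by (simp only: test_fun_def[abs_def])
  show "periodic (test_fun A i t)"
    using Vb_periodic[OF t] Fb_periodic[OF t] by (simp add: periodic_def test_fun_def gb_def Xb_def)
qed

lemma gradv_test_fun:
  assumes t: "t \<in> {0..T}"
  shows "gradv (test_fun A i t) x $ \<alpha> =
    Vb (t, x) $ i * (dderiv (0, axis \<alpha> 1) gb (t, x) \<bullet> A) + Ab (t, x) $ i $ \<alpha> * (gb (t, x) \<bullet> A)"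
proof -
  have gd: "(\<lambda>y. gb (t, y)) differentiable (at x)"
    using Ck_on_differentiable[OF Ck_on_slice[OF t gb_C2]] by simp
  have Vd: "(\<lambda>y. Vb (t, y) $ i) differentiable (at x)"
    using Ck_on_differentiable[OF Ck_on_slice[OF t Ck_on_nth[OF U_open Vb_smooth[of 1]]]] by simp
  have gAd: "(\<lambda>y. gb (t, y) \<bullet> A) differentiable (at x)"
    using Ck_on_differentiable[OF Ck_on_slice[OF t Ck_on_linear_compose[OF U_open bounded_linear_inner_left gb_C2]]] by simp
  have "partial \<alpha> (\<lambda>y. Vb (t, y) $ i * (gb (t, y) \<bullet> A)) x
     = Vb (t, x) $ i * partial \<alpha> (\<lambda>y. gb (t, y) \<bullet> A) x + partial \<alpha> (\<lambda>y. Vb (t, y) $ i) x * (gb (t, x) \<bullet> A)"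
    by (rule bounded_bilinear.dderiv_prod[OF bounded_bilinear_mult Vd gAd])
  also have "partial \<alpha> (\<lambda>y. gb (t, y) \<bullet> A) x = dderiv (0, axis \<alpha> 1) gb (t, x) \<bullet> A"
    using dderiv_linear_compose[OF bounded_linear_inner_left gd] by (simp add: spatial_gb[OF t])
  finally show ?thesis by (simp add: gradv_def test_fun_def[abs_def] Ab_def)
qed

lemma null_part_eq:
  assumes t: "t \<in> {0..T}"
  shows "null_part F (t, x) = (\<Sum>A\<in>Basis. \<Sum>i\<in>UNIV. A \<bullet> DPhi F (axis i (gradv (test_fun A i t) x)))"
proof -
  let ?d = "\<lambda>\<alpha>. dderiv (0, axis \<alpha> 1) gb (t, x)"
  have swap: "(\<Sum>A\<in>Basis. \<Sum>i\<in>UNIV. \<Sum>\<alpha>\<in>UNIV. k i \<alpha> * ((u \<alpha> \<bullet> A) * (A \<bullet> dPhi F i \<alpha>)))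
      = (\<Sum>i\<in>UNIV. \<Sum>\<alpha>\<in>UNIV. k i \<alpha> * (u \<alpha> \<bullet> dPhi F i \<alpha>))" for k and u :: "3 \<Rightarrow> xi"
  proof -
    have "(\<Sum>A\<in>Basis. \<Sum>i\<in>UNIV. \<Sum>\<alpha>\<in>UNIV. k i \<alpha> * ((u \<alpha> \<bullet> A) * (A \<bullet> dPhi F i \<alpha>)))
      = (\<Sum>i\<in>UNIV. \<Sum>\<alpha>\<in>UNIV. \<Sum>A\<in>Basis. k i \<alpha> * ((u \<alpha> \<bullet> A) * (dPhi F i \<alpha> \<bullet> A)))"
      by (subst sum.swap, rule sum.cong[OF refl], subst sum.swap) (simp only: inner_commute)
    also have "\<dots> = (\<Sum>i\<in>UNIV. \<Sum>\<alpha>\<in>UNIV. k i \<alpha> * (u \<alpha> \<bullet> dPhi F i \<alpha>))"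
      by (simp only: sum_distrib_left[symmetric] euclidean_inner[symmetric])
    finally show ?thesis .
  qed
  have "(\<Sum>A\<in>Basis. \<Sum>i\<in>UNIV. A \<bullet> DPhi F (axis i (gradv (test_fun A i t) x)))
     = (\<Sum>A\<in>Basis. \<Sum>i\<in>UNIV. \<Sum>\<alpha>\<in>UNIV. Vb (t, x) $ i * ((?d \<alpha> \<bullet> A) * (A \<bullet> dPhi F i \<alpha>)))
     + (\<Sum>A\<in>Basis. \<Sum>i\<in>UNIV. \<Sum>\<alpha>\<in>UNIV. Ab (t, x) $ i $ \<alpha> * ((gb (t, x) \<bullet> A) * (A \<bullet> dPhi F i \<alpha>)))"
    unfolding DPhi_row gradv_test_fun[OF t] inner_sum_right inner_scaleR_right distrib_right sum.distrib
    by (simp only: mult.assoc)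
  also have "\<dots> = (\<Sum>i\<in>UNIV. \<Sum>\<alpha>\<in>UNIV. Vb (t, x) $ i * (?d \<alpha> \<bullet> dPhi F i \<alpha>))
     + (\<Sum>i\<in>UNIV. \<Sum>\<alpha>\<in>UNIV. Ab (t, x) $ i $ \<alpha> * (gb (t, x) \<bullet> dPhi F i \<alpha>))"
    by (simp only: swap[of "\<lambda>i \<alpha>. Vb (t, x) $ i" ?d] swap[of "\<lambda>i \<alpha>. Ab (t, x) $ i $ \<alpha>" "\<lambda>\<alpha>. gb (t, x)"])
  also have "\<dots> = null_part F (t, x)"
    unfolding null_part_def flux_def DPhi_expand[of F "Ab (t, x)"]
    by (simp add: inner_sum_right gb_def[symmetric])
  finally show ?thesis by simp
qed

lemma null_part_integral:
  "\<exists>C>0. \<forall>t\<in>{0..T}. \<forall>v\<^sub>0 \<Xi>\<^sub>0. (v\<^sub>0, \<Xi>\<^sub>0) \<in> state_space p \<longrightarrow>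
     differ_by_gradient (\<lambda>x. fst (\<Xi>\<^sub>0 x)) (\<lambda>x. Fb (t, x)) \<longrightarrow>
     integrable torus (\<lambda>x. null_part (fst (\<Xi>\<^sub>0 x)) (t, x)) \<and>
     \<bar>LINT x|torus. null_part (fst (\<Xi>\<^sub>0 x)) (t, x)\<bar> \<le> C * (LINT x|torus. err (v\<^sub>0 x) (\<Xi>\<^sub>0 x) (t, x))"
proof -
  obtain M1 where M1: "M1 > 0" "\<And>t x. t \<in> {0..T} \<Longrightarrow> x \<in> cbox 0 1 \<Longrightarrow> norm (Vb (t, x)) \<le> M1"
    using slab_bounded[OF continuous_Vb] by blast
  obtain M2 where M2: "M2 > 0" "\<And>t x. t \<in> {0..T} \<Longrightarrow> x \<in> cbox 0 1 \<Longrightarrow> norm (gb (t, x)) \<le> M2"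
    using slab_bounded[OF continuous_gb] by blast
  obtain M3 where M3: "M3 > 0" "\<And>t x. t \<in> {0..T} \<Longrightarrow> x \<in> cbox 0 1 \<Longrightarrow> norm (Ab (t, x)) \<le> M3"
    using Ab_bounded by blast
  have "\<forall>\<alpha>. \<exists>M>0. \<forall>t\<in>{0..T}. \<forall>x\<in>cbox 0 1. norm (dderiv (0, axis \<alpha> 1) gb (t, x)) \<le> M"
    using slab_bounded[OF continuous_dgb] by blast
  then obtain Mg where Mg: "\<And>\<alpha>. Mg \<alpha> > 0" "\<And>\<alpha> t x. t \<in> {0..T} \<Longrightarrow> x \<in> cbox 0 1 \<Longrightarrow> norm (dderiv (0, axis \<alpha> 1) gb (t, x)) \<le> Mg \<alpha>"
    by metis
  define M where "M = (\<Sum>\<alpha>\<in>UNIV. M1 * Mg \<alpha> + M3 * M2)"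
  have Mpos: "M > 0" unfolding M_def using M1(1) M2(1) M3(1) Mg(1) by (intro sum_pos add_pos_pos mult_pos_pos) auto
  have gb_le: "norm (gradv (test_fun A i t) x) \<le> M" if tx: "t \<in> {0..T}" "x \<in> cbox 0 1" and A: "A \<in> Basis" for A i t x
  proof -
    have in1: "\<bar>y \<bullet> A\<bar> \<le> norm y" for y using A by (rule Basis_le_norm)
    have "norm (gradv (test_fun A i t) x) \<le> (\<Sum>\<alpha>\<in>UNIV. \<bar>gradv (test_fun A i t) x $ \<alpha>\<bar>)" by (rule norm_le_l1_cart)
    also have "\<dots> \<le> M" unfolding M_def gradv_test_fun[OF tx(1)]
    proof (rule sum_mono, rule order_trans[OF abs_triangle_ineq], unfold abs_mult, rule add_mono)
      fix \<alpha> :: 3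
      show "\<bar>Vb (t, x) $ i\<bar> * \<bar>dderiv (0, axis \<alpha> 1) gb (t, x) \<bullet> A\<bar> \<le> M1 * Mg \<alpha>"
        using M1(1) by (intro mult_mono order_trans[OF component_le_norm_cart M1(2)[OF tx]] order_trans[OF in1 Mg(2)[OF tx]]) auto
      have "\<bar>Ab (t, x) $ i $ \<alpha>\<bar> \<le> norm (Ab (t, x))"
        using component_le_norm_cart[of "Ab (t, x) $ i" \<alpha>] Finite_Cartesian_Product.norm_nth_le[of "Ab (t, x)" i] by linarith
      then show "\<bar>Ab (t, x) $ i $ \<alpha>\<bar> * \<bar>gb (t, x) \<bullet> A\<bar> \<le> M3 * M2"
        using M3(1) M3(2)[OF tx] by (intro mult_mono order_trans[OF in1 M2(2)[OF tx]]) auto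
    qed
    finally show ?thesis .
  qed
  define C where "C = real (card (Basis :: xi set)) * 3 * M"
  have main: "integrable torus (\<lambda>x. null_part (fst (\<Xi>\<^sub>0 x)) (t, x)) \<and>
     \<bar>LINT x|torus. null_part (fst (\<Xi>\<^sub>0 x)) (t, x)\<bar> \<le> C * (LINT x|torus. err (v\<^sub>0 x) (\<Xi>\<^sub>0 x) (t, x))"
    if t: "t \<in> {0..T}" and s0: "(v\<^sub>0, \<Xi>\<^sub>0) \<in> state_space p"
      and dg: "differ_by_gradient (\<lambda>x. fst (\<Xi>\<^sub>0 x)) (\<lambda>x. Fb (t, x))" for t v\<^sub>0 \<Xi>\<^sub>0
  proof -
    have p2: "p \<ge> 2" using p6 by simp
    let ?F = "\<lambda>x. fst (\<Xi>\<^sub>0 x)" and ?f = "\<lambda>A i. test_fun A i t"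
    let ?q = "\<lambda>A i x. A \<bullet> DPhi (?F x) (axis i (gradv (?f A i) x))"
    let ?e = "\<lambda>x. err (v\<^sub>0 x) (\<Xi>\<^sub>0 x) (t, x)"
    have gc: "continuous_on (cbox 0 1) (\<lambda>x. gradv (?f A i) x $ \<alpha>)" for A i \<alpha>
    proof -
      have "Ck_on (Suc 1) UNIV (?f A i)" using test_fun_C2(1)[OF t] by (simp only: Suc_1)
      from Ck_on_continuous[OF Ck_on_nth[OF open_UNIV Ck_on_gradv[OF this]]] show ?thesis
        by (rule continuous_on_subset) simp
    qed
    have qi: "integrable torus (?q A i)" for A i
    proof -
      have "?q A i x = (\<Sum>\<alpha>\<in>UNIV. (dPhi (?F x) i \<alpha> \<bullet> A) * gradv (?f A i) x $ \<alpha>)" for x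
        unfolding DPhi_row inner_sum_right inner_scaleR_right by (simp only: inner_commute mult.commute)
      then show ?thesis
        by (simp only:) (intro Bochner_Integration.integrable_sum torus_integrable_mult dPhi_integrable(1)[OF s0] gc)
    qed
    have int: "integrable torus (\<lambda>x. null_part (?F x) (t, x))"
      unfolding null_part_eq[OF t] by (intro Bochner_Integration.integrable_sum qi)
    have bound: "\<bar>LINT x|torus. ?q A i x\<bar> \<le> M * (LINT x|torus. ?e x)" if A: "A \<in> Basis" for A i
    proof -
      let ?r = "\<lambda>x. snd (snd A) * (gradv (?f A i) x \<bullet> cross3 ((?F x - Fb (t, x)) $ (i + 1)) ((?F x - Fb (t, x)) $ (i + 2)))"
      have eq: "(LINT x|torus. ?q A i x) = (LINT x|torus. ?r x)"
        by (rule null_lagrangian[OF state_measurable(3)[OF s0] state_integrable(3)[OF s0 p2] Fb_periodic[OF t]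
            Ck_on_slice[OF t Fb_smooth] curl_free_Fb[OF t] dg test_fun_C2(2,1)[OF t]])
      have "\<bar>LINT x|torus. ?r x\<bar> \<le> (LINT x|torus. \<bar>?r x\<bar>)" by (rule integral_abs_bound)
      also have "\<dots> \<le> (LINT x|torus. M * ?e x)"
      proof (rule integral_mono')
        show "integrable torus (\<lambda>x. M * ?e x)" using err_integrable[OF t s0] by simp
        fix x :: vec3 assume "x \<in> space torus"
        then have x: "x \<in> cbox 0 1" by simp
        let ?K = "?F x - Fb (t, x)"
        have a1: "\<bar>snd (snd A)\<bar> \<le> 1"
          using order_trans[OF norm_snd[of "snd A"] norm_snd[of A]] norm_Basis[OF A] by simp
        have K2: "norm ?K * norm ?K \<le> ?e x"
        proof -
          have "norm ?K * norm ?K \<le> norm (\<Xi>\<^sub>0 x - Xb (t, x)) * norm (\<Xi>\<^sub>0 x - Xb (t, x))"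
            using norm_fst[of "\<Xi>\<^sub>0 x - Xb (t, x)"] by (intro mult_mono) auto
          also have "\<dots> \<le> ?e x" by (simp add: err_def power2_eq_square)
          finally show ?thesis .
        qed
        have "\<bar>gradv (?f A i) x \<bullet> cross3 (?K $ (i + 1)) (?K $ (i + 2))\<bar> \<le> norm (gradv (?f A i) x) * norm (cross3 (?K $ (i + 1)) (?K $ (i + 2)))"
          by (rule Cauchy_Schwarz_ineq2)
        also have "\<dots> \<le> M * ?e x"
        proof (rule mult_mono[OF gb_le[OF t x A]])
          have "norm (cross3 (?K $ (i + 1)) (?K $ (i + 2))) \<le> norm (?K $ (i + 1)) * norm (?K $ (i + 2))" by (rule norm_cross_le)
          also have "\<dots> \<le> norm ?K * norm ?K" by (intro mult_mono Finite_Cartesian_Product.norm_nth_le) auto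
          also have "\<dots> \<le> ?e x" by (rule K2)
          finally show "norm (cross3 (?K $ (i + 1)) (?K $ (i + 2))) \<le> ?e x" .
        qed (use Mpos in auto)
        finally have "\<bar>?r x\<bar> \<le> 1 * (M * ?e x)" unfolding abs_mult by (intro mult_mono a1) auto
        then show "\<bar>?r x\<bar> \<le> M * ?e x" by (simp only: mult_1_left)
        show "0 \<le> M * ?e x" using Mpos err_nonneg by simp
      qed
      finally show ?thesis unfolding eq by simp
    qed
    have "(LINT x|torus. null_part (?F x) (t, x)) = (\<Sum>A\<in>Basis. \<Sum>i\<in>UNIV. LINT x|torus. ?q A i x)"
      unfolding null_part_eq[OF t] using qi by (simp add: Bochner_Integration.integral_sum Bochner_Integration.integrable_sum)
    also have "\<bar>\<dots>\<bar> \<le> (\<Sum>A\<in>(Basis :: xi set). \<Sum>i\<in>(UNIV :: 3 set). M * (LINT x|torus. ?e x))"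
      by (rule order_trans[OF sum_abs], rule sum_mono, rule order_trans[OF sum_abs], rule sum_mono, rule bound)
    also have "\<dots> = C * (LINT x|torus. ?e x)" by (simp add: C_def)
    finally show ?thesis using int by blast
  qed
  have "C > 0" unfolding C_def using Mpos by (simp add: DIM_positive)
  then show ?thesis using main by blast
qed

text \<open>The \<open>F\<close>-component of the kinematic equation changes \<open>F\<close> by a weak gradient.\<close>

lemma differ_by_gradient_step:
  assumes h: "h > 0" and s0: "(v\<^sub>0, \<Xi>\<^sub>0) \<in> state_space p" and s: "(v, \<Xi>) \<in> state_space p"
    and kc: "kinematic_constraint h \<Xi>\<^sub>0 v \<Xi>"
    and dg: "differ_by_gradient (\<lambda>x. fst (\<Xi>\<^sub>0 x)) F'"
  shows "differ_by_gradient (\<lambda>x. fst (\<Xi> x)) F'"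
  unfolding differ_by_gradient_def
proof (intro allI impI)
  fix j Y assume Y: "periodic Y" "Ck_on 1 UNIV Y" "\<forall>x. divv Y x = 0"
  have YC: "Ck_on 1 UNIV (\<lambda>x. Y x $ \<beta>)" for \<beta> by (rule Ck_on_nth[OF open_UNIV Y(2)])
  have Yp: "periodic (\<lambda>x. Y x $ \<beta>)" for \<beta> using Y(1) by (simp add: periodic_def)
  have Yc: "continuous_on (cbox 0 1) (\<lambda>x. Y x $ \<beta>)" for \<beta>
    using Ck_on_continuous[OF YC] continuous_on_subset by blast
  note ci = state_component_integrable[OF s] and ci0 = state_component_integrable[OF s0]
  let ?F = "\<lambda>\<beta> x. fst (\<Xi> x) $ j $ \<beta>" and ?Fo = "\<lambda>\<beta> x. fst (\<Xi>\<^sub>0 x) $ j $ \<beta>"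
  have Fi: "integrable torus (\<lambda>x. ?F \<beta> x * Y x $ \<beta>)" "integrable torus (\<lambda>x. ?Fo \<beta> x * Y x $ \<beta>)" for \<beta>
    by (intro torus_integrable_mult ci(3) ci0(3) Yc)+
  have dYc: "continuous_on (cbox 0 1) (\<lambda>x. partial \<beta> (\<lambda>x. Y x $ \<beta>) x)" for \<beta>
  proof -
    have "continuous_on UNIV (partial \<beta> (\<lambda>x. Y x $ \<beta>))" using YC[of \<beta>] by simp
    then show ?thesis by (rule continuous_on_subset) simp
  qed
  have eq: "(LINT x|torus. ?F \<beta> x * Y x $ \<beta>) - (LINT x|torus. ?Fo \<beta> x * Y x $ \<beta>)
     = - h * (LINT x|torus. v x $ j * partial \<beta> (\<lambda>x. Y x $ \<beta>) x)" for \<beta>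
  proof -
    let ?A = "(axis j (axis \<beta> 1), 0, 0) :: xi"
    have "axis j (axis \<beta> 1) \<in> (Basis :: mat3 set)" unfolding Basis_vec_def by auto
    then have A: "?A \<in> Basis" unfolding Basis_prod_def[where 'a = mat3 and 'b = "mat3 \<times> real"] zero_prod_def by blast
    have X: "X \<bullet> ?A = fst X $ j $ \<beta>" for X :: xi by (simp add: inner_prod_def inner_axis)
    have fi: "integrable torus (\<lambda>x. (\<Xi> x \<bullet> ?A - \<Xi>\<^sub>0 x \<bullet> ?A) / h)" using ci(2) ci0(2) by auto
    have gi: "integrable torus (\<lambda>x. \<Sum>i\<in>UNIV. (dPhi (fst (\<Xi>\<^sub>0 x)) i \<alpha> \<bullet> ?A) * v x $ i)" for \<alpha>
      by (intro Bochner_Integration.integrable_sum dPhi_integrable(2)[OF s0 s])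
    have P: "dPhi F i \<alpha> \<bullet> ?A = (if i = j \<and> \<alpha> = \<beta> then 1 else 0)" for F i \<alpha>
      unfolding X dPhi_eq DPhi_def by (auto simp: axis_def)
    have one: "(\<Sum>\<alpha>\<in>UNIV. (\<Sum>i\<in>UNIV. (dPhi (fst (\<Xi>\<^sub>0 x)) i \<alpha> \<bullet> ?A) * v x $ i) * partial \<alpha> (\<lambda>x. Y x $ \<beta>) x)
       = v x $ j * partial \<beta> (\<lambda>x. Y x $ \<beta>) x" for x
    proof -
      have "(\<Sum>i\<in>UNIV. (dPhi (fst (\<Xi>\<^sub>0 x)) i \<alpha> \<bullet> ?A) * v x $ i) = (if \<alpha> = \<beta> then v x $ j else 0)" for \<alpha>
      proof -
        have "(\<Sum>i\<in>UNIV. (dPhi (fst (\<Xi>\<^sub>0 x)) i \<alpha> \<bullet> ?A) * v x $ i)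
            = (\<Sum>i\<in>UNIV. if i = j then (if \<alpha> = \<beta> then v x $ j else 0) else 0)"
          unfolding P by (rule sum.cong) auto
        then show ?thesis by simp
      qed
      then have "(\<Sum>\<alpha>\<in>UNIV. (\<Sum>i\<in>UNIV. (dPhi (fst (\<Xi>\<^sub>0 x)) i \<alpha> \<bullet> ?A) * v x $ i) * partial \<alpha> (\<lambda>x. Y x $ \<beta>) x)
        = (\<Sum>\<alpha>\<in>UNIV. if \<alpha> = \<beta> then v x $ j * partial \<beta> (\<lambda>x. Y x $ \<beta>) x else 0)"
        by (intro sum.cong) auto
      then show ?thesis by simp
    qed
    have "(LINT x|torus. (\<Xi> x \<bullet> ?A - \<Xi>\<^sub>0 x \<bullet> ?A) / h * Y x $ \<beta>) = - (LINT x|torus. v x $ j * partial \<beta> (\<lambda>x. Y x $ \<beta>) x)"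
      using weak_div_C1[OF kc[unfolded kinematic_constraint_def, rule_format, OF A] fi gi Yp[of \<beta>] YC[of \<beta>]] unfolding one .
    moreover have "?F \<beta> x * Y x $ \<beta> - ?Fo \<beta> x * Y x $ \<beta> = h * ((\<Xi> x \<bullet> ?A - \<Xi>\<^sub>0 x \<bullet> ?A) / h * Y x $ \<beta>)" for x
      using h by (simp add: X left_diff_distrib)
    ultimately have "(LINT x|torus. ?F \<beta> x * Y x $ \<beta> - ?Fo \<beta> x * Y x $ \<beta>) = - h * (LINT x|torus. v x $ j * partial \<beta> (\<lambda>x. Y x $ \<beta>) x)"
      by (simp only: integral_mult_right_zero mult_minus_left mult_minus_right)
    then show ?thesis using Fi by (simp add: Bochner_Integration.integral_diff)
  qed
  have "(LINT x|torus. fst (\<Xi> x) $ j \<bullet> Y x) - (LINT x|torus. fst (\<Xi>\<^sub>0 x) $ j \<bullet> Y x)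
     = (\<Sum>\<beta>\<in>UNIV. (LINT x|torus. ?F \<beta> x * Y x $ \<beta>) - (LINT x|torus. ?Fo \<beta> x * Y x $ \<beta>))"
    using Fi by (simp add: inner_vec_def Bochner_Integration.integral_sum sum_subtractf)
  also have "\<dots> = - h * (\<Sum>\<beta>\<in>UNIV. LINT x|torus. v x $ j * partial \<beta> (\<lambda>x. Y x $ \<beta>) x)"
    by (simp only: eq sum_distrib_left)
  also have "(\<Sum>\<beta>\<in>UNIV. LINT x|torus. v x $ j * partial \<beta> (\<lambda>x. Y x $ \<beta>) x) = (LINT x|torus. v x $ j * divv Y x)"
    using torus_integrable_mult[OF ci(1) dYc] by (simp add: divv_def sum_distrib_left Bochner_Integration.integral_sum)
  also have "\<dots> = 0" using Y(3) by simp
  finally have "(LINT x|torus. fst (\<Xi> x) $ j \<bullet> Y x) = (LINT x|torus. fst (\<Xi>\<^sub>0 x) $ j \<bullet> Y x)" by simp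
  also have "\<dots> = (LINT x|torus. F' x $ j \<bullet> Y x)" using dg Y unfolding differ_by_gradient_def by blast
  finally show "(LINT x|torus. fst (\<Xi> x) $ j \<bullet> Y x) = (LINT x|torus. F' x $ j \<bullet> Y x)" .
qed

text \<open>The time derivative of \<open>Fb\<close> is a spatial gradient, which is orthogonal to solenoidal fields.\<close>

lemma differ_by_gradient_time:
  assumes t: "t \<in> {0..T}" and dg: "differ_by_gradient F (\<lambda>x. Fb (0, x))"
  shows "differ_by_gradient F (\<lambda>x. Fb (t, x))"
  unfolding differ_by_gradient_def
proof (intro allI impI)
  fix j Y assume Y: "periodic Y" "Ck_on 1 UNIV Y" "\<forall>x. divv Y x = 0"
  let ?I = "\<lambda>s. integral (cbox 0 1) (\<lambda>x. Fb (s, x) $ j \<bullet> Y x)"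
  have Yc: "continuous_on UNIV Y" by (rule Ck_on_continuous[OF Y(2)])
  have sub: "{0..T} \<times> cbox 0 1 \<subseteq> U" using U_sub by auto
  have cont: "continuous_on (cbox 0 1) (\<lambda>x. Fb (s, x) $ j \<bullet> Y x)" if "s \<in> {0..T}" for s
    by (intro continuous_intros slice_continuous[OF that] continuous_Fb continuous_on_subset[OF Yc]) auto
  have der: "(?I has_vector_derivative 0) (at s within {0..T})" if s: "s \<in> {0..T}" for s
  proof -
    have "(?I has_vector_derivative integral (cbox 0 1) (\<lambda>x. Ab (s, x) $ j \<bullet> Y x)) (at s within {0..T})"
    proof (rule leibniz_rule_vector_derivative)
      fix r x assume r: "r \<in> {0..T}"
      have "Fb differentiable (at (r, x))" using Ck_on_differentiable[OF Fb_smooth[of 1] _ in_U[OF r]] by simp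
      from time_derivative[OF this, of "{0..T}"]
      have "((\<lambda>r. Fb (r, x)) has_vector_derivative Ab (r, x)) (at r within {0..T})" by (simp add: dt_Fb[OF r])
      moreover have "bounded_linear (\<lambda>F :: mat3. F $ j \<bullet> Y x)"
        by (rule bounded_linear_compose[OF bounded_linear_inner_left bounded_linear_vec_nth])
      ultimately show "((\<lambda>r. Fb (r, x) $ j \<bullet> Y x) has_vector_derivative Ab (r, x) $ j \<bullet> Y x) (at r within {0..T})"
        by (rule bounded_linear.has_vector_derivative[rotated])
    next
      show "(\<lambda>x. Fb (r, x) $ j \<bullet> Y x) integrable_on cbox 0 1" if "r \<in> {0..T}" for r
        by (rule integrable_continuous[OF cont[OF that]])
      have "continuous_on ({0..T} \<times> cbox 0 1) (\<lambda>z. dderiv (1, 0) Fb z $ j \<bullet> Y (snd z))"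
        by (intro continuous_intros continuous_on_subset[OF continuous_dFb sub] continuous_on_compose2[OF Yc]) auto
      moreover have "dderiv (1, 0) Fb z $ j \<bullet> Y (snd z) = (case z of (r, x) \<Rightarrow> Ab (r, x) $ j \<bullet> Y x)"
        if "z \<in> {0..T} \<times> cbox 0 1" for z using that by (auto simp: dt_Fb)
      ultimately show "continuous_on ({0..T} \<times> cbox 0 1) (\<lambda>(r, x). Ab (r, x) $ j \<bullet> Y x)"
        by (simp cong: continuous_on_cong)
    qed (use s in auto)
    moreover have "integral (cbox 0 1) (\<lambda>x. Ab (s, x) $ j \<bullet> Y x) = 0"
    proof -
      have VC: "Ck_on 2 UNIV (\<lambda>y. Vb (s, y) $ j)" by (rule Ck_on_slice[OF s Ck_on_nth[OF U_open Vb_smooth]])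
      have VC1: "Ck_on 1 UNIV (\<lambda>y. Vb (s, y) $ j)" by (rule Ck_on_slice[OF s Ck_on_nth[OF U_open Vb_smooth]])
      have "periodic (\<lambda>y. Vb (s, y) $ j)" using Vb_periodic[OF s] by (simp add: periodic_def)
      from integral_grad_dot[OF this VC1 Y(1,2)] have "(LINT x|torus. gradv (\<lambda>y. Vb (s, y) $ j) x \<bullet> Y x) = 0" using Y(3) by simp
      moreover have "gradv (\<lambda>y. Vb (s, y) $ j) x = Ab (s, x) $ j" for x by (simp add: gradv_def Ab_def vec_eq_iff)
      ultimately have 0: "(LINT x|torus. Ab (s, x) $ j \<bullet> Y x) = 0" by simp
      have "continuous_on (cbox 0 1) (\<lambda>x. dderiv (1, 0) Fb (s, x) $ j \<bullet> Y x)"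
        by (intro continuous_intros slice_continuous[OF s continuous_dFb] continuous_on_subset[OF Yc]) auto
      then have "continuous_on (cbox 0 1) (\<lambda>x. Ab (s, x) $ j \<bullet> Y x)" by (simp add: dt_Fb[OF s])
      from torus_integral_eq[OF torus_integrable_continuous[OF this]] 0 show ?thesis by simp
    qed
    ultimately show ?thesis by simp
  qed
  have "\<exists>c. \<forall>s\<in>{0..T}. ?I s = c"
    by (rule has_field_derivative_zero_constant[of "{0..T}" ?I])
      (use der in \<open>auto simp: has_real_derivative_iff_has_vector_derivative\<close>)
  then have "?I t = ?I 0" using t T_pos by auto
  moreover have "(LINT x|torus. Fb (s, x) $ j \<bullet> Y x) = ?I s" if "s \<in> {0..T}" for s
    by (rule torus_integral_eq[OF torus_integrable_continuous[OF cont[OF that]]])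
  ultimately have "(LINT x|torus. Fb (t, x) $ j \<bullet> Y x) = (LINT x|torus. Fb (0, x) $ j \<bullet> Y x)" using t T_pos by simp
  moreover have "(LINT x|torus. F x $ j \<bullet> Y x) = (LINT x|torus. Fb (0, x) $ j \<bullet> Y x)"
    using dg Y unfolding differ_by_gradient_def by blast
  ultimately show "(LINT x|torus. F x $ j \<bullet> Y x) = (LINT x|torus. Fb (t, x) $ j \<bullet> Y x)" by simp
qed

end

section \<open>The discrete error\<close>

lemma discrete_gronwall:
  fixes a :: "nat \<Rightarrow> real"
  assumes "a 0 = 0" "\<alpha> \<ge> 0" "\<beta> \<ge> 0" "h \<ge> 0"
    and "\<And>j. real (Suc j) * h \<le> T \<Longrightarrow> a (Suc j) \<le> (1 + \<alpha> * h) * a j + \<beta> * h\<^sup>2"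
    and "real j * h \<le> T"
  shows "a j \<le> \<beta> * T * exp (\<alpha> * T) * h"
proof -
  have ind: "a j \<le> real j * \<beta> * h\<^sup>2 * exp (\<alpha> * (real j * h))" if "real j * h \<le> T" for j
    using that
  proof (induction j)
    case 0
    then show ?case using assms(1) by simp
  next
    case (Suc j)
    have le: "real j * h \<le> T" using Suc.prems assms(4) by (simp add: algebra_simps)
    have e: "1 + \<alpha> * h \<le> exp (\<alpha> * h)" by (rule exp_ge_add_one_self)
    have pos: "0 \<le> real j * \<beta> * h\<^sup>2 * exp (\<alpha> * (real j * h))" using assms by simp
    have "a (Suc j) \<le> (1 + \<alpha> * h) * a j + \<beta> * h\<^sup>2" by (rule assms(5)[OF Suc.prems])
    also have "\<dots> \<le> (1 + \<alpha> * h) * (real j * \<beta> * h\<^sup>2 * exp (\<alpha> * (real j * h))) + \<beta> * h\<^sup>2"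
      using Suc.IH[OF le] assms by (intro add_right_mono mult_left_mono) auto
    also have "\<dots> \<le> exp (\<alpha> * h) * (real j * \<beta> * h\<^sup>2 * exp (\<alpha> * (real j * h))) + \<beta> * h\<^sup>2 * exp (\<alpha> * (real (Suc j) * h))"
    proof (rule add_mono[OF mult_right_mono[OF e pos]])
      have "1 \<le> exp (\<alpha> * (real (Suc j) * h))" using assms by simp
      then show "\<beta> * h\<^sup>2 \<le> \<beta> * h\<^sup>2 * exp (\<alpha> * (real (Suc j) * h))"
        using mult_left_mono[of 1 "exp (\<alpha> * (real (Suc j) * h))" "\<beta> * h\<^sup>2"] assms by simp
    qed
    also have "exp (\<alpha> * h) * (real j * \<beta> * h\<^sup>2 * exp (\<alpha> * (real j * h)))
        = real j * \<beta> * h\<^sup>2 * (exp (\<alpha> * h) * exp (\<alpha> * (real j * h)))" by (simp only: mult_ac)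
    also have "exp (\<alpha> * h) * exp (\<alpha> * (real j * h)) = exp (\<alpha> * (real (Suc j) * h))"
      by (simp add: exp_add[symmetric] algebra_simps)
    finally show ?case by (simp add: algebra_simps)
  qed
  have "a j \<le> \<beta> * h * ((real j * h) * exp (\<alpha> * (real j * h)))"
    using ind[OF assms(6)] by (simp add: power2_eq_square mult_ac)
  also have "\<dots> \<le> \<beta> * h * (T * exp (\<alpha> * T))"
  proof (intro mult_left_mono mult_mono)
    show "exp (\<alpha> * (real j * h)) \<le> exp (\<alpha> * T)" using assms by (simp add: mult_left_mono)
    have "0 \<le> real j * h" using assms(4) by simp
    then show "T \<ge> 0" using assms(6) by linarith
  qed (use assms in auto)
  finally show ?thesis by (simp add: mult_ac)
qed

context smooth_flow
begin

lemma LINT_torus_one: "(LINT x|torus. (1 :: real)) = 1"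
proof -
  have "(LINT x|torus. (1 :: real)) = measure torus (space torus)" by simp
  then show ?thesis unfolding measure_def emeasure_torus by simp
qed

lemma LINT_err_le:
  "\<exists>C>0. \<forall>t\<in>{0..T}. \<forall>v \<Xi>. (v, \<Xi>) \<in> state_space p \<longrightarrow>
     0 \<le> (LINT x|torus. err (v x) (\<Xi> x) (t, x)) \<and>
     (LINT x|torus. err (v x) (\<Xi> x) (t, x)) \<le> C * ent v \<Xi> t"
proof -
  obtain C where C: "C > 0" "\<And>t x v \<Xi>. t \<in> {0..T} \<Longrightarrow> x \<in> cbox 0 1 \<Longrightarrow> err v \<Xi> (t, x) \<le> C * eta v \<Xi> (t, x)"
    using eta_coercive by blast
  have "(LINT x|torus. err (v x) (\<Xi> x) (t, x)) \<le> C * ent v \<Xi> t"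
    if t: "t \<in> {0..T}" and s: "(v, \<Xi>) \<in> state_space p" for t v \<Xi>
  proof -
    have "(LINT x|torus. err (v x) (\<Xi> x) (t, x)) \<le> (LINT x|torus. C * eta (v x) (\<Xi> x) (t, x))"
    proof (rule integral_mono[OF err_integrable[OF t s]])
      show "integrable torus (\<lambda>x. C * eta (v x) (\<Xi> x) (t, x))" using eta_integrable[OF t s] by simp
    qed (use C(2)[OF t] in simp)
    then show ?thesis by (simp add: ent_def)
  qed
  moreover have "0 \<le> (LINT x|torus. err (v x) (\<Xi> x) (t, x))" for t v \<Xi>
    by (simp add: err_nonneg)
  ultimately show ?thesis using C(1) by (intro exI[of _ C]) simp
qed

lemma ent_nonneg:
  assumes "t \<in> {0..T}" "(v, \<Xi>) \<in> state_space p"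
  shows "0 \<le> ent v \<Xi> t"
proof -
  obtain C where "C > 0" "0 \<le> C * ent v \<Xi> t" using LINT_err_le assms by (meson order_trans)
  then show ?thesis by (simp add: zero_le_mult_iff)
qed

lemma drift_integrable:
  assumes t: "t \<in> {0..T}" and s: "(v, \<Xi>) \<in> state_space p"
  shows "integrable torus (\<lambda>x. drift (v x) (\<Xi> x) (t, x))"
proof -
  obtain K where K: "K > 0" "\<And>t x v \<Xi>. t \<in> {0..T} \<Longrightarrow> x \<in> cbox 0 1 \<Longrightarrow> \<bar>drift v \<Xi> (t, x)\<bar> \<le> K * (1 + err v \<Xi> (t, x))"
    using drift_bound by blast
  have "integrable torus (\<lambda>x. K * (1 + err (v x) (\<Xi> x) (t, x)))"
    using err_integrable[OF t s] torus_integrable_const by simp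
  then show ?thesis
  proof (rule torus_integrable_bound)
    note [measurable] = state_measurable[OF s] slice_integrable(2)[OF t continuous_Vb] slice_integrable(2)[OF t continuous_Xb]
      slice_integrable(2)[OF t continuous_dVb] slice_integrable(2)[OF t continuous_dgb]
    show "(\<lambda>x. drift (v x) (\<Xi> x) (t, x)) \<in> borel_measurable torus"
      unfolding drift_def by measurable
    show "norm (drift (v x) (\<Xi> x) (t, x)) \<le> K * (1 + err (v x) (\<Xi> x) (t, x))" if "x \<in> cbox 0 1" for x
      using K(2)[OF t that] by simp
  qed
qed

lemma LINT_flux_le:
  "\<exists>C>0. \<forall>t\<in>{0..T}. \<forall>v\<^sub>0 \<Xi>\<^sub>0 v \<Xi>. (v\<^sub>0, \<Xi>\<^sub>0) \<in> state_space p \<longrightarrow> (v, \<Xi>) \<in> state_space p \<longrightarrow>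
     differ_by_gradient (\<lambda>x. fst (\<Xi>\<^sub>0 x)) (\<lambda>x. Fb (t, x)) \<longrightarrow>
     integrable torus (\<lambda>x. flux (v x) (\<Xi> x) (fst (\<Xi>\<^sub>0 x)) (t, x)) \<longrightarrow>
     (LINT x|torus. flux (v x) (\<Xi> x) (fst (\<Xi>\<^sub>0 x)) (t, x))
       \<le> (LINT x|torus. drift (v x) (\<Xi> x) (t, x)) + C * (ent v\<^sub>0 \<Xi>\<^sub>0 t + ent v \<Xi> t)"
proof -
  obtain C1 where C1: "C1 > 0" "\<And>t v \<Xi>. t \<in> {0..T} \<Longrightarrow> (v, \<Xi>) \<in> state_space p \<Longrightarrow> 0 \<le> (LINT x|torus. err (v x) (\<Xi> x) (t, x))"
     "\<And>t v \<Xi>. t \<in> {0..T} \<Longrightarrow> (v, \<Xi>) \<in> state_space p \<Longrightarrow> (LINT x|torus. err (v x) (\<Xi> x) (t, x)) \<le> C1 * ent v \<Xi> t"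
    using LINT_err_le by blast
  obtain C2 where C2: "C2 > 0" "\<And>t x v \<Xi> v\<^sub>0 \<Xi>\<^sub>0. t \<in> {0..T} \<Longrightarrow> x \<in> cbox 0 1 \<Longrightarrow>
     \<bar>flux v \<Xi> (fst \<Xi>\<^sub>0) (t, x) - drift v \<Xi> (t, x) - null_part (fst \<Xi>\<^sub>0) (t, x)\<bar>
       \<le> C2 * (err v \<Xi> (t, x) + err v\<^sub>0 \<Xi>\<^sub>0 (t, x))"
    using flux_drift by blast
  obtain C3 where C3: "C3 > 0" "\<And>t v\<^sub>0 \<Xi>\<^sub>0. t \<in> {0..T} \<Longrightarrow> (v\<^sub>0, \<Xi>\<^sub>0) \<in> state_space p \<Longrightarrow>
     differ_by_gradient (\<lambda>x. fst (\<Xi>\<^sub>0 x)) (\<lambda>x. Fb (t, x)) \<Longrightarrow>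
     integrable torus (\<lambda>x. null_part (fst (\<Xi>\<^sub>0 x)) (t, x)) \<and>
     \<bar>LINT x|torus. null_part (fst (\<Xi>\<^sub>0 x)) (t, x)\<bar> \<le> C3 * (LINT x|torus. err (v\<^sub>0 x) (\<Xi>\<^sub>0 x) (t, x))"
    using null_part_integral by blast
  have main: "(LINT x|torus. flux (v x) (\<Xi> x) (fst (\<Xi>\<^sub>0 x)) (t, x))
       \<le> (LINT x|torus. drift (v x) (\<Xi> x) (t, x)) + ((C2 + C3) * C1) * (ent v\<^sub>0 \<Xi>\<^sub>0 t + ent v \<Xi> t)"
    if t: "t \<in> {0..T}" and s0: "(v\<^sub>0, \<Xi>\<^sub>0) \<in> state_space p" and s: "(v, \<Xi>) \<in> state_space p"
      and dg: "differ_by_gradient (\<lambda>x. fst (\<Xi>\<^sub>0 x)) (\<lambda>x. Fb (t, x))"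
      and fi: "integrable torus (\<lambda>x. flux (v x) (\<Xi> x) (fst (\<Xi>\<^sub>0 x)) (t, x))" for t v\<^sub>0 \<Xi>\<^sub>0 v \<Xi>
  proof -
    let ?f = "\<lambda>x. flux (v x) (\<Xi> x) (fst (\<Xi>\<^sub>0 x)) (t, x)" and ?d = "\<lambda>x. drift (v x) (\<Xi> x) (t, x)"
      and ?n = "\<lambda>x. null_part (fst (\<Xi>\<^sub>0 x)) (t, x)" and ?e = "\<lambda>x. err (v x) (\<Xi> x) (t, x)"
      and ?g = "\<lambda>x. err (v\<^sub>0 x) (\<Xi>\<^sub>0 x) (t, x)"
    note n = C3(2)[OF t s0 dg] and di = drift_integrable[OF t s] and ei = err_integrable[OF t s] and gi = err_integrable[OF t s0]
    have le: "?f x \<le> ?d x + ?n x + C2 * (?e x + ?g x)" if "x \<in> cbox 0 1" for x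
      using C2(2)[OF t that, where v = "v x" and \<Xi> = "\<Xi> x" and \<Xi>\<^sub>0 = "\<Xi>\<^sub>0 x" and v\<^sub>0 = "v\<^sub>0 x"] by (simp add: abs_le_iff)
    have "(LINT x|torus. ?f x) \<le> (LINT x|torus. ?d x + ?n x + C2 * (?e x + ?g x))"
      using n di ei gi by (intro integral_mono[OF fi]) (auto intro: le)
    also have "\<dots> = (LINT x|torus. ?d x) + (LINT x|torus. ?n x) + C2 * ((LINT x|torus. ?e x) + (LINT x|torus. ?g x))"
      using n di ei gi by simp
    also have "\<dots> \<le> (LINT x|torus. ?d x) + C3 * (LINT x|torus. ?g x) + C2 * ((LINT x|torus. ?e x) + (LINT x|torus. ?g x))"
      using n by (simp add: abs_le_iff)
    also have "\<dots> \<le> (LINT x|torus. ?d x) + (C2 + C3) * ((LINT x|torus. ?e x) + (LINT x|torus. ?g x))"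
      using mult_nonneg_nonneg[of C3 "LINT x|torus. ?e x"] C3(1) C1(2)[OF t s] by (simp add: algebra_simps)
    also have "\<dots> \<le> (LINT x|torus. ?d x) + (C2 + C3) * (C1 * ent v \<Xi> t + C1 * ent v\<^sub>0 \<Xi>\<^sub>0 t)"
      using C2(1) C3(1) C1(3)[OF t s] C1(3)[OF t s0] by (intro add_left_mono mult_left_mono add_mono) auto
    finally show ?thesis by (simp add: algebra_simps)
  qed
  have "(C2 + C3) * C1 > 0" using C1 C2 C3 by simp
  then show ?thesis using main by blast
qed

lemma ent_time_step:
  "\<exists>C>0. \<forall>t h v \<Xi>. 0 \<le> t \<longrightarrow> 0 \<le> h \<longrightarrow> t + h \<le> T \<longrightarrow> (v, \<Xi>) \<in> state_space p \<longrightarrow>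
     ent v \<Xi> (t + h) \<le> ent v \<Xi> t - h * (LINT x|torus. drift (v x) (\<Xi> x) (t, x)) + C * h\<^sup>2 * (1 + ent v \<Xi> t)"
proof -
  obtain C1 where C1: "C1 > 0" "\<And>t v \<Xi>. t \<in> {0..T} \<Longrightarrow> (v, \<Xi>) \<in> state_space p \<Longrightarrow> (LINT x|torus. err (v x) (\<Xi> x) (t, x)) \<le> C1 * ent v \<Xi> t"
    using LINT_err_le by blast
  obtain K1 where K1: "K1 \<ge> 0" "\<And>t h x v \<Xi>. 0 \<le> t \<Longrightarrow> 0 \<le> h \<Longrightarrow> t + h \<le> T \<Longrightarrow> x \<in> cbox 0 1 \<Longrightarrow>
     \<bar>eta v \<Xi> (t + h, x) - eta v \<Xi> (t, x) + h * drift v \<Xi> (t, x)\<bar> \<le> K1 * h\<^sup>2 * (1 + norm v + norm \<Xi>)"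
    using eta_time_step by blast
  obtain K2 where K2: "K2 > 0" "\<And>t x v \<Xi>. t \<in> {0..T} \<Longrightarrow> x \<in> cbox 0 1 \<Longrightarrow> 1 + norm v + norm \<Xi> \<le> K2 * (1 + err v \<Xi> (t, x))"
    using norm_le_err by blast
  define C where "C = (K1 + 1) * K2 * (1 + C1)"
  have C: "C > 0" unfolding C_def using K1(1) K2(1) C1(1) by simp
  have main: "ent v \<Xi> (t + h) \<le> ent v \<Xi> t - h * (LINT x|torus. drift (v x) (\<Xi> x) (t, x)) + C * h\<^sup>2 * (1 + ent v \<Xi> t)"
    if t: "0 \<le> t" and h: "0 \<le> h" "t + h \<le> T" and s: "(v, \<Xi>) \<in> state_space p" for t h v \<Xi>
  proof -
    have t': "t \<in> {0..T}" "t + h \<in> {0..T}" using t h by auto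
    let ?k = "K1 * h\<^sup>2 * K2" and ?e = "\<lambda>x. err (v x) (\<Xi> x) (t, x)" and ?d = "\<lambda>x. drift (v x) (\<Xi> x) (t, x)"
      and ?a = "\<lambda>x. eta (v x) (\<Xi> x) (t, x)"
    note ei = err_integrable[OF t'(1) s] and ai = eta_integrable[OF t'(1) s] and di = drift_integrable[OF t'(1) s]
    have "eta (v x) (\<Xi> x) (t + h, x) \<le> ?a x - h * ?d x + ?k * (1 + ?e x)" if x: "x \<in> cbox 0 1" for x
    proof -
      have "K1 * h\<^sup>2 * (1 + norm (v x) + norm (\<Xi> x)) \<le> K1 * h\<^sup>2 * (K2 * (1 + ?e x))"
        using K2(2)[OF t'(1) x] K1(1) by (intro mult_left_mono) auto
      then show ?thesis using K1(2)[OF t h x, where v = "v x" and \<Xi> = "\<Xi> x"] by (simp add: abs_le_iff mult.assoc)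
    qed
    then have "ent v \<Xi> (t + h) \<le> (LINT x|torus. ?a x - h * ?d x + ?k * (1 + ?e x))"
      unfolding ent_def using ei ai di torus_integrable_const
      by (intro integral_mono[OF eta_integrable[OF t'(2) s]]) auto
    also have "\<dots> = ent v \<Xi> t - h * (LINT x|torus. ?d x) + ?k * (1 + (LINT x|torus. ?e x))"
      unfolding ent_def using ei ai di torus_integrable_const[of 1] LINT_torus_one
      by (simp del: lebesgue_integral_const add: Bochner_Integration.integral_add Bochner_Integration.integral_diff)
    also have "?k * (1 + (LINT x|torus. ?e x)) \<le> ?k * ((1 + C1) * (1 + ent v \<Xi> t))"
    proof (rule mult_left_mono)
      have "1 + C1 * ent v \<Xi> t \<le> (1 + C1) * (1 + ent v \<Xi> t)"
        using ent_nonneg[OF t'(1) s] C1(1) by (simp add: algebra_simps)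
      then show "1 + (LINT x|torus. ?e x) \<le> (1 + C1) * (1 + ent v \<Xi> t)"
        using C1(2)[OF t'(1) s] by linarith
    qed (use K1(1) K2(1) in simp)
    also have "?k * ((1 + C1) * (1 + ent v \<Xi> t)) \<le> C * h\<^sup>2 * (1 + ent v \<Xi> t)"
    proof -
      have "K1 * (h\<^sup>2 * K2 * ((1 + C1) * (1 + ent v \<Xi> t))) \<le> (K1 + 1) * (h\<^sup>2 * K2 * ((1 + C1) * (1 + ent v \<Xi> t)))"
        using K2(1) C1(1) ent_nonneg[OF t'(1) s] by (intro mult_right_mono mult_nonneg_nonneg) auto
      then show ?thesis by (simp add: C_def mult_ac)
    qed
    finally show ?thesis by simp
  qed
  show ?thesis using C main by blast
qed

lemma LINT_drift_le:
  "\<exists>C>0. \<forall>t\<in>{0..T}. \<forall>v \<Xi>. (v, \<Xi>) \<in> state_space p \<longrightarrow>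
     (LINT x|torus. drift (v x) (\<Xi> x) (t, x)) \<le> C * (1 + ent v \<Xi> t)"
proof -
  obtain C1 where C1: "C1 > 0" "\<And>t v \<Xi>. t \<in> {0..T} \<Longrightarrow> (v, \<Xi>) \<in> state_space p \<Longrightarrow> (LINT x|torus. err (v x) (\<Xi> x) (t, x)) \<le> C1 * ent v \<Xi> t"
    using LINT_err_le by blast
  obtain K where K: "K > 0" "\<And>t x v \<Xi>. t \<in> {0..T} \<Longrightarrow> x \<in> cbox 0 1 \<Longrightarrow> \<bar>drift v \<Xi> (t, x)\<bar> \<le> K * (1 + err v \<Xi> (t, x))"
    using drift_bound by blast
  have "(LINT x|torus. drift (v x) (\<Xi> x) (t, x)) \<le> K * (1 + C1) * (1 + ent v \<Xi> t)"
    if t: "t \<in> {0..T}" and s: "(v, \<Xi>) \<in> state_space p" for t v \<Xi>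
  proof -
    let ?e = "\<lambda>x. err (v x) (\<Xi> x) (t, x)"
    note ei = err_integrable[OF t s]
    have "(LINT x|torus. drift (v x) (\<Xi> x) (t, x)) \<le> (LINT x|torus. K * (1 + ?e x))"
      using ei torus_integrable_const K(2)[OF t]
      by (intro integral_mono[OF drift_integrable[OF t s]]) (auto simp: abs_le_iff)
    also have "\<dots> = K * (1 + (LINT x|torus. ?e x))"
      using ei torus_integrable_const[of 1] LINT_torus_one
      by (simp del: lebesgue_integral_const add: Bochner_Integration.integral_add)
    also have "\<dots> \<le> K * ((1 + C1) * (1 + ent v \<Xi> t))"
    proof (rule mult_left_mono)
      have "1 + C1 * ent v \<Xi> t \<le> (1 + C1) * (1 + ent v \<Xi> t)"
        using ent_nonneg[OF t s] C1(1) by (simp add: algebra_simps)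
      then show "1 + (LINT x|torus. ?e x) \<le> (1 + C1) * (1 + ent v \<Xi> t)"
        using C1(2)[OF t s] by linarith
    qed (use K(1) in simp)
    finally show ?thesis by (simp only: mult.assoc)
  qed
  moreover have "K * (1 + C1) > 0" using K C1 by simp
  ultimately show ?thesis by blast
qed

end

text \<open>\<open>a\<close> and \<open>a'\<close> stand for the relative entropies of two consecutive iterates at their own
  times, \<open>b\<close> for that of the second iterate at the time of the first. The drift \<open>D\<close>, of order
  one, cancels.\<close>

lemma one_step_recursion:
  fixes a b D :: real
  assumes "0 \<le> a" "0 \<le> b" "0 < C" "0 < h" "h \<le> 1" "4 * (C * h) \<le> 1"
    and b: "b \<le> a + h * D + C * h * (a + b)" and D: "D \<le> C * (1 + b)"
  shows "b \<le> 4 * a + 2 * C * h"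
    and "a' \<le> b - h * D + C * h\<^sup>2 * (1 + b) \<Longrightarrow> a' \<le> (1 + 9 * C * h) * a + (4 * C\<^sup>2 + C) * h\<^sup>2"
proof -
  have "h * D \<le> h * (C * (1 + b))" using D assms(4) by (intro mult_left_mono) auto
  then have 1: "b \<le> a + C * h + C * h * a + 2 * (C * h * b)"
    using b by (simp add: algebra_simps)
  have "4 * (C * h) * b \<le> 1 * b" using assms(2,6) by (rule mult_right_mono[rotated])
  moreover have "4 * (C * h) * a \<le> 1 * a" using assms(1,6) by (rule mult_right_mono[rotated])
  ultimately show le: "b \<le> 4 * a + 2 * C * h" using 1 assms(1) by (simp add: mult.assoc)
  assume a': "a' \<le> b - h * D + C * h\<^sup>2 * (1 + b)"
  have "h\<^sup>2 \<le> h" using assms(4,5) by (simp add: power2_eq_square mult_left_le)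
  then have "C * h\<^sup>2 * b \<le> C * h * b" using assms(2,3) by (intro mult_right_mono mult_left_mono) auto
  with a' b have 2: "a' \<le> a + C * h * a + 2 * (C * h * b) + C * h\<^sup>2" by (simp add: algebra_simps)
  have "C * h * b \<le> C * h * (4 * a + 2 * C * h)" using le assms(3,4) by (intro mult_left_mono) auto
  with 2 show "a' \<le> (1 + 9 * C * h) * a + (4 * C\<^sup>2 + C) * h\<^sup>2"
    by (simp add: algebra_simps power2_eq_square)
qed

context smooth_flow
begin

text \<open>A sequence of states generated by the scheme, with initial data left open.\<close>

definition discrete_solution :: "real \<Rightarrow> (nat \<Rightarrow> vec3 \<Rightarrow> vec3) \<Rightarrow> (nat \<Rightarrow> vec3 \<Rightarrow> xi) \<Rightarrow> bool" where
  "discrete_solution h v \<Xi> \<longleftrightarrow> (\<forall>j. (v j, \<Xi> j) \<in> state_space p \<and>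
     unique_minimizer p G h (v j) (\<Xi> j) (v (Suc j)) (\<Xi> (Suc j)) \<and>
     momentum_balance G h (v j) (\<Xi> j) (v (Suc j)) (\<Xi> (Suc j)) \<and>
     kinematic_constraint h (\<Xi> j) (v (Suc j)) (\<Xi> (Suc j)))"

text \<open>The second bound compares the new iterate with the smooth solution at the old time. It is meaningful
  also for the last step, which may end after \<open>T\<close>.\<close>

lemma discrete_error:
  "\<exists>B>0. \<exists>\<delta>>0. \<delta> \<le> 1 \<and> (\<forall>h v \<Xi> j. 0 < h \<longrightarrow> h \<le> \<delta> \<longrightarrow>
     discrete_solution h v \<Xi> \<longrightarrow>
     (AE x in lebesgue. v 0 x = Vb (0, x) \<and> \<Xi> 0 x = Xb (0, x)) \<longrightarrow>
     real j * h \<le> T \<longrightarrow>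
       ent (v j) (\<Xi> j) (real j * h) \<le> B * h \<and> ent (v (Suc j)) (\<Xi> (Suc j)) (real j * h) \<le> B * h)"
proof -
  obtain C1 where C1: "C1 > 0" "\<And>t v\<^sub>0 \<Xi>\<^sub>0 v \<Xi>. t \<in> {0..T} \<Longrightarrow> (v\<^sub>0, \<Xi>\<^sub>0) \<in> state_space p \<Longrightarrow> (v, \<Xi>) \<in> state_space p \<Longrightarrow>
     differ_by_gradient (\<lambda>x. fst (\<Xi>\<^sub>0 x)) (\<lambda>x. Fb (t, x)) \<Longrightarrow>
     integrable torus (\<lambda>x. flux (v x) (\<Xi> x) (fst (\<Xi>\<^sub>0 x)) (t, x)) \<Longrightarrow>
     (LINT x|torus. flux (v x) (\<Xi> x) (fst (\<Xi>\<^sub>0 x)) (t, x))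
       \<le> (LINT x|torus. drift (v x) (\<Xi> x) (t, x)) + C1 * (ent v\<^sub>0 \<Xi>\<^sub>0 t + ent v \<Xi> t)"
    using LINT_flux_le by blast
  obtain C2 where C2: "C2 > 0" "\<And>t h v \<Xi>. 0 \<le> t \<Longrightarrow> 0 \<le> h \<Longrightarrow> t + h \<le> T \<Longrightarrow> (v, \<Xi>) \<in> state_space p \<Longrightarrow>
     ent v \<Xi> (t + h) \<le> ent v \<Xi> t - h * (LINT x|torus. drift (v x) (\<Xi> x) (t, x)) + C2 * h\<^sup>2 * (1 + ent v \<Xi> t)"
    using ent_time_step by blast
  obtain C3 where C3: "C3 > 0" "\<And>t v \<Xi>. t \<in> {0..T} \<Longrightarrow> (v, \<Xi>) \<in> state_space p \<Longrightarrow>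
     (LINT x|torus. drift (v x) (\<Xi> x) (t, x)) \<le> C3 * (1 + ent v \<Xi> t)"
    using LINT_drift_le by blast
  define C where "C = C1 + C2 + C3"
  have C: "C > 0" "C1 \<le> C" "C2 \<le> C" "C3 \<le> C" using C1(1) C2(1) C3(1) by (simp_all add: C_def)
  \<comment> \<open>For \<open>h \<le> \<delta>\<close> the terms \<open>C h b\<close> on the right-hand side can be absorbed.\<close>
  define \<delta> where "\<delta> = min 1 (1 / (4 * C))"
  have \<delta>: "\<delta> > 0" "\<delta> \<le> 1" using C(1) by (simp_all add: \<delta>_def)
  \<comment> \<open>The constant of \<open>discrete_gronwall\<close> for the recursion in \<open>one_step_recursion\<close>.\<close>
  define A where "A = (4 * C\<^sup>2 + C) * T * exp (9 * C * T)"
  define B where "B = 4 * A + 2 * C"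
  have A: "A \<ge> 0" unfolding A_def using C(1) T_pos by simp
  have B: "B > 0" using A C(1) by (simp add: B_def)
  have main: "ent (v j) (\<Xi> j) (real j * h) \<le> B * h \<and> ent (v (Suc j)) (\<Xi> (Suc j)) (real j * h) \<le> B * h"
    if h: "0 < h" "h \<le> \<delta>" and ds: "discrete_solution h v \<Xi>"
      and init: "AE x in lebesgue. v 0 x = Vb (0, x) \<and> \<Xi> 0 x = Xb (0, x)"
      and j: "real j * h \<le> T" for h v \<Xi> j
  proof -
    have st: "(v j, \<Xi> j) \<in> state_space p"
      and um: "unique_minimizer p G h (v j) (\<Xi> j) (v (Suc j)) (\<Xi> (Suc j))"
      and mb: "momentum_balance G h (v j) (\<Xi> j) (v (Suc j)) (\<Xi> (Suc j))"
      and kc: "kinematic_constraint h (\<Xi> j) (v (Suc j)) (\<Xi> (Suc j))" for j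
      using ds by (simp_all add: discrete_solution_def)
    have h1: "h \<le> 1" using h \<delta> by simp
    have "h \<le> 1 / (4 * C)" using h(2) by (simp add: \<delta>_def)
    then have Ch: "4 * (C * h) \<le> 1" using C(1) by (simp add: field_simps)
    have ae: "AE x in torus. v 0 x = Vb (0, x) \<and> \<Xi> 0 x = Xb (0, x)"
      unfolding torus_def using init by (auto simp: AE_restrict_space_iff)
    have T0: "0 \<in> {0..T}" using T_pos by simp
    have time: "real k * h \<in> {0..T}" if "real k * h \<le> T" for k using that h by simp
    have dg0: "differ_by_gradient (\<lambda>x. fst (\<Xi> k x)) (\<lambda>x. Fb (0, x))" for k
    proof (induction k)
      case 0
      show ?case unfolding differ_by_gradient_def
      proof (intro allI impI)
        fix i Y assume Y: "Ck_on 1 UNIV (Y :: vec3 \<Rightarrow> vec3)"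
        have [measurable]: "Y \<in> borel_measurable torus"
          by (rule torus_measurable_continuous[OF continuous_on_subset[OF Ck_on_continuous[OF Y]]]) simp
        note [measurable] = state_measurable[OF st[of 0]] slice_integrable(2)[OF T0 continuous_Fb]
        have [measurable]: "(\<lambda>x. fst (\<Xi> 0 x) $ i) \<in> borel_measurable torus" "(\<lambda>x. Fb (0, x) $ i) \<in> borel_measurable torus"
          by (rule measurable_compose[OF _ borel_measurable_continuous_onI[OF linear_continuous_on[OF bounded_linear_vec_nth]]], measurable)+
        show "(LINT x|torus. fst (\<Xi> 0 x) $ i \<bullet> Y x) = (LINT x|torus. Fb (0, x) $ i \<bullet> Y x)"
        proof (rule integral_cong_AE)
          show "AE x in torus. fst (\<Xi> 0 x) $ i \<bullet> Y x = Fb (0, x) $ i \<bullet> Y x" using ae by eventually_elim simp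
        qed measurable
      qed
    next
      case (Suc k)
      show ?case by (rule differ_by_gradient_step[OF h(1) st st kc Suc])
    qed
    let ?a = "\<lambda>k. ent (v k) (\<Xi> k) (real k * h)" and ?b = "\<lambda>k. ent (v (Suc k)) (\<Xi> (Suc k)) (real k * h)"
    have a0: "?a 0 = 0"
    proof -
      have "?a 0 = (LINT x|torus. 0)"
        unfolding ent_def
      proof (rule integral_cong_AE)
        show "(\<lambda>x. eta (v 0 x) (\<Xi> 0 x) (real 0 * h, x)) \<in> borel_measurable torus"
          using eta_integrable[OF T0 st] by (simp add: borel_measurable_integrable)
        show "AE x in torus. eta (v 0 x) (\<Xi> 0 x) (real 0 * h, x) = 0"
          using ae by eventually_elim (simp add: eta_def Grel_def)
      qed simp
      then show ?thesis by simp
    qed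
    have step: "?b k \<le> 4 * ?a k + 2 * C * h"
      "real (Suc k) * h \<le> T \<Longrightarrow> ?a (Suc k) \<le> (1 + 9 * C * h) * ?a k + (4 * C\<^sup>2 + C) * h\<^sup>2"
      if k: "real k * h \<le> T" for k
    proof -
      note t = time[OF k]
      let ?D = "LINT x|torus. drift (v (Suc k) x) (\<Xi> (Suc k) x) (real k * h, x)"
      note pos = ent_nonneg[OF t st] 
      have "?b k - ?a k \<le> h * (LINT x|torus. flux (v (Suc k) x) (\<Xi> (Suc k) x) (fst (\<Xi> k x)) (real k * h, x))"
        by (rule entropy_step(2)[OF t h(1) st st um mb kc])
      also have "\<dots> \<le> h * (?D + C1 * (?a k + ?b k))"
        using h(1) by (intro mult_left_mono C1(2)[OF t st st differ_by_gradient_time[OF t dg0] entropy_step(1)[OF t h(1) st st um mb kc]]) simp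
      also have "\<dots> \<le> h * (?D + C * (?a k + ?b k))"
        using h(1) C(2) pos by (intro mult_left_mono add_left_mono mult_right_mono) auto
      finally have b: "?b k \<le> ?a k + h * ?D + C * h * (?a k + ?b k)" by (simp add: algebra_simps)
      have "?D \<le> C3 * (1 + ?b k)" by (rule C3(2)[OF t st])
      also have "\<dots> \<le> C * (1 + ?b k)" using C(4) pos by (intro mult_right_mono) auto
      finally have D: "?D \<le> C * (1 + ?b k)" .
      note rec = one_step_recursion[OF pos pos C(1) h(1) h1 Ch b D]
      show "?b k \<le> 4 * ?a k + 2 * C * h" by (rule rec(1))
      assume k': "real (Suc k) * h \<le> T"
      have eq: "real (Suc k) * h = real k * h + h" by (simp add: algebra_simps)
      have "?a (Suc k) \<le> ?b k - h * ?D + C2 * h\<^sup>2 * (1 + ?b k)"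
        unfolding eq by (rule C2(2)) (use t h k' st in \<open>auto simp only: eq atLeastAtMost_iff intro: less_imp_le\<close>)
      also have "\<dots> \<le> ?b k - h * ?D + C * h\<^sup>2 * (1 + ?b k)"
        using C(3) pos by (intro add_left_mono mult_right_mono) auto
      finally show "?a (Suc k) \<le> (1 + 9 * C * h) * ?a k + (4 * C\<^sup>2 + C) * h\<^sup>2" by (rule rec(2))
    qed
    have "?a j \<le> (4 * C\<^sup>2 + C) * T * exp (9 * C * T) * h"
    proof (rule discrete_gronwall[where a = ?a and h = h, OF a0 _ _ _ _ j])
      fix k assume k: "real (Suc k) * h \<le> T"
      then have "real k * h \<le> T" using h(1) by (simp add: algebra_simps)
      from step(2)[OF this k] show "?a (Suc k) \<le> (1 + 9 * C * h) * ?a k + (4 * C\<^sup>2 + C) * h\<^sup>2" .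
    qed (use C h in auto)
    then have a: "?a j \<le> A * h" by (simp add: A_def)
    moreover have "?b j \<le> 4 * (A * h) + 2 * C * h" using step(1)[OF j] a by linarith
    moreover have "A * h \<ge> 0" "C * h \<ge> 0" using A C h by auto
    ultimately show ?thesis by (simp add: B_def algebra_simps)
  qed
  show ?thesis
    by (rule exI[of _ B], rule conjI[OF B], rule exI[of _ \<delta>], rule conjI[OF \<delta>(1)], rule conjI[OF \<delta>(2)],
        intro allI impI) (rule main)
qed

end

section \<open>The interpolates\<close>

lemma interpolate_eq:
  assumes "h > 0" "real j * h \<le> t" "t < real (Suc j) * h"
  shows "interpolate h u t x = u j x + ((t - real j * h) / h) *\<^sub>R (u (Suc j) x - u j x)"
proof -
  let ?f = "\<lambda>k. indicator {real k * h ..< real (Suc k) * h} t *\<^sub>R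
        (u k x + ((t - h * real k) / h) *\<^sub>R (u (Suc k) x - u k x))"
  have "?f k = 0" if "k \<notin> {j}" for k
  proof -
    have "t \<notin> {real k * h ..< real (Suc k) * h}"
    proof
      assume "t \<in> {real k * h ..< real (Suc k) * h}"
      then have "real k * h < real (Suc j) * h" "real j * h < real (Suc k) * h"
        using assms unfolding atLeastLessThan_iff by linarith+
      then have "k < Suc j" "j < Suc k" using assms(1) by (simp_all only: mult_less_cancel_right_pos of_nat_less_iff)
      then show False using that by simp
    qed
    then show ?thesis by simp
  qed
  then have "suminf ?f = sum ?f {j}" by (intro suminf_finite) simp_all
  moreover have "sum ?f {j} = ?f j" by (subst sum.insert) (simp_all only: finite.emptyI empty_iff sum.empty add_0_right not_False_eq_True)
  ultimately have "interpolate h u t x = ?f j" unfolding interpolate_def by (rule trans)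
  moreover have "t \<in> {real j * h ..< real (Suc j) * h}" using assms by simp
  ultimately show ?thesis by (simp only: indicator_simps scaleR_one mult.commute[of h])
qed

lemma time_cell:
  fixes t h :: real
  assumes "h > 0" "t \<ge> 0"
  obtains j where "real j * h \<le> t" "t < real (Suc j) * h"
proof
  have "0 \<le> \<lfloor>t / h\<rfloor>" using assms by simp
  then have eq: "real (nat \<lfloor>t / h\<rfloor>) = of_int \<lfloor>t / h\<rfloor>" by simp
  have "of_int \<lfloor>t / h\<rfloor> \<le> t / h" "t / h < of_int \<lfloor>t / h\<rfloor> + 1" by linarith+
  then show "real (nat \<lfloor>t / h\<rfloor>) * h \<le> t" "t < real (Suc (nat \<lfloor>t / h\<rfloor>)) * h"
    using assms(1) unfolding of_nat_Suc eq by (simp_all only: pos_le_divide_eq pos_divide_less_eq add.commute)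
qed

text \<open>Here \<open>a\<close> and \<open>b\<close> are consecutive iterates, and \<open>c\<close>, \<open>c'\<close> values of the smooth solution at times
  less than \<open>h\<close> apart.\<close>

lemma interpolation_error:
  fixes a b c c' :: "'a::real_normed_vector"
  assumes s: "0 \<le> s" "s \<le> 1" and c: "norm (c' - c) \<le> K * h" and K: "K \<ge> 0" and h: "0 < h" "h \<le> 1" and q: "q \<ge> 1"
  shows "norm (a + s *\<^sub>R (b - a) - c') powr q
     \<le> 4 powr q * (norm (a - c) powr q + norm (b - c) powr q + K powr q * h)"
proof -
  have "a + s *\<^sub>R (b - a) - c' = (1 - s) *\<^sub>R (a - c) + s *\<^sub>R (b - c) - (c' - c)" by (simp add: algebra_simps)
  then have "norm (a + s *\<^sub>R (b - a) - c') \<le> norm ((1 - s) *\<^sub>R (a - c) + s *\<^sub>R (b - c)) + norm (c' - c)"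
    by (simp only: norm_triangle_ineq4)
  also have "norm ((1 - s) *\<^sub>R (a - c) + s *\<^sub>R (b - c)) \<le> norm ((1 - s) *\<^sub>R (a - c)) + norm (s *\<^sub>R (b - c))"
    by (rule norm_triangle_ineq)
  also have "\<dots> \<le> norm (a - c) + norm (b - c)"
    using s by (intro add_mono) (simp_all add: mult_left_le_one_le)
  finally have "norm (a + s *\<^sub>R (b - a) - c') \<le> (norm (a - c) + norm (b - c)) + K * h" using c by simp
  then have "norm (a + s *\<^sub>R (b - a) - c') powr q \<le> ((norm (a - c) + norm (b - c)) + K * h) powr q"
    using q by (intro powr_mono2) auto
  also have "\<dots> \<le> 2 powr q * ((norm (a - c) + norm (b - c)) powr q + (K * h) powr q)"
    using q K h by (intro powr_sum_le) auto
  also have "\<dots> \<le> 2 powr q * (2 powr q * (norm (a - c) powr q + norm (b - c) powr q) + 2 powr q * (K powr q * h))"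
  proof (intro mult_left_mono add_mono)
    show "(norm (a - c) + norm (b - c)) powr q \<le> 2 powr q * (norm (a - c) powr q + norm (b - c) powr q)"
      using q by (intro powr_sum_le) auto
    have "h powr q \<le> h powr 1" using h q by (intro powr_mono') auto
    then have "(K * h) powr q \<le> K powr q * h" using K h by (simp add: powr_mult mult_left_mono)
    also have "\<dots> = 1 * (K powr q * h)" by simp
    also have "\<dots> \<le> 2 powr q * (K powr q * h)"
      using h q ge_one_powr_ge_zero[of 2 q] by (intro mult_right_mono) auto
    finally show "(K * h) powr q \<le> 2 powr q * (K powr q * h)" .
  qed auto
  also have "\<dots> = (2 powr q * 2 powr q) * (norm (a - c) powr q + norm (b - c) powr q + K powr q * h)"
    by (simp add: algebra_simps)
  also have "2 powr q * 2 powr q = (4 powr q :: real)" by (simp add: powr_mult[symmetric])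
  finally show ?thesis .
qed

lemma Lp_pow_le:
  fixes f :: "vec3 \<Rightarrow> 'b::euclidean_space"
  assumes "integrable torus g" "\<And>x. x \<in> cbox 0 1 \<Longrightarrow> norm (f x) powr q \<le> g x"
  shows "Lp_pow q f \<le> ennreal (LINT x|torus. g x)"
proof -
  have g: "g x \<ge> 0" if "x \<in> cbox 0 1" for x using assms(2)[OF that] powr_ge_zero order_trans by blast
  have "Lp_pow q f \<le> (\<integral>\<^sup>+x. ennreal (g x) \<partial>torus)"
    unfolding Lp_pow_def by (intro nn_integral_mono ennreal_leI) (simp add: assms(2))
  also have "\<dots> = ennreal (LINT x|torus. g x)"
    by (rule nn_integral_eq_integral[OF assms(1)]) (auto intro!: AE_I2 g)
  finally show ?thesis .
qed

context smooth_flow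
begin

text \<open>On \<open>[j h, (j + 1) h)\<close> the interpolate is compared with the smooth solution at time \<open>j h\<close>,
  where both iterates are controlled; the last iterate may belong to a time after \<open>T\<close>.\<close>

lemma interpolated_error:
  "\<exists>B. \<exists>\<delta>>0. \<forall>h v \<Xi>. 0 < h \<longrightarrow> h \<le> \<delta> \<longrightarrow>
     discrete_solution h v \<Xi> \<longrightarrow>
     (AE x in lebesgue. interpolate h v 0 x = Vb (0, x) \<and> interpolate h \<Xi> 0 x = Xb (0, x)) \<longrightarrow>
     (\<forall>t\<in>{0..T}. Lp_pow 2 (\<lambda>x. interpolate h v t x - Vb (t, x))
        + Lp_pow 2 (\<lambda>x. interpolate h \<Xi> t x - Xb (t, x))
        + Lp_pow p (\<lambda>x. fst (interpolate h \<Xi> t x) - Fb (t, x)) \<le> ennreal (B * h))"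
proof -
  obtain A \<delta> where A: "A > 0" and \<delta>: "\<delta> > 0" "\<delta> \<le> 1" and disc: "\<And>h v \<Xi> j. 0 < h \<Longrightarrow> h \<le> \<delta> \<Longrightarrow>
     discrete_solution h v \<Xi> \<Longrightarrow>
     (AE x in lebesgue. v 0 x = Vb (0, x) \<and> \<Xi> 0 x = Xb (0, x)) \<Longrightarrow> real j * h \<le> T \<Longrightarrow>
     ent (v j) (\<Xi> j) (real j * h) \<le> A * h \<and> ent (v (Suc j)) (\<Xi> (Suc j)) (real j * h) \<le> A * h"
    using discrete_error by blast
  obtain C where C: "C > 0" "\<And>t v \<Xi>. t \<in> {0..T} \<Longrightarrow> (v, \<Xi>) \<in> state_space p \<Longrightarrow>
     (LINT x|torus. err (v x) (\<Xi> x) (t, x)) \<le> C * ent v \<Xi> t"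
    using LINT_err_le by blast
  obtain K1 where K1: "K1 \<ge> 0" "\<And>t h x. 0 \<le> t \<Longrightarrow> 0 \<le> h \<Longrightarrow> t + h \<le> T \<Longrightarrow> x \<in> cbox 0 1 \<Longrightarrow>
    norm (Vb (t + h, x) - Vb (t, x)) \<le> K1 * h"
    using time_lipschitz[OF Vb_smooth] by blast
  obtain K2 where K2: "K2 \<ge> 0" "\<And>t h x. 0 \<le> t \<Longrightarrow> 0 \<le> h \<Longrightarrow> t + h \<le> T \<Longrightarrow> x \<in> cbox 0 1 \<Longrightarrow>
    norm (Xb (t + h, x) - Xb (t, x)) \<le> K2 * h"
    using time_lipschitz[OF Xb_smooth] by blast
  define K where "K = max K1 K2"
  have K: "K \<ge> 0" "K1 \<le> K" "K2 \<le> K" using K1(1) by (auto simp: K_def)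
  define D where "D = (\<lambda>q. 4 powr q * (2 * (C * A) + K powr q))"
  have D: "D q \<ge> 0" for q unfolding D_def using C(1) A by simp
  have main: "Lp_pow 2 (\<lambda>x. interpolate h v t x - Vb (t, x))
        + Lp_pow 2 (\<lambda>x. interpolate h \<Xi> t x - Xb (t, x))
        + Lp_pow p (\<lambda>x. fst (interpolate h \<Xi> t x) - Fb (t, x)) \<le> ennreal ((2 * D 2 + D p) * h)"
    if h: "0 < h" "h \<le> \<delta>" and ds: "discrete_solution h v \<Xi>"
      and init: "AE x in lebesgue. interpolate h v 0 x = Vb (0, x) \<and> interpolate h \<Xi> 0 x = Xb (0, x)"
      and t: "t \<in> {0..T}" for h v \<Xi> t
  proof -
    have st: "\<forall>j. (v j, \<Xi> j) \<in> state_space p" using ds by (simp add: discrete_solution_def)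
    have i0: "interpolate h u 0 x = u 0 x" for u :: "nat \<Rightarrow> vec3 \<Rightarrow> 'z::real_normed_vector" and x
      using interpolate_eq[of h 0 0 u x] h(1) by simp
    have init': "AE x in lebesgue. v 0 x = Vb (0, x) \<and> \<Xi> 0 x = Xb (0, x)" using init by (simp only: i0)
    obtain j where j: "real j * h \<le> t" "t < real (Suc j) * h" using time_cell[OF h(1)] t by auto
    let ?r = "real j * h" and ?s = "(t - real j * h) / h"
    have jT: "?r \<le> T" "?r \<in> {0..T}" using j t h by auto
    have h1: "h \<le> 1" using h \<delta> by simp
    have s: "0 \<le> ?s" "?s \<le> 1" using j h(1) by (simp_all add: field_simps)
    have d: "0 \<le> t - ?r" "t - ?r \<le> h" using j by (simp_all add: algebra_simps)
    note i = interpolate_eq[OF h(1) j]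
    note ab = disc[OF h ds init' jT(1)]
    let ?g = "\<lambda>x. err (v j x) (\<Xi> j x) (?r, x)" and ?g' = "\<lambda>x. err (v (Suc j) x) (\<Xi> (Suc j) x) (?r, x)"
    note gi = err_integrable[OF jT(2) st[rule_format, of j]] err_integrable[OF jT(2) st[rule_format, of "Suc j"]]
    have lip: "norm (Vb (t, x) - Vb (?r, x)) \<le> K * h" "norm (Xb (t, x) - Xb (?r, x)) \<le> K * h"
      "norm (Fb (t, x) - Fb (?r, x)) \<le> K * h" if x: "x \<in> cbox 0 1" for x
    proof -
      have r: "0 \<le> ?r" "?r + (t - ?r) \<le> T" using jT(2) t by auto
      have Kh: "K1 * (t - ?r) \<le> K * h" "K2 * (t - ?r) \<le> K * h" using K K1(1) K2(1) d by (auto intro: mult_mono)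
      show "norm (Vb (t, x) - Vb (?r, x)) \<le> K * h" using K1(2)[OF r(1) d(1) r(2) x] Kh by simp
      show X: "norm (Xb (t, x) - Xb (?r, x)) \<le> K * h" using K2(2)[OF r(1) d(1) r(2) x] Kh by simp
      show "norm (Fb (t, x) - Fb (?r, x)) \<le> K * h" using norm_fst[of "Xb (t, x) - Xb (?r, x)"] X by simp
    qed
    have bound: "Lp_pow q f \<le> ennreal (D q * h)"
      if f: "\<And>x. x \<in> cbox 0 1 \<Longrightarrow> norm (f x) powr q \<le> 4 powr q * (?g x + ?g' x + K powr q * h)"
      for q and f :: "vec3 \<Rightarrow> 'z::euclidean_space"
    proof -
      have gi': "integrable torus (\<lambda>x. 4 powr q * (?g x + ?g' x + K powr q * h))"
        using gi torus_integrable_const by simp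
      have "Lp_pow q f \<le> ennreal (LINT x|torus. 4 powr q * (?g x + ?g' x + K powr q * h))"
        by (rule Lp_pow_le[OF gi' f])
      also have "(LINT x|torus. 4 powr q * (?g x + ?g' x + K powr q * h))
          = 4 powr q * ((LINT x|torus. ?g x) + (LINT x|torus. ?g' x) + K powr q * h)"
        using gi torus_integrable_const LINT_torus_one by simp
      also have "\<dots> \<le> 4 powr q * (C * (A * h) + C * (A * h) + K powr q * h)"
        using ab C(1) by (intro mult_left_mono add_mono order_trans[OF C(2)[OF jT(2) st[rule_format]]]) auto
      also have "\<dots> = D q * h" by (simp add: D_def algebra_simps)
      finally show ?thesis by (simp add: ennreal_leI)
    qed
    have e: "norm (v k x - Vb (?r, x)) powr 2 \<le> err (v k x) (\<Xi> k x) (?r, x)"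
      "norm (\<Xi> k x - Xb (?r, x)) powr 2 \<le> err (v k x) (\<Xi> k x) (?r, x)"
      "norm (fst (\<Xi> k x) - Fb (?r, x)) powr p \<le> err (v k x) (\<Xi> k x) (?r, x)" for k x
      unfolding err_def norm_powr_2 by auto
    have *: "4 powr q * (a + b + k) \<le> 4 powr q * (a' + b' + k)" if "a \<le> a'" "b \<le> b'" for q a b a' b' k :: real
      using that by (intro mult_left_mono) auto
    have "Lp_pow 2 (\<lambda>x. interpolate h v t x - Vb (t, x)) \<le> ennreal (D 2 * h)"
      unfolding i by (rule bound, rule order_trans[OF interpolation_error[OF s lip(1) K(1) h(1) h1] *[OF e(1) e(1)]]) auto
    moreover have "Lp_pow 2 (\<lambda>x. interpolate h \<Xi> t x - Xb (t, x)) \<le> ennreal (D 2 * h)"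
      unfolding i by (rule bound, rule order_trans[OF interpolation_error[OF s lip(2) K(1) h(1) h1] *[OF e(2) e(2)]]) auto
    moreover have "Lp_pow p (\<lambda>x. fst (interpolate h \<Xi> t x) - Fb (t, x)) \<le> ennreal (D p * h)"
      unfolding i fst_add fst_scaleR fst_diff
      by (rule bound, rule order_trans[OF interpolation_error[OF s lip(3) K(1) h(1) h1] *[OF e(3) e(3)]]) (use p6 in auto)
    ultimately have "Lp_pow 2 (\<lambda>x. interpolate h v t x - Vb (t, x))
        + Lp_pow 2 (\<lambda>x. interpolate h \<Xi> t x - Xb (t, x))
        + Lp_pow p (\<lambda>x. fst (interpolate h \<Xi> t x) - Fb (t, x)) \<le> ennreal (D 2 * h) + ennreal (D 2 * h) + ennreal (D p * h)"
      by (intro add_mono)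
    also have "\<dots> = ennreal ((2 * D 2 + D p) * h)" using D h by (simp add: ennreal_plus[symmetric] algebra_simps del: ennreal_plus)
    finally show ?thesis .
  qed
  show ?thesis
    by (rule exI[of _ "2 * D 2 + D p"], rule exI[of _ \<delta>], rule conjI[OF \<delta>(1)], intro allI impI ballI) (rule main)
qed

end

section \<open>Convergence\<close>

text \<open>A smooth solution comes from functions that are smooth near the closed time interval; its
  equations, with one-sided time derivatives at the ends, are equations for these functions.\<close>

lemma smooth_flow_exists:
  assumes se: "stored_energy p \<kappa> \<kappa>' \<gamma> \<gamma>' c1 c2 c3 c4 c5 c7 c8 H G R"
    and T: "T > 0" and sol: "smooth_solution G T V F" and gr: "is_gradient (F 0)"
  obtains U Vb Fb where "smooth_flow p \<kappa> \<kappa>' \<gamma> \<gamma>' c1 c2 c3 c4 c5 c7 c8 H G R T U Vb Fb"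
    "\<And>t x. t \<in> {0..T} \<Longrightarrow> Vb (t, x) = V t x" "\<And>t x. t \<in> {0..T} \<Longrightarrow> Fb (t, x) = F t x"
proof -
  have per: "\<And>t. t \<in> {0..T} \<Longrightarrow> periodic (V t) \<and> periodic (F t)"
    and sV: "smooth_on ({0..T} \<times> UNIV) (\<lambda>(t, x). V t x)" and sF: "smooth_on ({0..T} \<times> UNIV) (\<lambda>(t, x). F t x)"
    and dV: "\<And>t x i. t \<in> {0..T} \<Longrightarrow> ((\<lambda>s. V s x $ i) has_real_derivative
           (\<Sum>\<alpha>\<in>UNIV. partial \<alpha> (\<lambda>y. grad G (Phi (F t y)) \<bullet> dPhi (F t y) i \<alpha>) x)) (at t within {0..T})"
    and dF: "\<And>t x i \<alpha>. t \<in> {0..T} \<Longrightarrow> ((\<lambda>s. F s x $ i $ \<alpha>) has_real_derivative partial \<alpha> (\<lambda>y. V t y $ i) x)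
          (at t within {0..T})"
    using sol unfolding smooth_solution_def by blast+
  obtain U1 Vb where U1: "open U1" "{0..T} \<times> UNIV \<subseteq> U1" "\<And>k. Ck_on k U1 Vb" "\<And>z. z \<in> {0..T} \<times> UNIV \<Longrightarrow> Vb z = (case z of (t, x) \<Rightarrow> V t x)"
    using sV unfolding smooth_on_def by metis
  obtain U2 Fb where U2: "open U2" "{0..T} \<times> UNIV \<subseteq> U2" "\<And>k. Ck_on k U2 Fb" "\<And>z. z \<in> {0..T} \<times> UNIV \<Longrightarrow> Fb z = (case z of (t, x) \<Rightarrow> F t x)"
    using sF unfolding smooth_on_def by metis
  have eV: "Vb (t, x) = V t x" and eF: "Fb (t, x) = F t x" if "t \<in> {0..T}" for t x
    using U1(4)[of "(t, x)"] U2(4)[of "(t, x)"] that by auto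
  define U where "U = U1 \<inter> U2"
  have U: "open U" "{0..T} \<times> UNIV \<subseteq> U" using U1 U2 by (auto simp: U_def)
  have VC: "Ck_on k U Vb" and FC: "Ck_on k U Fb" for k
    using Ck_on_subset[OF U1(3)] Ck_on_subset[OF U2(3)] by (auto simp: U_def)
  have diff: "Vb differentiable (at (t, x))" "Fb differentiable (at (t, x))" if "t \<in> {0..T}" for t x
    using Ck_on_differentiable[OF VC[of 1], of "(t, x)"] Ck_on_differentiable[OF FC[of 1], of "(t, x)"] subsetD[OF U(2), of "(t, x)"] that by auto
  have unique: "d = d'" if t: "t \<in> {0..T}" and d: "(f has_vector_derivative d) (at t within {0..T})"
    "(f has_real_derivative d') (at t within {0..T})" for f :: "real \<Rightarrow> real" and d d' t
    using vector_derivative_unique_within_closed_interval[of 0 T t f d d'] T t d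
    by (simp add: has_real_derivative_iff_has_vector_derivative)
  have cong: "(f has_vector_derivative d) (at t within {0..T})"
    if "t \<in> {0..T}" "\<And>s. s \<in> {0..T} \<Longrightarrow> g s = f s" "(g has_vector_derivative d) (at t within {0..T})"
    for f g :: "real \<Rightarrow> real" and d t
    using has_vector_derivative_transform[OF that(1) that(2)[symmetric] that(3)] by simp
  have sf: "smooth_flow p \<kappa> \<kappa>' \<gamma> \<gamma>' c1 c2 c3 c4 c5 c7 c8 H G R T U Vb Fb"
    unfolding smooth_flow_def smooth_flow_axioms_def
  proof (intro conjI allI impI se T U VC FC)
    fix t assume t: "t \<in> {0..T}"
    show "periodic (\<lambda>x. Vb (t, x))" "periodic (\<lambda>x. Fb (t, x))" using per[OF t] by (simp_all add: eV[OF t] eF[OF t])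
    fix x i
    have "((\<lambda>s. Vb (s, x) $ i) has_vector_derivative dderiv (1, 0) Vb (t, x) $ i) (at t within {0..T})"
      by (rule bounded_linear.has_vector_derivative[OF bounded_linear_vec_nth time_derivative[OF diff(1)[OF t]]])
    then have "((\<lambda>s. V s x $ i) has_vector_derivative dderiv (1, 0) Vb (t, x) $ i) (at t within {0..T})"
      by (rule cong[OF t, rotated]) (simp add: eV)
    from unique[OF t this dV[OF t]]
    show "dderiv (1, 0) Vb (t, x) $ i = (\<Sum>\<alpha>\<in>UNIV. partial \<alpha> (\<lambda>y. grad G (Phi (Fb (t, y))) \<bullet> dPhi (Fb (t, y)) i \<alpha>) x)"
      by (simp only: eF[OF t])
    fix \<alpha>
    have "((\<lambda>s. Fb (s, x) $ i $ \<alpha>) has_vector_derivative dderiv (1, 0) Fb (t, x) $ i $ \<alpha>) (at t within {0..T})"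
      by (rule bounded_linear.has_vector_derivative[OF bounded_linear_vec_nth
            bounded_linear.has_vector_derivative[OF bounded_linear_vec_nth time_derivative[OF diff(2)[OF t]]]])
    then have "((\<lambda>s. F s x $ i $ \<alpha>) has_vector_derivative dderiv (1, 0) Fb (t, x) $ i $ \<alpha>) (at t within {0..T})"
      by (rule cong[OF t, rotated]) (simp add: eF)
    from unique[OF t this dF[OF t]]
    show "dderiv (1, 0) Fb (t, x) $ i $ \<alpha> = partial \<alpha> (\<lambda>y. Vb (t, y) $ i) x" by (simp only: eV[OF t])
  next
    fix i
    have T0: "0 \<in> {0..T}" using T by simp
    have F0: "F 0 = (\<lambda>x. Fb (0, x))" using eF[OF T0] by auto
    have "Ck_on 1 UNIV (\<lambda>x. Fb (0, x))"
    proof (rule Ck_on_compose[OF open_UNIV FC])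
      show "Ck_on 1 UNIV (\<lambda>x::vec3. (0 :: real, x))"
        by (intro Ck_on_Pair[OF open_UNIV Ck_on_const] Ck_on_linear[OF bounded_linear_ident])
      show "range (\<lambda>x::vec3. (0 :: real, x)) \<subseteq> U" using U(2) T0 by auto
    qed
    from is_gradient_curl_free[OF gr[unfolded F0] this] show "curl_free (\<lambda>x. Fb (0, x) $ i)"
      unfolding curl_free_def by blast
  qed
  show ?thesis by (rule that[OF sf eV eF])
qed

theorem mainTheorem2:
  fixes p \<kappa> \<kappa>' \<gamma> \<gamma>' c1 c2 c3 c4 c5 c6 c7 c8 E0 T :: real
    and W H :: "mat3 \<Rightarrow> real" and G R :: "xi \<Rightarrow> real"
    and v :: "real \<Rightarrow> nat \<Rightarrow> vec3 \<Rightarrow> vec3" and \<Xi> :: "real \<Rightarrow> nat \<Rightarrow> vec3 \<Rightarrow> xi"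
    and Vbar :: "real \<Rightarrow> vec3 \<Rightarrow> vec3" and Fbar :: "real \<Rightarrow> vec3 \<Rightarrow> mat3"
  assumes "polyconvex_energy W G"
    and "H1 p \<kappa> \<kappa>' \<gamma> \<gamma>' H R G" and "H2 p c1 c2 c3 c4 G" and "H3 p c5 G" and "H4 p c6 G"
    and "H5 p c7 c8 H R"
    and "E0 > 0" and "\<And>h. h > 0 \<Longrightarrow> iterates p G E0 h (v h) (\<Xi> h)"
    and "T > 0" and "smooth_solution G T Vbar Fbar" and "is_gradient (Fbar 0)"
    and "\<And>h. h > 0 \<Longrightarrow> AE x in lebesgue.
           interpolate h (v h) 0 x = Vbar 0 x \<and> interpolate h (\<Xi> h) 0 x = Phi (Fbar 0 x)"
  shows "\<exists>C. \<forall>\<^sub>F h in at_right 0.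
           (SUP t\<in>{0..T}.
              Lp_pow 2 (\<lambda>x. interpolate h (v h) t x - Vbar t x)
            + Lp_pow 2 (\<lambda>x. interpolate h (\<Xi> h) t x - Phi (Fbar t x))
            + Lp_pow p (\<lambda>x. fst (interpolate h (\<Xi> h) t x) - Fbar t x)) \<le> ennreal (C * h)"
proof -
  have se: "stored_energy p \<kappa> \<kappa>' \<gamma> \<gamma>' c1 c2 c3 c4 c5 c7 c8 H G R"
    using assms(1-4,6) unfolding stored_energy_def polyconvex_energy_def by simp
  obtain U Vb Fb where sf: "smooth_flow p \<kappa> \<kappa>' \<gamma> \<gamma>' c1 c2 c3 c4 c5 c7 c8 H G R T U Vb Fb"
    and V: "\<And>t x. t \<in> {0..T} \<Longrightarrow> Vb (t, x) = Vbar t x" and F: "\<And>t x. t \<in> {0..T} \<Longrightarrow> Fb (t, x) = Fbar t x"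
    using smooth_flow_exists[OF se assms(9-11)] by blast
  interpret smooth_flow p \<kappa> \<kappa>' \<gamma> \<gamma>' c1 c2 c3 c4 c5 c7 c8 H G R T U Vb Fb by (rule sf)
  have X: "Xb (t, x) = Phi (Fbar t x)" if "t \<in> {0..T}" for t x using F[OF that] by (simp add: Xb_def)
  have T0: "0 \<in> {0..T}" using assms(9) by simp
  obtain B \<delta> where \<delta>: "\<delta> > 0" and B: "\<And>h v \<Xi> t. 0 < h \<Longrightarrow> h \<le> \<delta> \<Longrightarrow> discrete_solution h v \<Xi> \<Longrightarrow>
     AE x in lebesgue. interpolate h v 0 x = Vb (0, x) \<and> interpolate h \<Xi> 0 x = Xb (0, x) \<Longrightarrow> t \<in> {0..T} \<Longrightarrow>
     Lp_pow 2 (\<lambda>x. interpolate h v t x - Vb (t, x))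
        + Lp_pow 2 (\<lambda>x. interpolate h \<Xi> t x - Xb (t, x))
        + Lp_pow p (\<lambda>x. fst (interpolate h \<Xi> t x) - Fb (t, x)) \<le> ennreal (B * h)"
    using interpolated_error by blast
  have "(SUP t\<in>{0..T}.
              Lp_pow 2 (\<lambda>x. interpolate h (v h) t x - Vbar t x)
            + Lp_pow 2 (\<lambda>x. interpolate h (\<Xi> h) t x - Phi (Fbar t x))
            + Lp_pow p (\<lambda>x. fst (interpolate h (\<Xi> h) t x) - Fbar t x)) \<le> ennreal (B * h)"
    if h: "0 < h" "h < \<delta>" for h
  proof (rule SUP_least)
    fix t assume t: "t \<in> {0..T}"
    have ds: "discrete_solution h (v h) (\<Xi> h)"
      using assms(8)[OF h(1)] unfolding iterates_def discrete_solution_def by blast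
    have "AE x in lebesgue. interpolate h (v h) 0 x = Vb (0, x) \<and> interpolate h (\<Xi> h) 0 x = Xb (0, x)"
      using assms(12)[OF h(1)] by (simp only: V[OF T0] X[OF T0])
    from B[OF h(1) less_imp_le[OF h(2)] ds this t]
    show "Lp_pow 2 (\<lambda>x. interpolate h (v h) t x - Vbar t x)
            + Lp_pow 2 (\<lambda>x. interpolate h (\<Xi> h) t x - Phi (Fbar t x))
            + Lp_pow p (\<lambda>x. fst (interpolate h (\<Xi> h) t x) - Fbar t x) \<le> ennreal (B * h)"
      by (simp only: V[OF t] X[OF t] F[OF t])
  qed
  moreover have "\<forall>\<^sub>F h in at_right 0. (0::real) < h \<and> h < \<delta>"
    using \<delta> by (auto simp: eventually_at_right_field)
  ultimately show ?thesis by (intro exI[of _ B]) (auto elim: eventually_mono)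
qed

end
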